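(* Let $n\ge4$. Any free boundary minimal M\"obius band in $\mathbb B^n$ that is sufficiently $C^2$-close to the critical M\"obius band is a rotation of the critical M\"obius band. That is, there is $\delta>0$ such that if $u:N\to\mathbb B^n$ is a free boundary minimal immersion of the M\"obius band $N$ (defined in the context) with $\|u-u_0\|_{C^2(N)}<\delta$, where $u_0$ is the standard parametrization of the critical M\"obius band, then $u(N)$ is the image of the critical M\"obius band under an orthogonal transformation of $\mathbb R^n$.
   Context: $\mathbb B^n$ is the closed unit ball in $\mathbb R^n$. A free boundary minimal surface in $\mathbb B^n$ is a properly immersed minimal surface with boundary (exactly the boundary of the surface is mapped to $\partial\mathbb B^n$) that meets $\partial\mathbb B^n$ orthogonally along its boundary. The critical M\"obius band is an explicit free boundary minimal embedding of the M\"obius band into $\mathbb B^4$ by first Steklov eigenfunctions: let $T>0$ be the unique positive solution of $2\tanh(2t)=\coth t$, let $N$ be the quotient of $[-T,T]\times\mathbb S^1$ by the identification $(t,\theta)\sim(-t,\theta+\pi)$, and set $$u_0(t,\theta)=\frac{1}{\sqrt{4\sinh^2T+\cosh^2 2T}}\,(2\sinh t\cos\theta,\ 2\sinh t\sin\theta,\ \cosh 2t\cos2\theta,\ \cosh2t\sin2\theta).$$ The critical M\"obius band is $u_0(N)\subset\mathbb B^4$. For $n>4$ it is regarded as a surface in $\mathbb B^n$ via the standard inclusion $\mathbb R^4\subset\mathbb R^n$. *)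

theory Defs
  imports "HOL-Analysis.Analysis"
begin

section \<open>Functions of class $C^k$ up to the boundary\<close>

text \<open>
  Derivatives are taken within \<^term>\<open>S\<close>, so they are meaningful at boundary points, too.
  They are unique if \<^term>\<open>S\<close> is convex with nonempty interior, which is the only case used here.
\<close>

definition partial_within ::
    "'a::euclidean_space set \<Rightarrow> 'a \<Rightarrow> ('a \<Rightarrow> 'b::real_normed_vector) \<Rightarrow> 'a \<Rightarrow> 'b" where
  "partial_within S b f p = frechet_derivative f (at p within S) b"

primrec Ck_on ::
    "'a::euclidean_space set \<Rightarrow> nat \<Rightarrow> ('a \<Rightarrow> 'b::real_normed_vector) \<Rightarrow> bool" where
  "Ck_on S 0 f \<longleftrightarrow> continuous_on S f"
| "Ck_on S (Suc k) f \<longleftrightarrow> f differentiable_on S \<and> (\<forall>b\<in>Basis. Ck_on S k (partial_within S b f))"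

definition smooth_on_set :: "'a::euclidean_space set \<Rightarrow> ('a \<Rightarrow> 'b::real_normed_vector) \<Rightarrow> bool" where
  "smooth_on_set S f \<longleftrightarrow> (\<forall>k. Ck_on S k f)"


section \<open>The Moebius band\<close>

definition mob_T :: real where
  "mob_T = (THE t. 0 < t \<and> 2 * tanh (2 * t) = cosh t / sinh t)"

text \<open>
  The circle is \<open>\<real>/2\<pi>\<int>\<close>; points of \<open>[-T,T] \<times> \<real>\<close> are pairs of a height and an angle, and the
  relation below comprises both the periodicity of the angle and \<open>(t,\<theta>) \<sim> (-t,\<theta>+\<pi>)\<close>.
\<close>

definition mob_strip :: "(real \<times> real) set" where
  "mob_strip = {-mob_T..mob_T} \<times> UNIV"

definition mob_rel :: "((real \<times> real) \<times> (real \<times> real)) set" where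
  "mob_rel = {((t, \<theta>), (s, \<phi>)). (t, \<theta>) \<in> mob_strip \<and> (s, \<phi>) \<in> mob_strip \<and>
     (s = t \<and> (\<exists>k::int. \<phi> = \<theta> + 2 * pi * k) \<or>
      s = - t \<and> (\<exists>k::int. \<phi> = \<theta> + pi + 2 * pi * k))}"

definition mobius_band :: "(real \<times> real) set set" where
  "mobius_band = mob_strip // mob_rel"

definition mob_proj :: "real \<times> real \<Rightarrow> (real \<times> real) set" where
  "mob_proj p = mob_rel `` {p}"

definition mobius_boundary :: "(real \<times> real) set set" where
  "mobius_boundary = mob_proj ` ({-mob_T, mob_T} \<times> UNIV)"

text \<open>
  The projection of the strip onto the band is a local diffeomorphism, so differential notions for
  a map on the band are expressed through its pullback to the strip.
\<close>

definition pullback :: "((real \<times> real) set \<Rightarrow> 'b) \<Rightarrow> real \<times> real \<Rightarrow> 'b" where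
  "pullback u p = u (mob_proj p)"

definition mob_dt :: "(real \<times> real \<Rightarrow> 'b::real_normed_vector) \<Rightarrow> real \<times> real \<Rightarrow> 'b" where
  "mob_dt = partial_within mob_strip (1, 0)"

definition mob_d\<theta> :: "(real \<times> real \<Rightarrow> 'b::real_normed_vector) \<Rightarrow> real \<times> real \<Rightarrow> 'b" where
  "mob_d\<theta> = partial_within mob_strip (0, 1)"

definition mob_C2_norm :: "((real \<times> real) set \<Rightarrow> 'b::real_normed_vector) \<Rightarrow> real" where
  "mob_C2_norm w = (let f = pullback w in
     (SUP p\<in>mob_strip. norm (f p)) +
     (SUP p\<in>mob_strip. norm (mob_dt f p)) +
     (SUP p\<in>mob_strip. norm (mob_d\<theta> f p)) +
     (SUP p\<in>mob_strip. norm (mob_dt (mob_dt f) p)) +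
     (SUP p\<in>mob_strip. norm (mob_dt (mob_d\<theta> f) p)) +
     (SUP p\<in>mob_strip. norm (mob_d\<theta> (mob_d\<theta> f) p)))"


section \<open>Free boundary minimal immersions into the unit ball\<close>

definition normal_part :: "'b::euclidean_space set \<Rightarrow> 'b \<Rightarrow> 'b" where
  "normal_part V v = (THE w. (\<forall>x\<in>V. w \<bullet> x = 0) \<and> v - w \<in> V)"

definition tangent_plane :: "(real \<times> real \<Rightarrow> 'b::euclidean_space) \<Rightarrow> real \<times> real \<Rightarrow> 'b set" where
  "tangent_plane f p = span {mob_dt f p, mob_d\<theta> f p}"

text \<open>
  The mean curvature vector is the trace $g^{ij} (\partial_i \partial_j f)^\perp$ of the second
  fundamental form with respect to the induced metric $g$, with coefficients \<open>E\<close>, \<open>F\<close>, \<open>G\<close>.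
\<close>

definition mean_curvature :: "(real \<times> real \<Rightarrow> 'b::euclidean_space) \<Rightarrow> real \<times> real \<Rightarrow> 'b" where
  "mean_curvature f p = (let
     E = mob_dt f p \<bullet> mob_dt f p;
     F = mob_dt f p \<bullet> mob_d\<theta> f p;
     G = mob_d\<theta> f p \<bullet> mob_d\<theta> f p;
     nor = normal_part (tangent_plane f p)
   in (1 / (E * G - F\<^sup>2)) *\<^sub>R
      (G *\<^sub>R nor (mob_dt (mob_dt f) p) - (2 * F) *\<^sub>R nor (mob_dt (mob_d\<theta> f) p)
       + E *\<^sub>R nor (mob_d\<theta> (mob_d\<theta> f) p)))"

text \<open>
  A conormal (not normalized) at a boundary point: tangent to the surface and orthogonal to the
  boundary curve, whose tangent is the angular derivative.
\<close>

definition conormal :: "(real \<times> real \<Rightarrow> 'b::euclidean_space) \<Rightarrow> real \<times> real \<Rightarrow> 'b" where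
  "conormal f p =
     mob_dt f p - ((mob_dt f p \<bullet> mob_d\<theta> f p) / (mob_d\<theta> f p \<bullet> mob_d\<theta> f p)) *\<^sub>R mob_d\<theta> f p"

definition mob_immersion :: "((real \<times> real) set \<Rightarrow> 'b::euclidean_space) \<Rightarrow> bool" where
  "mob_immersion u \<longleftrightarrow> smooth_on_set mob_strip (pullback u) \<and>
     (\<forall>p\<in>mob_strip. inj (frechet_derivative (pullback u) (at p within mob_strip)))"

text \<open>
  Properness is the condition that exactly the boundary is mapped to the unit sphere (the band
  being compact). In the last condition, \<open>{v. v \<bullet> pullback u p = 0}\<close> is the tangent space of the
  sphere at the boundary point.
\<close>

definition free_boundary_minimal_immersion ::
    "((real \<times> real) set \<Rightarrow> 'b::euclidean_space) \<Rightarrow> bool" where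
  "free_boundary_minimal_immersion u \<longleftrightarrow>
     mob_immersion u \<and>
     u ` mobius_band \<subseteq> cball 0 1 \<and>
     (\<forall>x\<in>mobius_band. u x \<in> sphere 0 1 \<longleftrightarrow> x \<in> mobius_boundary) \<and>
     (\<forall>p\<in>mob_strip. mean_curvature (pullback u) p = 0) \<and>
     (\<forall>p\<in>mob_strip. mob_proj p \<in> mobius_boundary \<longrightarrow>
        (\<forall>v. v \<bullet> pullback u p = 0 \<longrightarrow> conormal (pullback u) p \<bullet> v = 0))"


section \<open>The critical Moebius band\<close>

text \<open>
  The parameter \<open>\<sigma>\<close> enumerates the coordinates of \<open>\<real>\<^sup>n\<close>, so that \<open>axis (\<sigma> i) 1\<close> is the
  \<open>i\<close>-th standard basis vector; the standard inclusion of \<open>\<real>\<^sup>4\<close> uses the first four.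
\<close>

definition crit_map :: "(nat \<Rightarrow> 'n::finite) \<Rightarrow> real \<times> real \<Rightarrow> real ^ 'n" where
  "crit_map \<sigma> = (\<lambda>(t, \<theta>).
     (1 / sqrt (4 * (sinh mob_T)\<^sup>2 + (cosh (2 * mob_T))\<^sup>2)) *\<^sub>R
       (axis (\<sigma> 1) (2 * sinh t * cos \<theta>) +
        axis (\<sigma> 2) (2 * sinh t * sin \<theta>) +
        axis (\<sigma> 3) (cosh (2 * t) * cos (2 * \<theta>)) +
        axis (\<sigma> 4) (cosh (2 * t) * sin (2 * \<theta>))))"

definition critical_mobius :: "(nat \<Rightarrow> 'n::finite) \<Rightarrow> (real \<times> real) set \<Rightarrow> real ^ 'n" where
  "critical_mobius \<sigma> x = the_elem (crit_map \<sigma> ` x)"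


section \<open>Well-definedness\<close>

lemma mob_T_equation_iff:
  fixes t :: real
  assumes "0 < t"
  shows "2 * tanh (2 * t) = cosh t / sinh t \<longleftrightarrow> t = arsinh (sqrt (1 / 2))"
proof -
  have s: "0 < sinh t" and c: "0 < cosh t" and c2: "0 < cosh (2 * t)"
    using assms by auto
  have "2 * tanh (2 * t) = cosh t / sinh t \<longleftrightarrow>
      2 * sinh (2 * t) * sinh t = cosh t * cosh (2 * t)"
    unfolding tanh_def using s c2 by (simp add: frac_eq_eq)
  also have "\<dots> \<longleftrightarrow> cosh t * (4 * (sinh t)\<^sup>2) = cosh t * (2 * (sinh t)\<^sup>2 + 1)"
  proof -
    have "2 * sinh (2 * t) * sinh t = cosh t * (4 * (sinh t)\<^sup>2)"
      by (simp add: sinh_double power2_eq_square)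
    moreover have "cosh (2 * t) = 2 * (sinh t)\<^sup>2 + 1"
      using cosh_double[of t] cosh_square_eq[of t] by linarith
    ultimately show ?thesis
      by (simp only:)
  qed
  also have "\<dots> \<longleftrightarrow> 4 * (sinh t)\<^sup>2 = 2 * (sinh t)\<^sup>2 + 1"
    by (rule mult_left_cancel) (use c in simp)
  also have "\<dots> \<longleftrightarrow> (sinh t)\<^sup>2 = 1 / 2"
    by linarith
  also have "\<dots> \<longleftrightarrow> sinh t = sqrt (1 / 2)"
  proof
    assume "(sinh t)\<^sup>2 = 1 / 2"
    then show "sinh t = sqrt (1 / 2)"
      using s by (intro real_sqrt_unique[symmetric]) simp_all
  next
    assume "sinh t = sqrt (1 / 2)"
    then show "(sinh t)\<^sup>2 = 1 / 2"
      using real_sqrt_pow2[of "1/2"] by simp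
  qed
  also have "\<dots> \<longleftrightarrow> t = arsinh (sqrt (1 / 2))"
    using arsinh_sinh_real[of t] sinh_arsinh_real[of "sqrt (1/2)"] by auto
  finally show ?thesis .
qed

lemma mob_T_eq: "mob_T = arsinh (sqrt (1 / 2))"
  unfolding mob_T_def
proof (rule the_equality)
  have "0 < arsinh (sqrt (1 / 2 :: real))"
    by simp
  with mob_T_equation_iff[OF this]
  show "0 < arsinh (sqrt (1 / 2 :: real)) \<and> 2 * tanh (2 * arsinh (sqrt (1 / 2 :: real))) =
      cosh (arsinh (sqrt (1 / 2 :: real))) / sinh (arsinh (sqrt (1 / 2 :: real)))"
    by blast
qed (use mob_T_equation_iff in blast)

lemma mob_T_pos: "0 < mob_T"
  and mob_T_equation: "2 * tanh (2 * mob_T) = cosh mob_T / sinh mob_T"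
proof -
  show *: "0 < mob_T" by (simp add: mob_T_eq)
  show "2 * tanh (2 * mob_T) = cosh mob_T / sinh mob_T"
    using mob_T_equation_iff[OF *] mob_T_eq by simp
qed

lemma mob_rel_cases:
  assumes "((t, \<theta>), (s, \<phi>)) \<in> mob_rel"
  obtains (same) k :: int where "s = t" "\<phi> = \<theta> + 2 * pi * k"
  | (flip) k :: int where "s = - t" "\<phi> = \<theta> + pi + 2 * pi * k"
  using assms unfolding mob_rel_def by blast

lemma mob_relI_same:
  assumes "(t, \<theta>) \<in> mob_strip" "(s, \<phi>) \<in> mob_strip" "s = t" "\<phi> = \<theta> + 2 * pi * real_of_int k"
  shows "((t, \<theta>), (s, \<phi>)) \<in> mob_rel"
  unfolding mob_rel_def using assms by blast

lemma mob_relI_flip: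
  assumes "(t, \<theta>) \<in> mob_strip" "(s, \<phi>) \<in> mob_strip" "s = - t" "\<phi> = \<theta> + pi + 2 * pi * real_of_int k"
  shows "((t, \<theta>), (s, \<phi>)) \<in> mob_rel"
  unfolding mob_rel_def using assms by blast

lemma equiv_mob_rel: "equiv mob_strip mob_rel"
proof (rule equivI)
  show sub: "mob_rel \<subseteq> mob_strip \<times> mob_strip"
    unfolding mob_rel_def by blast
  show "refl_on mob_strip mob_rel"
  proof (rule refl_onI)
    fix p assume "p \<in> mob_strip"
    then show "(p, p) \<in> mob_rel"
      by (cases p) (simp add: mob_relI_same[where k = 0])
  qed
  show "sym mob_rel"
  proof (rule symI)
    fix p q assume pq: "(p, q) \<in> mob_rel"
    obtain t \<theta> s \<phi> where eq: "p = (t, \<theta>)" "q = (s, \<phi>)" by (cases p, cases q) blast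
    have S: "(t, \<theta>) \<in> mob_strip" "(s, \<phi>) \<in> mob_strip"
      using pq sub unfolding eq by blast+
    from pq show "(q, p) \<in> mob_rel"
      unfolding eq
    proof (cases rule: mob_rel_cases)
      case (same k)
      show "((s, \<phi>), (t, \<theta>)) \<in> mob_rel"
      proof (rule mob_relI_same[OF S(2,1)])
        show "t = s" "\<theta> = \<phi> + 2 * pi * real_of_int (- k)"
          unfolding same of_int_add of_int_diff of_int_minus of_int_1 distrib_left right_diff_distrib mult_minus_right
            by linarith+
      qed
    next
      case (flip k)
      show "((s, \<phi>), (t, \<theta>)) \<in> mob_rel"
      proof (rule mob_relI_flip[OF S(2,1)])
        show "t = - s" "\<theta> = \<phi> + pi + 2 * pi * real_of_int (- k - 1)"
          unfolding flip of_int_add of_int_diff of_int_minus of_int_1 distrib_left right_diff_distrib mult_minus_right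
            by linarith+
      qed
    qed
  qed
  show "trans mob_rel"
  proof (rule transI)
    fix p q w assume pq: "(p, q) \<in> mob_rel" and qw: "(q, w) \<in> mob_rel"
    obtain t \<theta> s \<phi> r \<psi> where eq: "p = (t, \<theta>)" "q = (s, \<phi>)" "w = (r, \<psi>)"
      by (cases p, cases q, cases w) blast
    have S: "(t, \<theta>) \<in> mob_strip" "(r, \<psi>) \<in> mob_strip"
      using pq qw sub unfolding eq by blast+
    from pq show "(p, w) \<in> mob_rel"
      unfolding eq
    proof (cases rule: mob_rel_cases)
      case k: (same k)
      from qw show "((t, \<theta>), (r, \<psi>)) \<in> mob_rel"
        unfolding eq
      proof (cases rule: mob_rel_cases)
        case l: (same l)
        show "((t, \<theta>), (r, \<psi>)) \<in> mob_rel"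
        proof (rule mob_relI_same[OF S])
          show "r = t" "\<psi> = \<theta> + 2 * pi * real_of_int (k + l)"
            unfolding l k of_int_add of_int_diff of_int_minus of_int_1 distrib_left right_diff_distrib mult_minus_right
            by linarith+
        qed
      next
        case l: (flip l)
        show "((t, \<theta>), (r, \<psi>)) \<in> mob_rel"
        proof (rule mob_relI_flip[OF S])
          show "r = - t" "\<psi> = \<theta> + pi + 2 * pi * real_of_int (k + l)"
            unfolding l k of_int_add of_int_diff of_int_minus of_int_1 distrib_left right_diff_distrib mult_minus_right
            by linarith+
        qed
      qed
    next
      case k: (flip k)
      from qw show "((t, \<theta>), (r, \<psi>)) \<in> mob_rel"
        unfolding eq
      proof (cases rule: mob_rel_cases)
        case l: (same l)
        show "((t, \<theta>), (r, \<psi>)) \<in> mob_rel"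
        proof (rule mob_relI_flip[OF S])
          show "r = - t" "\<psi> = \<theta> + pi + 2 * pi * real_of_int (k + l)"
            unfolding l k of_int_add of_int_diff of_int_minus of_int_1 distrib_left right_diff_distrib mult_minus_right
            by linarith+
        qed
      next
        case l: (flip l)
        show "((t, \<theta>), (r, \<psi>)) \<in> mob_rel"
        proof (rule mob_relI_same[OF S])
          show "r = t" "\<psi> = \<theta> + 2 * pi * real_of_int (k + l + 1)"
            unfolding l k of_int_add of_int_diff of_int_minus of_int_1 distrib_left right_diff_distrib mult_minus_right
            by linarith+
        qed
      qed
    qed
  qed
qed

lemma crit_map_respects_mob_rel:
  assumes "(p, q) \<in> mob_rel"
  shows "crit_map \<sigma> p = crit_map \<sigma> q"
proof -
  have per: "cos (x + 2 * pi * k) = cos x" "sin (x + 2 * pi * k) = sin x" for x and k :: int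
    by (simp_all only: cos_add sin_add cos_int_2pin sin_int_2pin mult_1_right mult_zero_right diff_zero add_0_right)
  obtain t \<theta> s \<phi> where pq: "p = (t, \<theta>)" "q = (s, \<phi>)" by fastforce
  from assms consider (a) k :: int where "s = t" "\<phi> = \<theta> + 2 * pi * k"
    | (b) k :: int where "s = - t" "\<phi> = \<theta> + pi + 2 * pi * k"
    unfolding pq mob_rel_def by blast
  then show ?thesis
  proof cases
    case a
    have "cos \<phi> = cos \<theta>" "sin \<phi> = sin \<theta>"
      unfolding a(2) by (rule per)+
    then show ?thesis
      unfolding crit_map_def pq a(1) prod.case cos_double sin_double by (simp only:)
  next
    case b
    have "cos \<phi> = - cos \<theta>" "sin \<phi> = - sin \<theta>"
      unfolding b(2) per by simp_all
    then show ?thesis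
      unfolding crit_map_def pq b(1) prod.case cos_double sin_double
      by (simp only: sinh_minus cosh_minus mult_minus_left mult_minus_right minus_minus power2_minus)
  qed
qed

lemma pullback_critical_mobius:
  assumes "p \<in> mob_strip"
  shows "pullback (critical_mobius \<sigma>) p = crit_map \<sigma> p"
proof -
  have p: "p \<in> mob_proj p"
    unfolding mob_proj_def by (rule equiv_class_self[OF equiv_mob_rel assms])
  have const: "crit_map \<sigma> q = crit_map \<sigma> p" if "q \<in> mob_proj p" for q
    using that unfolding mob_proj_def by (intro crit_map_respects_mob_rel[symmetric]) simp
  have "crit_map \<sigma> ` mob_proj p = {crit_map \<sigma> p}"
    using p by (intro equalityI subsetI) (auto dest: const)
  then show ?thesis
    by (simp add: pullback_def critical_mobius_def)
qed

end

theory Submission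
  imports Defs
begin

text \<open>
  Why the theorem holds. Let \<open>f\<close> be the pullback of \<open>u\<close> to the strip.

  \<^bold>\<open>A conformal coordinate.\<close> Minimality says that the coordinate functions of \<open>f\<close> are harmonic for the
  induced metric, that is, that \<open>P dt + Q d\<theta>\<close> with \<open>P = f\<^sub>t - i B\<^sub>2\<close>, \<open>Q = f\<^sub>\<theta> + i B\<^sub>1\<close> is a closed form,
  where \<open>B\<^sub>1\<close>, \<open>B\<^sub>2\<close> are the rotated tangent vectors. One has \<open>Q = m P\<close> for a complex function \<open>m\<close> describing the
  conformal structure, and \<open>q = \<Sum> (\<partial>\<^sub>t P\<^sub>i)\<^sup>2\<close> makes \<open>q (dt + m d\<theta>)\<close>-to-the-fourth a holomorphic quartic
  differential. The free boundary condition forces it to be real along the boundary. For the critical band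
  \<open>q\<close> is the constant 2, so for a nearby \<open>f\<close> the fourth root \<open>\<kappa>\<close> of \<open>q\<close> is defined and the form
  \<open>\<kappa> (dt + m d\<theta>)\<close> is closed; up to a real factor and a translation its primitive \<open>\<omega>\<close> is a conformal coordinate,
  close to \<open>t + i \<theta>\<close>, that maps the strip to \<open>\<bar>Re z\<bar> \<le> X\<close> and respects the Moebius identification. This
  explicit coordinate replaces uniformization, and its closeness to \<open>t + i \<theta>\<close> needs only that
  the 2-jets of \<open>f\<close> and of the critical map are close.

  \<^bold>\<open>The Steklov relation.\<close> In the coordinate \<open>\<omega>\<close>, the boundary is a unit vector valued, \<open>2\<pi>\<close>-periodic
  curve \<open>U\<close>, and the outer normal derivative of the harmonic map is \<open>l U\<close> with \<open>l\<close> the conformal factor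
  \<open>\<bar>U'\<bar>\<close>. On Fourier coefficients this reads \<open>(l U)\<^sub>k = d\<^sub>k U\<^sub>k\<close>, where \<open>d\<^sub>k\<close> is \<open>k tanh (k X)\<close> for even \<open>k\<close>
  and \<open>k coth (k X)\<close> for odd \<open>k\<close>.

  \<^bold>\<open>Rigidity.\<close> Near the critical curve, \<open>d\<^sub>1\<close> and \<open>d\<^sub>2\<close> are close to the square root of 3 and the other \<open>d\<^sub>k\<close> stay
  away from it. Let \<open>\<mu> = l - d\<^sub>1\<close> and let \<open>H\<close> be the part of \<open>U\<close> in the modes other than \<open>\<plusminus>1\<close>, \<open>\<plusminus>2\<close>. The relation in the
  modes \<open>\<plusminus>1\<close>, \<open>\<plusminus>2\<close> shows that \<open>d\<^sub>2 - d\<^sub>1\<close> and the low Fourier coefficients of \<open>\<mu>\<close> are at most \<open>\<epsilon> \<bar>H\<bar>\<close>;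
  integrating \<open>\<mu> U \<bullet> H\<close>, the spectral gap bounds it from below by a multiple of \<open>\<bar>H\<bar>\<^sup>2\<close>, whereas
  \<open>2 U \<bullet> H = 1 - \<bar>L\<bar>\<^sup>2 + \<bar>H\<bar>\<^sup>2\<close> with \<open>L = U - H\<close> bounds it from above by \<open>\<epsilon> \<bar>H\<bar>\<^sup>2\<close>. Hence \<open>H = 0\<close>, \<open>l = d\<^sub>1 = d\<^sub>2\<close>.
  The equation \<open>d\<^sub>1 = d\<^sub>2\<close> is the equation defining \<open>T\<close>, so \<open>X = T\<close>; and a curve on the sphere with only these
  modes and speed \<open>l\<close> has orthogonal coefficient vectors of the critical lengths. So \<open>U\<close> is
  a rotated critical boundary curve, and \<open>f\<close> is the rotated critical map composed with \<open>\<omega>\<close> by uniqueness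
  for the Dirichlet problem. Finally \<open>\<omega>\<close> is onto, so the images agree.

  The argument is carried by the lemmas \<open>q_equation\<close>, \<open>boundary_imaginary\<close>, \<open>conformal_coordinate\<close>, \<open>steklov\<close>,
  \<open>rigidity\<close>, \<open>real_part_uniqueness\<close> and \<open>nearby_jets\<close>.
\<close>

section \<open>Fourier series of periodic functions\<close>

lemma integral_of_real_complex:
  fixes f :: "real \<Rightarrow> real"
  assumes "continuous_on {a..b} f"
  shows "integral {a..b} (\<lambda>x. complex_of_real (f x)) = of_real (integral {a..b} f)"
  using integral_linear[OF integrable_continuous_real[OF assms] bounded_linear_of_real] by (simp add: o_def)

text \<open>
  Unnormalized: the usual coefficient times \<open>2 \<pi>\<close>.
\<close>

definition fourier :: "(real \<Rightarrow> complex) \<Rightarrow> int \<Rightarrow> complex" where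
  "fourier f k = integral {0..2*pi} (\<lambda>x. f x * cis (- of_int k * x))"

lemma has_vector_derivative_cis_mult:
  "((\<lambda>x. cis (a * x)) has_vector_derivative (\<i> * of_real a * cis (a * x))) (at x within X)"
proof -
  have "((\<lambda>y. \<i> * of_real (a * y)) has_vector_derivative (\<i> * of_real (a * 1))) (at x)"
    by (intro has_vector_derivative_mult_right has_vector_derivative_of_real has_real_derivative_iff_has_vector_derivative[THEN iffD1] DERIV_cmult DERIV_ident)
  moreover have "(exp has_field_derivative exp (\<i> * of_real (a * x))) (at (\<i> * of_real (a * x)))"
    by (rule DERIV_exp)
  ultimately have "(exp \<circ> (\<lambda>y. \<i> * of_real (a * y)) has_vector_derivative (\<i> * of_real (a * 1)) * exp (\<i> * of_real (a * x))) (at x)"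
    by (rule field_vector_diff_chain_at)
  from this[unfolded o_def mult_1_right, folded cis_conv_exp] show ?thesis
    by (rule has_vector_derivative_at_within)
qed

lemma cis_int_2pi [simp]: "cis (of_int k * (2 * pi)) = 1"
  by (simp add: complex_eq_iff cos_int_2pin sin_int_2pin mult.commute[of "of_int k"])

lemma cis_int_periodic: "cis (of_int k * (x + 2 * pi)) = cis (of_int k * x)"
  by (simp add: distrib_left cis_mult[symmetric])

lemma continuous_on_cis_mult [continuous_intros]: "continuous_on X (\<lambda>x. cis (a * x))"
  unfolding cis_conv_exp by (intro continuous_intros)

lemma integral_cis: "integral {0..2*pi} (\<lambda>x. cis (of_int k * x)) = (if k = 0 then 2 * pi else 0)"
proof (cases "k = 0")
  case False
  have "((\<lambda>x. cis (of_int k * x)) has_integral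
      (cis (of_int k * (2*pi)) / (\<i> * of_int k) - cis (of_int k * 0) / (\<i> * of_int k))) {0..2*pi}"
  proof (rule fundamental_theorem_of_calculus)
    fix x :: real
    have "((\<lambda>x. cis (of_int k * x) / (\<i> * of_int k)) has_vector_derivative
        (\<i> * of_real (of_int k) * cis (of_int k * x)) / (\<i> * of_int k)) (at x within {0..2*pi})"
      by (intro has_vector_derivative_divide has_vector_derivative_cis_mult)
    then show "((\<lambda>x. cis (of_int k * x) / (\<i> * of_int k)) has_vector_derivative cis (of_int k * x)) (at x within {0..2*pi})"
      using False by simp
  qed simp
  then show ?thesis using False by (simp add: integral_unique)
qed (simp add: scaleR_conv_of_real)

inductive trig_poly :: "(real \<Rightarrow> complex) \<Rightarrow> bool" where
  monom: "trig_poly (\<lambda>x. c * cis (of_int k * x))"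
| add: "trig_poly P \<Longrightarrow> trig_poly Q \<Longrightarrow> trig_poly (\<lambda>x. P x + Q x)"

lemma trig_poly_mult_monom: "trig_poly P \<Longrightarrow> trig_poly (\<lambda>x. P x * (c * cis (of_int k * x)))"
proof (induction rule: trig_poly.induct)
  case (monom d l)
  have "(\<lambda>x. d * cis (of_int l * x) * (c * cis (of_int k * x))) = (\<lambda>x. (d * c) * cis (of_int (l + k) * x))"
    by (auto simp: distrib_right cis_mult[symmetric])
  then show ?case by (simp only: trig_poly.monom)
next
  case (add P Q)
  then show ?case by (simp add: distrib_right trig_poly.add)
qed

lemma trig_poly_mult: "trig_poly Q \<Longrightarrow> trig_poly P \<Longrightarrow> trig_poly (\<lambda>x. P x * Q x)"
proof (induction rule: trig_poly.induct)
  case (monom d l)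
  then show ?case by (rule trig_poly_mult_monom)
next
  case (add P Q)
  then show ?case by (simp add: distrib_left trig_poly.add)
qed

lemma continuous_on_trig_poly: "trig_poly P \<Longrightarrow> continuous_on X P"
  by (induction rule: trig_poly.induct) (auto intro!: continuous_intros)

text \<open>
  Restricting real linear functions of the plane to the circle gives the modes \<open>\<plusminus>1\<close>; products of
  trigonometric polynomials are again such.
\<close>

lemma trig_poly_real_polynomial:
  fixes p :: "complex \<Rightarrow> real"
  assumes "real_polynomial_function p"
  shows "trig_poly (\<lambda>x. of_real (p (cis x)))"
  using assms
proof (induction rule: real_polynomial_function.induct)
  case (linear f)
  then interpret f: bounded_linear f .
  have "complex_of_real (f (cis x)) = (of_real (f 1) / 2 + of_real (f \<i>) / (2 * \<i>)) * cis (of_int 1 * x)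
      + (of_real (f 1) / 2 - of_real (f \<i>) / (2 * \<i>)) * cis (of_int (-1) * x)" for x
  proof -
    have "f (cis x) = f (cos x *\<^sub>R 1 + sin x *\<^sub>R \<i>)"
      by (rule arg_cong[of _ _ f]) (simp add: complex_eq_iff)
    also have "\<dots> = cos x * f 1 + sin x * f \<i>" by (simp add: f.add f.scaleR)
    finally show ?thesis by (simp add: complex_eq_iff field_simps)
  qed
  then show ?case by (simp only: trig_poly.intros)
next
  case (const c)
  show ?case using trig_poly.monom[of "of_real c" 0] by simp
next
  case (add f g)
  then show ?case by (simp add: trig_poly.add)
next
  case (mult f g)
  then show ?case by (simp add: trig_poly_mult)
qed

lemma periodic_int_shift:
  assumes "\<And>x. f (x + 2 * pi) = f x"
  shows "f (x + of_int k * (2 * pi)) = f x"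
proof -
  have "f (y + of_nat n * (2 * pi)) = f y" for y and n :: nat
  proof (induction n)
    case (Suc n)
    have "f (y + of_nat (Suc n) * (2 * pi)) = f ((y + of_nat n * (2 * pi)) + 2 * pi)"
      by (simp add: algebra_simps)
    with Suc show ?case by (simp add: assms)
  qed simp
  from this[of x "nat k"] this[of "x + of_int k * (2 * pi)" "nat (-k)"] show ?thesis
    by (cases "k \<ge> 0") (auto simp: algebra_simps)
qed

text \<open>
  Periodic functions are functions on a compact set of the plane, to which the theorem of Stone and Weierstrass applies. Closed
  sets of the circle are images of compact sets of angles, hence continuity of the quotient map.
\<close>

lemma periodic_on_circle:
  fixes f :: "real \<Rightarrow> real"
  assumes cont: "continuous_on UNIV f" and per: "\<And>x. f (x + 2 * pi) = f x"
  obtains g where "continuous_on (sphere 0 1) g" "\<And>x. g (cis x) = f x"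
proof
  define g where "g z = f (Arg2pi z)" for z
  show g: "g (cis x) = f x" for x
  proof -
    have "cis (Arg2pi (cis x)) = cis x" by (metis Arg2pi_eq cis_conv_exp mult.commute norm_cis mult_1 of_real_1)
    then obtain k :: int where "Arg2pi (cis x) = x + 2 * pi * k"
      by (metis complex_eq_iff cis.simps sin_cos_eq_iff)
    then show ?thesis using periodic_int_shift[of f x k, OF per] by (simp add: g_def mult.commute)
  qed
  show "continuous_on (sphere 0 1) g"
  proof (subst continuous_on_closed_vimage)
    show "\<forall>B. closed B \<longrightarrow> closed (g -` B \<inter> sphere 0 1)"
    proof (intro allI impI)
      fix B :: "real set" assume B: "closed B"
      have "g -` B \<inter> sphere 0 1 = cis ` ({0..2*pi} \<inter> f -` B)"
      proof (intro equalityI subsetI)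
        fix z assume z: "z \<in> g -` B \<inter> sphere 0 1"
        then have "z = cis (Arg2pi z)" by (metis Arg2pi_eq IntD2 cis_conv_exp mem_sphere_0 mult_1 of_real_1)
        moreover have "Arg2pi z \<in> {0..2*pi} \<inter> f -` B"
          using z Arg2pi_ge_0[of z] Arg2pi_lt_2pi[of z] by (auto simp: g_def)
        ultimately show "z \<in> cis ` ({0..2*pi} \<inter> f -` B)" by blast
      qed (auto simp: g)
      moreover have "compact ({0..2*pi} \<inter> f -` B)"
        using B cont by (intro compact_Int_closed) (auto simp: continuous_on_closed_vimage)
      then have "compact (cis ` ({0..2*pi} \<inter> f -` B))"
        by (intro compact_continuous_image) (auto intro: continuous_on_cis continuous_on_id)
      ultimately show "closed (g -` B \<inter> sphere 0 1)" by (simp add: compact_imp_closed)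
    qed
  qed simp
qed

lemma trig_poly_dense:
  fixes f :: "real \<Rightarrow> real"
  assumes "continuous_on UNIV f" "\<And>x. f (x + 2 * pi) = f x" "e > 0"
  obtains P where "trig_poly P" "\<And>x. cmod (of_real (f x) - P x) < e"
proof -
  obtain g where g: "continuous_on (sphere 0 1) g" "\<And>x. g (cis x) = f x"
    using periodic_on_circle[OF assms(1,2)] by blast
  obtain p where p: "real_polynomial_function p" "\<And>z. z \<in> sphere 0 1 \<Longrightarrow> \<bar>g z - p z\<bar> < e"
    using Stone_Weierstrass_real_polynomial_function[OF compact_sphere g(1) assms(3)] by blast
  show ?thesis
  proof (rule that[OF trig_poly_real_polynomial[OF p(1)]])
    show "cmod (of_real (f x) - of_real (p (cis x))) < e" for x
      using p(2)[of "cis x"] by (simp add: g(2) flip: of_real_diff)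
  qed
qed

definition fourier_sum :: "(real \<Rightarrow> real) \<Rightarrow> nat \<Rightarrow> real \<Rightarrow> complex" where
  "fourier_sum f n x = (\<Sum>k = -int n..int n. fourier f k / (2 * pi) * cis (of_int k * x))"

lemma continuous_on_fourier_sum [continuous_intros]: "continuous_on X (fourier_sum f n)"
  unfolding fourier_sum_def[abs_def] by (intro continuous_intros)

text \<open>
  The partial sum is the orthogonal projection to the modes up to \<open>n\<close>.
\<close>

lemma integral_remainder_cis:
  assumes f: "continuous_on UNIV f" and k: "k \<in> {-int n..int n}"
  shows "integral {0..2*pi} (\<lambda>x. (of_real (f x) - fourier_sum f n x) * cis (- of_int k * x)) = 0"
proof -
  have f': "continuous_on X (\<lambda>x. complex_of_real (f x))" for X
    by (intro continuous_intros continuous_on_subset[OF f]) auto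
  have cis: "cis (of_int l * x) * cis (- of_int k * x) = cis (of_int (l - k) * x)" for l and x :: real
    by (simp add: cis_mult left_diff_distrib)
  have "(of_real (f x) - fourier_sum f n x) * cis (- of_int k * x) =
     of_real (f x) * cis (- of_int k * x) - (\<Sum>l = -int n..int n. fourier f l / (2*pi) * cis (of_int (l - k) * x))" for x
    unfolding left_diff_distrib fourier_sum_def sum_distrib_right mult.assoc cis ..
  then have "integral {0..2*pi} (\<lambda>x. (of_real (f x) - fourier_sum f n x) * cis (- of_int k * x)) =
    integral {0..2*pi} (\<lambda>x. of_real (f x) * cis (- of_int k * x) - (\<Sum>l = -int n..int n. fourier f l / (2*pi) * cis (of_int (l - k) * x)))"
    by (simp only:)
  also have "\<dots> = fourier f k - integral {0..2*pi} (\<lambda>x. \<Sum>l = -int n..int n. fourier f l / (2*pi) * cis (of_int (l - k) * x))"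
    unfolding fourier_def[of _ k]
    by (rule Henstock_Kurzweil_Integration.integral_diff; intro integrable_continuous_real continuous_intros f')
  also have "integral {0..2*pi} (\<lambda>x. \<Sum>l = -int n..int n. fourier f l / (2*pi) * cis (of_int (l - k) * x))
     = (\<Sum>l = -int n..int n. integral {0..2*pi} (\<lambda>x. fourier f l / (2*pi) * cis (of_int (l - k) * x)))"
    by (rule Henstock_Kurzweil_Integration.integral_sum) (auto intro!: integrable_continuous_real continuous_intros simp del: of_int_diff)
  also have "\<dots> = (\<Sum>l = -int n..int n. fourier f l / (2*pi) * (if l - k = 0 then 2 * pi else 0))"
    by (simp only: Henstock_Kurzweil_Integration.integral_mult_right integral_cis)
  also have "\<dots> = (\<Sum>l = -int n..int n. if l = k then fourier f l else 0)"
    by (intro sum.cong) auto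
  also have "\<dots> = fourier f k" using k by (subst sum.delta) auto
  finally show ?thesis by simp
qed

lemma integral_remainder_trig_poly:
  assumes f: "continuous_on UNIV f" and P: "trig_poly P"
  shows "\<exists>N. \<forall>n\<ge>N. integral {0..2*pi} (\<lambda>x. (of_real (f x) - fourier_sum f n x) * cnj (P x)) = 0"
  using P
proof (induction rule: trig_poly.induct)
  case (monom c k)
  have "integral {0..2*pi} (\<lambda>x. (of_real (f x) - fourier_sum f n x) * cnj (c * cis (of_int k * x))) = 0"
    if "n \<ge> nat \<bar>k\<bar>" for n
  proof -
    have "(\<lambda>x. (of_real (f x) - fourier_sum f n x) * cnj (c * cis (of_int k * x))) =
      (\<lambda>x. cnj c * ((of_real (f x) - fourier_sum f n x) * cis (- of_int k * x)))"
      by (auto simp: cis_cnj algebra_simps)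
    moreover have "k \<in> {-int n..int n}" using that by auto
    ultimately show ?thesis
      using integral_remainder_cis[OF f] by (simp only: Henstock_Kurzweil_Integration.integral_mult_right mult_zero_right)
  qed
  then show ?case by blast
next
  case (add P Q)
  then obtain N M where NM: "\<forall>n\<ge>N. integral {0..2*pi} (\<lambda>x. (of_real (f x) - fourier_sum f n x) * cnj (P x)) = 0"
    "\<forall>n\<ge>M. integral {0..2*pi} (\<lambda>x. (of_real (f x) - fourier_sum f n x) * cnj (Q x)) = 0" by blast
  have f': "continuous_on X (\<lambda>x. complex_of_real (f x))" for X
    by (intro continuous_intros continuous_on_subset[OF f]) auto
  have "integral {0..2*pi} (\<lambda>x. (of_real (f x) - fourier_sum f n x) * cnj (P x + Q x)) = 0" if "n \<ge> max N M" for n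
  proof -
    have "integral {0..2*pi} (\<lambda>x. (of_real (f x) - fourier_sum f n x) * cnj (P x) + (of_real (f x) - fourier_sum f n x) * cnj (Q x)) =
      integral {0..2*pi} (\<lambda>x. (of_real (f x) - fourier_sum f n x) * cnj (P x)) + integral {0..2*pi} (\<lambda>x. (of_real (f x) - fourier_sum f n x) * cnj (Q x))"
      by (rule Henstock_Kurzweil_Integration.integral_add; intro integrable_continuous_real continuous_intros f' continuous_on_trig_poly add.hyps)
    then show ?thesis
      unfolding complex_cnj_add distrib_left using NM that by simp
  qed
  then show ?case by blast
qed

lemma integral_remainder_fourier_sum:
  assumes f: "continuous_on UNIV f"
  shows "integral {0..2*pi} (\<lambda>x. (of_real (f x) - fourier_sum f n x) * cnj (fourier_sum f n x)) = 0"
proof -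
  have f': "continuous_on X (\<lambda>x. complex_of_real (f x))" for X
    by (intro continuous_intros continuous_on_subset[OF f]) auto
  have cnj: "cnj (fourier_sum f n x) = (\<Sum>k = -int n..int n. cnj (fourier f k / (2*pi)) * cis (- of_int k * x))" for x
    unfolding fourier_sum_def cnj_sum complex_cnj_mult[of _ "cis _"] cis_cnj mult_minus_left ..
  have "(of_real (f x) - fourier_sum f n x) * cnj (fourier_sum f n x) =
    (\<Sum>k = -int n..int n. cnj (fourier f k / (2*pi)) * ((of_real (f x) - fourier_sum f n x) * cis (- of_int k * x)))" for x
    unfolding cnj sum_distrib_left by (simp only: mult.left_commute)
  then have "integral {0..2*pi} (\<lambda>x. (of_real (f x) - fourier_sum f n x) * cnj (fourier_sum f n x)) =
    integral {0..2*pi} (\<lambda>x. \<Sum>k = -int n..int n. cnj (fourier f k / (2*pi)) * ((of_real (f x) - fourier_sum f n x) * cis (- of_int k * x)))"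
    by (simp only:)
  also have "\<dots> = (\<Sum>k = -int n..int n. integral {0..2*pi} (\<lambda>x. cnj (fourier f k / (2*pi)) * ((of_real (f x) - fourier_sum f n x) * cis (- of_int k * x))))"
    by (rule Henstock_Kurzweil_Integration.integral_sum) (simp, intro integrable_continuous_real continuous_intros f')
  also have "\<dots> = 0"
    by (intro sum.neutral ballI) (simp only: Henstock_Kurzweil_Integration.integral_mult_right integral_remainder_cis[OF f] mult_zero_right)
  finally show ?thesis .
qed

lemma integral_remainder_square:
  assumes f: "continuous_on UNIV f"
  shows "integral {0..2*pi} (\<lambda>x. (cmod (of_real (f x) - fourier_sum f n x))\<^sup>2) =
    integral {0..2*pi} (\<lambda>x. (f x)\<^sup>2) - (\<Sum>k = -int n..int n. (cmod (fourier f k))\<^sup>2) / (2 * pi)"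
proof -
  have f': "continuous_on X (\<lambda>x. complex_of_real (f x))" "continuous_on X f" for X
    by (intro continuous_intros continuous_on_subset[OF f]; simp)+
  define R where "R x = of_real (f x) - fourier_sum f n x" for x
  have R: "continuous_on X R" for X unfolding R_def[abs_def] by (intro continuous_intros f')
  have "complex_of_real (integral {0..2*pi} (\<lambda>x. (cmod (R x))\<^sup>2)) = integral {0..2*pi} (\<lambda>x. R x * cnj (R x))"
    unfolding complex_norm_square[symmetric] of_real_power[symmetric]
    by (rule integral_of_real_complex[symmetric]) (intro continuous_intros R)
  also have "\<dots> = integral {0..2*pi} (\<lambda>x. R x * of_real (f x) - R x * cnj (fourier_sum f n x))"
    by (simp add: R_def right_diff_distrib)
  also have "\<dots> = integral {0..2*pi} (\<lambda>x. R x * of_real (f x)) - integral {0..2*pi} (\<lambda>x. R x * cnj (fourier_sum f n x))"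
    by (rule Henstock_Kurzweil_Integration.integral_diff; intro integrable_continuous_real continuous_intros R f')
  also have "integral {0..2*pi} (\<lambda>x. R x * cnj (fourier_sum f n x)) = 0"
    unfolding R_def by (rule integral_remainder_fourier_sum[OF f])
  also have "integral {0..2*pi} (\<lambda>x. R x * of_real (f x)) =
     integral {0..2*pi} (\<lambda>x. of_real ((f x)\<^sup>2) - (\<Sum>k = -int n..int n. fourier f k / (2*pi) * (of_real (f x) * cis (- of_int (-k) * x))))"
  proof -
    have "c * cis (of_int k * x) * of_real (f x) = c * (of_real (f x) * cis (- of_int (-k) * x))" for c and k :: int and x
      by (simp add: mult.commute)
    then have "fourier_sum f n x * of_real (f x) = (\<Sum>k = -int n..int n. fourier f k / (2*pi) * (of_real (f x) * cis (- of_int (-k) * x)))" for x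
      unfolding fourier_sum_def sum_distrib_right by (simp only:)
    moreover have "of_real (f x) * of_real (f x) = complex_of_real ((f x)\<^sup>2)" for x
      by (simp add: power2_eq_square)
    ultimately show ?thesis unfolding R_def left_diff_distrib by (simp only:)
  qed
  also have "\<dots> = integral {0..2*pi} (\<lambda>x. of_real ((f x)\<^sup>2)) - integral {0..2*pi} (\<lambda>x. \<Sum>k = -int n..int n. fourier f k / (2*pi) * (of_real (f x) * cis (- of_int (-k) * x)))"
    by (rule Henstock_Kurzweil_Integration.integral_diff; intro integrable_continuous_real continuous_intros f')
  also have "integral {0..2*pi} (\<lambda>x. complex_of_real ((f x)\<^sup>2)) = of_real (integral {0..2*pi} (\<lambda>x. (f x)\<^sup>2))"
    by (rule integral_of_real_complex) (intro continuous_intros f')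
  also have "integral {0..2*pi} (\<lambda>x. \<Sum>k = -int n..int n. fourier f k / (2*pi) * (of_real (f x) * cis (- of_int (-k) * x))) =
     (\<Sum>k = -int n..int n. integral {0..2*pi} (\<lambda>x. fourier f k / (2*pi) * (of_real (f x) * cis (- of_int (-k) * x))))"
    by (rule Henstock_Kurzweil_Integration.integral_sum) (simp, intro integrable_continuous_real continuous_intros f')
  also have "\<dots> = (\<Sum>k = -int n..int n. fourier f k / (2*pi) * fourier f (-k))"
    by (simp only: Henstock_Kurzweil_Integration.integral_mult_right fourier_def[of _ "- _"])
  also have "\<dots> = (\<Sum>k = -int n..int n. of_real ((cmod (fourier f k))\<^sup>2 / (2*pi)))"
  proof (intro sum.cong refl)
    fix k
    have "fourier f (-k) = cnj (fourier f k)"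
      unfolding fourier_def by (subst Henstock_Kurzweil_Integration.integral_cnj) (simp add: cis_cnj)
    then show "fourier f k / (2*pi) * fourier f (-k) = of_real ((cmod (fourier f k))\<^sup>2 / (2*pi))"
      using complex_norm_square[of "fourier f k"] by simp
  qed
  finally show ?thesis
    unfolding R_def by (simp only: sum_divide_distrib of_real_sum[symmetric] of_real_diff[symmetric] of_real_eq_iff diff_0_right)
qed

lemma Bessel_inequality:
  assumes f: "continuous_on UNIV f"
  shows "(\<Sum>k = -int n..int n. (cmod (fourier f k))\<^sup>2) \<le> 2 * pi * integral {0..2*pi} (\<lambda>x. (f x)\<^sup>2)"
proof -
  have "0 \<le> integral {0..2*pi} (\<lambda>x. (cmod (of_real (f x) - fourier_sum f n x))\<^sup>2)"
    by (rule integral_nonneg)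
       (auto intro!: integrable_continuous_real continuous_intros continuous_on_subset[OF f])
  then show ?thesis unfolding integral_remainder_square[OF f] by (simp add: field_simps)
qed

text \<open>
  Projections are best approximations, so a uniformly close trigonometric polynomial bounds the remainder of all large partial
  sums.
\<close>

lemma Parseval_square:
  fixes f :: "real \<Rightarrow> real"
  assumes f: "continuous_on UNIV f" and per: "\<And>x. f (x + 2 * pi) = f x"
  shows "(\<lambda>n. \<Sum>k = -int n..int n. (cmod (fourier f k))\<^sup>2) \<longlonglongrightarrow> 2 * pi * integral {0..2*pi} (\<lambda>x. (f x)\<^sup>2)"
proof (rule LIMSEQ_I)
  fix r :: real assume r: "0 < r"
  have f': "continuous_on X (\<lambda>x. complex_of_real (f x))" for X
    by (intro continuous_intros continuous_on_subset[OF f]) auto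
  define e where "e = sqrt r / (2 * pi) / 2"
  have e: "0 < e" using r by (simp add: e_def)
  obtain P where P: "trig_poly P" "\<And>x. cmod (of_real (f x) - P x) < e"
    using trig_poly_dense[OF f per e] by blast
  obtain N where N: "\<And>n. n \<ge> N \<Longrightarrow> integral {0..2*pi} (\<lambda>x. (of_real (f x) - fourier_sum f n x) * cnj (P x)) = 0"
    using integral_remainder_trig_poly[OF f P(1)] by blast
  note cP = continuous_on_trig_poly[OF P(1)]
  have "norm ((\<Sum>k = -int n..int n. (cmod (fourier f k))\<^sup>2) - 2 * pi * integral {0..2*pi} (\<lambda>x. (f x)\<^sup>2)) < r" if n: "n \<ge> N" for n
  proof -
    define R where "R x = of_real (f x) - fourier_sum f n x" for x
    define D where "D x = fourier_sum f n x - P x" for x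
    have cR: "continuous_on X R" and cD: "continuous_on X D" for X
      unfolding R_def[abs_def] D_def[abs_def] by (intro continuous_intros f' cP)+
    have RD: "integral {0..2*pi} (\<lambda>x. R x * cnj (D x)) = 0"
    proof -
      have "integral {0..2*pi} (\<lambda>x. R x * cnj (D x)) = integral {0..2*pi} (\<lambda>x. R x * cnj (fourier_sum f n x)) - integral {0..2*pi} (\<lambda>x. R x * cnj (P x))"
        unfolding D_def complex_cnj_diff right_diff_distrib
        by (rule Henstock_Kurzweil_Integration.integral_diff; intro integrable_continuous_real continuous_intros cR cP)
      then show ?thesis
        using N[OF n] integral_remainder_fourier_sum[OF f, of n] by (simp add: R_def)
    qed
    have exp: "(cmod (of_real (f x) - P x))\<^sup>2 = (cmod (R x))\<^sup>2 + (2 * Re (R x * cnj (D x)) + (cmod (D x))\<^sup>2)" for x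
    proof -
      have "of_real (f x) - P x = R x + D x" by (simp add: R_def D_def)
      then show ?thesis unfolding cmod_power2 by (simp only:) (simp add: power2_eq_square algebra_simps)
    qed
    have "integral {0..2*pi} (\<lambda>x. (cmod (of_real (f x) - P x))\<^sup>2) = integral {0..2*pi} (\<lambda>x. (cmod (R x))\<^sup>2) +
       (2 * integral {0..2*pi} (\<lambda>x. Re (R x * cnj (D x))) + integral {0..2*pi} (\<lambda>x. (cmod (D x))\<^sup>2))"
    proof -
      have "integral {0..2*pi} (\<lambda>x. 2 * Re (R x * cnj (D x)) + (cmod (D x))\<^sup>2) = 2 * integral {0..2*pi} (\<lambda>x. Re (R x * cnj (D x))) + integral {0..2*pi} (\<lambda>x. (cmod (D x))\<^sup>2)"
        unfolding Henstock_Kurzweil_Integration.integral_mult_right[symmetric]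
        by (rule Henstock_Kurzweil_Integration.integral_add; intro integrable_continuous_real continuous_intros cR cD)
      moreover have "integral {0..2*pi} (\<lambda>x. (cmod (R x))\<^sup>2 + (2 * Re (R x * cnj (D x)) + (cmod (D x))\<^sup>2)) =
          integral {0..2*pi} (\<lambda>x. (cmod (R x))\<^sup>2) + integral {0..2*pi} (\<lambda>x. 2 * Re (R x * cnj (D x)) + (cmod (D x))\<^sup>2)"
        by (rule Henstock_Kurzweil_Integration.integral_add; intro integrable_continuous_real continuous_intros cR cD)
      ultimately show ?thesis unfolding exp by simp
    qed
    moreover have "integral {0..2*pi} (\<lambda>x. Re (R x * cnj (D x))) = Re (integral {0..2*pi} (\<lambda>x. R x * cnj (D x)))"
      by (rule integral_linear[OF _ bounded_linear_Re, unfolded o_def])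
         (intro integrable_continuous_real continuous_intros cR cD)
    moreover have "0 \<le> integral {0..2*pi} (\<lambda>x. (cmod (D x))\<^sup>2)"
      by (rule integral_nonneg) (auto intro!: integrable_continuous_real continuous_intros cD)
    ultimately have "integral {0..2*pi} (\<lambda>x. (cmod (R x))\<^sup>2) \<le> integral {0..2*pi} (\<lambda>x. (cmod (of_real (f x) - P x))\<^sup>2)"
      using RD by simp
    also have "\<dots> \<le> integral {0..2*pi} (\<lambda>x. e\<^sup>2)"
    proof (rule integral_le)
      show "(cmod (of_real (f x) - P x))\<^sup>2 \<le> e\<^sup>2" for x
        by (rule power_mono[OF less_imp_le[OF P(2)]]) simp
    qed (intro integrable_continuous_real continuous_intros f' cP)+
    also have "\<dots> = 2 * pi * e\<^sup>2" by simp
    finally have "2 * pi * integral {0..2*pi} (\<lambda>x. (f x)\<^sup>2) - (\<Sum>k = -int n..int n. (cmod (fourier f k))\<^sup>2) \<le> 2 * pi * (2 * pi * e\<^sup>2)"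
      unfolding R_def integral_remainder_square[OF f] by (simp add: field_simps)
    also have "\<dots> = r / 4" using r by (simp add: e_def field_simps power2_eq_square)
    finally show ?thesis using Bessel_inequality[OF f, of n] r by (simp add: abs_if)
  qed
  then show "\<exists>N. \<forall>n\<ge>N. norm ((\<Sum>k = -int n..int n. (cmod (fourier f k))\<^sup>2) - 2 * pi * integral {0..2*pi} (\<lambda>x. (f x)\<^sup>2)) < r"
    by blast
qed

lemma fourier_add:
  assumes "continuous_on UNIV f" "continuous_on UNIV g"
  shows "fourier (\<lambda>x. f x + g x) k = fourier f k + fourier g k"
  unfolding fourier_def distrib_right
  by (rule Henstock_Kurzweil_Integration.integral_add; intro integrable_continuous_real continuous_intros continuous_on_subset[OF assms(1)] continuous_on_subset[OF assms(2)] subset_UNIV)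

lemma fourier_diff:
  assumes "continuous_on UNIV f" "continuous_on UNIV g"
  shows "fourier (\<lambda>x. f x - g x) k = fourier f k - fourier g k"
  unfolding fourier_def left_diff_distrib
  by (rule Henstock_Kurzweil_Integration.integral_diff; intro integrable_continuous_real continuous_intros continuous_on_subset[OF assms(1)] continuous_on_subset[OF assms(2)] subset_UNIV)

lemma fourier_cmult: "fourier (\<lambda>x. c * f x) k = c * fourier f k"
  unfolding fourier_def mult.assoc by (simp only: Henstock_Kurzweil_Integration.integral_mult_right)

lemma fourier_cis_mult: "fourier (\<lambda>x. f x * cis (of_int j * x)) k = fourier f (k - j)"
proof -
  have "cis (of_int j * x) * cis (- of_int k * x) = cis (- of_int (k - j) * x)" for x :: real
    by (simp add: cis_mult left_diff_distrib)
  then show ?thesis unfolding fourier_def mult.assoc by (simp only:)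
qed

lemma fourier_uminus: "fourier (\<lambda>x. complex_of_real (f x)) (- k) = cnj (fourier (\<lambda>x. complex_of_real (f x)) k)"
  unfolding fourier_def by (subst Henstock_Kurzweil_Integration.integral_cnj) (simp add: cis_cnj)

lemma fourier_1: "fourier (\<lambda>x. 1) k = (if k = 0 then 2 * pi else 0)"
  using integral_cis[of "- k"] unfolding fourier_def by simp

lemma cis_of_int_uminus: "cis (of_int (- j) * x) = cnj (cis (of_int j * x))"
  by (simp add: cis_cnj)

lemma of_real_cos_int: "complex_of_real (cos (of_int j * x)) = 1/2 * cis (of_int j * x) + 1/2 * cis (of_int (- j) * x)"
  unfolding cis_of_int_uminus by (simp add: complex_eq_iff)

lemma of_real_sin_int: "complex_of_real (sin (of_int j * x)) = (1/(2*\<i>)) * cis (of_int j * x) + (-1/(2*\<i>)) * cis (of_int (- j) * x)"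
  unfolding cis_of_int_uminus by (simp add: complex_eq_iff)

lemma fourier_mult_cos:
  assumes "continuous_on UNIV f"
  shows "fourier (\<lambda>x. f x * of_real (cos (of_int j * x))) k = (fourier f (k - j) + fourier f (k + j)) / 2"
proof -
  have "fourier (\<lambda>x. f x * of_real (cos (of_int j * x))) k =
     fourier (\<lambda>x. 1/2 * (f x * cis (of_int j * x)) + 1/2 * (f x * cis (of_int (- j) * x))) k"
    unfolding of_real_cos_int by (simp only: distrib_left mult.left_commute)
  also have "\<dots> = 1/2 * fourier f (k - j) + 1/2 * fourier f (k - (- j))"
    by (subst fourier_add) (intro continuous_intros assms | simp only: fourier_cmult fourier_cis_mult)+
  finally show ?thesis by simp
qed

lemma fourier_mult_sin:
  assumes "continuous_on UNIV f"
  shows "fourier (\<lambda>x. f x * of_real (sin (of_int j * x))) k = (fourier f (k - j) - fourier f (k + j)) / (2 * \<i>)"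
proof -
  have "fourier (\<lambda>x. f x * of_real (sin (of_int j * x))) k =
     fourier (\<lambda>x. (1/(2*\<i>)) * (f x * cis (of_int j * x)) + (-1/(2*\<i>)) * (f x * cis (of_int (- j) * x))) k"
    unfolding of_real_sin_int by (simp only: distrib_left mult.left_commute)
  also have "\<dots> = (1/(2*\<i>)) * fourier f (k - j) + (-1/(2*\<i>)) * fourier f (k - (- j))"
    by (subst fourier_add) (intro continuous_intros assms | simp only: fourier_cmult fourier_cis_mult)+
  finally show ?thesis by (simp add: diff_divide_distrib right_diff_distrib)
qed

lemma Re_Im_fourier:
  assumes "continuous_on UNIV f"
  shows "Re (fourier (\<lambda>x. complex_of_real (f x)) k) = integral {0..2*pi} (\<lambda>x. f x * cos (of_int k * x))"
    and "Im (fourier (\<lambda>x. complex_of_real (f x)) k) = - integral {0..2*pi} (\<lambda>x. f x * sin (of_int k * x))"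
proof -
  have int: "(\<lambda>x. complex_of_real (f x) * cis (- of_int k * x)) integrable_on {0..2*pi}"
    by (intro integrable_continuous_real continuous_intros continuous_on_subset[OF assms] subset_UNIV)
  show "Re (fourier (\<lambda>x. complex_of_real (f x)) k) = integral {0..2*pi} (\<lambda>x. f x * cos (of_int k * x))"
    using integral_linear[OF int bounded_linear_Re] by (simp add: o_def fourier_def)
  show "Im (fourier (\<lambda>x. complex_of_real (f x)) k) = - integral {0..2*pi} (\<lambda>x. f x * sin (of_int k * x))"
    using integral_linear[OF int bounded_linear_Im] by (simp add: o_def fourier_def)
qed

lemma norm_fourier_le:
  assumes "continuous_on UNIV f"
  shows "cmod (fourier (\<lambda>x. complex_of_real (f x)) k) \<le> integral {0..2*pi} (\<lambda>x. \<bar>f x\<bar>)"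
  unfolding fourier_def
  by (rule integral_norm_bound_integral)
     (auto intro!: integrable_continuous_real continuous_intros continuous_on_subset[OF assms] simp: norm_mult)

lemma fourier_derivative:
  fixes f :: "real \<Rightarrow> real"
  assumes "\<And>x. (f has_real_derivative f' x) (at x)" "continuous_on UNIV f'" "\<And>x. f (x + 2 * pi) = f x"
  shows "fourier (\<lambda>x. of_real (f' x)) k = \<i> * of_int k * fourier (\<lambda>x. of_real (f x)) k"
proof -
  have cf: "continuous_on UNIV f"
    by (intro continuous_at_imp_continuous_on ballI DERIV_isCont[OF assms(1)])
  have D: "((\<lambda>x. complex_of_real (f x) * cis (- of_int k * x)) has_vector_derivative
      of_real (f x) * (\<i> * of_real (- of_int k) * cis (- of_int k * x)) + of_real (f' x) * cis (- of_int k * x)) (at x within {0..2*pi})" for x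
  proof (rule has_vector_derivative_mult[OF _ has_vector_derivative_cis_mult])
    show "((\<lambda>x. complex_of_real (f x)) has_vector_derivative of_real (f' x)) (at x within {0..2*pi})"
      by (rule has_vector_derivative_of_real) (rule has_field_derivative_at_within[OF assms(1)])
  qed
  have "((\<lambda>x. of_real (f x) * (\<i> * of_real (- of_int k) * cis (- of_int k * x)) + of_real (f' x) * cis (- of_int k * x))
     has_integral (complex_of_real (f (2*pi)) * cis (- of_int k * (2*pi)) - of_real (f 0) * cis (- of_int k * 0))) {0..2*pi}"
    by (rule fundamental_theorem_of_calculus[OF _ D]) simp
  then have "integral {0..2*pi} (\<lambda>x. of_real (f x) * (\<i> * of_real (- of_int k) * cis (- of_int k * x)) + of_real (f' x) * cis (- of_int k * x)) = 0"
    using assms(3)[of 0] cis_int_2pi[of "- k"] by (simp add: integral_unique)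
  moreover have "integral {0..2*pi} (\<lambda>x. of_real (f x) * (\<i> * of_real (- of_int k) * cis (- of_int k * x)) + of_real (f' x) * cis (- of_int k * x)) =
    integral {0..2*pi} (\<lambda>x. (- \<i> * of_int k) * (of_real (f x) * cis (- of_int k * x))) + integral {0..2*pi} (\<lambda>x. of_real (f' x) * cis (- of_int k * x))"
    by (subst Henstock_Kurzweil_Integration.integral_add[symmetric])
       (intro integrable_continuous_real continuous_intros continuous_on_subset[OF cf] continuous_on_subset[OF assms(2)] subset_UNIV
        | simp add: mult_ac)+
  ultimately show ?thesis
    unfolding fourier_def by (simp only: Henstock_Kurzweil_Integration.integral_mult_right) (simp add: eq_neg_iff_add_eq_0 add.commute)
qed

text \<open>
  By polarization.
\<close>

lemma Parseval:
  fixes f g :: "real \<Rightarrow> real"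
  assumes f: "continuous_on UNIV f" "\<And>x. f (x + 2 * pi) = f x"
    and g: "continuous_on UNIV g" "\<And>x. g (x + 2 * pi) = g x"
  shows "(\<lambda>n. \<Sum>k = -int n..int n. Re (fourier f k * cnj (fourier g k))) \<longlonglongrightarrow> 2 * pi * integral {0..2*pi} (\<lambda>x. f x * g x)"
proof -
  have cf: "continuous_on X f" and cg: "continuous_on X g" for X
    using f(1) g(1) continuous_on_subset by blast+
  have pl: "fourier (\<lambda>x. complex_of_real (f x + g x)) k = fourier f k + fourier g k"
    and mi: "fourier (\<lambda>x. complex_of_real (f x - g x)) k = fourier f k - fourier g k" for k
    unfolding of_real_add of_real_diff
    by (intro fourier_add fourier_diff continuous_intros cf cg)+
  have id: "(cmod (a + b))\<^sup>2 - (cmod (a - b))\<^sup>2 = 4 * Re (a * cnj b)" for a b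
    unfolding cmod_power2 by (simp add: power2_eq_square algebra_simps)
  have P1: "(\<lambda>n. \<Sum>k = -int n..int n. (cmod (fourier f k + fourier g k))\<^sup>2) \<longlonglongrightarrow> 2 * pi * integral {0..2*pi} (\<lambda>x. (f x + g x)\<^sup>2)"
    using Parseval_square[of "\<lambda>x. f x + g x"] unfolding pl by (simp add: continuous_on_add cf cg f(2) g(2))
  have P2: "(\<lambda>n. \<Sum>k = -int n..int n. (cmod (fourier f k - fourier g k))\<^sup>2) \<longlonglongrightarrow> 2 * pi * integral {0..2*pi} (\<lambda>x. (f x - g x)\<^sup>2)"
    using Parseval_square[of "\<lambda>x. f x - g x"] unfolding mi by (simp add: continuous_on_diff cf cg f(2) g(2))
  have "integral {0..2*pi} (\<lambda>x. (f x + g x)\<^sup>2) - integral {0..2*pi} (\<lambda>x. (f x - g x)\<^sup>2) = integral {0..2*pi} (\<lambda>x. (f x + g x)\<^sup>2 - (f x - g x)\<^sup>2)"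
    by (rule Henstock_Kurzweil_Integration.integral_diff[symmetric]; intro integrable_continuous_real continuous_intros cf cg)
  also have "(\<lambda>x. (f x + g x)\<^sup>2 - (f x - g x)\<^sup>2) = (\<lambda>x. 4 * (f x * g x))"
    by (auto simp: power2_eq_square algebra_simps)
  finally have I: "integral {0..2*pi} (\<lambda>x. (f x + g x)\<^sup>2) - integral {0..2*pi} (\<lambda>x. (f x - g x)\<^sup>2) = 4 * integral {0..2*pi} (\<lambda>x. f x * g x)"
    by (simp only: Henstock_Kurzweil_Integration.integral_mult_right)
  have "(\<lambda>n. ((\<Sum>k = -int n..int n. (cmod (fourier f k + fourier g k))\<^sup>2) - (\<Sum>k = -int n..int n. (cmod (fourier f k - fourier g k))\<^sup>2)) / 4)
     \<longlonglongrightarrow> (2 * pi * integral {0..2*pi} (\<lambda>x. (f x + g x)\<^sup>2) - 2 * pi * integral {0..2*pi} (\<lambda>x. (f x - g x)\<^sup>2)) / 4"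
    by (intro tendsto_divide tendsto_diff P1 P2 tendsto_const) simp
  then show ?thesis
    unfolding sum_subtractf[symmetric] id right_diff_distrib[symmetric] I sum_distrib_left[symmetric] by (simp add: mult.assoc)
qed

section \<open>Mapping properties of the Steklov multipliers\<close>

lemma continuous_on_of_DERIV: "(\<And>x. (f has_real_derivative f' x) (at x)) \<Longrightarrow> continuous_on X f"
  by (intro continuous_at_imp_continuous_on ballI DERIV_isCont[of f "f' _"]) auto

lemma integral_square_le:
  fixes f :: "real \<Rightarrow> real"
  assumes "continuous_on UNIV f" "\<And>x. \<bar>f x\<bar> \<le> B"
  shows "integral {0..2*pi} (\<lambda>x. (f x)\<^sup>2) \<le> 2 * pi * B\<^sup>2"
proof -
  have "integral {0..2*pi} (\<lambda>x. (f x)\<^sup>2) \<le> integral {0..2*pi} (\<lambda>x. B\<^sup>2)"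
  proof (rule integral_le)
    show "(f x)\<^sup>2 \<le> B\<^sup>2" for x using power_mono[OF assms(2)[of x], of 2] by simp
  qed (intro integrable_continuous_real continuous_intros continuous_on_subset[OF assms(1)] subset_UNIV)+
  then show ?thesis by simp
qed

lemma norm_fourier_le_sup:
  fixes f :: "real \<Rightarrow> real"
  assumes "continuous_on UNIV f" "\<And>x. \<bar>f x\<bar> \<le> B"
  shows "cmod (fourier f k) \<le> 2 * pi * B"
proof -
  have "cmod (fourier f k) \<le> integral {0..2*pi} (\<lambda>x. \<bar>f x\<bar>)" by (rule norm_fourier_le[OF assms(1)])
  also have "\<dots> \<le> integral {0..2*pi} (\<lambda>x. B)"
    by (rule integral_le) (intro integrable_continuous_real continuous_intros continuous_on_subset[OF assms(1)] subset_UNIV assms(2))+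
  finally show ?thesis by simp
qed

text \<open>
  The function \<open>m\<close> stands for \<open>(D - d\<^sub>1) u\<close> with a first order multiplier \<open>D\<close>. It has
  no modes \<open>\<plusminus>1\<close>, its modes \<open>\<plusminus>2\<close> are of size \<open>\<delta>\<close>, and its other
  modes are those of \<open>H\<close> multiplied by at most \<open>3 (1 + \<bar>k\<bar>)\<close>. Moving the factor \<open>1 +
  \<bar>k\<bar>\<close> to the differentiable function \<open>\<psi>\<close> makes the pairing bounded by the
  \<open>L\<^sup>2\<close> norm of \<open>H\<close>, not by a norm of its derivative.
\<close>

lemma pairing_bound:
  fixes u m H \<psi> \<psi>' :: "real \<Rightarrow> real" and c :: "int \<Rightarrow> real"
  assumes u: "continuous_on UNIV u" "\<And>x. \<bar>u x\<bar> \<le> 1"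
    and m: "continuous_on UNIV m" "\<And>x. m (x + 2 * pi) = m x"
    and H: "continuous_on UNIV H"
    and \<psi>: "\<And>x. (\<psi> has_real_derivative \<psi>' x) (at x)" "continuous_on UNIV \<psi>'" "\<And>x. \<psi> (x + 2 * pi) = \<psi> x"
    and B: "\<And>x. \<bar>\<psi> x\<bar> \<le> B" "\<And>x. \<bar>\<psi>' x\<bar> \<le> B"
    and mk: "\<And>k. fourier m k = of_real (c k) * fourier u k"
    and Hk: "\<And>k. fourier H k = (if \<bar>k\<bar> = 1 \<or> \<bar>k\<bar> = 2 then 0 else fourier u k)"
    and c1: "\<And>k. \<bar>k\<bar> = 1 \<Longrightarrow> c k = 0" and c2: "\<And>k. \<bar>k\<bar> = 2 \<Longrightarrow> \<bar>c k\<bar> \<le> \<delta>"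
    and c3: "\<And>k. \<bar>k\<bar> \<noteq> 1 \<Longrightarrow> \<bar>k\<bar> \<noteq> 2 \<Longrightarrow> \<bar>c k\<bar> \<le> 3 * (1 + \<bar>of_int k\<bar>)"
    and \<delta>: "0 \<le> \<delta>"
  shows "\<bar>integral {0..2*pi} (\<lambda>x. m x * \<psi> x)\<bar> \<le> 20 * B * (sqrt (integral {0..2*pi} (\<lambda>x. (H x)\<^sup>2)) + \<delta>)"
proof -
  define h where "h = sqrt (integral {0..2*pi} (\<lambda>x. (H x)\<^sup>2))"
  have B0: "0 \<le> B" using B(1)[of 0] by linarith
  have ih: "0 \<le> integral {0..2*pi} (\<lambda>x. (H x)\<^sup>2)"
    by (rule integral_nonneg) (auto intro!: integrable_continuous_real continuous_intros continuous_on_subset[OF H])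
  have h0: "0 \<le> h" by (simp add: h_def ih)
  have c\<psi>: "continuous_on UNIV \<psi>" by (rule continuous_on_of_DERIV[OF \<psi>(1)])
  define E where "E = \<delta> * (2 * pi) * (2 * pi * B)"
  have E0: "0 \<le> E" using \<delta> B0 by (simp add: E_def)
  have summand: "\<bar>Re (fourier m k * cnj (fourier \<psi> k))\<bar> \<le>
     3 * (\<bar>cmod (fourier H k)\<bar> * \<bar>(1 + \<bar>of_int k\<bar>) * cmod (fourier \<psi> k)\<bar>) + (if \<bar>k\<bar> = 2 then E else 0)" for k
  proof -
    have a: "\<bar>Re (fourier m k * cnj (fourier \<psi> k))\<bar> \<le> \<bar>c k\<bar> * cmod (fourier u k) * cmod (fourier \<psi> k)"
      using abs_Re_le_cmod[of "fourier m k * cnj (fourier \<psi> k)"] by (simp add: norm_mult mk)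
    show ?thesis
    proof (cases "\<bar>k\<bar> = 1")
      case True
      then show ?thesis using a c1[of k] by simp
    next
      case n1: False
      show ?thesis
      proof (cases "\<bar>k\<bar> = 2")
        case True
        have "\<bar>c k\<bar> * cmod (fourier u k) * cmod (fourier \<psi> k) \<le> \<delta> * (2 * pi * 1) * (2 * pi * B)"
          by (intro mult_mono c2[OF True] norm_fourier_le_sup u c\<psi> B) (auto intro!: mult_nonneg_nonneg \<delta>)
        then show ?thesis using a True by (simp add: E_def Hk)
      next
        case False
        have "\<bar>c k\<bar> * cmod (fourier u k) * cmod (fourier \<psi> k) \<le> 3 * (1 + \<bar>of_int k\<bar>) * cmod (fourier u k) * cmod (fourier \<psi> k)"
          by (intro mult_right_mono c3 n1 False) auto
        with a have "\<bar>Re (fourier m k * cnj (fourier \<psi> k))\<bar> \<le> 3 * (1 + \<bar>of_int k\<bar>) * cmod (fourier u k) * cmod (fourier \<psi> k)"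
          by (rule order_trans)
        also have "\<dots> = 3 * (\<bar>cmod (fourier H k)\<bar> * \<bar>(1 + \<bar>of_int k\<bar>) * cmod (fourier \<psi> k)\<bar>)"
          using n1 False by (simp add: Hk abs_mult)
        finally show ?thesis using False by simp
      qed
    qed
  qed
  have bound: "\<bar>\<Sum>k = -int n..int n. Re (fourier m k * cnj (fourier \<psi> k))\<bar> \<le> 3 * (sqrt (2 * pi) * h * (4 * pi * B)) + 2 * E" for n
  proof -
    let ?A = "{-int n..int n}"
    have "(\<Sum>k\<in>?A. \<bar>cmod (fourier H k)\<bar> * \<bar>(1 + \<bar>of_int k\<bar>) * cmod (fourier \<psi> k)\<bar>)
       \<le> L2_set (\<lambda>k. cmod (fourier H k)) ?A * L2_set (\<lambda>k. (1 + \<bar>of_int k\<bar>) * cmod (fourier \<psi> k)) ?A"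
      by (rule L2_set_mult_ineq)
    also have "\<dots> \<le> (sqrt (2 * pi) * h) * (4 * pi * B)"
    proof (intro mult_mono)
      show "L2_set (\<lambda>k. cmod (fourier H k)) ?A \<le> sqrt (2 * pi) * h"
        unfolding L2_set_def h_def real_sqrt_mult[symmetric] by (rule real_sqrt_le_mono[OF Bessel_inequality[OF H]])
      have "(\<Sum>k\<in>?A. ((1 + \<bar>of_int k\<bar>) * cmod (fourier \<psi> k))\<^sup>2) \<le> (\<Sum>k\<in>?A. 2 * (cmod (fourier \<psi> k))\<^sup>2 + 2 * (cmod (fourier \<psi>' k))\<^sup>2)"
      proof (intro sum_mono)
        fix k
        have d: "cmod (fourier \<psi>' k) = \<bar>of_int k\<bar> * cmod (fourier \<psi> k)"
          unfolding fourier_derivative[OF \<psi>] by (simp add: norm_mult)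
        have "0 \<le> (1 - \<bar>real_of_int k\<bar>)\<^sup>2 * (cmod (fourier \<psi> k))\<^sup>2" by simp
        then show "((1 + \<bar>of_int k\<bar>) * cmod (fourier \<psi> k))\<^sup>2 \<le> 2 * (cmod (fourier \<psi> k))\<^sup>2 + 2 * (cmod (fourier \<psi>' k))\<^sup>2"
          unfolding d by (simp add: power2_eq_square algebra_simps)
      qed
      also have "\<dots> = 2 * (\<Sum>k\<in>?A. (cmod (fourier \<psi> k))\<^sup>2) + 2 * (\<Sum>k\<in>?A. (cmod (fourier \<psi>' k))\<^sup>2)"
        by (simp add: sum.distrib sum_distrib_left)
      also have "\<dots> \<le> 2 * (2 * pi * (2 * pi * B\<^sup>2)) + 2 * (2 * pi * (2 * pi * B\<^sup>2))"
      proof (intro add_mono mult_left_mono)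
        show "(\<Sum>k\<in>?A. (cmod (fourier \<psi> k))\<^sup>2) \<le> 2 * pi * (2 * pi * B\<^sup>2)"
          by (rule order_trans[OF Bessel_inequality[OF c\<psi>] mult_left_mono[OF integral_square_le[OF c\<psi> B(1)]]]) simp
        show "(\<Sum>k\<in>?A. (cmod (fourier \<psi>' k))\<^sup>2) \<le> 2 * pi * (2 * pi * B\<^sup>2)"
          by (rule order_trans[OF Bessel_inequality[OF \<psi>(2)] mult_left_mono[OF integral_square_le[OF \<psi>(2) B(2)]]]) simp
      qed auto
      also have "\<dots> = (4 * pi * B)\<^sup>2" by (simp add: power2_eq_square)
      finally show "L2_set (\<lambda>k. (1 + \<bar>of_int k\<bar>) * cmod (fourier \<psi> k)) ?A \<le> 4 * pi * B"
        unfolding L2_set_def using B0 by (intro real_le_lsqrt) auto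
    qed (auto simp: h0 L2_set_def intro!: sum_nonneg)
    finally have CS: "(\<Sum>k\<in>?A. \<bar>cmod (fourier H k)\<bar> * \<bar>(1 + \<bar>of_int k\<bar>) * cmod (fourier \<psi> k)\<bar>) \<le> sqrt (2 * pi) * h * (4 * pi * B)" .
    have "(\<Sum>k\<in>?A. if \<bar>k\<bar> = 2 then E else 0) = (\<Sum>k\<in>{k\<in>?A. \<bar>k\<bar> = 2}. E)"
      by (rule sum.inter_filter[symmetric]) simp
    also have "\<dots> \<le> (\<Sum>k\<in>{-2,2::int}. E)"
      using E0 by (intro sum_mono2) auto
    finally have E2: "(\<Sum>k\<in>?A. if \<bar>k\<bar> = 2 then E else 0) \<le> 2 * E" by simp
    have "\<bar>\<Sum>k\<in>?A. Re (fourier m k * cnj (fourier \<psi> k))\<bar> \<le> (\<Sum>k\<in>?A. \<bar>Re (fourier m k * cnj (fourier \<psi> k))\<bar>)" by (rule sum_abs)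
    also have "\<dots> \<le> (\<Sum>k\<in>?A. 3 * (\<bar>cmod (fourier H k)\<bar> * \<bar>(1 + \<bar>of_int k\<bar>) * cmod (fourier \<psi> k)\<bar>) + (if \<bar>k\<bar> = 2 then E else 0))"
      by (rule sum_mono) (rule summand)
    also have "\<dots> = 3 * (\<Sum>k\<in>?A. \<bar>cmod (fourier H k)\<bar> * \<bar>(1 + \<bar>of_int k\<bar>) * cmod (fourier \<psi> k)\<bar>) + (\<Sum>k\<in>?A. if \<bar>k\<bar> = 2 then E else 0)"
      by (simp only: sum.distrib sum_distrib_left)
    finally show ?thesis using CS E2 by linarith
  qed
  have "(\<lambda>n. \<bar>\<Sum>k = -int n..int n. Re (fourier m k * cnj (fourier \<psi> k))\<bar>) \<longlonglongrightarrow> \<bar>2 * pi * integral {0..2*pi} (\<lambda>x. m x * \<psi> x)\<bar>"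
    by (rule tendsto_rabs[OF Parseval[OF m c\<psi> \<psi>(3)]])
  then have "\<bar>2 * pi * integral {0..2*pi} (\<lambda>x. m x * \<psi> x)\<bar> \<le> 3 * (sqrt (2 * pi) * h * (4 * pi * B)) + 2 * E"
    by (rule LIMSEQ_le_const2) (use bound in blast)
  also have "\<dots> = 2 * pi * (6 * sqrt (2 * pi) * (h * B) + 4 * pi * (\<delta> * B))"
    unfolding E_def by (simp add: algebra_simps)
  finally have "\<bar>integral {0..2*pi} (\<lambda>x. m x * \<psi> x)\<bar> \<le> 6 * sqrt (2 * pi) * (h * B) + 4 * pi * (\<delta> * B)"
    by (simp add: abs_mult)
  also have "\<dots> \<le> 6 * 3 * (h * B) + 4 * 4 * (\<delta> * B)"
  proof (intro add_mono mult_right_mono mult_left_mono)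
    show "sqrt (2 * pi) \<le> 3" using pi_less_4 by (intro real_le_lsqrt) auto
  qed (use h0 B0 \<delta> pi_less_4 in auto)
  also have "\<dots> \<le> 20 * B * (h + \<delta>)"
    using mult_nonneg_nonneg[OF h0 B0] mult_nonneg_nonneg[OF \<delta> B0] by (simp add: algebra_simps)
  finally show ?thesis by (simp add: h_def)
qed

text \<open>
  The spectral gap: on modes \<open>\<bar>k\<bar> \<ge> 3\<close> the multiplier is at least \<open>1/2\<close>. Only the mode 0
  has a negative multiplier; it is bounded separately, its coefficient being small for the curves of interest.
\<close>

lemma energy_lower_bound:
  fixes u m H :: "real \<Rightarrow> real" and c :: "int \<Rightarrow> real"
  assumes m: "continuous_on UNIV m" "\<And>x. m (x + 2 * pi) = m x"
    and H: "continuous_on UNIV H" "\<And>x. H (x + 2 * pi) = H x"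
    and mk: "\<And>k. fourier m k = of_real (c k) * fourier u k"
    and Hk: "\<And>k. fourier H k = (if \<bar>k\<bar> = 1 \<or> \<bar>k\<bar> = 2 then 0 else fourier u k)"
    and c0: "c 0 \<ge> - 2" and c3: "\<And>k. \<bar>k\<bar> \<ge> 3 \<Longrightarrow> c k \<ge> 1/2"
  shows "2 * pi * integral {0..2*pi} (\<lambda>x. m x * H x) \<ge>
     pi * integral {0..2*pi} (\<lambda>x. (H x)\<^sup>2) - 5/2 * (cmod (fourier u 0))\<^sup>2"
proof -
  have summand: "Re (fourier m k * cnj (fourier H k)) \<ge> 1/2 * (cmod (fourier H k))\<^sup>2 - (if k = 0 then 5/2 * (cmod (fourier u 0))\<^sup>2 else 0)" for k
  proof (cases "\<bar>k\<bar> = 1 \<or> \<bar>k\<bar> = 2")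
    case True
    then show ?thesis by (auto simp: Hk)
  next
    case False
    then have "Re (fourier m k * cnj (fourier H k)) = c k * (cmod (fourier u k))\<^sup>2" "fourier H k = fourier u k"
      by (simp_all add: Hk mk mult.assoc complex_norm_square[symmetric] flip: of_real_mult)
    moreover have "c k * (cmod (fourier u k))\<^sup>2 \<ge> 1/2 * (cmod (fourier u k))\<^sup>2 - (if k = 0 then 5/2 * (cmod (fourier u 0))\<^sup>2 else 0)"
    proof (cases "k = 0")
      case True
      then show ?thesis using mult_right_mono[OF c0, of "(cmod (fourier u 0))\<^sup>2"] by simp
    next
      case k0: False
      with False have "\<bar>k\<bar> \<ge> 3" by linarith
      then show ?thesis using mult_right_mono[OF c3[of k], of "(cmod (fourier u k))\<^sup>2"] k0 by simp
    qed
    ultimately show ?thesis by simp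
  qed
  have "(\<Sum>k = -int n..int n. Re (fourier m k * cnj (fourier H k))) \<ge>
     1/2 * (\<Sum>k = -int n..int n. (cmod (fourier H k))\<^sup>2) - 5/2 * (cmod (fourier u 0))\<^sup>2" for n
  proof -
    have "(\<Sum>k = -int n..int n. Re (fourier m k * cnj (fourier H k))) \<ge>
      (\<Sum>k = -int n..int n. 1/2 * (cmod (fourier H k))\<^sup>2 - (if k = 0 then 5/2 * (cmod (fourier u 0))\<^sup>2 else 0))"
      by (rule sum_mono) (rule summand)
    also have "(\<Sum>k = -int n..int n. 1/2 * (cmod (fourier H k))\<^sup>2 - (if k = 0 then 5/2 * (cmod (fourier u 0))\<^sup>2 else 0)) =
       1/2 * (\<Sum>k = -int n..int n. (cmod (fourier H k))\<^sup>2) - 5/2 * (cmod (fourier u 0))\<^sup>2"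
      by (simp add: sum_subtractf sum_distrib_left)
    finally show ?thesis .
  qed
  moreover have "(\<lambda>n. 1/2 * (\<Sum>k = -int n..int n. (cmod (fourier H k))\<^sup>2) - 5/2 * (cmod (fourier u 0))\<^sup>2)
     \<longlonglongrightarrow> 1/2 * (2 * pi * integral {0..2*pi} (\<lambda>x. (H x)\<^sup>2)) - 5/2 * (cmod (fourier u 0))\<^sup>2"
    by (intro tendsto_diff tendsto_mult tendsto_const Parseval_square H)
  ultimately have "1/2 * (2 * pi * integral {0..2*pi} (\<lambda>x. (H x)\<^sup>2)) - 5/2 * (cmod (fourier u 0))\<^sup>2 \<le> 2 * pi * integral {0..2*pi} (\<lambda>x. m x * H x)"
    by (intro LIMSEQ_le[OF _ Parseval[OF m H]]) auto
  then show ?thesis by simp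
qed

section \<open>Curves close to the critical boundary curve\<close>

lemma fourier_mult_trig:
  fixes f :: "real \<Rightarrow> real"
  assumes f: "continuous_on UNIV f"
  shows "fourier (\<lambda>x. complex_of_real (f x * (a * cos x + b * sin x + c * cos (2 * x) + e * sin (2 * x)))) k =
     of_real a * ((fourier f (k - 1) + fourier f (k + 1)) / 2) + of_real b * ((fourier f (k - 1) - fourier f (k + 1)) / (2 * \<i>)) +
     of_real c * ((fourier f (k - 2) + fourier f (k + 2)) / 2) + of_real e * ((fourier f (k - 2) - fourier f (k + 2)) / (2 * \<i>))"
proof -
  have cf: "continuous_on X (\<lambda>x. complex_of_real (f x))" for X
    by (intro continuous_intros continuous_on_subset[OF f]) auto
  have "(\<lambda>x. complex_of_real (f x * (a * cos x + b * sin x + c * cos (2 * x) + e * sin (2 * x)))) =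
    (\<lambda>x. of_real a * (of_real (f x) * of_real (cos (of_int 1 * x))) + of_real b * (of_real (f x) * of_real (sin (of_int 1 * x))) +
      of_real c * (of_real (f x) * of_real (cos (of_int 2 * x))) + of_real e * (of_real (f x) * of_real (sin (of_int 2 * x))))"
    by (simp add: fun_eq_iff algebra_simps)
  moreover have g: "continuous_on UNIV (\<lambda>x. of_real w * (of_real (f x) * complex_of_real (cos (of_int j * x))))"
    "continuous_on UNIV (\<lambda>x. of_real w * (of_real (f x) * complex_of_real (sin (of_int j * x))))" for w :: real and j :: int
    by (intro continuous_intros cf)+
  ultimately show ?thesis
    by (simp only: fourier_add[OF continuous_on_add[OF continuous_on_add[OF g(1) g(2)] g(1)] g(2)]
          fourier_add[OF continuous_on_add[OF g(1) g(2)] g(1)] fourier_add[OF g(1) g(2)]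
          fourier_cmult fourier_mult_cos[OF cf] fourier_mult_sin[OF cf])
qed

lemma continuous_periodic_zero:
  fixes f :: "real \<Rightarrow> real"
  assumes "continuous_on UNIV f" "\<And>x. f (x + 2 * pi) = f x" "integral {0..2*pi} (\<lambda>x. (f x)\<^sup>2) = 0"
  shows "f x = 0"
proof -
  have z: "f y = 0" if "y \<in> {0..2*pi}" for y
  proof -
    have "\<forall>y\<in>{0..2*pi}. (f y)\<^sup>2 = 0"
      using assms(3) by (subst (asm) integral_eq_0_iff)
        (auto intro!: continuous_intros continuous_on_subset[OF assms(1)])
    with that show ?thesis by simp
  qed
  define k where "k = \<lfloor>x / (2 * pi)\<rfloor>"
  have "of_int k \<le> x / (2 * pi)" "x / (2 * pi) \<le> of_int k + 1"
    unfolding k_def by linarith+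
  then have "x + of_int (- k) * (2 * pi) \<in> {0..2*pi}"
    by (auto simp: field_simps)
  from z[OF this] periodic_int_shift[of f x "- k", OF assms(2)] show ?thesis by simp
qed

lemma integral_abs_le:
  fixes f :: "real \<Rightarrow> real"
  assumes f: "continuous_on UNIV f" and h: "integral {0..2*pi} (\<lambda>x. (f x)\<^sup>2) \<le> h\<^sup>2" "h > 0"
  shows "integral {0..2*pi} (\<lambda>x. \<bar>f x\<bar>) \<le> 4 * h"
proof -
  have "integral {0..2*pi} (\<lambda>x. \<bar>f x\<bar>) \<le> integral {0..2*pi} (\<lambda>x. h / 2 + (1 / (2 * h)) * (f x)\<^sup>2)"
  proof (rule integral_le)
    fix x
    have "0 \<le> (h - \<bar>f x\<bar>)\<^sup>2" by simp
    then show "\<bar>f x\<bar> \<le> h / 2 + (1 / (2 * h)) * (f x)\<^sup>2"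
      using h(2) by (simp add: field_simps power2_eq_square)
  qed (intro integrable_continuous_real continuous_intros continuous_on_subset[OF f] subset_UNIV)+
  also have "\<dots> = integral {0..2*pi} (\<lambda>x. h / 2) + integral {0..2*pi} (\<lambda>x. (1 / (2 * h)) * (f x)\<^sup>2)"
    by (rule Henstock_Kurzweil_Integration.integral_add)
       (intro integrable_continuous_real continuous_intros continuous_on_subset[OF f] subset_UNIV)+
  also have "\<dots> = pi * h + integral {0..2*pi} (\<lambda>x. (f x)\<^sup>2) / (2 * h)"
    by simp
  also have "\<dots> \<le> pi * h + h\<^sup>2 / (2 * h)"
    using h by (intro add_left_mono divide_right_mono) auto
  also have "\<dots> \<le> 4 * h"
  proof -
    have "pi \<le> 7/2" using pi_approx by simp
    then have "pi * h \<le> 7/2 * h" using h(2) by (intro mult_right_mono) auto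
    moreover have "h\<^sup>2 / (2 * h) = h / 2" using h(2) by (simp add: power2_eq_square)
    ultimately show ?thesis by linarith
  qed
  finally show ?thesis .
qed

text \<open>
  The boundary curve of the critical band; the map \<open>crit_curve'\<close> below is its derivative.
\<close>

definition crit_curve :: "(nat \<Rightarrow> 'n::finite) \<Rightarrow> real \<Rightarrow> real ^ 'n" where
  "crit_curve \<sigma> x = axis (\<sigma> 1) (sqrt (1/3) * cos x) + axis (\<sigma> 2) (sqrt (1/3) * sin x) +
     axis (\<sigma> 3) (sqrt (2/3) * cos (2 * x)) + axis (\<sigma> 4) (sqrt (2/3) * sin (2 * x))"

definition crit_curve' :: "(nat \<Rightarrow> 'n::finite) \<Rightarrow> real \<Rightarrow> real ^ 'n" where
  "crit_curve' \<sigma> x = axis (\<sigma> 1) (- sqrt (1/3) * sin x) + axis (\<sigma> 2) (sqrt (1/3) * cos x) +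
     axis (\<sigma> 3) (- 2 * sqrt (2/3) * sin (2 * x)) + axis (\<sigma> 4) (2 * sqrt (2/3) * cos (2 * x))"

lemma sqrt_third_bounds: "1/2 \<le> sqrt (1/3)" "sqrt (1/3) \<le> 3/4" "1/2 \<le> sqrt (2/3)" "sqrt (2/3) \<le> 9/10"
  by (rule real_le_rsqrt real_le_lsqrt; simp add: power2_eq_square)+

lemma cos_sin_2_periodic:
  "cos (2 * (x + 2 * pi)) = cos (2 * x)" "sin (2 * (x + 2 * pi)) = sin (2 * (x::real))"
proof -
  have "2 * (x + 2 * pi) = (2 * x + 2 * pi) + 2 * pi" by simp
  then show "cos (2 * (x + 2 * pi)) = cos (2 * x)" "sin (2 * (x + 2 * pi)) = sin (2 * x)"
    by (simp_all only: cos_periodic sin_periodic)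
qed

lemma sqrt_3_bounds: "17/10 \<le> sqrt 3" "sqrt 3 \<le> 18/10"
  by (rule real_le_rsqrt real_le_lsqrt; simp add: power2_eq_square)+

text \<open>
  The circle problem extracted from a free boundary minimal Moebius band: \<open>U\<close> is the boundary curve in the conformal
  coordinate, \<open>l\<close> the conformal factor and \<open>d\<close> the Dirichlet-to-Neumann multiplier. The bound on
  \<open>\<epsilon>\<close> is a convenient one that absorbs all constants below; the power of the dimension \<open>N\<close>
  comes from summing over coordinates twice.
\<close>

locale near_critical =
  fixes U U' :: "real \<Rightarrow> real ^ 'n::finite" and l :: "real \<Rightarrow> real" and d :: "int \<Rightarrow> real"
    and \<sigma> :: "nat \<Rightarrow> 'n" and \<epsilon> N :: real
  assumes distinct: "distinct [\<sigma> 1, \<sigma> 2, \<sigma> 3, \<sigma> 4]"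
    and U_deriv: "\<And>x. (U has_vector_derivative U' x) (at x)"
    and U'_cont: "continuous_on UNIV U'"
    and U_per: "\<And>x. U (x + 2 * pi) = U x"
    and l_cont: "continuous_on UNIV l"
    and l_per: "\<And>x. l (x + 2 * pi) = l x"
    and U_unit: "\<And>x. norm (U x) = 1"
    and steklov: "\<And>i k. fourier (\<lambda>x. complex_of_real (l x * U x $ i)) k = of_real (d k) * fourier (\<lambda>x. complex_of_real (U x $ i)) k"
    and d_0: "d 0 = 0" and d_sym: "d (-1) = d 1" "d (-2) = d 2"
    and d_3: "\<And>k. \<bar>k\<bar> \<ge> 3 \<Longrightarrow> 5/2 \<le> d k" "\<And>k. \<bar>k\<bar> \<ge> 3 \<Longrightarrow> d k \<le> 3 * \<bar>of_int k\<bar>"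
    and d_1: "\<bar>d 1 - sqrt 3\<bar> \<le> \<epsilon>"
    and l_near: "\<And>x. \<bar>l x - sqrt 3\<bar> \<le> \<epsilon>"
    and U_near: "\<And>x i. \<bar>U x $ i - crit_curve \<sigma> x $ i\<bar> \<le> \<epsilon>"
    and U'_near: "\<And>x i. \<bar>U' x $ i - crit_curve' \<sigma> x $ i\<bar> \<le> \<epsilon>"
    and eps: "0 < \<epsilon>" "\<epsilon> \<le> 1 / (10000000 * N\<^sup>2)" and N_eq: "N = real CARD('n)"
begin

lemma sigma_neq:
  "\<sigma> 1 \<noteq> \<sigma> 2" "\<sigma> 1 \<noteq> \<sigma> 3" "\<sigma> 1 \<noteq> \<sigma> 4" "\<sigma> 2 \<noteq> \<sigma> 1" "\<sigma> 2 \<noteq> \<sigma> 3" "\<sigma> 2 \<noteq> \<sigma> 4"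
  "\<sigma> 3 \<noteq> \<sigma> 1" "\<sigma> 3 \<noteq> \<sigma> 2" "\<sigma> 3 \<noteq> \<sigma> 4" "\<sigma> 4 \<noteq> \<sigma> 1" "\<sigma> 4 \<noteq> \<sigma> 2" "\<sigma> 4 \<noteq> \<sigma> 3"
  using distinct by auto

lemma N1: "1 \<le> N" by (simp add: N_eq Suc_le_eq)

lemma eps_N: "\<epsilon> * N\<^sup>2 \<le> 1 / 10000000" "\<epsilon> * N \<le> 1 / 10000000" "\<epsilon> \<le> 1 / 10000000"
proof -
  show 1: "\<epsilon> * N\<^sup>2 \<le> 1 / 10000000" using eps(2) N1 by (simp add: field_simps)
  have "\<epsilon> * N * 1 \<le> \<epsilon> * N * N" using eps(1) N1 by (intro mult_left_mono) auto
  with 1 show 2: "\<epsilon> * N \<le> 1 / 10000000" by (simp add: power2_eq_square)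
  have "\<epsilon> * 1 \<le> \<epsilon> * N" using eps(1) N1 by (intro mult_left_mono) auto
  with 2 show "\<epsilon> \<le> 1 / 10000000" by simp
qed

text \<open>
  Coordinates of the curve, the deviation \<open>mu\<close> of the conformal factor from \<open>d 1\<close>, and the deviation
  \<open>\<phi>\<close> of \<open>u\<close> from the critical curve \<open>C\<close>.
\<close>

definition u where "u i x = U x $ i"
definition u' where "u' i x = U' x $ i"
definition mu where "mu x = l x - d 1"
definition m where "m i x = mu x * u i x"
definition C where "C i x = crit_curve \<sigma> x $ i"
definition C' where "C' i x = crit_curve' \<sigma> x $ i"
definition \<phi> where "\<phi> i x = u i x - C i x"
definition \<phi>' where "\<phi>' i x = u' i x - C' i x"

lemma u_deriv: "(u i has_real_derivative u' i x) (at x)"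
  using bounded_linear.has_vector_derivative[OF bounded_linear_vec_nth U_deriv] unfolding u_def[abs_def] u'_def
  by (simp add: has_real_derivative_iff_has_vector_derivative)

lemma cont: "continuous_on X (u i)" "continuous_on X (u' i)" "continuous_on X mu" "continuous_on X (m i)"
proof -
  show 1: "continuous_on X (u i)" by (rule continuous_on_of_DERIV[OF u_deriv])
  show "continuous_on X (u' i)" unfolding u'_def[abs_def]
    by (intro continuous_intros continuous_on_subset[OF U'_cont]) auto
  show 2: "continuous_on X mu" unfolding mu_def[abs_def]
    by (intro continuous_intros continuous_on_subset[OF l_cont]) auto
  show "continuous_on X (m i)" unfolding m_def[abs_def] by (intro continuous_intros 1 2)
qed

lemma per: "u i (x + 2 * pi) = u i x" "mu (x + 2 * pi) = mu x" "m i (x + 2 * pi) = m i x"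
  by (simp_all add: u_def mu_def m_def U_per l_per)

lemma sum_u_square: "(\<Sum>i\<in>UNIV. u i x * u i x) = 1"
  using U_unit[of x] by (simp add: u_def norm_eq_1 inner_vec_def)

lemma abs_u_le: "\<bar>u i x\<bar> \<le> 1"
  using component_le_norm_cart[of "U x" i] U_unit[of x] by (simp add: u_def)

lemma C_eq: "C i x = (if i = \<sigma> 1 then sqrt (1/3) else 0) * cos x + (if i = \<sigma> 2 then sqrt (1/3) else 0) * sin x +
    (if i = \<sigma> 3 then sqrt (2/3) else 0) * cos (2 * x) + (if i = \<sigma> 4 then sqrt (2/3) else 0) * sin (2 * x)"
  by (auto simp: C_def crit_curve_def axis_def)

lemma C'_eq: "C' i x = (if i = \<sigma> 1 then - sqrt (1/3) else 0) * sin x + (if i = \<sigma> 2 then sqrt (1/3) else 0) * cos x +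
    (if i = \<sigma> 3 then - 2 * sqrt (2/3) else 0) * sin (2 * x) + (if i = \<sigma> 4 then 2 * sqrt (2/3) else 0) * cos (2 * x)"
  by (auto simp: C'_def crit_curve'_def axis_def)

lemma C_deriv: "(C i has_real_derivative C' i x) (at x)"
  unfolding C_eq[abs_def] by (auto intro!: derivative_eq_intros simp: C'_def crit_curve'_def axis_def)

lemma \<phi>_deriv: "(\<phi> i has_real_derivative \<phi>' i x) (at x)"
  unfolding \<phi>_def[abs_def] \<phi>'_def by (intro derivative_intros u_deriv C_deriv)

lemma cont_\<phi>: "continuous_on X (C i)" "continuous_on X (\<phi> i)" "continuous_on X (\<phi>' i)"
proof -
  show "continuous_on X (C i)" by (rule continuous_on_of_DERIV[OF C_deriv])
  show "continuous_on X (\<phi> i)" by (rule continuous_on_of_DERIV[OF \<phi>_deriv])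
  have "continuous_on X (C' i)"
    unfolding C'_eq[abs_def] by (intro continuous_intros)
  then show "continuous_on X (\<phi>' i)" unfolding \<phi>'_def[abs_def] by (intro continuous_intros cont)
qed

lemma \<phi>_bounds: "\<bar>\<phi> i x\<bar> \<le> \<epsilon>" "\<bar>\<phi>' i x\<bar> \<le> \<epsilon>" "\<phi> i (x + 2 * pi) = \<phi> i x"
proof -
  show "\<bar>\<phi> i x\<bar> \<le> \<epsilon>" "\<bar>\<phi>' i x\<bar> \<le> \<epsilon>"
    using U_near[of x i] U'_near[of x i] by (simp_all add: \<phi>_def \<phi>'_def u_def u'_def C_def C'_def)
  show "\<phi> i (x + 2 * pi) = \<phi> i x"
    unfolding \<phi>_def per C_eq by (simp only: cos_periodic sin_periodic cos_sin_2_periodic)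
qed

lemma abs_u'_le: "\<bar>u' i x\<bar> \<le> 2"
proof -
  have "\<bar>C' i x\<bar> \<le> 19/10"
  proof -
    have b: "\<bar>sqrt (1/3) * sin x\<bar> \<le> 3/4 * 1" "\<bar>sqrt (1/3) * cos x\<bar> \<le> 3/4 * 1"
      "\<bar>sqrt (2/3) * sin (2 * x)\<bar> \<le> 9/10 * 1" "\<bar>sqrt (2/3) * cos (2 * x)\<bar> \<le> 9/10 * 1"
      unfolding abs_mult using sqrt_third_bounds by (intro mult_mono; simp)+
    consider "i = \<sigma> 1" | "i = \<sigma> 2" | "i = \<sigma> 3" | "i = \<sigma> 4" | "i \<notin> {\<sigma> 1, \<sigma> 2, \<sigma> 3, \<sigma> 4}" by blast
    then show ?thesis
    proof cases
      case 1
      then have "C' i x = - (sqrt (1/3) * sin x)" by (simp add: C'_eq sigma_neq del: One_nat_def)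
      then show ?thesis using b(1) by linarith
    next
      case 2
      then have "C' i x = sqrt (1/3) * cos x" by (simp add: C'_eq sigma_neq del: One_nat_def)
      then show ?thesis using b(2) by linarith
    next
      case 3
      then have "C' i x = - 2 * (sqrt (2/3) * sin (2 * x))" by (simp add: C'_eq sigma_neq del: One_nat_def)
      then show ?thesis using b(3) by linarith
    next
      case 4
      then have "C' i x = 2 * (sqrt (2/3) * cos (2 * x))" by (simp add: C'_eq sigma_neq del: One_nat_def)
      then show ?thesis using b(4) by linarith
    next
      case 5
      then have "C' i x = 0" by (simp add: C'_eq)
      then show ?thesis by simp
    qed
  qed
  with \<phi>_bounds(2)[of i x] eps_N(3) show ?thesis unfolding \<phi>'_def by linarith
qed

lemma fourier_m: "fourier (m i) k = of_real (d k - d 1) * fourier (u i) k"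
proof -
  have "fourier (m i) k = fourier (\<lambda>x. complex_of_real (l x * U x $ i) - of_real (d 1) * of_real (U x $ i)) k"
    by (simp add: m_def mu_def u_def left_diff_distrib)
  also have "\<dots> = fourier (\<lambda>x. complex_of_real (l x * U x $ i)) k - of_real (d 1) * fourier (\<lambda>x. of_real (U x $ i)) k"
    unfolding fourier_cmult[symmetric]
    by (rule fourier_diff) (intro continuous_intros l_cont cont(1)[unfolded u_def[abs_def]])+
  finally show ?thesis unfolding steklov by (simp add: u_def[abs_def] left_diff_distrib)
qed

text \<open>
  \<open>L\<close> is the projection of \<open>u\<close> to the modes \<open>\<plusminus>1\<close>, \<open>\<plusminus>2\<close>,
  and \<open>H\<close> is the remainder, which has to be shown to vanish.
\<close>

definition L where "L i x = (Re (fourier (u i) 1) / pi) * cos x + (- Im (fourier (u i) 1) / pi) * sin x +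
   (Re (fourier (u i) 2) / pi) * cos (2 * x) + (- Im (fourier (u i) 2) / pi) * sin (2 * x)"
definition H where "H i x = u i x - L i x"

lemma cont_L: "continuous_on X (L i)" "continuous_on X (H i)"
proof -
  show "continuous_on X (L i)" unfolding L_def[abs_def] by (intro continuous_intros)
  then show "continuous_on X (H i)" unfolding H_def[abs_def] by (intro continuous_intros cont)
qed

lemma per_L: "L i (x + 2 * pi) = L i x" "H i (x + 2 * pi) = H i x"
proof -
  show "L i (x + 2 * pi) = L i x" "H i (x + 2 * pi) = H i x"
    unfolding H_def L_def per by (simp_all only: cos_periodic sin_periodic cos_sin_2_periodic)
qed

lemma fourier_L: "fourier (L i) k = (if \<bar>k\<bar> = 1 \<or> \<bar>k\<bar> = 2 then fourier (u i) k else 0)"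
proof -
  have "fourier (\<lambda>x. complex_of_real (1 * L i x)) k = (if \<bar>k\<bar> = 1 \<or> \<bar>k\<bar> = 2 then fourier (u i) k else 0)"
  proof -
    consider "k = 1" | "k = -1" | "k = 2" | "k = -2" | "\<bar>k\<bar> \<noteq> 1" "\<bar>k\<bar> \<noteq> 2" by linarith
    then show ?thesis
    proof cases
      case 5
      then have "k - 1 \<noteq> 0" "k + 1 \<noteq> 0" "k - 2 \<noteq> 0" "k + 2 \<noteq> 0" by linarith+
      with 5 show ?thesis unfolding L_def fourier_mult_trig[OF continuous_on_const] by (simp add: fourier_1)
    qed (unfold L_def fourier_mult_trig[OF continuous_on_const],
         use fourier_uminus[of "u i" 1] fourier_uminus[of "u i" 2] in \<open>simp_all add: fourier_1 complex_eq_iff\<close>)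
  qed
  then show ?thesis by simp
qed

lemma fourier_H: "fourier (H i) k = (if \<bar>k\<bar> = 1 \<or> \<bar>k\<bar> = 2 then 0 else fourier (u i) k)"
proof -
  have "fourier (H i) k = fourier (u i) k - fourier (L i) k"
    unfolding H_def of_real_diff by (rule fourier_diff) (intro continuous_intros cont cont_L)+
  then show ?thesis by (simp add: fourier_L)
qed

text \<open>
  All errors are measured against the defect \<open>e\<close>, which is the \<open>L\<^sup>2\<close> norm \<open>h\<close> of
  \<open>H\<close> plus the splitting \<open>\<delta>\<close> of the double eigenvalue; \<open>\<eta>\<close> is the size of
  products of the defect with an \<open>\<epsilon>\<close>-small function.
\<close>

definition h where "h = sqrt (\<Sum>i\<in>UNIV. integral {0..2*pi} (\<lambda>x. (H i x)\<^sup>2))"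
definition \<delta> where "\<delta> = \<bar>d 2 - d 1\<bar>"
definition e where "e = h + \<delta>"
definition \<eta> where "\<eta> = 360 * N * \<epsilon> * e"

lemma iH: "0 \<le> integral {0..2*pi} (\<lambda>x. (H i x)\<^sup>2)"
  by (rule integral_nonneg) (auto intro!: integrable_continuous_real continuous_intros cont_L)

lemma h0: "0 \<le> h" "0 \<le> \<delta>" "0 \<le> e" "0 \<le> \<eta>"
  using eps N1 by (auto simp: h_def \<delta>_def e_def \<eta>_def iH sum_nonneg)

lemma h_sq: "h\<^sup>2 = (\<Sum>i\<in>UNIV. integral {0..2*pi} (\<lambda>x. (H i x)\<^sup>2))"
  unfolding h_def by (simp add: iH sum_nonneg)

lemma iH_le: "integral {0..2*pi} (\<lambda>x. (H i x)\<^sup>2) \<le> h\<^sup>2"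
  unfolding h_sq by (rule member_le_sum) (auto simp: iH)

lemma d1_bounds: "16/10 \<le> d 1" "d 1 \<le> 19/10"
  using d_1 eps_N(3) sqrt_3_bounds by (auto simp: abs_le_iff)

lemma m_pairing:
  assumes "\<And>x. (\<psi> has_real_derivative \<psi>' x) (at x)" "continuous_on UNIV \<psi>'" "\<And>x. \<psi> (x + 2 * pi) = \<psi> x"
    "\<And>x. \<bar>\<psi> x\<bar> \<le> B" "\<And>x. \<bar>\<psi>' x\<bar> \<le> B"
  shows "\<bar>integral {0..2*pi} (\<lambda>x. m i x * \<psi> x)\<bar> \<le> 20 * B * e"
proof -
  have "\<bar>integral {0..2*pi} (\<lambda>x. m i x * \<psi> x)\<bar> \<le> 20 * B * (sqrt (integral {0..2*pi} (\<lambda>x. (H i x)\<^sup>2)) + \<delta>)"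
  proof (rule pairing_bound[OF cont(1) abs_u_le cont(4) per(3) cont_L(2) assms fourier_m fourier_H])
    show "d k - d 1 = 0" if "\<bar>k\<bar> = 1" for k using that d_sym by (cases "k \<ge> 0") auto
    show "\<bar>d k - d 1\<bar> \<le> \<delta>" if "\<bar>k\<bar> = 2" for k
    proof -
      have "k = 2 \<or> k = -2" using that by linarith
      then show ?thesis using d_sym by (auto simp: \<delta>_def)
    qed
    show "\<bar>d k - d 1\<bar> \<le> 3 * (1 + \<bar>of_int k\<bar>)" if "\<bar>k\<bar> \<noteq> 1" "\<bar>k\<bar> \<noteq> 2" for k
    proof (cases "k = 0")
      case True
      then show ?thesis using d_0 d1_bounds by (simp add: abs_le_iff)
    next
      case False
      with that have "\<bar>k\<bar> \<ge> 3" by linarith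
      with d_3[OF this] d1_bounds show ?thesis by (simp add: abs_le_iff)
    qed
  qed (rule h0(2))
  also have "\<dots> \<le> 20 * B * e"
  proof (rule mult_left_mono)
    have "sqrt (integral {0..2*pi} (\<lambda>x. (H i x)\<^sup>2)) \<le> h"
      using real_sqrt_le_mono[OF iH_le[of i]] h0(1) by simp
    then show "sqrt (integral {0..2*pi} (\<lambda>x. (H i x)\<^sup>2)) + \<delta> \<le> e" by (simp add: e_def)
    show "0 \<le> 20 * B" using assms(4)[of 0] by simp
  qed
  finally show ?thesis .
qed

text \<open>
  As \<open>U\<close> is a unit vector, \<open>mu\<close> is the sum of the \<open>m i * u i\<close>, so the bound for the
  pairings of \<open>m i\<close> carries over with \<open>u i * \<psi>\<close> as the test function.
\<close>

lemma mu_pairing: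
  assumes \<psi>: "\<And>x. (\<psi> has_real_derivative \<psi>' x) (at x)" "continuous_on UNIV \<psi>'" "\<And>x. \<psi> (x + 2 * pi) = \<psi> x"
    "\<And>x. \<bar>\<psi> x\<bar> \<le> B" "\<And>x. \<bar>\<psi>' x\<bar> \<le> B"
  shows "\<bar>integral {0..2*pi} (\<lambda>x. mu x * \<psi> x)\<bar> \<le> 60 * N * B * e"
proof -
  have c\<psi>: "continuous_on X \<psi>" for X by (rule continuous_on_of_DERIV[OF \<psi>(1)])
  have B0: "0 \<le> B" using \<psi>(4)[of 0] by linarith
  have "mu x * \<psi> x = (\<Sum>i\<in>UNIV. m i x * (u i x * \<psi> x))" for x
  proof -
    have "(\<Sum>i\<in>UNIV. m i x * (u i x * \<psi> x)) = mu x * \<psi> x * (\<Sum>i\<in>UNIV. u i x * u i x)"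
      unfolding m_def sum_distrib_left by (simp add: mult_ac)
    then show ?thesis by (simp add: sum_u_square)
  qed
  then have "integral {0..2*pi} (\<lambda>x. mu x * \<psi> x) = integral {0..2*pi} (\<lambda>x. \<Sum>i\<in>UNIV. m i x * (u i x * \<psi> x))"
    by (simp only:)
  also have "\<dots> = (\<Sum>i\<in>UNIV. integral {0..2*pi} (\<lambda>x. m i x * (u i x * \<psi> x)))"
    by (rule Henstock_Kurzweil_Integration.integral_sum) (simp, intro integrable_continuous_real continuous_intros cont c\<psi>)
  finally have "\<bar>integral {0..2*pi} (\<lambda>x. mu x * \<psi> x)\<bar> \<le> (\<Sum>i\<in>UNIV. \<bar>integral {0..2*pi} (\<lambda>x. m i x * (u i x * \<psi> x))\<bar>)"
    by simp
  also have "\<dots> \<le> (\<Sum>i\<in>(UNIV::'n set). 20 * (3 * B) * e)"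
  proof (rule sum_mono)
    fix i
    show "\<bar>integral {0..2*pi} (\<lambda>x. m i x * (u i x * \<psi> x))\<bar> \<le> 20 * (3 * B) * e"
    proof (rule m_pairing)
      show "((\<lambda>x. u i x * \<psi> x) has_real_derivative u' i x * \<psi> x + u i x * \<psi>' x) (at x)" for x
        by (auto intro!: derivative_eq_intros u_deriv \<psi>(1))
      show "continuous_on UNIV (\<lambda>x. u' i x * \<psi> x + u i x * \<psi>' x)"
        by (intro continuous_intros cont c\<psi> \<psi>(2))
      show "u i (x + 2 * pi) * \<psi> (x + 2 * pi) = u i x * \<psi> x" for x by (simp add: per \<psi>(3))
      have *: "\<bar>u i x * \<psi> x\<bar> \<le> 1 * B" "\<bar>u i x * \<psi>' x\<bar> \<le> 1 * B" "\<bar>u' i x * \<psi> x\<bar> \<le> 2 * B" for x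
        unfolding abs_mult by (intro mult_mono abs_u_le abs_u'_le \<psi>; simp)+
      show "\<bar>u i x * \<psi> x\<bar> \<le> 3 * B" for x using *(1)[of x] B0 by linarith
      show "\<bar>u' i x * \<psi> x + u i x * \<psi>' x\<bar> \<le> 3 * B" for x using *(2,3)[of x] by linarith
    qed
  qed
  also have "\<dots> = 60 * N * B * e" by (simp add: N_eq)
  finally show ?thesis .
qed

text \<open>
  The product with the \<open>C\<^sup>1\<close>-small function \<open>\<phi>\<close> gains a factor \<open>\<epsilon>\<close>;
  this is where closeness of the first derivatives of the curves enters.
\<close>

lemma fourier_mu_\<phi>:
  assumes k: "k \<in> {0, 1, 2::int}"
  shows "cmod (fourier (\<lambda>x. of_real (mu x * \<phi> i x)) k) \<le> \<eta>"
proof -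
  have c: "continuous_on UNIV (\<lambda>x. mu x * \<phi> i x)" by (intro continuous_intros cont cont_\<phi>)
  have pk: "cos (of_int k * (x + 2 * pi)) = cos (of_int k * x)" "sin (of_int k * (x + 2 * pi)) = sin (of_int k * x)" for x
    using cis_int_periodic[of k x] by (simp_all add: complex_eq_iff)
  have kk: "\<bar>of_int k :: real\<bar> \<le> 2" using k by auto
  have *: "\<bar>\<phi> i x * y\<bar> \<le> \<epsilon> * 1" "\<bar>\<phi>' i x * y\<bar> \<le> \<epsilon> * 1" if "\<bar>y\<bar> \<le> 1" for x y
    unfolding abs_mult using that by (intro mult_mono \<phi>_bounds; use eps in simp)+
  have **: "\<bar>\<phi> i x * (of_int k * y)\<bar> \<le> \<epsilon> * (2 * 1)" if "\<bar>y\<bar> \<le> 1" for x y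
    unfolding abs_mult using that by (intro mult_mono \<phi>_bounds kk; use eps in simp)
  have "\<bar>integral {0..2*pi} (\<lambda>x. mu x * (\<phi> i x * cos (of_int k * x)))\<bar> \<le> 60 * N * (3 * \<epsilon>) * e"
  proof (rule mu_pairing)
    show "((\<lambda>x. \<phi> i x * cos (of_int k * x)) has_real_derivative \<phi>' i x * cos (of_int k * x) - \<phi> i x * (of_int k * sin (of_int k * x))) (at x)" for x
      by (auto intro!: derivative_eq_intros \<phi>_deriv)
    show "continuous_on UNIV (\<lambda>x. \<phi>' i x * cos (of_int k * x) - \<phi> i x * (of_int k * sin (of_int k * x)))"
      by (intro continuous_intros cont_\<phi>)
    show "\<phi> i (x + 2 * pi) * cos (of_int k * (x + 2 * pi)) = \<phi> i x * cos (of_int k * x)" for x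
      by (simp only: pk \<phi>_bounds(3))
    show "\<bar>\<phi> i x * cos (of_int k * x)\<bar> \<le> 3 * \<epsilon>" for x using *(1)[OF abs_cos_le_one, of x "of_int k * x"] eps by linarith
    show "\<bar>\<phi>' i x * cos (of_int k * x) - \<phi> i x * (of_int k * sin (of_int k * x))\<bar> \<le> 3 * \<epsilon>" for x
      using *(2)[OF abs_cos_le_one, of x "of_int k * x"] **[OF abs_sin_le_one, of x "of_int k * x"] by linarith
  qed
  then have R: "\<bar>Re (fourier (\<lambda>x. of_real (mu x * \<phi> i x)) k)\<bar> \<le> \<eta> / 2"
    unfolding Re_Im_fourier[OF c] by (simp add: mult.assoc \<eta>_def)
  have "\<bar>integral {0..2*pi} (\<lambda>x. mu x * (\<phi> i x * sin (of_int k * x)))\<bar> \<le> 60 * N * (3 * \<epsilon>) * e"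
  proof (rule mu_pairing)
    show "((\<lambda>x. \<phi> i x * sin (of_int k * x)) has_real_derivative \<phi>' i x * sin (of_int k * x) + \<phi> i x * (of_int k * cos (of_int k * x))) (at x)" for x
      by (auto intro!: derivative_eq_intros \<phi>_deriv)
    show "continuous_on UNIV (\<lambda>x. \<phi>' i x * sin (of_int k * x) + \<phi> i x * (of_int k * cos (of_int k * x)))"
      by (intro continuous_intros cont_\<phi>)
    show "\<phi> i (x + 2 * pi) * sin (of_int k * (x + 2 * pi)) = \<phi> i x * sin (of_int k * x)" for x
      by (simp only: pk \<phi>_bounds(3))
    show "\<bar>\<phi> i x * sin (of_int k * x)\<bar> \<le> 3 * \<epsilon>" for x using *(1)[OF abs_sin_le_one, of x "of_int k * x"] eps by linarith
    show "\<bar>\<phi>' i x * sin (of_int k * x) + \<phi> i x * (of_int k * cos (of_int k * x))\<bar> \<le> 3 * \<epsilon>" for x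
      using *(2)[OF abs_sin_le_one, of x "of_int k * x"] **[OF abs_cos_le_one, of x "of_int k * x"] by linarith
  qed
  then have I: "\<bar>Im (fourier (\<lambda>x. of_real (mu x * \<phi> i x)) k)\<bar> \<le> \<eta> / 2"
    unfolding Re_Im_fourier[OF c] by (simp add: mult.assoc \<eta>_def)
  from R I cmod_le[of "fourier (\<lambda>x. of_real (mu x * \<phi> i x)) k"] show ?thesis by linarith
qed

end

section \<open>Rigidity of the boundary curve\<close>

context near_critical
begin

abbreviation mk :: "int \<Rightarrow> complex" where "mk k \<equiv> fourier (\<lambda>x. complex_of_real (mu x)) k"

lemma fourier_mu_C:
  "fourier (\<lambda>x. complex_of_real (mu x * C i x)) k =
    of_real (if i = \<sigma> 1 then sqrt (1/3) else 0) * ((mk (k - 1) + mk (k + 1)) / 2) +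
    of_real (if i = \<sigma> 2 then sqrt (1/3) else 0) * ((mk (k - 1) - mk (k + 1)) / (2 * \<i>)) +
    of_real (if i = \<sigma> 3 then sqrt (2/3) else 0) * ((mk (k - 2) + mk (k + 2)) / 2) +
    of_real (if i = \<sigma> 4 then sqrt (2/3) else 0) * ((mk (k - 2) - mk (k + 2)) / (2 * \<i>))"
  unfolding C_eq by (rule fourier_mult_trig[OF cont(3)])

text \<open>
  The Steklov relation in one mode, with \<open>u\<close> split into the critical curve and the perturbation.
\<close>

lemma fourier_m_split:
  "of_real (d k - d 1) * fourier (u i) k = fourier (\<lambda>x. complex_of_real (mu x * C i x)) k + fourier (\<lambda>x. complex_of_real (mu x * \<phi> i x)) k"
proof -
  have "of_real (d k - d 1) * fourier (u i) k = fourier (\<lambda>x. complex_of_real (mu x * C i x) + complex_of_real (mu x * \<phi> i x)) k"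
    unfolding fourier_m[symmetric] by (rule arg_cong[of _ _ "\<lambda>f. fourier f k"]) (simp add: fun_eq_iff m_def \<phi>_def algebra_simps)
  also have "\<dots> = fourier (\<lambda>x. complex_of_real (mu x * C i x)) k + fourier (\<lambda>x. complex_of_real (mu x * \<phi> i x)) k"
    by (rule fourier_add) (intro continuous_intros cont cont_\<phi>)+
  finally show ?thesis .
qed

lemma fourier_u_\<phi>: "cmod (fourier (u i) k - fourier (\<lambda>x. of_real (C i x)) k) \<le> 8 * \<epsilon>"
proof -
  have "fourier (u i) k - fourier (\<lambda>x. of_real (C i x)) k = fourier (\<phi> i) k"
    unfolding \<phi>_def of_real_diff by (rule fourier_diff[symmetric]) (intro continuous_intros cont cont_\<phi>)+
  moreover have "cmod (fourier (\<phi> i) k) \<le> 2 * pi * \<epsilon>" by (rule norm_fourier_le_sup[OF cont_\<phi>(2) \<phi>_bounds(1)])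
  moreover have "2 * pi * \<epsilon> \<le> 2 * 4 * \<epsilon>" using pi_less_4 eps by (intro mult_right_mono) auto
  ultimately show ?thesis by simp
qed

lemma eps_e: "16 * \<epsilon> * \<delta> \<le> \<eta>"
proof -
  have "\<epsilon> * \<delta> \<le> \<epsilon> * e" using eps h0 by (intro mult_left_mono) (auto simp: e_def)
  also have "\<dots> \<le> N * (\<epsilon> * e)" using mult_right_mono[OF N1, of "\<epsilon> * e"] eps h0 by simp
  finally show ?thesis unfolding \<eta>_def using h0 eps by (simp add: mult.assoc)
qed

text \<open>
  The relation in the modes 1 and 2 of the four critical coordinates. In mode 1 the left side vanishes, and the cosine and sine
  coordinates give \<open>mk 0 \<plusminus> mk 2\<close> and \<open>mk (-1) \<plusminus> mk 3\<close>. In mode 2 the unknown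
  \<open>\<delta>\<close> appears in both equations: their difference determines \<open>mk 4\<close>, and their sum then
  determines \<open>\<delta>\<close> because \<open>mk 0\<close> is already known to be small.
\<close>

lemma mu_modes:
  shows "cmod (mk 0) \<le> 6 * \<eta>" "cmod (mk 1) \<le> 6 * \<eta>" "cmod (mk 2) \<le> 6 * \<eta>" "cmod (mk 3) \<le> 6 * \<eta>" "cmod (mk 4) \<le> 6 * \<eta>"
    and "\<delta> \<le> 3 * \<eta>"
proof -
  have small: "cmod z \<le> 4 * \<eta>" if "cmod (of_real a * (z / 2)) \<le> \<eta>" "1/2 \<le> a" for z a
  proof -
    have "cmod z / 4 \<le> a * (cmod z / 2)" using mult_right_mono[OF that(2), of "cmod z / 2"] by simp
    with that show ?thesis by (simp add: norm_mult norm_divide)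
  qed
  have small': "cmod z \<le> 4 * \<eta>" if "cmod (of_real a * (z / (2 * \<i>))) \<le> \<eta>" "1/2 \<le> a" for z a
    by (rule small[OF _ that(2)]) (use that(1) in \<open>simp add: norm_mult norm_divide\<close>)
  have half: "cmod x \<le> 4 * \<eta>" "cmod y \<le> 4 * \<eta>" if "cmod (x + y) \<le> 4 * \<eta>" "cmod (x - y) \<le> 4 * \<eta>" for x y
  proof -
    have "cmod (2 * x) \<le> cmod (x + y) + cmod (x - y)" using norm_triangle_ineq[of "x + y" "x - y"] by (simp add: algebra_simps)
    moreover have "cmod (2 * y) \<le> cmod (x + y) + cmod (x - y)" using norm_triangle_ineq4[of "x + y" "x - y"] by (simp add: algebra_simps)
    ultimately show "cmod x \<le> 4 * \<eta>" "cmod y \<le> 4 * \<eta>" using that by (simp_all add: norm_mult)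
  qed
  have k1: "cmod (fourier (\<lambda>x. complex_of_real (mu x * C i x)) 1) \<le> \<eta>" for i
    using fourier_m_split[of 1 i] fourier_mu_\<phi>[of 1 i] by (simp add: eq_neg_iff_add_eq_0[symmetric] norm_minus_commute)
  note s = sigma_neq
  have "cmod (mk 0 + mk 2) \<le> 4 * \<eta>"
    by (rule small[OF _ sqrt_third_bounds(1)]) (use k1[of "\<sigma> 1", unfolded fourier_mu_C] in \<open>simp add: s del: One_nat_def\<close>)
  moreover have "cmod (mk 0 - mk 2) \<le> 4 * \<eta>"
    by (rule small'[OF _ sqrt_third_bounds(1)]) (use k1[of "\<sigma> 2", unfolded fourier_mu_C] in \<open>simp add: s del: One_nat_def\<close>)
  ultimately have m02: "cmod (mk 0) \<le> 4 * \<eta>" "cmod (mk 2) \<le> 4 * \<eta>" by (rule half)+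
  have "cmod (mk (-1) + mk 3) \<le> 4 * \<eta>"
    by (rule small[OF _ sqrt_third_bounds(3)]) (use k1[of "\<sigma> 3", unfolded fourier_mu_C] in \<open>simp add: s del: One_nat_def\<close>)
  moreover have "cmod (mk (-1) - mk 3) \<le> 4 * \<eta>"
    by (rule small'[OF _ sqrt_third_bounds(3)]) (use k1[of "\<sigma> 4", unfolded fourier_mu_C] in \<open>simp add: s del: One_nat_def\<close>)
  ultimately have m13: "cmod (mk (-1)) \<le> 4 * \<eta>" "cmod (mk 3) \<le> 4 * \<eta>" by (rule half)+
  have m1: "cmod (mk 1) = cmod (mk (-1))" using fourier_uminus[of mu 1] by simp
  define b where "b = sqrt (2/3)"
  have b: "1/2 \<le> b" "b \<le> 9/10" using sqrt_third_bounds by (simp_all add: b_def)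
  (* mode 2 of the third and the fourth coordinate; multiplying the latter by i aligns the leading terms *)
  define D where "D = complex_of_real (d 2 - d 1)"
  have nD: "cmod D = \<delta>" unfolding D_def \<delta>_def by (simp only: norm_of_real)
  have fC: "fourier (\<lambda>x. complex_of_real (C (\<sigma> 3) x)) 2 = of_real b * pi" "fourier (\<lambda>x. complex_of_real (C (\<sigma> 4) x)) 2 = of_real b * pi / \<i>"
    using fourier_mult_trig[OF continuous_on_const, of 1 0 0 b 0 2] fourier_mult_trig[OF continuous_on_const, of 1 0 0 0 b 2]
    by (simp_all add: C_eq s fourier_1 b_def del: One_nat_def)
  define s3 where "s3 = fourier (u (\<sigma> 3)) 2 - of_real b * pi"
  define s4 where "s4 = fourier (u (\<sigma> 4)) 2 - of_real b * pi / \<i>"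
  have s34: "cmod s3 \<le> 8 * \<epsilon>" "cmod s4 \<le> 8 * \<epsilon>"
    using fourier_u_\<phi>[of "\<sigma> 3" 2] fourier_u_\<phi>[of "\<sigma> 4" 2] unfolding fC s3_def s4_def by auto
  define r3 where "r3 = fourier (\<lambda>x. complex_of_real (mu x * \<phi> (\<sigma> 3) x)) 2"
  define r4 where "r4 = fourier (\<lambda>x. complex_of_real (mu x * \<phi> (\<sigma> 4) x)) 2"
  have r34: "cmod r3 \<le> \<eta>" "cmod r4 \<le> \<eta>" unfolding r3_def r4_def by (rule fourier_mu_\<phi>; simp)+
  have e3: "D * (of_real b * pi + s3) = of_real b * ((mk 0 + mk 4) / 2) + r3"
    using fourier_m_split[of 2 "\<sigma> 3", unfolded fourier_mu_C] by (simp add: s D_def s3_def r3_def b_def del: One_nat_def)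
  have e4: "D * (of_real b * pi / \<i> + s4) = of_real b * ((mk 0 - mk 4) / (2 * \<i>)) + r4"
    using fourier_m_split[of 2 "\<sigma> 4", unfolded fourier_mu_C] by (simp add: s D_def s4_def r4_def b_def del: One_nat_def)
  have e4': "D * (of_real b * pi + \<i> * s4) = of_real b * ((mk 0 - mk 4) / 2) + \<i> * r4"
  proof -
    have "\<i> * (D * (of_real b * pi / \<i> + s4)) = \<i> * (of_real b * ((mk 0 - mk 4) / (2 * \<i>)) + r4)"
      by (simp only: e4)
    moreover have "\<i> * (D * (P / \<i> + s4)) = D * (P + \<i> * s4)" for P
      by (simp add: algebra_simps)
    moreover have "\<i> * (of_real b * (z / (2 * \<i>)) + r4) = of_real b * (z / 2) + \<i> * r4" for z
      by (simp add: algebra_simps)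
    ultimately show ?thesis by (simp only:)
  qed
  have "of_real b * mk 4 = of_real b * ((mk 0 + mk 4) / 2) - of_real b * ((mk 0 - mk 4) / 2)"
    by (simp add: field_simps)
  also have "\<dots> = (D * (of_real b * pi + s3) - r3) - (D * (of_real b * pi + \<i> * s4) - \<i> * r4)"
    unfolding e3 e4' by (simp only: add_diff_cancel_right')
  also have "\<dots> = D * (s3 - \<i> * s4) - r3 + \<i> * r4"
    by (simp add: algebra_simps)
  finally have "of_real b * mk 4 = D * (s3 - \<i> * s4) - r3 + \<i> * r4" .
  then have "cmod (of_real b * mk 4) \<le> cmod (D * (s3 - \<i> * s4)) + cmod r3 + cmod (\<i> * r4)"
    by (metis add_right_mono norm_triangle_ineq norm_triangle_ineq4 order_trans)
  also have "cmod (D * (s3 - \<i> * s4)) \<le> \<delta> * (16 * \<epsilon>)"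
    unfolding norm_mult nD using norm_triangle_ineq4[of s3 "\<i> * s4"] s34 h0 by (intro mult_left_mono) (auto simp: norm_mult)
  finally have "b * cmod (mk 4) \<le> 3 * \<eta>"
    using r34 eps_e b by (simp add: norm_mult mult_ac)
  moreover have "1/2 * cmod (mk 4) \<le> b * cmod (mk 4)" using b by (intro mult_right_mono) auto
  ultimately have m4: "cmod (mk 4) \<le> 6 * \<eta>" by linarith
  have "D * of_real (2 * b * pi) = D * (of_real b * pi + s3) + D * (of_real b * pi + \<i> * s4) - D * (s3 + \<i> * s4)"
    by (simp add: algebra_simps)
  also have "\<dots> = of_real b * ((mk 0 + mk 4) / 2) + of_real b * ((mk 0 - mk 4) / 2) + r3 + \<i> * r4 - D * (s3 + \<i> * s4)"
    unfolding e3 e4' by (simp only: add_ac)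
  also have "of_real b * ((mk 0 + mk 4) / 2) + of_real b * ((mk 0 - mk 4) / 2) = of_real b * mk 0"
    by (simp add: field_simps)
  finally have "D * of_real (2 * b * pi) = of_real b * mk 0 + r3 + \<i> * r4 - D * (s3 + \<i> * s4)" .
  then have "cmod (D * of_real (2 * b * pi)) \<le> cmod (of_real b * mk 0) + cmod r3 + cmod (\<i> * r4) + cmod (D * (s3 + \<i> * s4))"
    by (smt (verit) norm_triangle_ineq norm_triangle_ineq4)
  also have "cmod (D * (s3 + \<i> * s4)) \<le> \<delta> * (16 * \<epsilon>)"
    unfolding norm_mult nD using norm_triangle_ineq[of s3 "\<i> * s4"] s34 h0 by (intro mult_left_mono) (auto simp: norm_mult)
  also have "cmod (of_real b * mk 0) \<le> 1 * (4 * \<eta>)"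
    unfolding norm_mult using b m02(1) by (intro mult_mono) auto
  finally have "cmod (D * of_real (2 * b * pi)) \<le> 7 * \<eta>"
    using r34 eps_e by (simp add: norm_mult mult_ac)
  moreover have "cmod (D * of_real (2 * b * pi)) = \<delta> * (2 * b * pi)" unfolding norm_mult nD norm_of_real using b by simp
  moreover have "\<delta> * (2 * (1/2) * 3) \<le> \<delta> * (2 * b * pi)"
    using b pi_gt3 h0 by (intro mult_left_mono mult_mono) auto
  ultimately show "\<delta> \<le> 3 * \<eta>" using h0 by linarith
  show "cmod (mk 0) \<le> 6 * \<eta>" "cmod (mk 1) \<le> 6 * \<eta>" "cmod (mk 2) \<le> 6 * \<eta>" "cmod (mk 3) \<le> 6 * \<eta>" "cmod (mk 4) \<le> 6 * \<eta>"
    using m02 m13 m1 m4 h0 by linarith+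
qed

lemma eta_small: "N * \<eta> \<le> 1/10000 * h" "\<eta> \<le> 1/10000 * h" "N * \<eta>\<^sup>2 \<le> 1/10000 * h\<^sup>2" "\<delta> \<le> h"
proof -
  have "N * \<epsilon> * e \<le> 1 / 10000000 * e" using eps_N(2) h0 by (intro mult_right_mono) (auto simp: mult.commute)
  then have "\<eta> \<le> 360 / 10000000 * e" by (simp add: \<eta>_def)
  then have "\<delta> \<le> e / 2" using mu_modes(6) h0 by simp
  then show \<delta>: "\<delta> \<le> h" by (simp add: e_def)
  then have e: "e \<le> 2 * h" by (simp add: e_def)
  have "N * \<eta> = 360 * ((\<epsilon> * N\<^sup>2) * e)" by (simp add: \<eta>_def power2_eq_square)
  also have "\<dots> \<le> 360 * ((1 / 10000000) * (2 * h))"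
    using eps_N(1) e h0 eps by (intro mult_left_mono mult_mono) auto
  finally show 1: "N * \<eta> \<le> 1/10000 * h" using h0 by simp
  have "1 * \<eta> \<le> N * \<eta>" using N1 h0 by (intro mult_right_mono) auto
  with 1 show 2: "\<eta> \<le> 1/10000 * h" by simp
  have "(N * \<eta>) * \<eta> \<le> (1/10000 * h) * (1/10000 * h)"
    by (rule mult_mono[OF 1 2 _ h0(4)]) (use h0(1) in simp)
  also have "\<dots> \<le> 1/10000 * h\<^sup>2" by (simp add: power2_eq_square)
  finally show "N * \<eta>\<^sup>2 \<le> 1/10000 * h\<^sup>2" by (simp add: power2_eq_square mult.assoc)
qed

text \<open>
  Since \<open>d 0 = 0\<close>, the relation in mode 0 expresses the mean of \<open>u\<close> by low modes of \<open>mu\<close>.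
\<close>

lemma mean_bound: "cmod (fourier (u i) 0) \<le> 16 * \<eta>"
proof -
  have "cmod (fourier (\<lambda>x. complex_of_real (mu x * C i x)) 0) \<le> 6 * \<eta>"
  proof -
    have neg: "cmod (mk (-1)) \<le> 6 * \<eta>" "cmod (mk (-2)) \<le> 6 * \<eta>"
      using mu_modes(2,3) fourier_uminus[of mu 1] fourier_uminus[of mu 2] by simp_all
    have a: "cmod (of_real a * ((x + y) / 2)) \<le> 6 * \<eta>" "cmod (of_real a * ((x - y) / (2 * \<i>))) \<le> 6 * \<eta>"
      if "0 \<le> a" "a \<le> 1" "cmod x \<le> 6 * \<eta>" "cmod y \<le> 6 * \<eta>" for a x y
    proof -
      have "a * (cmod (x + y) / 2) \<le> 1 * (6 * \<eta>)" "a * (cmod (x - y) / 2) \<le> 1 * (6 * \<eta>)"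
        using that norm_triangle_ineq[of x y] norm_triangle_ineq4[of x y] by (intro mult_mono; simp)+
      then show "cmod (of_real a * ((x + y) / 2)) \<le> 6 * \<eta>" "cmod (of_real a * ((x - y) / (2 * \<i>))) \<le> 6 * \<eta>"
        using that by (simp_all add: norm_mult norm_divide)
    qed
    have b: "0 \<le> sqrt (1/3::real)" "sqrt (1/3) \<le> (1::real)" "0 \<le> sqrt (2/3::real)" "sqrt (2/3) \<le> (1::real)"
      using sqrt_third_bounds by auto
    note modes = mu_modes neg
    consider "i = \<sigma> 1" | "i = \<sigma> 2" | "i = \<sigma> 3" | "i = \<sigma> 4" | "i \<noteq> \<sigma> 1" "i \<noteq> \<sigma> 2" "i \<noteq> \<sigma> 3" "i \<noteq> \<sigma> 4" by blast
    then show ?thesis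
    proof cases
      case 1
      then show ?thesis using a(1)[OF b(1,2) neg(1) mu_modes(2)] unfolding fourier_mu_C by (simp add: sigma_neq del: One_nat_def)
    next
      case 2
      then show ?thesis using a(2)[OF b(1,2) neg(1) mu_modes(2)] unfolding fourier_mu_C by (simp add: sigma_neq del: One_nat_def)
    next
      case 3
      then show ?thesis using a(1)[OF b(3,4) neg(2) mu_modes(3)] unfolding fourier_mu_C by (simp add: sigma_neq del: One_nat_def)
    next
      case 4
      then show ?thesis using a(2)[OF b(3,4) neg(2) mu_modes(3)] unfolding fourier_mu_C by (simp add: sigma_neq del: One_nat_def)
    next
      case 5
      then show ?thesis unfolding fourier_mu_C using h0 by (simp del: One_nat_def)
    qed
  qed
  moreover have "cmod (fourier (\<lambda>x. complex_of_real (mu x * \<phi> i x)) 0) \<le> \<eta>" by (rule fourier_mu_\<phi>) simp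
  ultimately have "cmod (of_real (d 0 - d 1) * fourier (u i) 0) \<le> 7 * \<eta>"
    unfolding fourier_m_split using norm_triangle_ineq[of "fourier (\<lambda>x. complex_of_real (mu x * C i x)) 0" "fourier (\<lambda>x. complex_of_real (mu x * \<phi> i x)) 0"]
    by linarith
  then have "d 1 * cmod (fourier (u i) 0) \<le> 7 * \<eta>" unfolding norm_mult norm_of_real d_0 using d1_bounds by simp
  moreover have "1 * cmod (fourier (u i) 0) \<le> d 1 * cmod (fourier (u i) 0)" using d1_bounds by (intro mult_right_mono) auto
  ultimately show ?thesis using h0 by linarith
qed

text \<open>
  As \<open>U\<close> has length one, \<open>g\<close> is of the order of \<open>H\<close>; it is also a trigonometric polynomial
  of degree at most 4.
\<close>

definition g where "g x = 1 - (\<Sum>i\<in>UNIV. L i x * L i x)"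

lemma cont_g: "continuous_on X g" unfolding g_def[abs_def] by (intro continuous_intros cont_L)
lemma per_g: "g (x + 2 * pi) = g x" by (simp add: g_def per_L)

lemma fourier_sum_fun:
  assumes "finite I" "\<And>i. i \<in> I \<Longrightarrow> continuous_on UNIV (f i)"
  shows "fourier (\<lambda>x. \<Sum>i\<in>I. f i x) k = (\<Sum>i\<in>I. fourier (f i) k)"
  using assms
proof (induction I rule: finite_induct)
  case empty
  then show ?case by (simp add: fourier_def)
next
  case (insert a I)
  then show ?case by (simp add: fourier_add continuous_on_sum)
qed

lemma fourier_g: "\<bar>k\<bar> \<ge> 5 \<Longrightarrow> fourier g k = 0"
proof -
  assume k: "\<bar>k\<bar> \<ge> 5"
  have LL: "fourier (\<lambda>x. complex_of_real (L i x * L i x)) k = 0" for i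
  proof -
    have "fourier (L i) (k - 1) = 0" "fourier (L i) (k + 1) = 0" "fourier (L i) (k - 2) = 0" "fourier (L i) (k + 2) = 0"
      using k by (auto simp: fourier_L abs_if split: if_splits)
    then show ?thesis
      unfolding L_def[of i "_::real", THEN arg_cong[of _ _ "\<lambda>z. _ * z"]] fourier_mult_trig[OF cont_L(1)] by simp
  qed
  have "fourier g k = fourier (\<lambda>x. 1 - (\<Sum>i\<in>UNIV. complex_of_real (L i x * L i x))) k"
    by (rule arg_cong[of _ _ "\<lambda>f. fourier f k"]) (simp add: fun_eq_iff g_def)
  also have "\<dots> = fourier (\<lambda>x. 1) k - fourier (\<lambda>x. \<Sum>i\<in>UNIV. complex_of_real (L i x * L i x)) k"
    by (rule fourier_diff) (intro continuous_intros cont_L)+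
  also have "fourier (\<lambda>x. \<Sum>i\<in>UNIV. complex_of_real (L i x * L i x)) k = (\<Sum>i\<in>UNIV. fourier (\<lambda>x. complex_of_real (L i x * L i x)) k)"
    by (rule fourier_sum_fun) (simp, intro continuous_intros cont_L)
  finally show "fourier g k = 0" using k by (simp only: LL fourier_1) auto
qed

lemma abs_L_le: "\<bar>L i x\<bar> \<le> 8"
proof -
  have F: "cmod (fourier (u i) k) \<le> 2 * pi * 1" for k by (rule norm_fourier_le_sup[OF cont(1) abs_u_le])
  have t: "\<bar>(Re (fourier (u i) k) / pi) * y\<bar> \<le> 2" "\<bar>(- Im (fourier (u i) k) / pi) * y\<bar> \<le> 2" if "\<bar>y\<bar> \<le> 1" for k y
  proof -
    have "\<bar>Re (fourier (u i) k) / pi\<bar> \<le> 2" "\<bar>- Im (fourier (u i) k) / pi\<bar> \<le> 2"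
      using F[of k] abs_Re_le_cmod[of "fourier (u i) k"] abs_Im_le_cmod[of "fourier (u i) k"] by (simp_all add: field_simps)
    then have "\<bar>Re (fourier (u i) k) / pi\<bar> * \<bar>y\<bar> \<le> 2 * 1" "\<bar>- Im (fourier (u i) k) / pi\<bar> * \<bar>y\<bar> \<le> 2 * 1"
      using that by (intro mult_mono; simp)+
    then show "\<bar>(Re (fourier (u i) k) / pi) * y\<bar> \<le> 2" "\<bar>(- Im (fourier (u i) k) / pi) * y\<bar> \<le> 2" by (simp_all only: abs_mult)
  qed
  show ?thesis
    using t(1)[OF abs_cos_le_one, of 1 x] t(2)[OF abs_sin_le_one, of 1 x] t(1)[OF abs_cos_le_one, of 2 "2*x"] t(2)[OF abs_sin_le_one, of 2 "2*x"]
    unfolding L_def by linarith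
qed

lemma integral_abs_g: assumes "h > 0" shows "integral {0..2*pi} (\<lambda>x. \<bar>g x\<bar>) \<le> 36 * N * h"
proof -
  have "\<bar>g x\<bar> \<le> (\<Sum>i\<in>UNIV. 9 * \<bar>H i x\<bar>)" for x
  proof -
    have "g x = (\<Sum>i\<in>UNIV. H i x * (u i x + L i x))"
      unfolding g_def H_def sum_u_square[of x, symmetric] sum_subtractf[symmetric] by (simp add: algebra_simps)
    then have "\<bar>g x\<bar> \<le> (\<Sum>i\<in>UNIV. \<bar>H i x * (u i x + L i x)\<bar>)" by simp
    also have "\<dots> \<le> (\<Sum>i\<in>UNIV. 9 * \<bar>H i x\<bar>)"
    proof (rule sum_mono)
      fix i
      have "\<bar>u i x + L i x\<bar> \<le> 9" using abs_u_le[of i x] abs_L_le[of i x] by linarith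
      then show "\<bar>H i x * (u i x + L i x)\<bar> \<le> 9 * \<bar>H i x\<bar>"
        unfolding abs_mult using mult_left_mono[of "\<bar>u i x + L i x\<bar>" 9 "\<bar>H i x\<bar>"] by simp
    qed
    finally show ?thesis .
  qed
  then have "integral {0..2*pi} (\<lambda>x. \<bar>g x\<bar>) \<le> integral {0..2*pi} (\<lambda>x. \<Sum>i\<in>UNIV. 9 * \<bar>H i x\<bar>)"
    by (intro integral_le integrable_continuous_real continuous_intros cont_g cont_L)
  also have "\<dots> = (\<Sum>i\<in>UNIV. integral {0..2*pi} (\<lambda>x. 9 * \<bar>H i x\<bar>))"
    by (rule Henstock_Kurzweil_Integration.integral_sum) (simp, intro integrable_continuous_real continuous_intros cont_L)
  also have "\<dots> = (\<Sum>i\<in>UNIV. 9 * integral {0..2*pi} (\<lambda>x. \<bar>H i x\<bar>))" by simp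
  also have "\<dots> \<le> (\<Sum>i\<in>(UNIV::'n set). 9 * (4 * h))"
    by (intro sum_mono mult_left_mono integral_abs_le[OF cont_L(2) iH_le assms]) auto
  also have "\<dots> = 36 * N * h" by (simp add: N_eq)
  finally show ?thesis .
qed

text \<open>
  Only the modes \<open>\<bar>k\<bar> \<le> 4\<close> of \<open>mu\<close> are seen by \<open>g\<close>, and those gain the factor
  \<open>\<epsilon>\<close>. A direct estimate of \<open>mu\<close> in terms of \<open>h\<close> would only give the order
  \<open>h\<^sup>2\<close>, which is no better than the gap.
\<close>

lemma integral_mu_g: assumes "h > 0" shows "integral {0..2*pi} (\<lambda>x. mu x * g x) \<le> 324 * (N * \<eta>) * h"
proof -
  define G where "G = 36 * N * h"
  have G0: "0 \<le> G" using h0 N1 by (simp add: G_def)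
  have Gk: "cmod (fourier g k) \<le> G" for k
    using norm_fourier_le[OF cont_g, of k] integral_abs_g[OF assms] by (simp add: G_def)
  have mk4: "cmod (mk k) \<le> 6 * \<eta>" if "\<bar>k\<bar> \<le> 4" for k
  proof -
    have c: "cmod (mk (-k)) = cmod (mk k)" using fourier_uminus[of mu k] by simp
    have pos: "cmod (mk j) \<le> 6 * \<eta>" if "0 \<le> j" "j \<le> 4" for j
    proof -
      have "j = 0 \<or> j = 1 \<or> j = 2 \<or> j = 3 \<or> j = 4" using that by linarith
      then show ?thesis using mu_modes by blast
    qed
    show ?thesis using pos[of k] pos[of "-k"] c that by (cases "k \<ge> 0") auto
  qed
  have bound: "(\<Sum>k = -int n..int n. Re (mk k * cnj (fourier g k))) \<le> 54 * \<eta> * G" for n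
  proof -
    have "(\<Sum>k = -int n..int n. Re (mk k * cnj (fourier g k))) \<le> (\<Sum>k = -int n..int n. if \<bar>k\<bar> \<le> 4 then 6 * \<eta> * G else 0)"
    proof (rule sum_mono)
      fix k
      show "Re (mk k * cnj (fourier g k)) \<le> (if \<bar>k\<bar> \<le> 4 then 6 * \<eta> * G else 0)"
      proof (cases "\<bar>k\<bar> \<le> 4")
        case True
        have "Re (mk k * cnj (fourier g k)) \<le> cmod (mk k) * cmod (fourier g k)"
          using complex_Re_le_cmod[of "mk k * cnj (fourier g k)"] by (simp only: norm_mult complex_mod_cnj)
        also have "\<dots> \<le> 6 * \<eta> * G" using mk4[OF True] Gk[of k] h0 by (intro mult_mono) auto
        finally show ?thesis using True by simp
      next
        case False
        then show ?thesis using fourier_g[of k] by simp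
      qed
    qed
    also have "\<dots> = (\<Sum>k\<in>{k\<in>{-int n..int n}. \<bar>k\<bar> \<le> 4}. 6 * \<eta> * G)" by (rule sum.inter_filter[symmetric]) simp
    also have "\<dots> \<le> (\<Sum>k\<in>{-4..4::int}. 6 * \<eta> * G)" using h0 G0 by (intro sum_mono2) auto
    also have "\<dots> = 54 * \<eta> * G" by simp
    finally show ?thesis .
  qed
  have "2 * pi * integral {0..2*pi} (\<lambda>x. mu x * g x) \<le> 54 * \<eta> * G"
    by (rule LIMSEQ_le_const2[OF Parseval[OF cont(3) per(2) cont_g per_g]]) (use bound in blast)
  moreover have "54 * \<eta> * G \<le> 2 * pi * (9 * \<eta> * G)"
  proof -
    have "6 * (9 * \<eta> * G) \<le> 2 * pi * (9 * \<eta> * G)" using pi_gt3 h0 G0 by (intro mult_right_mono) auto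
    then show ?thesis by simp
  qed
  ultimately have "2 * pi * integral {0..2*pi} (\<lambda>x. mu x * g x) \<le> 2 * pi * (9 * \<eta> * G)" by (rule order_trans)
  then have "integral {0..2*pi} (\<lambda>x. mu x * g x) \<le> 9 * \<eta> * G"
    by (rule mult_left_le_imp_le) simp
  then show ?thesis by (simp add: G_def mult_ac)
qed

text \<open>
  The integral of \<open>mu U \<bullet> H\<close> is at least a fixed multiple of \<open>h\<^sup>2\<close> by the spectral gap,
  and at most a small multiple of \<open>h\<^sup>2\<close> because \<open>2 U \<bullet> H = g + \<bar>H\<bar>\<^sup>2\<close> for
  the unit vector \<open>U = L + H\<close>.
\<close>

lemma h_zero: "h = 0"
proof (rule ccontr)
  assume "h \<noteq> 0"
  then have h: "h > 0" using h0 by simp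
  (* lower bound: the multiplier is at least 1/2 on H, up to the mean of u *)
  have energy: "2 * pi * integral {0..2*pi} (\<lambda>x. m i x * H i x) \<ge> pi * integral {0..2*pi} (\<lambda>x. (H i x)\<^sup>2) - 5/2 * (16 * \<eta>)\<^sup>2" for i
  proof -
    have "2 * pi * integral {0..2*pi} (\<lambda>x. m i x * H i x) \<ge> pi * integral {0..2*pi} (\<lambda>x. (H i x)\<^sup>2) - 5/2 * (cmod (fourier (u i) 0))\<^sup>2"
    proof (rule energy_lower_bound[OF cont(4) per(3) cont_L(2) per_L(2) fourier_m fourier_H])
      show "d 0 - d 1 \<ge> - 2" using d_0 d1_bounds by simp
      show "d k - d 1 \<ge> 1/2" if "\<bar>k\<bar> \<ge> 3" for k using d_3(1)[OF that] d1_bounds by simp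
    qed
    moreover have "(cmod (fourier (u i) 0))\<^sup>2 \<le> (16 * \<eta>)\<^sup>2" by (rule power_mono[OF mean_bound]) simp
    ultimately show ?thesis by linarith
  qed
  have "pi * h\<^sup>2 - 5/2 * N * (16 * \<eta>)\<^sup>2 = (\<Sum>i\<in>UNIV. pi * integral {0..2*pi} (\<lambda>x. (H i x)\<^sup>2) - 5/2 * (16 * \<eta>)\<^sup>2)"
    unfolding h_sq sum_subtractf sum_distrib_left by (simp add: N_eq)
  also have "\<dots> \<le> (\<Sum>i\<in>UNIV. 2 * pi * integral {0..2*pi} (\<lambda>x. m i x * H i x))"
    by (rule sum_mono) (rule energy)
  also have "\<dots> = 2 * pi * integral {0..2*pi} (\<lambda>x. \<Sum>i\<in>UNIV. m i x * H i x)"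
    unfolding sum_distrib_left[symmetric]
    by (subst Henstock_Kurzweil_Integration.integral_sum) (simp, intro integrable_continuous_real continuous_intros cont cont_L, simp)
  (* upper bound: 2 U . H = |U|^2 - |L|^2 + |H|^2 with |U| = 1 *)
  also have "(\<lambda>x. \<Sum>i\<in>UNIV. m i x * H i x) = (\<lambda>x. 1/2 * (mu x * g x) + 1/2 * (mu x * (\<Sum>i\<in>UNIV. (H i x)\<^sup>2)))"
  proof
    fix x
    have "(\<Sum>i\<in>UNIV. u i x * H i x) = 1/2 * (g x + (\<Sum>i\<in>UNIV. (H i x)\<^sup>2))"
    proof -
      have "2 * (\<Sum>i\<in>UNIV. u i x * H i x) = (\<Sum>i\<in>UNIV. u i x * u i x - L i x * L i x + (H i x)\<^sup>2)"
        unfolding sum_distrib_left by (rule sum.cong) (auto simp: H_def power2_eq_square algebra_simps)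
      also have "\<dots> = g x + (\<Sum>i\<in>UNIV. (H i x)\<^sup>2)"
        unfolding sum.distrib sum_subtractf sum_u_square g_def ..
      finally show ?thesis by simp
    qed
    moreover have "(\<Sum>i\<in>UNIV. m i x * H i x) = mu x * (\<Sum>i\<in>UNIV. u i x * H i x)"
      unfolding m_def sum_distrib_left by (simp add: mult.assoc)
    ultimately show "(\<Sum>i\<in>UNIV. m i x * H i x) = 1/2 * (mu x * g x) + 1/2 * (mu x * (\<Sum>i\<in>UNIV. (H i x)\<^sup>2))"
      by (simp add: algebra_simps)
  qed
  also have "integral {0..2*pi} (\<lambda>x. 1/2 * (mu x * g x) + 1/2 * (mu x * (\<Sum>i\<in>UNIV. (H i x)\<^sup>2))) =
     integral {0..2*pi} (\<lambda>x. 1/2 * (mu x * g x)) + integral {0..2*pi} (\<lambda>x. 1/2 * (mu x * (\<Sum>i\<in>UNIV. (H i x)\<^sup>2)))"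
    by (rule Henstock_Kurzweil_Integration.integral_add) (intro integrable_continuous_real continuous_intros cont cont_g cont_L)+
  also have "\<dots> = 1/2 * integral {0..2*pi} (\<lambda>x. mu x * g x) + 1/2 * integral {0..2*pi} (\<lambda>x. mu x * (\<Sum>i\<in>UNIV. (H i x)\<^sup>2))"
    by (simp only: Henstock_Kurzweil_Integration.integral_mult_right)
  finally have main: "pi * h\<^sup>2 - 5/2 * N * (16 * \<eta>)\<^sup>2 \<le> 2 * pi * (1/2 * integral {0..2*pi} (\<lambda>x. mu x * g x) + 1/2 * integral {0..2*pi} (\<lambda>x. mu x * (\<Sum>i\<in>UNIV. (H i x)\<^sup>2)))" .
  have "integral {0..2*pi} (\<lambda>x. mu x * (\<Sum>i\<in>UNIV. (H i x)\<^sup>2)) \<le> integral {0..2*pi} (\<lambda>x. 2 * \<epsilon> * (\<Sum>i\<in>UNIV. (H i x)\<^sup>2))"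
  proof (rule integral_le)
    fix x
    have "mu x \<le> 2 * \<epsilon>" using l_near[of x] d_1 unfolding mu_def by linarith
    then show "mu x * (\<Sum>i\<in>UNIV. (H i x)\<^sup>2) \<le> 2 * \<epsilon> * (\<Sum>i\<in>UNIV. (H i x)\<^sup>2)"
      by (intro mult_right_mono sum_nonneg) auto
  qed (intro integrable_continuous_real continuous_intros cont cont_L)+
  also have "\<dots> = 2 * \<epsilon> * integral {0..2*pi} (\<lambda>x. \<Sum>i\<in>UNIV. (H i x)\<^sup>2)"
    by (rule Henstock_Kurzweil_Integration.integral_mult_right)
  also have "integral {0..2*pi} (\<lambda>x. \<Sum>i\<in>UNIV. (H i x)\<^sup>2) = h\<^sup>2"
    unfolding h_sq by (rule Henstock_Kurzweil_Integration.integral_sum) (simp, intro integrable_continuous_real continuous_intros cont_L)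
  finally have 2: "integral {0..2*pi} (\<lambda>x. mu x * (\<Sum>i\<in>UNIV. (H i x)\<^sup>2)) \<le> 2 * \<epsilon> * h\<^sup>2" .
  have "2 * \<epsilon> * h\<^sup>2 \<le> 1/1000 * h\<^sup>2" using eps_N(3) by (intro mult_right_mono) auto
  moreover have "integral {0..2*pi} (\<lambda>x. mu x * g x) \<le> 1/20 * h\<^sup>2"
  proof -
    have "324 * (N * \<eta>) * h \<le> 324 * (1/10000 * h) * h"
      using eta_small(1) h by (intro mult_right_mono mult_left_mono) auto
    also have "\<dots> = 324/10000 * h\<^sup>2" by (simp add: power2_eq_square)
    finally show ?thesis using integral_mu_g[OF h] zero_le_power2[of h] by linarith
  qed
  ultimately have "1/2 * integral {0..2*pi} (\<lambda>x. mu x * g x) + 1/2 * integral {0..2*pi} (\<lambda>x. mu x * (\<Sum>i\<in>UNIV. (H i x)\<^sup>2)) \<le> 1/20 * h\<^sup>2"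
    using 2 zero_le_power2[of h] by linarith
  then have "2 * pi * (1/2 * integral {0..2*pi} (\<lambda>x. mu x * g x) + 1/2 * integral {0..2*pi} (\<lambda>x. mu x * (\<Sum>i\<in>UNIV. (H i x)\<^sup>2))) \<le> 2 * pi * (1/20 * h\<^sup>2)"
    by (intro mult_left_mono) auto
  from order_trans[OF main this] have "pi * h\<^sup>2 - 5/2 * N * (16 * \<eta>)\<^sup>2 \<le> 1/10 * (pi * h\<^sup>2)"
    by simp
  moreover have "5/2 * N * (16 * \<eta>)\<^sup>2 = 640 * (N * \<eta>\<^sup>2)" by (simp add: power_mult_distrib)
  moreover have "3 * h\<^sup>2 \<le> pi * h\<^sup>2" using pi_gt3 by (intro mult_right_mono) auto
  moreover have "0 < h\<^sup>2" using h by simp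
  ultimately show False using eta_small(3) by linarith
qed

text \<open>
  With \<open>h\<close> also \<open>\<delta>\<close> vanishes; then all Fourier coefficients of \<open>mu U\<close> are zero.
\<close>

theorem rigidity:
  shows "d 2 = d 1" and "l x = d 1" and "U x $ i = L i x"
proof -
  have "\<delta> = 0" using eta_small(4) h_zero h0 by simp
  then show d2: "d 2 = d 1" by (simp add: \<delta>_def)
  have iz: "integral {0..2*pi} (\<lambda>x. (H i x)\<^sup>2) = 0" for i
    using iH_le[of i] iH[of i] h_zero by simp
  have H: "H i x = 0" for i x by (rule continuous_periodic_zero[OF cont_L(2) per_L(2) iz])
  then show "U x $ i = L i x" by (simp add: H_def u_def)
  have fz: "fourier (m i) k = 0" for i k
  proof -
    have "fourier (H i) k = 0" by (simp add: H fourier_def)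
    then have "fourier (u i) k = 0" if "\<bar>k\<bar> \<noteq> 1" "\<bar>k\<bar> \<noteq> 2" using that by (simp add: fourier_H)
    moreover have "d k = d 1" if "\<bar>k\<bar> = 1 \<or> \<bar>k\<bar> = 2"
    proof -
      have "k = 1 \<or> k = -1 \<or> k = 2 \<or> k = -2" using that by linarith
      then show ?thesis using d_sym d2 by auto
    qed
    ultimately show ?thesis by (cases "\<bar>k\<bar> = 1 \<or> \<bar>k\<bar> = 2") (auto simp: fourier_m)
  qed
  have "m i x = 0" for i x
  proof (rule continuous_periodic_zero[OF cont(4) per(3)])
    have "(\<lambda>n. \<Sum>k = -int n..int n. (cmod (fourier (m i) k))\<^sup>2) \<longlonglongrightarrow> 2 * pi * integral {0..2*pi} (\<lambda>x. (m i x)\<^sup>2)"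
      by (rule Parseval_square[OF cont(4) per(3)])
    then have "2 * pi * integral {0..2*pi} (\<lambda>x. (m i x)\<^sup>2) = 0" by (simp add: fz LIMSEQ_const_iff)
    then show "integral {0..2*pi} (\<lambda>x. (m i x)\<^sup>2) = 0" by simp
  qed
  moreover have "mu x = (\<Sum>i\<in>UNIV. m i x * u i x)"
    unfolding m_def mult.assoc sum_distrib_left[symmetric] sum_u_square by simp
  ultimately show "l x = d 1" by (simp add: mu_def)
qed

end

section \<open>Circle diffeomorphisms and the Dirichlet-to-Neumann multipliers\<close>

lemma integral_periodic_shift:
  fixes g :: "real \<Rightarrow> complex"
  assumes g: "continuous_on UNIV g" "\<And>x. g (x + 2 * pi) = g x" and a: "0 \<le> a" "a \<le> 2 * pi"
  shows "integral {0..2*pi} (\<lambda>x. g (x + a)) = integral {0..2*pi} g"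
proof -
  have c: "continuous_on X g" for X using g(1) continuous_on_subset by blast
  have i: "g integrable_on X" if "X = {b..d}" for X b d using c that by (simp add: integrable_continuous_real)
  have "integral {0..2*pi} (\<lambda>x. g (x + a)) = integral {0 + a..2*pi + a} g"
    using integral_shift[of 0 a "2*pi" g] c by (simp add: o_def)
  also have "\<dots> = integral {a..2*pi} g + integral {2*pi..2*pi + a} g"
    by (subst Henstock_Kurzweil_Integration.integral_combine) (use a in \<open>auto intro!: i\<close>)
  also have "integral {2*pi..2*pi + a} g = integral {0..a} (\<lambda>x. g (x + 2*pi))"
    using integral_shift[of 0 "2*pi" a g] c by (simp add: o_def add.commute)
  also have "\<dots> = integral {0..a} g" by (simp add: g(2))
  also have "integral {a..2*pi} g + integral {0..a} g = integral {0..2*pi} g"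
    using Henstock_Kurzweil_Integration.integral_combine[of 0 a "2*pi" g] a i by (simp add: add.commute)
  finally show ?thesis .
qed

text \<open>
  The lower bound on \<open>y'\<close> makes \<open>y\<close> expanding up to the factor \<open>1/2\<close>, so the inverse is
  Lipschitz continuous and the inverse function theorem applies.
\<close>

lemma circle_diffeomorphism_inverse:
  fixes y y' :: "real \<Rightarrow> real"
  assumes y: "\<And>x. (y has_real_derivative y' x) (at x)" and pos: "\<And>x. y' x \<ge> 1/2"
    and per: "\<And>x. y (x + 2 * pi) = y x + 2 * pi" and y0: "y 0 = 0"
  obtains \<Theta> where "\<And>x. y (\<Theta> x) = x" "\<And>x. \<Theta> (y x) = x" "\<Theta> 0 = 0" "\<And>x. \<Theta> (x + 2 * pi) = \<Theta> x + 2 * pi"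
    "\<And>x. (\<Theta> has_real_derivative inverse (y' (\<Theta> x))) (at x)"
proof -
  have cont: "continuous_on X y" for X by (rule continuous_on_of_DERIV[OF y])
  have incr: "y b - y a \<ge> (b - a) / 2" if "a \<le> b" for a b
  proof (cases "a = b")
    case False
    then have ab: "a < b" using that by simp
    obtain z where z: "y b - y a = (b - a) * y' z" using MVT2[OF ab, of y y'] y by blast
    have "(b - a) * (1/2) \<le> (b - a) * y' z" using pos[of z] that by (intro mult_left_mono) auto
    then show ?thesis using z by simp
  qed simp
  have inj: "a = b" if "y a = y b" for a b
  proof (cases "a \<le> b")
    case True
    then have "b \<le> a" using incr[OF True] that by simp
    then show ?thesis using True by simp
  next
    case False
    then have "b \<le> a" by simp
    from incr[OF this] show ?thesis using that False by simp
  qed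
  have surj: "\<exists>a. y a = x" for x
  proof -
    define M where "M = 2 * \<bar>x\<bar> + 1"
    have M: "M > 0" by (simp add: M_def)
    have "(0 - (-M)) / 2 \<le> y 0 - y (-M)" "(M - 0) / 2 \<le> y M - y 0" by (rule incr; use M in simp)+
    then have "y (-M) \<le> - (M / 2)" "M / 2 \<le> y M" by (simp_all add: y0)
    moreover have "- (M / 2) \<le> x" "x \<le> M / 2" by (auto simp: M_def abs_if field_simps)
    ultimately have "y (-M) \<le> x" "x \<le> y M" by auto
    then obtain a where "y a = x" using IVT'[of y "-M" x M, OF _ _ _ cont] M by auto
    then show ?thesis by blast
  qed
  define \<Theta> where "\<Theta> x = (SOME a. y a = x)" for x
  have y\<Theta>: "y (\<Theta> x) = x" for x unfolding \<Theta>_def by (rule someI_ex[OF surj])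
  have \<Theta>y: "\<Theta> (y x) = x" for x by (rule inj) (rule y\<Theta>)
  have lip: "\<bar>\<Theta> a - \<Theta> b\<bar> \<le> 2 * \<bar>a - b\<bar>" for a b
  proof (cases "\<Theta> a \<le> \<Theta> b")
    case True
    then show ?thesis using incr[OF True] unfolding y\<Theta> by (simp add: field_simps abs_if)
  next
    case False
    then have "\<Theta> b \<le> \<Theta> a" by simp
    from incr[OF this] show ?thesis unfolding y\<Theta> using False by (simp add: field_simps abs_if)
  qed
  have c\<Theta>: "isCont \<Theta> x" for x
    unfolding isCont_def
  proof (rule LIM_I)
    fix r :: real assume r: "0 < r"
    have "norm (\<Theta> z - \<Theta> x) < r" if "norm (z - x) < r / 2" for z
      using lip[of z x] that by simp
    then show "\<exists>s>0. \<forall>z. z \<noteq> x \<and> norm (z - x) < s \<longrightarrow> norm (\<Theta> z - \<Theta> x) < r"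
      using r by (intro exI[of _ "r/2"]) auto
  qed
  show ?thesis
  proof (rule that[of \<Theta>])
    show "y (\<Theta> x) = x" "\<Theta> (y x) = x" for x by (rule y\<Theta> \<Theta>y)+
    show "\<Theta> 0 = 0" using \<Theta>y[of 0] y0 by simp
    show "\<Theta> (x + 2 * pi) = \<Theta> x + 2 * pi" for x
      by (rule inj) (simp add: y\<Theta> per)
    show "(\<Theta> has_real_derivative inverse (y' (\<Theta> x))) (at x)" for x
      by (rule DERIV_inverse_function[of y "y' (\<Theta> x)" \<Theta> x "x - 1" "x + 1"])
         (use y pos[of "\<Theta> x"] y\<Theta> c\<Theta> in auto)
  qed
qed

text \<open>
  The Dirichlet-to-Neumann multiplier of the flat Moebius band of half-width \<open>X\<close>: a harmonic function on
  \<open>\<bar>x\<bar> \<le> X\<close> invariant under \<open>(x, y) \<mapsto> (- x, y + \<pi>)\<close> consists of \<open>cosh (k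
  x) cis (k y)\<close> for even and \<open>sinh (k x) cis (k y)\<close> for odd \<open>k\<close>.
\<close>

definition dtn :: "real \<Rightarrow> int \<Rightarrow> real" where
  "dtn X k = (if even k then of_int k * tanh (of_int k * X) else of_int k * (cosh (of_int k * X) / sinh (of_int k * X)))"

text \<open>
  The hypothesis is Green's identity for \<open>exp (- k z)\<close>, where \<open>u\<close> and \<open>v\<close> are the Fourier
  coefficients of the boundary value and of the normal derivative, and the bottom boundary has been identified with the top one.
\<close>

lemma dtn_relation:
  fixes u v :: complex
  assumes X: "X > 0" and eq: "of_real (exp (- of_int k * X)) * (\<i> * of_int k * u + \<i> * v) =
    (if even k then 1 else -1) * of_real (exp (of_int k * X)) * (\<i> * of_int k * u - \<i> * v)"
  shows "v = of_real (dtn X k) * u"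
proof -
  define a where "a = exp (of_int k * X)"
  define b where "b = exp (- of_int k * X)"
  have ab: "a > 0" "b > 0" by (simp_all add: a_def b_def)
  have e: "of_real b * (of_int k * u + v) = (if even k then 1 else -1) * of_real a * (of_int k * u - v)"
  proof -
    have "\<i> * (of_real b * (of_int k * u + v)) = \<i> * ((if even k then 1 else -1) * of_real a * (of_int k * u - v))"
      using eq by (simp add: a_def b_def algebra_simps)
    then show ?thesis by simp
  qed
  have sc: "cosh (of_int k * X) = (a + b) / 2" "sinh (of_int k * X) = (a - b) / 2"
    by (simp_all add: cosh_def sinh_def a_def b_def)
  have half: "(x / 2) / (z / 2) = x / z" for x z :: real by simp
  show ?thesis
  proof (cases "even k")
    case True
    have nz: "complex_of_real (a + b) \<noteq> 0" using ab by (simp only: of_real_eq_0_iff)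
    have "of_real (a + b) * v = of_int k * of_real (a - b) * u" using e True by (simp add: algebra_simps)
    then have "v = of_int k * of_real (a - b) * u / of_real (a + b)" using nz by (simp add: field_simps)
    moreover have "tanh (of_int k * X) = (a - b) / (a + b)" unfolding tanh_def sc by (rule half)
    ultimately show ?thesis using True by (simp add: dtn_def)
  next
    case False
    then have "k \<noteq> 0" by auto
    have "a \<noteq> b"
    proof
      assume "a = b"
      then have "of_int k * X = - of_int k * X" by (simp add: a_def b_def)
      then show False using X \<open>k \<noteq> 0\<close> by simp
    qed
    then have nz: "complex_of_real (a - b) \<noteq> 0" by (simp only: of_real_eq_0_iff)
    have "of_real (a - b) * v = of_int k * of_real (a + b) * u" using e False by (simp add: algebra_simps)
    then have "v = of_int k * of_real (a + b) * u / of_real (a - b)" using nz by (simp add: field_simps)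
    moreover have "cosh (of_int k * X) / sinh (of_int k * X) = (a + b) / (a - b)" unfolding sc by (rule half)
    ultimately show ?thesis using False by (simp add: dtn_def)
  qed
qed

section \<open>Differential calculus on the strip\<close>

abbreviation pd :: "real \<times> real \<Rightarrow> (real \<times> real \<Rightarrow> 'b::real_normed_vector) \<Rightarrow> real \<times> real \<Rightarrow> 'b" where
  "pd \<equiv> partial_within mob_strip"

abbreviation smooth :: "(real \<times> real \<Rightarrow> 'b::real_normed_vector) \<Rightarrow> bool" where
  "smooth \<equiv> smooth_on_set mob_strip"

lemma mem_mob_strip [simp]: "(t, \<theta>) \<in> mob_strip \<longleftrightarrow> \<bar>t\<bar> \<le> mob_T"
  by (auto simp: mob_strip_def)

lemma convex_mob_strip: "convex mob_strip"
  unfolding mob_strip_def by (intro convex_Times) auto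

text \<open>
  Every point of the strip can be moved inside the strip along both axes, boundary points in one direction only; this suffices for
  uniqueness of derivatives.
\<close>

lemma mob_strip_derivative_unique:
  fixes F :: "real \<times> real \<Rightarrow> 'b::real_normed_vector"
  assumes "(F has_derivative D) (at p within mob_strip)" "(F has_derivative D') (at p within mob_strip)"
    and p: "p \<in> mob_strip"
  shows "D = D'"
proof (rule frechet_derivative_unique_within[OF assms(1,2)])
  fix i :: "real \<times> real" and e :: real
  assume i: "i \<in> Basis" and e: "0 < e"
  obtain t \<theta> where pt: "p = (t, \<theta>)" by fastforce
  have t: "\<bar>t\<bar> \<le> mob_T" using p pt by simp
  from i consider "i = (1, 0)" | "i = (0, 1)" by (auto simp: Basis_prod_def)
  then show "\<exists>d. 0 < \<bar>d\<bar> \<and> \<bar>d\<bar> < e \<and> p + d *\<^sub>R i \<in> mob_strip"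
  proof cases
    case 1
    define d where "d = (if t \<le> 0 then min (e/2) mob_T else - min (e/2) mob_T)"
    have "0 < \<bar>d\<bar> \<and> \<bar>d\<bar> < e \<and> p + d *\<^sub>R i \<in> mob_strip"
      using t e mob_T_pos unfolding pt 1 d_def by (auto simp: min_def abs_le_iff)
    then show ?thesis by blast
  next
    case 2
    have "0 < \<bar>e/2\<bar> \<and> \<bar>e/2\<bar> < e \<and> p + (e/2) *\<^sub>R i \<in> mob_strip"
      using t e unfolding pt 2 by auto
    then show ?thesis by blast
  qed
qed

lemma pd_eq:
  assumes "(F has_derivative D) (at p within mob_strip)" "p \<in> mob_strip"
  shows "pd b F p = D b"
proof -
  have "(F has_derivative frechet_derivative F (at p within mob_strip)) (at p within mob_strip)"
    using assms by (metis differentiableI frechet_derivative_works)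
  from mob_strip_derivative_unique[OF this assms(1) assms(2)] show ?thesis
    by (simp add: partial_within_def)
qed

lemma has_derivative_pd:
  assumes "F differentiable_on mob_strip" "p \<in> mob_strip"
  shows "(F has_derivative (\<lambda>h. fst h *\<^sub>R pd (1, 0) F p + snd h *\<^sub>R pd (0, 1) F p)) (at p within mob_strip)"
proof -
  define D where "D = frechet_derivative F (at p within mob_strip)"
  have D: "(F has_derivative D) (at p within mob_strip)"
    using assms unfolding D_def differentiable_on_def by (metis frechet_derivative_works)
  have lin: "linear D" using D has_derivative_linear by blast
  have "D h = fst h *\<^sub>R D (1, 0) + snd h *\<^sub>R D (0, 1)" for h
  proof -
    have "D h = D (fst h *\<^sub>R (1, 0) + snd h *\<^sub>R (0, 1))" by simp
    then show ?thesis unfolding linear_add[OF lin] linear_scale[OF lin] .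
  qed
  then show ?thesis
    unfolding partial_within_def D_def[symmetric] by (intro has_derivative_eq_rhs[OF D] ext)
qed

lemma pd_cong:
  assumes "\<And>q. q \<in> mob_strip \<Longrightarrow> F q = G q" "p \<in> mob_strip"
  shows "pd b F p = pd b G p"
proof -
  have "(F has_derivative D) (at p within mob_strip) \<longleftrightarrow> (G has_derivative D) (at p within mob_strip)" for D
    using assms has_derivative_transform[of p mob_strip F G D] has_derivative_transform[of p mob_strip G F D] by metis
  then show ?thesis unfolding partial_within_def frechet_derivative_def by simp
qed

lemma Ck_on_cong:
  assumes "\<And>q. q \<in> mob_strip \<Longrightarrow> F q = G q"
  shows "Ck_on mob_strip k F \<longleftrightarrow> Ck_on mob_strip k G"
  using assms
proof (induction k arbitrary: F G)
  case 0
  then show ?case by (simp cong: continuous_on_cong)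
next
  case (Suc k)
  have "F differentiable_on mob_strip \<longleftrightarrow> G differentiable_on mob_strip"
    using Suc.prems unfolding differentiable_on_def differentiable_def
    by (metis has_derivative_transform)
  moreover have "Ck_on mob_strip k (pd b F) \<longleftrightarrow> Ck_on mob_strip k (pd b G)" for b
    by (rule Suc.IH) (rule pd_cong[OF Suc.prems])
  ultimately show ?case by simp
qed

lemma Ck_on_mob_strip_Suc:
  "Ck_on mob_strip (Suc k) F \<longleftrightarrow> F differentiable_on mob_strip \<and>
     Ck_on mob_strip k (pd (1, 0) F) \<and> Ck_on mob_strip k (pd (0, 1) F)"
  by (auto simp: Basis_prod_def)

declare Ck_on.simps(2) [simp del]

lemma Ck_on_SucD: "Ck_on mob_strip (Suc k) F \<Longrightarrow> Ck_on mob_strip k F"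
proof (induction k arbitrary: F)
  case 0
  then show ?case by (simp add: Ck_on_mob_strip_Suc differentiable_imp_continuous_on)
next
  case (Suc k)
  then show ?case using Ck_on_mob_strip_Suc by blast
qed

text \<open>
  Induction principle for all closure properties of \<open>C\<^sup>k\<close> functions: it suffices to exhibit partial derivatives
  of class \<open>C\<^sup>k\<close>.
\<close>

lemma Ck_on_SucI:
  assumes "\<And>p. p \<in> mob_strip \<Longrightarrow> (F has_derivative (\<lambda>h. fst h *\<^sub>R A p + snd h *\<^sub>R B p)) (at p within mob_strip)"
    and "Ck_on mob_strip k A" "Ck_on mob_strip k B"
  shows "Ck_on mob_strip (Suc k) F"
proof -
  have "F differentiable_on mob_strip"
    using assms(1) unfolding differentiable_on_def differentiable_def by blast
  moreover have "pd (1, 0) F p = A p" "pd (0, 1) F p = B p" if "p \<in> mob_strip" for p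
    using pd_eq[OF assms(1)[OF that] that] by simp_all
  ultimately show ?thesis
    unfolding Ck_on_mob_strip_Suc using assms(2,3) Ck_on_cong[of "pd (1, 0) F" A k] Ck_on_cong[of "pd (0, 1) F" B k] by blast
qed

lemma Ck_on_SucE:
  assumes "Ck_on mob_strip (Suc k) F"
  shows "\<And>p. p \<in> mob_strip \<Longrightarrow> (F has_derivative (\<lambda>h. fst h *\<^sub>R pd (1, 0) F p + snd h *\<^sub>R pd (0, 1) F p)) (at p within mob_strip)"
    "Ck_on mob_strip k (pd (1, 0) F)" "Ck_on mob_strip k (pd (0, 1) F)" "Ck_on mob_strip k F"
proof -
  note A = assms[unfolded Ck_on_mob_strip_Suc]
  show "\<And>p. p \<in> mob_strip \<Longrightarrow> (F has_derivative (\<lambda>h. fst h *\<^sub>R pd (1, 0) F p + snd h *\<^sub>R pd (0, 1) F p)) (at p within mob_strip)"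
    by (rule has_derivative_pd) (use A in simp)
  show "Ck_on mob_strip k (pd (1, 0) F)" "Ck_on mob_strip k (pd (0, 1) F)" using A by simp_all
  show "Ck_on mob_strip k F" by (rule Ck_on_SucD[OF assms])
qed

lemma Ck_on_const: "Ck_on mob_strip k (\<lambda>p. c)"
proof (induction k arbitrary: c)
  case (Suc k)
  then show ?case by (intro Ck_on_SucI[where A = "\<lambda>_. 0" and B = "\<lambda>_. 0"]) simp_all
qed simp

lemma Ck_on_linear:
  assumes "bounded_linear L"
  shows "Ck_on mob_strip k F \<Longrightarrow> Ck_on mob_strip k (\<lambda>p. L (F p))"
proof (induction k arbitrary: F)
  case 0
  then show ?case using assms by (simp add: linear_continuous_on_compose linear_conv_bounded_linear bounded_linear.continuous_on)
next
  case (Suc k)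
  note F = Ck_on_SucE[OF Suc.prems]
  show ?case
    by (rule Ck_on_SucI[OF _ Suc.IH[OF F(2)] Suc.IH[OF F(3)]])
       (rule has_derivative_eq_rhs[OF bounded_linear.has_derivative[OF assms F(1)]],
        auto simp: bounded_linear.linear[OF assms] linear_add linear_scale)
qed

lemma Ck_on_add: "Ck_on mob_strip k F \<Longrightarrow> Ck_on mob_strip k G \<Longrightarrow> Ck_on mob_strip k (\<lambda>p. F p + G p)"
proof (induction k arbitrary: F G)
  case 0
  then show ?case by (simp add: continuous_on_add)
next
  case (Suc k)
  note F = Ck_on_SucE[OF Suc.prems(1)] and G = Ck_on_SucE[OF Suc.prems(2)]
  show ?case
    by (rule Ck_on_SucI[OF _ Suc.IH[OF F(2) G(2)] Suc.IH[OF F(3) G(3)]])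
       (rule has_derivative_eq_rhs[OF has_derivative_add[OF F(1) G(1)]], auto simp: algebra_simps)
qed

lemma Ck_on_bilinear:
  assumes "bounded_bilinear pr"
  shows "Ck_on mob_strip k F \<Longrightarrow> Ck_on mob_strip k G \<Longrightarrow> Ck_on mob_strip k (\<lambda>p. pr (F p) (G p))"
proof (induction k arbitrary: F G)
  case 0
  then show ?case by (simp add: bounded_bilinear.continuous_on[OF assms])
next
  case (Suc k)
  note F = Ck_on_SucE[OF Suc.prems(1)] and G = Ck_on_SucE[OF Suc.prems(2)]
  show ?case
    by (rule Ck_on_SucI[OF _ Ck_on_add[OF Suc.IH[OF F(4) G(2)] Suc.IH[OF F(2) G(4)]]
            Ck_on_add[OF Suc.IH[OF F(4) G(3)] Suc.IH[OF F(3) G(4)]]])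
       (rule has_derivative_eq_rhs[OF bounded_bilinear.FDERIV[OF assms F(1) G(1)]],
        auto simp: bounded_bilinear.add_left[OF assms] bounded_bilinear.add_right[OF assms]
         bounded_bilinear.scaleR_left[OF assms] bounded_bilinear.scaleR_right[OF assms] algebra_simps)
qed

lemmas Ck_on_mult = Ck_on_bilinear[OF bounded_bilinear_mult]

lemma Ck_on_inverse:
  fixes F :: "real \<times> real \<Rightarrow> 'a::real_normed_field"
  assumes nz: "\<And>p. p \<in> mob_strip \<Longrightarrow> F p \<noteq> 0"
  shows "Ck_on mob_strip k F \<Longrightarrow> Ck_on mob_strip k (\<lambda>p. inverse (F p))"
proof (induction k)
  case 0
  then show ?case using nz by (auto intro!: continuous_on_inverse)
next
  case (Suc k)
  note F = Ck_on_SucE[OF Suc.prems]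
  note I = Suc.IH[OF F(4)]
  have "((\<lambda>p. inverse (F p)) has_derivative
     (\<lambda>h. fst h *\<^sub>R (- 1 * (inverse (F p) * inverse (F p) * pd (1, 0) F p)) + snd h *\<^sub>R (- 1 * (inverse (F p) * inverse (F p) * pd (0, 1) F p))))
      (at p within mob_strip)" if "p \<in> mob_strip" for p
    by (rule has_derivative_eq_rhs[OF Deriv.has_derivative_inverse[OF nz[OF that] F(1)[OF that]]])
       (auto simp: algebra_simps)
  then show ?case
    by (rule Ck_on_SucI) (assumption | intro Ck_on_mult Ck_on_const I F(2,3))+
qed

lemma Ck_on_sqrt:
  assumes pos: "\<And>p. p \<in> mob_strip \<Longrightarrow> F p > (0::real)"
  shows "Ck_on mob_strip k F \<Longrightarrow> Ck_on mob_strip k (\<lambda>p. sqrt (F p))"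
proof (induction k)
  case 0
  then show ?case by (auto intro!: continuous_on_real_sqrt)
next
  case (Suc k)
  note F = Ck_on_SucE[OF Suc.prems]
  note I = Suc.IH[OF F(4)]
  have nz: "sqrt (F p) \<noteq> 0" if "p \<in> mob_strip" for p using pos[OF that] by simp
  note II = Ck_on_inverse[OF nz I]
  have "((\<lambda>p. sqrt (F p)) has_derivative
     (\<lambda>h. fst h *\<^sub>R ((1/2) * inverse (sqrt (F p)) * pd (1, 0) F p) + snd h *\<^sub>R ((1/2) * inverse (sqrt (F p)) * pd (0, 1) F p)))
      (at p within mob_strip)" if "p \<in> mob_strip" for p
    by (rule has_derivative_eq_rhs[OF has_derivative_real_sqrt[OF pos[OF that] F(1)[OF that]]])
       (auto simp: field_simps add_divide_distrib)
  then show ?case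
    by (rule Ck_on_SucI) (assumption | intro Ck_on_mult Ck_on_const II F(2,3))+
qed

lemma has_derivative_csqrt_comp:
  assumes "F p \<notin> \<real>\<^sub>\<le>\<^sub>0" "(F has_derivative D) (at p within S)"
  shows "((\<lambda>p. csqrt (F p)) has_derivative (\<lambda>h. D h / (2 * csqrt (F p)))) (at p within S)"
proof -
  have "(csqrt has_derivative (*) (inverse (2 * csqrt (F p)))) (at (F p))"
    using has_field_derivative_csqrt[OF assms(1)] by (simp add: has_field_derivative_def)
  from has_derivative_compose[OF assms(2) this] show ?thesis
    by (rule has_derivative_eq_rhs) (simp add: fun_eq_iff field_simps)
qed

lemma Ck_on_csqrt:
  assumes pos: "\<And>p. p \<in> mob_strip \<Longrightarrow> F p \<notin> \<real>\<^sub>\<le>\<^sub>0"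
  shows "Ck_on mob_strip k F \<Longrightarrow> Ck_on mob_strip k (\<lambda>p. csqrt (F p))"
proof (induction k)
  case 0
  then show ?case using pos by (auto intro!: continuous_on_compose2[OF continuous_on_csqrt])
next
  case (Suc k)
  note F = Ck_on_SucE[OF Suc.prems]
  note I = Suc.IH[OF F(4)]
  have nz: "csqrt (F p) \<noteq> 0" if "p \<in> mob_strip" for p using pos[OF that] by auto
  note II = Ck_on_inverse[OF nz I]
  have "((\<lambda>p. csqrt (F p)) has_derivative
     (\<lambda>h. fst h *\<^sub>R ((1/2) * inverse (csqrt (F p)) * pd (1, 0) F p) + snd h *\<^sub>R ((1/2) * inverse (csqrt (F p)) * pd (0, 1) F p)))
      (at p within mob_strip)" if "p \<in> mob_strip" for p
    by (rule has_derivative_eq_rhs[OF has_derivative_csqrt_comp[OF pos[OF that] F(1)[OF that]]])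
       (auto simp: scaleR_conv_of_real field_simps add_divide_distrib)
  then show ?case
    by (rule Ck_on_SucI) (assumption | intro Ck_on_mult Ck_on_const II F(2,3))+
qed

lemma smoothE:
  assumes "smooth F"
  shows smooth_Ck: "Ck_on mob_strip k F"
    and smooth_has_derivative: "\<And>p. p \<in> mob_strip \<Longrightarrow>
      (F has_derivative (\<lambda>h. fst h *\<^sub>R pd (1, 0) F p + snd h *\<^sub>R pd (0, 1) F p)) (at p within mob_strip)"
    and smooth_continuous: "continuous_on mob_strip F"
    and smooth_pd_t: "smooth (pd (1, 0) F)"
    and smooth_pd_th: "smooth (pd (0, 1) F)"
proof -
  have k: "Ck_on mob_strip k F" for k using assms by (simp add: smooth_on_set_def)
  note E = Ck_on_SucE[OF k[of "Suc k" for k]]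
  show "Ck_on mob_strip k F" by (rule k)
  show "\<And>p. p \<in> mob_strip \<Longrightarrow>
      (F has_derivative (\<lambda>h. fst h *\<^sub>R pd (1, 0) F p + snd h *\<^sub>R pd (0, 1) F p)) (at p within mob_strip)"
    by (rule E(1))
  show "continuous_on mob_strip F" using k[of 0] by simp
  show "smooth (pd (1, 0) F)" "smooth (pd (0, 1) F)"
    unfolding smooth_on_set_def using E(2,3) by blast+
qed

lemma smoothI:
  assumes "\<And>p. p \<in> mob_strip \<Longrightarrow> (F has_derivative (\<lambda>h. fst h *\<^sub>R A p + snd h *\<^sub>R B p)) (at p within mob_strip)"
    and "smooth A" "smooth B"
  shows "smooth F"
  unfolding smooth_on_set_def
proof
  fix k show "Ck_on mob_strip k F"
    by (rule Ck_on_SucD, rule Ck_on_SucI[OF assms(1)]) (use assms(2,3) smooth_Ck in blast)+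
qed

lemma smooth_cong: "(\<And>q. q \<in> mob_strip \<Longrightarrow> F q = G q) \<Longrightarrow> smooth F \<longleftrightarrow> smooth G"
  unfolding smooth_on_set_def using Ck_on_cong[of F G] by simp

named_theorems smooth_intros

lemma smooth_const [smooth_intros]: "smooth (\<lambda>p. c)"
  by (simp add: smooth_on_set_def Ck_on_const)

lemma smooth_linear: "bounded_linear L \<Longrightarrow> smooth F \<Longrightarrow> smooth (\<lambda>p. L (F p))"
  by (simp add: smooth_on_set_def Ck_on_linear)

lemma smooth_add [smooth_intros]: "smooth F \<Longrightarrow> smooth G \<Longrightarrow> smooth (\<lambda>p. F p + G p)"
  by (simp add: smooth_on_set_def Ck_on_add)

lemma smooth_bilinear: "bounded_bilinear pr \<Longrightarrow> smooth F \<Longrightarrow> smooth G \<Longrightarrow> smooth (\<lambda>p. pr (F p) (G p))"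
  by (simp add: smooth_on_set_def Ck_on_bilinear)

lemmas smooth_bilinears [smooth_intros] =
  smooth_bilinear[OF bounded_bilinear_mult] smooth_bilinear[OF bounded_bilinear_scaleR]
  smooth_bilinear[OF bounded_bilinear_inner]

lemmas smooth_linears [smooth_intros] =
  smooth_linear[OF bounded_linear_of_real] smooth_linear[OF bounded_linear_Re]
  smooth_linear[OF bounded_linear_Im] smooth_linear[OF bounded_linear_vec_nth]
  smooth_linear[OF bounded_linear_minus[OF bounded_linear_ident]]

lemma smooth_diff [smooth_intros]: "smooth F \<Longrightarrow> smooth G \<Longrightarrow> smooth (\<lambda>p. F p - G p)"
  using smooth_add[of F "\<lambda>p. - G p"] smooth_linears(5)[of G] by simp

lemma smooth_sum [smooth_intros]:
  "finite I \<Longrightarrow> (\<And>i. i \<in> I \<Longrightarrow> smooth (F i)) \<Longrightarrow> smooth (\<lambda>p. \<Sum>i\<in>I. F i p)"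
  by (induction I rule: finite_induct) (auto intro!: smooth_intros)

lemma smooth_inverse:
  fixes F :: "real \<times> real \<Rightarrow> 'a::real_normed_field"
  shows "smooth F \<Longrightarrow> (\<And>p. p \<in> mob_strip \<Longrightarrow> F p \<noteq> 0) \<Longrightarrow> smooth (\<lambda>p. inverse (F p))"
  by (simp add: smooth_on_set_def Ck_on_inverse)

lemma smooth_divide:
  fixes F :: "real \<times> real \<Rightarrow> 'a::real_normed_field"
  shows "smooth F \<Longrightarrow> smooth G \<Longrightarrow> (\<And>p. p \<in> mob_strip \<Longrightarrow> G p \<noteq> 0) \<Longrightarrow> smooth (\<lambda>p. F p / G p)"
  unfolding divide_inverse by (intro smooth_intros smooth_inverse)

lemma smooth_sqrt: "smooth F \<Longrightarrow> (\<And>p. p \<in> mob_strip \<Longrightarrow> F p > 0) \<Longrightarrow> smooth (\<lambda>p. sqrt (F p))"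
  by (simp add: smooth_on_set_def Ck_on_sqrt)

lemma smooth_csqrt: "smooth F \<Longrightarrow> (\<And>p. p \<in> mob_strip \<Longrightarrow> F p \<notin> \<real>\<^sub>\<le>\<^sub>0) \<Longrightarrow> smooth (\<lambda>p. csqrt (F p))"
  by (simp add: smooth_on_set_def Ck_on_csqrt)

context
  fixes p :: "real \<times> real" and b :: "real \<times> real"
  assumes p: "p \<in> mob_strip"
begin

lemma pd_direction:
  assumes "smooth F"
  shows "pd b F p = fst b *\<^sub>R pd (1, 0) F p + snd b *\<^sub>R pd (0, 1) F p"
  by (rule pd_eq[OF smooth_has_derivative[OF assms p] p])

lemma pd_const [simp]: "pd b (\<lambda>p. c) p = 0"
  by (rule pd_eq[OF has_derivative_const p])

lemma pd_linear:
  assumes "bounded_linear L" "smooth F"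
  shows "pd b (\<lambda>p. L (F p)) p = L (pd b F p)"
  using pd_eq[OF bounded_linear.has_derivative[OF assms(1) smooth_has_derivative[OF assms(2) p]] p]
  by (simp add: pd_direction[OF assms(2)])

lemma pd_add:
  assumes "smooth F" "smooth G"
  shows "pd b (\<lambda>p. F p + G p) p = pd b F p + pd b G p"
  using pd_eq[OF has_derivative_add[OF smooth_has_derivative[OF assms(1) p] smooth_has_derivative[OF assms(2) p]] p]
  by (simp add: pd_direction[OF assms(1)] pd_direction[OF assms(2)])

lemma pd_diff:
  assumes "smooth F" "smooth G"
  shows "pd b (\<lambda>p. F p - G p) p = pd b F p - pd b G p"
  using pd_eq[OF has_derivative_diff[OF smooth_has_derivative[OF assms(1) p] smooth_has_derivative[OF assms(2) p]] p]
  by (simp add: pd_direction[OF assms(1)] pd_direction[OF assms(2)])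

lemma pd_bilinear:
  assumes "bounded_bilinear pr" "smooth F" "smooth G"
  shows "pd b (\<lambda>p. pr (F p) (G p)) p = pr (F p) (pd b G p) + pr (pd b F p) (G p)"
  using pd_eq[OF bounded_bilinear.FDERIV[OF assms(1) smooth_has_derivative[OF assms(2) p] smooth_has_derivative[OF assms(3) p]] p]
  by (simp add: pd_direction[OF assms(2)] pd_direction[OF assms(3)])

lemmas pd_mult = pd_bilinear[OF bounded_bilinear_mult]
lemmas pd_scaleR = pd_bilinear[OF bounded_bilinear_scaleR]
lemmas pd_inner = pd_bilinear[OF bounded_bilinear_inner]
lemmas pd_of_real = pd_linear[OF bounded_linear_of_real]
lemmas pd_Re = pd_linear[OF bounded_linear_Re]
lemmas pd_Im = pd_linear[OF bounded_linear_Im]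
lemmas pd_vec_nth = pd_linear[OF bounded_linear_vec_nth]

lemma pd_inverse:
  fixes F :: "real \<times> real \<Rightarrow> 'a::real_normed_field"
  assumes "smooth F" "F p \<noteq> 0"
  shows "pd b (\<lambda>p. inverse (F p)) p = - pd b F p / (F p)\<^sup>2"
  using pd_eq[where b = b, OF Deriv.has_derivative_inverse[OF assms(2) smooth_has_derivative[OF assms(1) p]] p]
  unfolding pd_direction[OF assms(1), symmetric] by (simp add: field_simps power2_eq_square)

lemma pd_sqrt:
  assumes "smooth F" "F p > 0"
  shows "pd b (\<lambda>p. sqrt (F p)) p = pd b F p / (2 * sqrt (F p))"
  using pd_eq[where b = b, OF has_derivative_real_sqrt[OF assms(2) smooth_has_derivative[OF assms(1) p]] p]
  unfolding pd_direction[OF assms(1), symmetric] by (simp add: field_simps)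

lemma pd_sum:
  assumes "finite I" "\<And>i. i \<in> I \<Longrightarrow> smooth (F i)"
  shows "pd b (\<lambda>p. \<Sum>i\<in>I. F i p) p = (\<Sum>i\<in>I. pd b (F i) p)"
  using assms
  by (induction I rule: finite_induct) (simp_all add: pd_add smooth_sum)

end

lemma smooth_vector_derivative_t:
  assumes "smooth F" "\<bar>t\<bar> \<le> mob_T"
  shows "((\<lambda>s. F (s, \<theta>)) has_vector_derivative pd (1, 0) F (t, \<theta>)) (at t within {-mob_T..mob_T})"
proof -
  have "((\<lambda>s. F (s, \<theta>)) has_derivative (\<lambda>h. h *\<^sub>R pd (1, 0) F (t, \<theta>))) (at t within {-mob_T..mob_T})"
  proof (rule has_derivative_eq_rhs)
    show "((\<lambda>s. F (s, \<theta>)) has_derivative (\<lambda>h. fst (h, 0::real) *\<^sub>R pd (1, 0) F (t, \<theta>) + snd (h, 0::real) *\<^sub>R pd (0, 1) F (t, \<theta>)))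
       (at t within {-mob_T..mob_T})"
      by (rule has_derivative_in_compose2[OF smooth_has_derivative[OF assms(1)], where f = "\<lambda>s. (s, \<theta>)"])
         (use assms(2) in \<open>auto intro!: derivative_eq_intros\<close>)
  qed auto
  then show ?thesis by (simp add: has_vector_derivative_def)
qed

lemma smooth_vector_derivative_th:
  assumes "smooth F" "\<bar>t\<bar> \<le> mob_T"
  shows "((\<lambda>s. F (t, s)) has_vector_derivative pd (0, 1) F (t, \<theta>)) (at \<theta> within X)"
proof -
  have "((\<lambda>s. F (t, s)) has_derivative (\<lambda>h. h *\<^sub>R pd (0, 1) F (t, \<theta>))) (at \<theta>)"
  proof (rule has_derivative_eq_rhs)
    show "((\<lambda>s. F (t, s)) has_derivative (\<lambda>h. fst (0::real, h) *\<^sub>R pd (1, 0) F (t, \<theta>) + snd (0::real, h) *\<^sub>R pd (0, 1) F (t, \<theta>)))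
       (at \<theta>)"
      by (rule has_derivative_in_compose2[OF smooth_has_derivative[OF assms(1)], where f = "\<lambda>s. (t, s)"])
         (use assms(2) in \<open>auto intro!: derivative_eq_intros\<close>)
  qed auto
  then have "((\<lambda>s. F (t, s)) has_vector_derivative pd (0, 1) F (t, \<theta>)) (at \<theta>)" by (simp add: has_vector_derivative_def)
  then show ?thesis by (rule has_vector_derivative_at_within)
qed

lemma pd_th_boundary_cong:
  assumes "smooth F" "smooth G" "\<And>s. F (t, s) = G (t, s)" "\<bar>t\<bar> \<le> mob_T"
  shows "pd (0, 1) F (t, \<theta>) = pd (0, 1) G (t, \<theta>)"
  using smooth_vector_derivative_th[OF assms(1,4), of \<theta> UNIV] smooth_vector_derivative_th[OF assms(2,4), of \<theta> UNIV]
  unfolding assms(3) by (rule vector_derivative_unique_at)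

lemma continuous_on_strip_line:
  assumes "continuous_on mob_strip F" "\<bar>t\<bar> \<le> mob_T"
  shows "continuous_on X (\<lambda>s. F (t, s))"
  by (rule continuous_on_compose2[OF assms(1)]) (use assms(2) in \<open>auto intro!: continuous_intros\<close>)

text \<open>
  Differentiation under the integral sign, applied to \<open>F (t, x) = F (t, a) + \<integral> pd (0, 1) F\<close>. Schwarz's
  theorem is needed up to the boundary.
\<close>

lemma pd_commute:
  fixes F :: "real \<times> real \<Rightarrow> 'b::euclidean_space"
  assumes F: "smooth F" and p: "p \<in> mob_strip"
  shows "pd (0, 1) (pd (1, 0) F) p = pd (1, 0) (pd (0, 1) F) p"
proof -
  obtain t \<theta> where pt: "p = (t, \<theta>)" by fastforce
  have t: "\<bar>t\<bar> \<le> mob_T" using p pt by simp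
  define a where "a = \<theta> - 1"
  note sm = smooth_pd_t[OF F] smooth_pd_th[OF F] smooth_pd_t[OF smooth_pd_th[OF F]] smooth_pd_th[OF smooth_pd_t[OF F]]
  have int: "F (s, x) = F (s, a) + integral (cbox a x) (\<lambda>y. pd (0, 1) F (s, y))"
    if "\<bar>s\<bar> \<le> mob_T" "a \<le> x" for s x
  proof -
    have "((\<lambda>y. pd (0, 1) F (s, y)) has_integral F (s, x) - F (s, a)) {a..x}"
      by (rule fundamental_theorem_of_calculus[OF that(2)]) (rule smooth_vector_derivative_th[OF F that(1)])
    then show ?thesis by (simp add: integral_unique)
  qed
  have eq: "pd (1, 0) F (t, x) = pd (1, 0) F (t, a) + integral {a..x} (\<lambda>y. pd (1, 0) (pd (0, 1) F) (t, y))"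
    if x: "a \<le> x" for x
  proof (rule vector_derivative_unique_within_closed_interval)
    show "- mob_T < mob_T" "t \<in> cbox (- mob_T) mob_T" using mob_T_pos t by auto
    show "((\<lambda>s. F (s, x)) has_vector_derivative pd (1, 0) F (t, x)) (at t within cbox (- mob_T) mob_T)"
      using smooth_vector_derivative_t[OF F t] by simp
    have "((\<lambda>s. F (s, a) + integral (cbox a x) (\<lambda>y. pd (0, 1) F (s, y))) has_vector_derivative
       pd (1, 0) F (t, a) + integral (cbox a x) (\<lambda>y. pd (1, 0) (pd (0, 1) F) (t, y))) (at t within {- mob_T..mob_T})"
    proof (intro has_vector_derivative_add smooth_vector_derivative_t[OF F t] leibniz_rule_vector_derivative)
      show "continuous_on ({- mob_T..mob_T} \<times> cbox a x) (\<lambda>(s, y). pd (1, 0) (pd (0, 1) F) (s, y))"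
        unfolding split_beta prod.collapse
        by (rule continuous_on_subset[OF smooth_continuous[OF sm(3)]]) auto
      show "((\<lambda>s. pd (0, 1) F (s, y)) has_vector_derivative pd (1, 0) (pd (0, 1) F) (s, y)) (at s within {- mob_T..mob_T})"
        if "s \<in> {- mob_T..mob_T}" for s y
        by (rule smooth_vector_derivative_t[OF sm(2)]) (use that in auto)
      show "(\<lambda>y. pd (0, 1) F (s, y)) integrable_on cbox a x" if "s \<in> {- mob_T..mob_T}" for s
        by (rule integrable_continuous, rule continuous_on_strip_line[OF smooth_continuous[OF sm(2)]]) (use that in auto)
      show "t \<in> {- mob_T..mob_T}" using t by auto
    qed simp
    from this[unfolded box_real]
    show "((\<lambda>s. F (s, x)) has_vector_derivative pd (1, 0) F (t, a) + integral {a..x} (\<lambda>y. pd (1, 0) (pd (0, 1) F) (t, y))) (at t within cbox (- mob_T) mob_T)"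
      unfolding box_real
    proof (rule has_vector_derivative_transform[rotated 2])
      show "F (s, x) = F (s, a) + integral {a..x} (\<lambda>y. pd (0, 1) F (s, y))" if "s \<in> {- mob_T..mob_T}" for s
        using int[of s x] that x unfolding box_real by auto
      show "t \<in> {- mob_T..mob_T}" using t by auto
    qed
  qed
  have th: "\<theta> \<in> {a..\<theta> + 1}" unfolding a_def by simp
  show ?thesis
    unfolding pt
  proof (rule vector_derivative_unique_within_closed_interval)
    show "a < \<theta> + 1" "\<theta> \<in> cbox a (\<theta> + 1)" by (auto simp: a_def)
    show "((\<lambda>x. pd (1, 0) F (t, x)) has_vector_derivative pd (0, 1) (pd (1, 0) F) (t, \<theta>)) (at \<theta> within cbox a (\<theta> + 1))"
      by (rule smooth_vector_derivative_th[OF sm(1) t])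
    have "((\<lambda>x. pd (1, 0) F (t, a) + integral {a..x} (\<lambda>y. pd (1, 0) (pd (0, 1) F) (t, y))) has_vector_derivative
        0 + pd (1, 0) (pd (0, 1) F) (t, \<theta>)) (at \<theta> within {a..\<theta> + 1})"
      by (intro has_vector_derivative_add integral_has_vector_derivative has_vector_derivative_const
            continuous_on_strip_line smooth_continuous sm t th)
    then show "((\<lambda>x. pd (1, 0) F (t, x)) has_vector_derivative pd (1, 0) (pd (0, 1) F) (t, \<theta>)) (at \<theta> within cbox a (\<theta> + 1))"
      unfolding box_real add_0_left
    proof (rule has_vector_derivative_transform[OF th, rotated])
      show "pd (1, 0) F (t, x) = pd (1, 0) F (t, a) + integral {a..x} (\<lambda>y. pd (1, 0) (pd (0, 1) F) (t, y))"
        if "x \<in> {a..\<theta> + 1}" for x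
        by (rule eq) (use that in auto)
    qed
  qed
qed

text \<open>
  The deck transformation that generates the identifications of the strip.
\<close>

definition mob_flip :: "real \<times> real \<Rightarrow> real \<times> real" where
  "mob_flip p = (- fst p, snd p + pi)"

lemma mob_flip_strip [simp]: "mob_flip p \<in> mob_strip \<longleftrightarrow> p \<in> mob_strip"
  by (cases p) (simp add: mob_flip_def)

text \<open>
  The flip reverses the direction of \<open>t\<close>; hence the sign. The linear map \<open>L\<close> covers invariant, odd and
  conjugation-equivariant functions.
\<close>

lemma pd_flip:
  assumes F: "smooth F" and L: "bounded_linear L" and eq: "\<And>q. q \<in> mob_strip \<Longrightarrow> F (mob_flip q) = L (F q)"
    and p: "p \<in> mob_strip"
  shows "pd (1, 0) F (mob_flip p) = - L (pd (1, 0) F p)" "pd (0, 1) F (mob_flip p) = L (pd (0, 1) F p)"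
proof -
  have "((\<lambda>q. F (mob_flip q)) has_derivative (\<lambda>h. fst (- fst h, snd h) *\<^sub>R pd (1, 0) F (mob_flip p) +
      snd (- fst h, snd h) *\<^sub>R pd (0, 1) F (mob_flip p))) (at p within mob_strip)"
    by (rule has_derivative_in_compose2[OF smooth_has_derivative[OF F], where f = mob_flip])
       (use p in \<open>auto simp: mob_flip_def[abs_def] intro!: derivative_eq_intros\<close>)
  then have d1: "((\<lambda>q. L (F q)) has_derivative (\<lambda>h. fst (- fst h, snd h) *\<^sub>R pd (1, 0) F (mob_flip p) +
      snd (- fst h, snd h) *\<^sub>R pd (0, 1) F (mob_flip p))) (at p within mob_strip)"
    by (rule has_derivative_transform[OF p, rotated]) (simp add: eq)
  have "pd b (\<lambda>q. L (F q)) p = L (pd b F p)" for b by (rule pd_linear[OF p L F])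
  with pd_eq[OF d1 p, of "(1, 0)"] pd_eq[OF d1 p, of "(0, 1)"]
  show "pd (1, 0) F (mob_flip p) = - L (pd (1, 0) F p)" "pd (0, 1) F (mob_flip p) = L (pd (0, 1) F p)"
    by simp_all
qed

section \<open>The closed forms and the quartic differential of a minimal strip\<close>

lemma normal_part_properties:
  fixes V :: "'b::euclidean_space set"
  assumes V: "subspace V"
  shows "\<forall>x\<in>V. normal_part V v \<bullet> x = 0" and "v - normal_part V v \<in> V"
proof -
  obtain y z where y: "y \<in> span V" and z: "\<And>w. w \<in> span V \<Longrightarrow> orthogonal z w" and v: "v = y + z"
    using orthogonal_subspace_decomp_exists[of V v] by blast
  have sp: "span V = V" using V by (simp add: span_eq_iff)
  have "(\<forall>x\<in>V. normal_part V v \<bullet> x = 0) \<and> v - normal_part V v \<in> V"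
    unfolding normal_part_def
  proof (rule theI[of _ z])
    show "(\<forall>x\<in>V. z \<bullet> x = 0) \<and> v - z \<in> V" using y z v by (auto simp: sp orthogonal_def)
    fix w assume w: "(\<forall>x\<in>V. w \<bullet> x = 0) \<and> v - w \<in> V"
    have "v - w \<in> V" "v - z \<in> V" using w y v sp by auto
    from subspace_diff[OF V this] have m: "z - w \<in> V" by simp
    then have "z \<bullet> (z - w) = 0" "w \<bullet> (z - w) = 0" using z w by (auto simp: sp orthogonal_def)
    then have "(z - w) \<bullet> (z - w) = 0" by (simp add: inner_diff_left)
    then show "w = z" by simp
  qed
  then show "\<forall>x\<in>V. normal_part V v \<bullet> x = 0" "v - normal_part V v \<in> V" by blast+
qed

text \<open>
  Notation of classical surface theory: \<open>E\<close>, \<open>F\<close>, \<open>G\<close> are the coefficients of the induced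
  metric, \<open>W\<close> is its area density, and \<open>B1\<close>, \<open>B2\<close> are \<open>W\<close> times the gradients
  of \<open>t\<close> and \<open>\<theta>\<close>, so that \<open>B1 d\<theta> - B2 dt\<close> is the conjugate differential of
  \<open>f\<close>.
\<close>

locale minimal_strip =
  fixes f :: "real \<times> real \<Rightarrow> real ^ 'n::finite"
  assumes smooth_f: "smooth f"
    and immersed: "\<And>p. p \<in> mob_strip \<Longrightarrow>
      (pd (1, 0) f p \<bullet> pd (1, 0) f p) * (pd (0, 1) f p \<bullet> pd (0, 1) f p) - (pd (1, 0) f p \<bullet> pd (0, 1) f p)\<^sup>2 > 0"
    and minimal: "\<And>p. p \<in> mob_strip \<Longrightarrow> mean_curvature f p = 0"
begin

definition ft where "ft = pd (1, 0) f"
definition fh where "fh = pd (0, 1) f"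
definition E where "E p = ft p \<bullet> ft p"
definition F where "F p = ft p \<bullet> fh p"
definition G where "G p = fh p \<bullet> fh p"
definition Wsq where "Wsq p = E p * G p - F p * F p"
definition W where "W p = sqrt (Wsq p)"
definition B1 where "B1 p = inverse (W p) *\<^sub>R (G p *\<^sub>R ft p - F p *\<^sub>R fh p)"
definition B2 where "B2 p = inverse (W p) *\<^sub>R (E p *\<^sub>R fh p - F p *\<^sub>R ft p)"

lemma Wsq_pos: "p \<in> mob_strip \<Longrightarrow> Wsq p > 0"
  using immersed[of p] by (simp add: Wsq_def E_def F_def G_def ft_def fh_def power2_eq_square)

lemma W_pos: "p \<in> mob_strip \<Longrightarrow> W p > 0" by (simp add: W_def Wsq_pos)

lemma W_square: "p \<in> mob_strip \<Longrightarrow> W p * W p = E p * G p - F p * F p"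
  using Wsq_pos[of p] by (simp add: W_def Wsq_def[symmetric] less_imp_le)

lemma E_pos: "p \<in> mob_strip \<Longrightarrow> E p > 0"
proof -
  assume p: "p \<in> mob_strip"
  have "E p \<noteq> 0"
  proof
    assume "E p = 0"
    then have "Wsq p = - (F p * F p)" by (simp add: Wsq_def)
    with Wsq_pos[OF p] zero_le_square[of "F p"] show False by linarith
  qed
  then show "E p > 0" by (simp add: E_def)
qed

lemma smooth_geo [smooth_intros]:
  "smooth ft" "smooth fh" "smooth E" "smooth F" "smooth G" "smooth Wsq" "smooth W" "smooth B1" "smooth B2"
proof -
  show 1: "smooth ft" "smooth fh" unfolding ft_def fh_def using smooth_f by (rule smooth_pd_t smooth_pd_th)+
  show 2: "smooth E" "smooth F" "smooth G" unfolding E_def[abs_def] F_def[abs_def] G_def[abs_def]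
    by (intro smooth_intros 1)+
  show 3: "smooth Wsq" unfolding Wsq_def[abs_def] by (intro smooth_intros 2)
  show 4: "smooth W" unfolding W_def[abs_def] using 3 Wsq_pos by (rule smooth_sqrt)
  have nz: "W p \<noteq> 0" if "p \<in> mob_strip" for p using W_pos[OF that] by simp
  show "smooth B1" "smooth B2" unfolding B1_def[abs_def] B2_def[abs_def]
    by (intro smooth_intros smooth_inverse[OF 4 nz] 1 2; assumption)+
qed

lemma inner_B: assumes p: "p \<in> mob_strip"
  shows "B1 p \<bullet> ft p = W p" "B1 p \<bullet> fh p = 0" "B2 p \<bullet> ft p = 0" "B2 p \<bullet> fh p = W p"
    "B1 p \<bullet> B1 p = G p" "B2 p \<bullet> B2 p = E p"
proof -
  have nz: "W p \<noteq> 0" using W_pos[OF p] by simp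
  note i = inner_simps E_def[symmetric] F_def[symmetric] G_def[symmetric] inner_commute[of "fh p" "ft p"]
  show 1: "B1 p \<bullet> ft p = W p" "B2 p \<bullet> fh p = W p"
    using W_square[OF p] nz by (simp_all add: B1_def B2_def i field_simps)
  show 0: "B1 p \<bullet> fh p = 0" "B2 p \<bullet> ft p = 0"
    by (simp_all add: B1_def B2_def i)
  have "B1 p \<bullet> B1 p = B1 p \<bullet> (inverse (W p) *\<^sub>R (G p *\<^sub>R ft p - F p *\<^sub>R fh p))" by (simp add: B1_def)
  also have "\<dots> = G p" using nz by (simp add: inner_diff_right 0 1)
  finally show "B1 p \<bullet> B1 p = G p" .
  have "B2 p \<bullet> B2 p = B2 p \<bullet> (inverse (W p) *\<^sub>R (E p *\<^sub>R fh p - F p *\<^sub>R ft p))" by (simp add: B2_def)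
  also have "\<dots> = E p" using nz by (simp add: inner_diff_right 0 1)
  finally show "B2 p \<bullet> B2 p = E p" .
qed

lemma fht: "p \<in> mob_strip \<Longrightarrow> pd (0, 1) ft p = pd (1, 0) fh p"
  unfolding ft_def fh_def by (rule pd_commute[OF smooth_f])

text \<open>
  The normal part of the divergence is \<open>W\<close> times the mean curvature vector.
\<close>

lemma divergence_tangent:
  assumes p: "p \<in> mob_strip"
  shows "pd (1, 0) B1 p + pd (0, 1) B2 p \<in> span {ft p, fh p}"
proof -
  let ?V = "span {ft p, fh p}"
  let ?n = "normal_part ?V"
  have V: "subspace ?V" by (rule subspace_span)
  have ftV: "ft p \<in> ?V" "fh p \<in> ?V" by (auto intro: span_base)
  define a b c where "a = pd (1, 0) ft p" and "b = pd (1, 0) fh p" and "c = pd (0, 1) fh p"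
  have mc: "G p *\<^sub>R ?n a - (2 * F p) *\<^sub>R ?n b + E p *\<^sub>R ?n c = 0"
  proof -
    have "mean_curvature f p = (1 / (E p * G p - (F p)\<^sup>2)) *\<^sub>R (G p *\<^sub>R ?n a - (2 * F p) *\<^sub>R ?n b + E p *\<^sub>R ?n c)"
      unfolding mean_curvature_def Let_def a_def b_def c_def ft_def fh_def E_def F_def G_def tangent_plane_def mob_dt_def mob_d\<theta>_def ..
    moreover have "E p * G p - (F p)\<^sup>2 \<noteq> 0" using Wsq_pos[OF p] by (simp add: Wsq_def power2_eq_square)
    ultimately show ?thesis using minimal[OF p] by simp
  qed
  have "G p *\<^sub>R a - (2 * F p) *\<^sub>R b + E p *\<^sub>R c =
     G p *\<^sub>R (a - ?n a) - (2 * F p) *\<^sub>R (b - ?n b) + E p *\<^sub>R (c - ?n c)"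
    using mc by (simp add: algebra_simps)
  also have "\<dots> \<in> ?V"
    by (intro subspace_add[OF V] subspace_diff[OF V] subspace_scale[OF V] normal_part_properties(2)[OF V])
  finally have N: "G p *\<^sub>R a - (2 * F p) *\<^sub>R b + E p *\<^sub>R c \<in> ?V" .
  have nz: "W p \<noteq> 0" using W_pos[OF p] by simp
  have "W r \<noteq> 0" if "r \<in> mob_strip" for r using W_pos[OF that] by simp
  from smooth_inverse[OF smooth_geo(7) this] have iW: "smooth (\<lambda>p. inverse (W p))" .
  note sm = smooth_geo iW
  have d1: "pd (1, 0) B1 p = inverse (W p) *\<^sub>R (G p *\<^sub>R a + pd (1, 0) G p *\<^sub>R ft p - (F p *\<^sub>R b + pd (1, 0) F p *\<^sub>R fh p)) +
     pd (1, 0) (\<lambda>p. inverse (W p)) p *\<^sub>R (G p *\<^sub>R ft p - F p *\<^sub>R fh p)"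
    unfolding B1_def[abs_def] a_def b_def
    by (simp add: pd_scaleR[OF p] pd_diff[OF p] smooth_intros sm)
  have d2: "pd (0, 1) B2 p = inverse (W p) *\<^sub>R (E p *\<^sub>R c + pd (0, 1) E p *\<^sub>R fh p - (F p *\<^sub>R b + pd (0, 1) F p *\<^sub>R ft p)) +
     pd (0, 1) (\<lambda>p. inverse (W p)) p *\<^sub>R (E p *\<^sub>R fh p - F p *\<^sub>R ft p)"
    unfolding B2_def[abs_def] b_def c_def fht[OF p, symmetric]
    by (simp add: pd_scaleR[OF p] pd_diff[OF p] smooth_intros sm)
  have "pd (1, 0) B1 p + pd (0, 1) B2 p = inverse (W p) *\<^sub>R (G p *\<^sub>R a - (2 * F p) *\<^sub>R b + E p *\<^sub>R c) +
     (inverse (W p) *\<^sub>R (pd (1, 0) G p *\<^sub>R ft p - pd (1, 0) F p *\<^sub>R fh p) + pd (1, 0) (\<lambda>p. inverse (W p)) p *\<^sub>R (G p *\<^sub>R ft p - F p *\<^sub>R fh p)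
      + inverse (W p) *\<^sub>R (pd (0, 1) E p *\<^sub>R fh p - pd (0, 1) F p *\<^sub>R ft p) + pd (0, 1) (\<lambda>p. inverse (W p)) p *\<^sub>R (E p *\<^sub>R fh p - F p *\<^sub>R ft p))"
    unfolding d1 d2 mult_2 scaleR_add_left scaleR_diff_right scaleR_add_right by simp
  also have "\<dots> \<in> ?V"
    by (intro subspace_add[OF V] subspace_diff[OF V] subspace_scale[OF V] N ftV)
  finally show ?thesis .
qed

text \<open>
  Differentiating the area density gives the tangential components of the divergence, by symmetry of second derivatives.
\<close>

lemma W_derivative:
  assumes p: "p \<in> mob_strip"
  shows "pd b W p = B1 p \<bullet> pd b ft p + B2 p \<bullet> pd b fh p"
proof -
  have nz: "W p \<noteq> 0" using W_pos[OF p] by simp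
  have dE: "pd b E p = 2 * (ft p \<bullet> pd b ft p)" and dG: "pd b G p = 2 * (fh p \<bullet> pd b fh p)"
    and dF: "pd b F p = ft p \<bullet> pd b fh p + fh p \<bullet> pd b ft p"
    unfolding E_def[abs_def] F_def[abs_def] G_def[abs_def]
    by (simp_all add: pd_inner[OF p] smooth_geo inner_commute)
  have "pd b W p = pd b Wsq p / (2 * W p)"
    unfolding W_def[abs_def] by (rule pd_sqrt[OF p smooth_geo(6) Wsq_pos[OF p]])
  also have "pd b Wsq p = E p * pd b G p + pd b E p * G p - (F p * pd b F p + pd b F p * F p)"
    unfolding Wsq_def[abs_def] by (simp add: pd_diff[OF p] pd_mult[OF p] smooth_intros)
  finally have "W p * pd b W p = E p * (fh p \<bullet> pd b fh p) + G p * (ft p \<bullet> pd b ft p) - F p * (ft p \<bullet> pd b fh p + fh p \<bullet> pd b ft p)"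
    using nz unfolding dE dF dG by (simp add: field_simps)
  also have "\<dots> = W p * (B1 p \<bullet> pd b ft p + B2 p \<bullet> pd b fh p)"
    using nz by (simp add: B1_def B2_def inner_simps distrib_left mult.assoc[symmetric])
  finally show ?thesis using nz by simp
qed

text \<open>
  The tangential part of the divergence vanishes for every immersion; so minimality is equivalent to harmonicity of the coordinate
  functions.
\<close>

lemma divergence_free:
  assumes p: "p \<in> mob_strip"
  shows "pd (1, 0) B1 p + pd (0, 1) B2 p = 0"
proof -
  define V where "V = pd (1, 0) B1 p + pd (0, 1) B2 p"
  note c = pd_cong[OF _ p]
  have "pd (1, 0) (\<lambda>q. B1 q \<bullet> ft q) p = pd (1, 0) W p" by (rule c) (rule inner_B)
  then have 1: "B1 p \<bullet> pd (1, 0) ft p + pd (1, 0) B1 p \<bullet> ft p = pd (1, 0) W p"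
    by (simp add: pd_inner[OF p] smooth_geo)
  have "pd (0, 1) (\<lambda>q. B2 q \<bullet> ft q) p = pd (0, 1) (\<lambda>q. 0) p" by (rule c) (rule inner_B)
  then have 2: "B2 p \<bullet> pd (0, 1) ft p + pd (0, 1) B2 p \<bullet> ft p = 0"
    by (simp add: pd_inner[OF p] smooth_geo p)
  have "pd (1, 0) (\<lambda>q. B1 q \<bullet> fh q) p = pd (1, 0) (\<lambda>q. 0) p" by (rule c) (rule inner_B)
  then have 3: "B1 p \<bullet> pd (1, 0) fh p + pd (1, 0) B1 p \<bullet> fh p = 0"
    by (simp add: pd_inner[OF p] smooth_geo p)
  have "pd (0, 1) (\<lambda>q. B2 q \<bullet> fh q) p = pd (0, 1) W p" by (rule c) (rule inner_B)
  then have 4: "B2 p \<bullet> pd (0, 1) fh p + pd (0, 1) B2 p \<bullet> fh p = pd (0, 1) W p"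
    by (simp add: pd_inner[OF p] smooth_geo)
  have "V \<bullet> ft p = 0" "V \<bullet> fh p = 0"
    using 1 2 3 4 fht[OF p] unfolding V_def W_derivative[OF p] inner_add_left by auto
  moreover have "V \<in> span {ft p, fh p}" unfolding V_def by (rule divergence_tangent[OF p])
  ultimately have "orthogonal V V"
    by (intro orthogonal_to_span[of V "{ft p, fh p}"]) (auto simp: orthogonal_def)
  then show ?thesis by (simp add: V_def orthogonal_def)
qed

text \<open>
  The form \<open>dt + m d\<theta>\<close> is of type (1,0) for the conformal structure of the surface, \<open>P dt + Q
  d\<theta>\<close> is twice the (1,0)-part of \<open>df\<close>, and \<open>q\<close> is the coefficient of the quartic
  differential \<open>q (dt + m d\<theta>)\<close> to the fourth power.
\<close>

definition m :: "real \<times> real \<Rightarrow> complex" where "m p = (of_real (F p) + \<i> * of_real (W p)) / of_real (E p)"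
definition P :: "'n \<Rightarrow> real \<times> real \<Rightarrow> complex" where "P i p = of_real (ft p $ i) - \<i> * of_real (B2 p $ i)"
definition Q :: "'n \<Rightarrow> real \<times> real \<Rightarrow> complex" where "Q i p = of_real (fh p $ i) + \<i> * of_real (B1 p $ i)"
definition q :: "real \<times> real \<Rightarrow> complex" where "q p = (\<Sum>i\<in>UNIV. pd (1, 0) (P i) p * pd (1, 0) (P i) p)"

lemma smooth_complex [smooth_intros]: "smooth m" "smooth (P i)" "smooth (Q i)" "smooth (pd (1, 0) (P i))" "smooth q"
proof -
  have "complex_of_real (E p) \<noteq> 0" if "p \<in> mob_strip" for p using E_pos[OF that] by simp
  then show "smooth m" unfolding m_def[abs_def] by (intro smooth_divide smooth_intros)
  show 1: "smooth (P i)" "smooth (Q i)" for i unfolding P_def[abs_def] Q_def[abs_def] by (intro smooth_intros)+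
  show 2: "smooth (pd (1, 0) (P i))" for i by (rule smooth_pd_t[OF 1(1)])
  show "smooth q" unfolding q_def[abs_def] by (intro smooth_intros 2) simp
qed

lemma Q_eq: assumes p: "p \<in> mob_strip" shows "Q i p = m p * P i p"
proof -
  have nz: "W p \<noteq> 0" "E p \<noteq> 0" using W_pos[OF p] E_pos[OF p] by auto
  have r: "F p * ft p $ i + W p * B2 p $ i = E p * fh p $ i"
    using nz by (simp add: B2_def mult.assoc[symmetric])
  have "W p * (W p * ft p $ i - F p * B2 p $ i) = W p * (E p * B1 p $ i)"
  proof -
    have "W p * (W p * ft p $ i - F p * B2 p $ i) = (W p * W p) * ft p $ i - F p * (W p * B2 p $ i)" by (simp add: algebra_simps)
    also have "W p * B2 p $ i = E p * fh p $ i - F p * ft p $ i" using nz by (simp add: B2_def)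
    also have "W p * W p = E p * G p - F p * F p" by (rule W_square[OF p])
    finally have "W p * (W p * ft p $ i - F p * B2 p $ i) = E p * (G p * ft p $ i - F p * fh p $ i)" by (simp add: algebra_simps)
    also have "G p * ft p $ i - F p * fh p $ i = W p * B1 p $ i" using nz by (simp add: B1_def mult.assoc[symmetric])
    finally show ?thesis by simp
  qed
  then have im: "W p * ft p $ i - F p * B2 p $ i = E p * B1 p $ i" using nz by simp
  have "of_real (E p) * Q i p = (of_real (F p) + \<i> * of_real (W p)) * P i p"
    using r im by (auto simp: complex_eq_iff P_def Q_def)
  then show ?thesis using nz by (simp add: m_def field_simps)
qed

lemma P_null: assumes p: "p \<in> mob_strip" shows "(\<Sum>i\<in>UNIV. P i p * P i p) = 0"
proof -
  have "(\<Sum>i\<in>UNIV. P i p * P i p) = (\<Sum>i\<in>UNIV. of_real (ft p $ i * ft p $ i - B2 p $ i * B2 p $ i) - \<i> * of_real (2 * (B2 p $ i * ft p $ i)))"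
    by (rule sum.cong) (auto simp: P_def complex_eq_iff)
  also have "\<dots> = of_real (ft p \<bullet> ft p - B2 p \<bullet> B2 p) - \<i> * of_real (2 * (B2 p \<bullet> ft p))"
    by (simp add: inner_vec_def sum_subtractf sum_distrib_left)
  also have "\<dots> = 0" using inner_B[OF p] by (simp add: E_def[symmetric])
  finally show ?thesis .
qed

lemma closed_PQ: assumes p: "p \<in> mob_strip" shows "pd (0, 1) (P i) p = pd (1, 0) (Q i) p"
proof -
  have 1: "pd (0, 1) (P i) p = of_real (pd (0, 1) ft p $ i) - \<i> * of_real (pd (0, 1) B2 p $ i)"
    unfolding P_def[abs_def] by (simp add: pd_diff[OF p] pd_mult[OF p] pd_of_real[OF p] pd_vec_nth[OF p] pd_const[OF p] smooth_intros)
  have 2: "pd (1, 0) (Q i) p = of_real (pd (1, 0) fh p $ i) + \<i> * of_real (pd (1, 0) B1 p $ i)"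
    unfolding Q_def[abs_def] by (simp add: pd_add[OF p] pd_mult[OF p] pd_of_real[OF p] pd_vec_nth[OF p] pd_const[OF p] smooth_intros)
  have "pd (1, 0) B1 p $ i = - pd (0, 1) B2 p $ i"
    using arg_cong[OF divergence_free[OF p], of "\<lambda>v. v $ i"] by simp
  then show ?thesis unfolding 1 2 fht[OF p] by simp
qed

lemma P_null_derivative: assumes p: "p \<in> mob_strip" shows "(\<Sum>i\<in>UNIV. P i p * pd (1, 0) (P i) p) = 0"
proof -
  have "pd (1, 0) (\<lambda>p. \<Sum>i\<in>UNIV. P i p * P i p) p = pd (1, 0) (\<lambda>p. 0) p"
    by (rule pd_cong[OF _ p]) (rule P_null)
  then have "(\<Sum>i\<in>UNIV. 2 * (P i p * pd (1, 0) (P i) p)) = 0"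
    by (simp add: pd_sum[OF p] pd_mult[OF p] smooth_intros pd_const[OF p] mult.commute)
  then show ?thesis by (simp add: sum_distrib_left[symmetric])
qed

text \<open>
  The equation says that the quartic differential is holomorphic. The expression \<open>\<Sum> (\<partial>\<^sub>t
  P\<^sub>i)\<^sup>2\<close> transforms like a tensor because \<open>P\<close> is a null vector: all terms with a derivative of
  \<open>m\<close> and an undifferentiated \<open>P\<close> are multiples of \<open>P \<bullet> P\<close> or of its derivative.
\<close>

lemma q_equation:
  assumes p: "p \<in> mob_strip"
  shows "pd (0, 1) q p = m p * pd (1, 0) q p + 4 * pd (1, 0) m p * q p"
proof -
  have qd: "pd b q p = (\<Sum>i\<in>UNIV. 2 * (pd (1, 0) (P i) p * pd b (pd (1, 0) (P i)) p))" for b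
    unfolding q_def[abs_def] by (simp add: pd_sum[OF p] pd_mult[OF p] smooth_intros mult.commute)
  have Pth: "pd (0, 1) (P i) r = m r * pd (1, 0) (P i) r + pd (1, 0) m r * P i r" if r: "r \<in> mob_strip" for i r
  proof -
    have "pd (1, 0) (Q i) r = pd (1, 0) (\<lambda>p. m p * P i p) r" by (rule pd_cong[OF _ r]) (rule Q_eq)
    then show ?thesis unfolding closed_PQ[OF r] by (simp add: pd_mult[OF r] smooth_intros)
  qed
  have mt: "smooth (pd (1, 0) m)" by (rule smooth_pd_t[OF smooth_complex(1)])
  have "pd (0, 1) (pd (1, 0) (P i)) p = m p * pd (1, 0) (pd (1, 0) (P i)) p + 2 * pd (1, 0) m p * pd (1, 0) (P i) p + pd (1, 0) (pd (1, 0) m) p * P i p" for i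
  proof -
    have "pd (0, 1) (pd (1, 0) (P i)) p = pd (1, 0) (pd (0, 1) (P i)) p" by (rule pd_commute[OF smooth_complex(2) p])
    also have "\<dots> = pd (1, 0) (\<lambda>r. m r * pd (1, 0) (P i) r + pd (1, 0) m r * P i r) p" by (rule pd_cong[OF _ p]) (rule Pth)
    finally show ?thesis by (simp add: pd_add[OF p] pd_mult[OF p] smooth_intros mt algebra_simps)
  qed
  then have "pd (0, 1) q p = (\<Sum>i\<in>UNIV. m p * (2 * (pd (1, 0) (P i) p * pd (1, 0) (pd (1, 0) (P i)) p)) +
       4 * pd (1, 0) m p * (pd (1, 0) (P i) p * pd (1, 0) (P i) p) + 2 * pd (1, 0) (pd (1, 0) m) p * (P i p * pd (1, 0) (P i) p))"
    unfolding qd by (intro sum.cong) (auto simp: algebra_simps)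
  also have "\<dots> = m p * pd (1, 0) q p + 4 * pd (1, 0) m p * q p + 2 * pd (1, 0) (pd (1, 0) m) p * (\<Sum>i\<in>UNIV. P i p * pd (1, 0) (P i) p)"
    unfolding sum.distrib qd q_def sum_distrib_left[symmetric] ..
  finally show ?thesis by (simp add: P_null_derivative[OF p])
qed

end

section \<open>Primitives on the strip and the free boundary condition\<close>

lemma Ck_on_exp:
  fixes F :: "real \<times> real \<Rightarrow> complex"
  shows "Ck_on mob_strip k F \<Longrightarrow> Ck_on mob_strip k (\<lambda>p. exp (F p))"
proof (induction k)
  case 0
  then show ?case by (auto intro!: continuous_intros)
next
  case (Suc k)
  note F = Ck_on_SucE[OF Suc.prems]
  note I = Suc.IH[OF F(4)]
  have "((\<lambda>p. exp (F p)) has_derivative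
     (\<lambda>h. fst h *\<^sub>R (exp (F p) * pd (1, 0) F p) + snd h *\<^sub>R (exp (F p) * pd (0, 1) F p)))
      (at p within mob_strip)" if "p \<in> mob_strip" for p
    by (rule has_derivative_eq_rhs[OF has_derivative_compose[OF F(1)[OF that] DERIV_exp[unfolded has_field_derivative_def]]])
       (auto simp: scaleR_conv_of_real algebra_simps)
  then show ?case
    by (rule Ck_on_SucI) (assumption | intro Ck_on_mult I F(2,3))+
qed

lemma smooth_exp [smooth_intros]: "smooth F \<Longrightarrow> smooth (\<lambda>p. exp (F p :: complex))"
  by (simp add: smooth_on_set_def Ck_on_exp)

lemma pd_exp:
  fixes F :: "real \<times> real \<Rightarrow> complex"
  assumes p: "p \<in> mob_strip" and "smooth F"
  shows "pd b (\<lambda>p. exp (F p)) p = exp (F p) * pd b F p"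
  using pd_eq[where b = b, OF has_derivative_compose[OF smooth_has_derivative[OF assms(2) p] DERIV_exp[unfolded has_field_derivative_def]] p]
  unfolding pd_direction[OF p assms(2), symmetric] .

lemma continuous_antiderivative:
  fixes g :: "real \<Rightarrow> 'b::euclidean_space"
  assumes g: "continuous_on UNIV g"
  obtains h where "\<And>x. (h has_vector_derivative g x) (at x)"
proof
  define h where "h x = integral {0..x} g - integral {x..0} g" for x
  have c: "continuous_on X g" for X using g continuous_on_subset by blast
  show "(h has_vector_derivative g x) (at x)" for x
  proof -
    define a where "a = - \<bar>x\<bar> - 1"
    have a: "a < 0" "a < x" by (auto simp: a_def)
    have eq: "integral {a..y} g - integral {a..0} g = h y" if "y > a" for y
    proof (cases "y \<ge> 0")
      case True
      have "integral {a..0} g + integral {0..y} g = integral {a..y} g"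
        by (rule Henstock_Kurzweil_Integration.integral_combine) (use a True in \<open>auto intro!: integrable_continuous_real c\<close>)
      moreover have "integral {y..0} g = 0" using True by (cases "y = 0") auto
      ultimately show ?thesis unfolding h_def by (metis add_diff_cancel_left' diff_zero)
    next
      case False
      have "integral {a..y} g + integral {y..0} g = integral {a..0} g"
        by (rule Henstock_Kurzweil_Integration.integral_combine) (use that False in \<open>auto intro!: integrable_continuous_real c\<close>)
      then show ?thesis using False by (auto simp: h_def algebra_simps)
    qed
    have "((\<lambda>y. integral {a..y} g) has_vector_derivative g x) (at x within {a..x + 1})"
      by (rule integral_has_vector_derivative[OF c]) (use a in auto)
    then have "((\<lambda>y. integral {a..y} g) has_vector_derivative g x) (at x)"
      using a by (simp add: at_within_Icc_at)
    then have "((\<lambda>y. integral {a..y} g - integral {a..0} g) has_vector_derivative g x - 0) (at x)"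
      by (intro has_vector_derivative_diff has_vector_derivative_const)
    then have "((\<lambda>y. integral {a..y} g - integral {a..0} g) has_vector_derivative g x) (at x)"
      by simp
    then show ?thesis
      by (rule has_vector_derivative_transform_within_open[of _ _ _ "{a<..}"]) (use a eq in auto)
  qed
qed

lemma continuous_on_strip_column:
  assumes "continuous_on mob_strip F" "X \<subseteq> {-mob_T..mob_T}"
  shows "continuous_on X (\<lambda>s. F (s, \<theta>))"
  by (rule continuous_on_compose2[OF assms(1)]) (auto intro!: continuous_intros dest!: subsetD[OF assms(2)])

lemma integral_column_derivative:
  fixes A :: "real \<times> real \<Rightarrow> complex"
  assumes A: "smooth A" and t: "\<bar>t\<bar> \<le> mob_T"
  shows "((\<lambda>y. integral {-mob_T..t} (\<lambda>s. A (s, y))) has_vector_derivative integral {-mob_T..t} (\<lambda>s. pd (0, 1) A (s, \<theta>))) (at \<theta>)"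
proof -
  have "((\<lambda>y. integral (cbox (-mob_T) t) (\<lambda>s. A (s, y))) has_vector_derivative integral (cbox (-mob_T) t) (\<lambda>s. pd (0, 1) A (s, \<theta>))) (at \<theta> within UNIV)"
  proof (rule leibniz_rule_vector_derivative)
    show "((\<lambda>y. A (s, y)) has_vector_derivative pd (0, 1) A (s, y)) (at y within UNIV)" if "s \<in> cbox (- mob_T) t" for y s
      by (rule smooth_vector_derivative_th[OF A]) (use that t in auto)
    show "(\<lambda>s. A (s, y)) integrable_on cbox (- mob_T) t" for y
      by (rule integrable_continuous, rule continuous_on_strip_column[OF smooth_continuous[OF A]]) (use t in auto)
    show "continuous_on (UNIV \<times> cbox (- mob_T) t) (\<lambda>(y, s). pd (0, 1) A (s, y))"
      unfolding split_beta
      by (rule continuous_on_compose2[OF smooth_continuous[OF smooth_pd_th[OF A]]]) (use t in \<open>auto intro!: continuous_intros\<close>)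
  qed auto
  then show ?thesis by simp
qed

text \<open>
  The Poincare lemma; smoothness up to the boundary is inherited from the given partial derivatives.
\<close>

lemma primitive_on_strip:
  fixes A B :: "real \<times> real \<Rightarrow> complex"
  assumes A: "smooth A" and B: "smooth B" and closed: "\<And>p. p \<in> mob_strip \<Longrightarrow> pd (0, 1) A p = pd (1, 0) B p"
  obtains w where "smooth w" "\<And>p. p \<in> mob_strip \<Longrightarrow> pd (1, 0) w p = A p" "\<And>p. p \<in> mob_strip \<Longrightarrow> pd (0, 1) w p = B p"
    "w (mob_T, 0) = 0"
proof -
  have T: "\<bar>- mob_T\<bar> \<le> mob_T" using mob_T_pos by simp
  obtain h where h: "\<And>\<theta>. (h has_vector_derivative B (- mob_T, \<theta>)) (at \<theta>)"
    using continuous_antiderivative[OF continuous_on_strip_line[OF smooth_continuous[OF B] T]] by blast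
  define v where "v t \<theta> = h \<theta> + integral {-mob_T..t} (\<lambda>s. A (s, \<theta>))" for t \<theta>
  have vt: "((\<lambda>t. v t \<theta>) has_vector_derivative A (t, \<theta>)) (at t within {-mob_T..mob_T})" if "\<bar>t\<bar> \<le> mob_T" for t \<theta>
  proof -
    have "((\<lambda>t. integral {-mob_T..t} (\<lambda>s. A (s, \<theta>))) has_vector_derivative A (t, \<theta>)) (at t within {-mob_T..mob_T})"
      by (rule integral_has_vector_derivative) (use that in \<open>auto intro!: continuous_on_strip_column smooth_continuous A\<close>)
    then have "((\<lambda>t. v t \<theta>) has_vector_derivative 0 + A (t, \<theta>)) (at t within {-mob_T..mob_T})"
      unfolding v_def by (intro has_vector_derivative_add has_vector_derivative_const)
    then show ?thesis by simp
  qed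
  have vth: "((\<lambda>\<theta>. v t \<theta>) has_vector_derivative B (t, \<theta>)) (at \<theta>)" if t: "\<bar>t\<bar> \<le> mob_T" for t \<theta>
  proof -
    have "((\<lambda>s. pd (0, 1) A (s, \<theta>)) has_integral B (t, \<theta>) - B (-mob_T, \<theta>)) {-mob_T..t}"
    proof (rule fundamental_theorem_of_calculus)
      fix s assume s: "s \<in> {-mob_T..t}"
      then have s': "\<bar>s\<bar> \<le> mob_T" using t by auto
      have "((\<lambda>s. B (s, \<theta>)) has_vector_derivative pd (1, 0) B (s, \<theta>)) (at s within {-mob_T..t})"
        by (rule has_vector_derivative_within_subset[OF smooth_vector_derivative_t[OF B s']]) (use t in auto)
      then show "((\<lambda>s. B (s, \<theta>)) has_vector_derivative pd (0, 1) A (s, \<theta>)) (at s within {-mob_T..t})"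
        using closed[of "(s, \<theta>)"] s' by simp
    qed (use t in auto)
    then have "integral {-mob_T..t} (\<lambda>s. pd (0, 1) A (s, \<theta>)) = B (t, \<theta>) - B (-mob_T, \<theta>)" by (rule integral_unique)
    with has_vector_derivative_add[OF h[of \<theta>] integral_column_derivative[OF A t, of \<theta>]] show ?thesis
      unfolding v_def by simp
  qed
  have dv: "((\<lambda>p. v (fst p) (snd p)) has_derivative (\<lambda>h. fst h *\<^sub>R A p + snd h *\<^sub>R B p)) (at p within mob_strip)" if p: "p \<in> mob_strip" for p
  proof -
    obtain t \<theta> where pt: "p = (t, \<theta>)" by fastforce
    have t: "\<bar>t\<bar> \<le> mob_T" using p pt by simp
    have "((\<lambda>(t, \<theta>). v t \<theta>) has_derivative (\<lambda>(a, b). a *\<^sub>R A (t, \<theta>) + blinfun_scaleR_left (B (t, \<theta>)) b)) (at (t, \<theta>) within {-mob_T..mob_T} \<times> UNIV)"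
    proof (rule has_derivative_partialsI)
      show "((\<lambda>t. v t \<theta>) has_derivative (\<lambda>a. a *\<^sub>R A (t, \<theta>))) (at t within {-mob_T..mob_T})"
        using vt[OF t] by (simp add: has_vector_derivative_def)
      show "((\<lambda>\<theta>. v t \<theta>) has_derivative blinfun_apply (blinfun_scaleR_left (B (t, \<theta>)))) (at \<theta> within UNIV)"
        if "t \<in> {-mob_T..mob_T}" for t \<theta>
        using vth[of t \<theta>] that by (auto simp: has_vector_derivative_def)
      have "continuous_on ({-mob_T..mob_T} \<times> UNIV) (\<lambda>x. blinfun_scaleR_left (B x))"
        by (intro continuous_intros bounded_linear.continuous_on[OF bounded_linear_blinfun_scaleR_left])
           (use smooth_continuous[OF B] in \<open>simp add: mob_strip_def\<close>)
      then show "continuous (at (t, \<theta>) within {-mob_T..mob_T} \<times> UNIV) (\<lambda>(x, y). blinfun_scaleR_left (B (x, y)))"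
        unfolding split_beta prod.collapse
        by (rule bspec[OF continuous_on_eq_continuous_within[THEN iffD1]]) (use t in auto)
    qed auto
    then show ?thesis unfolding pt mob_strip_def case_prod_unfold by simp
  qed
  define w where "w p = v (fst p) (snd p) - v mob_T 0" for p
  have dw: "(w has_derivative (\<lambda>h. fst h *\<^sub>R A p + snd h *\<^sub>R B p)) (at p within mob_strip)" if "p \<in> mob_strip" for p
    unfolding w_def[abs_def] by (rule has_derivative_eq_rhs[OF has_derivative_diff[OF dv[OF that] has_derivative_const]]) simp
  show ?thesis
  proof (rule that)
    show "smooth w" by (rule smoothI[OF dw A B])
    show "pd (1, 0) w p = A p" "pd (0, 1) w p = B p" if "p \<in> mob_strip" for p
      using pd_eq[OF dw[OF that] that] by simp_all
    show "w (mob_T, 0) = 0" by (simp add: w_def)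
  qed
qed

text \<open>
  Green's formula on one period of the strip; the contributions of the two sides cancel by periodicity.
\<close>

lemma green_strip:
  fixes Z Y :: "real \<times> real \<Rightarrow> 'b::euclidean_space"
  assumes Z: "smooth Z" and Y: "smooth Y" and per: "\<And>t. \<bar>t\<bar> \<le> mob_T \<Longrightarrow> Y (t, 2 * pi) = Y (t, 0)"
  shows "((\<lambda>t. integral {0..2*pi} (\<lambda>\<theta>. pd (1, 0) Z (t, \<theta>) - pd (0, 1) Y (t, \<theta>))) has_integral
     (integral {0..2*pi} (\<lambda>\<theta>. Z (mob_T, \<theta>)) - integral {0..2*pi} (\<lambda>\<theta>. Z (-mob_T, \<theta>)))) {-mob_T..mob_T}"
proof (rule fundamental_theorem_of_calculus)
  show "- mob_T \<le> mob_T" using mob_T_pos by simp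
  fix t assume "t \<in> {-mob_T..mob_T}"
  then have t: "\<bar>t\<bar> \<le> mob_T" by auto
  have "((\<lambda>t. integral (cbox 0 (2*pi)) (\<lambda>\<theta>. Z (t, \<theta>))) has_vector_derivative integral (cbox 0 (2*pi)) (\<lambda>\<theta>. pd (1, 0) Z (t, \<theta>))) (at t within {-mob_T..mob_T})"
  proof (rule leibniz_rule_vector_derivative)
    show "((\<lambda>s. Z (s, \<theta>)) has_vector_derivative pd (1, 0) Z (s, \<theta>)) (at s within {-mob_T..mob_T})" if "s \<in> {-mob_T..mob_T}" for s \<theta>
      by (rule smooth_vector_derivative_t[OF Z]) (use that in auto)
    show "(\<lambda>\<theta>. Z (s, \<theta>)) integrable_on cbox 0 (2*pi)" if "s \<in> {-mob_T..mob_T}" for s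
      by (rule integrable_continuous, rule continuous_on_strip_line[OF smooth_continuous[OF Z]]) (use that in auto)
    show "continuous_on ({-mob_T..mob_T} \<times> cbox 0 (2*pi)) (\<lambda>(s, \<theta>). pd (1, 0) Z (s, \<theta>))"
      unfolding split_beta prod.collapse
      by (rule continuous_on_subset[OF smooth_continuous[OF smooth_pd_t[OF Z]]]) auto
    show "t \<in> {-mob_T..mob_T}" using t by auto
  qed simp
  moreover have "integral {0..2*pi} (\<lambda>\<theta>. pd (1, 0) Z (t, \<theta>) - pd (0, 1) Y (t, \<theta>)) = integral {0..2*pi} (\<lambda>\<theta>. pd (1, 0) Z (t, \<theta>))"
  proof -
    have "((\<lambda>\<theta>. pd (0, 1) Y (t, \<theta>)) has_integral Y (t, 2*pi) - Y (t, 0)) {0..2*pi}"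
      by (rule fundamental_theorem_of_calculus) (auto intro!: smooth_vector_derivative_th[OF Y t])
    then have "integral {0..2*pi} (\<lambda>\<theta>. pd (0, 1) Y (t, \<theta>)) = 0" using per[OF t] by (simp add: integral_unique)
    moreover have "integral {0..2*pi} (\<lambda>\<theta>. pd (1, 0) Z (t, \<theta>) - pd (0, 1) Y (t, \<theta>)) =
      integral {0..2*pi} (\<lambda>\<theta>. pd (1, 0) Z (t, \<theta>)) - integral {0..2*pi} (\<lambda>\<theta>. pd (0, 1) Y (t, \<theta>))"
      by (rule Henstock_Kurzweil_Integration.integral_diff; rule integrable_continuous_real, rule continuous_on_strip_line[OF _ t])
         (intro smooth_continuous smooth_pd_t[OF Z] smooth_pd_th[OF Y])+
    ultimately show ?thesis by simp
  qed
  ultimately show "((\<lambda>t. integral {0..2*pi} (\<lambda>\<theta>. Z (t, \<theta>))) has_vector_derivative integral {0..2*pi} (\<lambda>\<theta>. pd (1, 0) Z (t, \<theta>) - pd (0, 1) Y (t, \<theta>))) (at t within {-mob_T..mob_T})"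
    by simp
qed

declare mob_T_pos [simp] less_imp_le[OF mob_T_pos, simp]

text \<open>
  The last three assumptions hold near the critical map. They fix the outward direction, make the fourth root of \<open>q\<close>
  smooth, and select one of the branches of the fourth root on the boundary.
\<close>

locale free_boundary_strip = minimal_strip f for f :: "real \<times> real \<Rightarrow> real ^ 'n::finite" +
  assumes flip: "\<And>p. p \<in> mob_strip \<Longrightarrow> f (mob_flip p) = f p"
    and boundary_norm: "\<And>\<theta>. norm (f (mob_T, \<theta>)) = 1"
    and boundary_conormal: "\<And>\<theta> v. v \<bullet> f (mob_T, \<theta>) = 0 \<Longrightarrow> conormal f (mob_T, \<theta>) \<bullet> v = 0"
    and boundary_sign: "\<And>\<theta>. B1 (mob_T, \<theta>) \<bullet> f (mob_T, \<theta>) > 0"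
    and q_slit: "\<And>p. p \<in> mob_strip \<Longrightarrow> q p \<notin> \<real>\<^sub>\<le>\<^sub>0"
    and boundary_argument: "\<And>\<theta>. \<bar>Re (csqrt (csqrt (q (mob_T, \<theta>))) * m (mob_T, \<theta>))\<bar> < \<bar>Im (csqrt (csqrt (q (mob_T, \<theta>))) * m (mob_T, \<theta>))\<bar>"
begin

lemma T_strip [simp]: "(mob_T, \<theta>) \<in> mob_strip" "(- mob_T, \<theta>) \<in> mob_strip"
  using mob_T_pos by simp_all

lemma flip_ft: "p \<in> mob_strip \<Longrightarrow> ft (mob_flip p) = - ft p" and flip_fh: "p \<in> mob_strip \<Longrightarrow> fh (mob_flip p) = fh p"
  unfolding ft_def fh_def using pd_flip[OF smooth_f bounded_linear_ident flip] by simp_all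

lemma flip_EFGW: assumes "p \<in> mob_strip"
  shows "E (mob_flip p) = E p" "F (mob_flip p) = - F p" "G (mob_flip p) = G p" "W (mob_flip p) = W p"
  using assms by (simp_all add: E_def F_def G_def W_def Wsq_def flip_ft flip_fh)

lemma flip_B: assumes "p \<in> mob_strip"
  shows "B1 (mob_flip p) = - B1 p" "B2 (mob_flip p) = B2 p"
  using assms by (simp_all add: B1_def B2_def flip_EFGW flip_ft flip_fh algebra_simps)

lemma flip_PQm: assumes "p \<in> mob_strip"
  shows "P i (mob_flip p) = - cnj (P i p)" "Q i (mob_flip p) = cnj (Q i p)" "m (mob_flip p) = - cnj (m p)"
  using assms by (simp_all add: P_def Q_def m_def flip_EFGW flip_ft flip_fh flip_B complex_eq_iff)

lemma flip_q: assumes p: "p \<in> mob_strip" shows "q (mob_flip p) = cnj (q p)"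
proof -
  have "pd (1, 0) (P i) (mob_flip p) = cnj (pd (1, 0) (P i) p)" for i
    using pd_flip(1)[OF smooth_complex(2) bounded_linear_minus[OF bounded_linear_cnj] flip_PQm(1) p] by simp
  then show ?thesis by (simp add: q_def)
qed

definition \<kappa> :: "real \<times> real \<Rightarrow> complex" where "\<kappa> p = csqrt (csqrt (q p))"

lemma \<kappa>_power: "\<kappa> p ^ 4 = q p"
proof -
  have "\<kappa> p ^ 4 = ((\<kappa> p)\<^sup>2)\<^sup>2" by (simp only: power_mult[symmetric]) simp
  then show ?thesis by (simp add: \<kappa>_def)
qed

lemma \<kappa>_nz: "p \<in> mob_strip \<Longrightarrow> \<kappa> p \<noteq> 0"
  using q_slit[of p] by (auto simp: \<kappa>_def)

lemma csqrt_q_slit: "p \<in> mob_strip \<Longrightarrow> csqrt (q p) \<notin> \<real>\<^sub>\<le>\<^sub>0"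
  using q_slit[of p] by auto

lemma smooth_\<kappa> [smooth_intros]: "smooth \<kappa>" "smooth (\<lambda>p. m p * \<kappa> p)"
proof -
  show "smooth \<kappa>" unfolding \<kappa>_def[abs_def]
    by (intro smooth_csqrt smooth_complex q_slit csqrt_q_slit; assumption)
  then show "smooth (\<lambda>p. m p * \<kappa> p)" by (intro smooth_intros)
qed

text \<open>
  The fourth root turns the equation of the quartic differential into closedness of \<open>\<kappa> (dt + m d\<theta>)\<close>,
  because \<open>q = \<kappa>\<close> to the fourth power contributes the factor 4 in front of the derivative of \<open>m\<close>.
\<close>

lemma \<kappa>_closed: assumes p: "p \<in> mob_strip" shows "pd (0, 1) \<kappa> p = pd (1, 0) (\<lambda>p. m p * \<kappa> p) p"
proof -
  have pq: "4 * \<kappa> p ^ 3 * pd b \<kappa> p = pd b q p" for b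
  proof -
    have "pd b (\<lambda>p. (\<kappa> p * \<kappa> p) * (\<kappa> p * \<kappa> p)) p = pd b q p"
      by (rule pd_cong[OF _ p]) (simp add: \<kappa>_power[symmetric] power4_eq_xxxx mult.assoc)
    then show ?thesis by (simp add: pd_mult[OF p] smooth_intros power3_eq_cube algebra_simps)
  qed
  have "4 * \<kappa> p ^ 3 * pd (0, 1) \<kappa> p = m p * (4 * \<kappa> p ^ 3 * pd (1, 0) \<kappa> p) + 4 * pd (1, 0) m p * \<kappa> p ^ 4"
    unfolding pq \<kappa>_power by (rule q_equation[OF p])
  also have "\<dots> = 4 * \<kappa> p ^ 3 * (m p * pd (1, 0) \<kappa> p + pd (1, 0) m p * \<kappa> p)"
    by (simp add: power4_eq_xxxx power3_eq_cube algebra_simps)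
  finally have "pd (0, 1) \<kappa> p = m p * pd (1, 0) \<kappa> p + pd (1, 0) m p * \<kappa> p" using \<kappa>_nz[OF p] by simp
  then show ?thesis by (simp add: pd_mult[OF p] smooth_intros)
qed

lemma flip_\<kappa>: assumes p: "p \<in> mob_strip" shows "\<kappa> (mob_flip p) = cnj (\<kappa> p)"
  unfolding \<kappa>_def flip_q[OF p] cnj_csqrt[OF csqrt_q_slit[OF p]] cnj_csqrt[OF q_slit[OF p]] ..

text \<open>
  The speed of the surface in the normal direction of the ball along the boundary, which by the free boundary condition is the
  length of \<open>B1\<close>.
\<close>

definition lam where "lam p = B1 p \<bullet> f p"

lemma smooth_lam [smooth_intros]: "smooth lam" unfolding lam_def[abs_def] by (intro smooth_intros smooth_f)

lemma boundary_inner: "f (mob_T, \<theta>) \<bullet> f (mob_T, \<theta>) = 1" using boundary_norm[of \<theta>] by (simp add: norm_eq_1)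

lemma boundary_B1: "B1 (mob_T, \<theta>) = lam (mob_T, \<theta>) *\<^sub>R f (mob_T, \<theta>)"
proof -
  let ?p = "(mob_T, \<theta>)"
  define c where "c = conormal f ?p"
  define v where "v = c - (c \<bullet> f ?p) *\<^sub>R f ?p"
  have v0: "v \<bullet> f ?p = 0" by (simp add: v_def inner_diff_left boundary_inner)
  then have "c \<bullet> v = 0" unfolding c_def by (rule boundary_conormal)
  then have "v \<bullet> v = 0" using v0 by (simp add: v_def inner_diff_left inner_commute)
  then have c: "c = (c \<bullet> f ?p) *\<^sub>R f ?p" by (simp add: v_def)
  have G: "G ?p \<noteq> 0"
  proof
    assume "G ?p = 0"
    then have "fh ?p = 0" by (simp add: G_def)
    then have "Wsq ?p = 0" by (simp add: Wsq_def F_def G_def)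
    then show False using Wsq_pos[of ?p] by simp
  qed
  have "c = ft ?p - (F ?p / G ?p) *\<^sub>R fh ?p"
    unfolding c_def conormal_def F_def G_def ft_def fh_def mob_dt_def mob_d\<theta>_def ..
  then have "G ?p *\<^sub>R ft ?p - F ?p *\<^sub>R fh ?p = G ?p *\<^sub>R c" using G by (simp add: scaleR_diff_right)
  then have B: "B1 ?p = (inverse (W ?p) * G ?p) *\<^sub>R c" by (simp add: B1_def)
  define a where "a = inverse (W ?p) * G ?p * (c \<bullet> f ?p)"
  have "B1 ?p = a *\<^sub>R f ?p" unfolding B a_def by (subst c) simp
  moreover have "lam ?p = a" unfolding lam_def calculation by (simp add: boundary_inner)
  ultimately show ?thesis by simp
qed

lemma boundary_lam: "lam (mob_T, \<theta>) * lam (mob_T, \<theta>) = G (mob_T, \<theta>)" "lam (mob_T, \<theta>) > 0"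
proof -
  show "lam (mob_T, \<theta>) * lam (mob_T, \<theta>) = G (mob_T, \<theta>)"
    using inner_B(5)[of "(mob_T, \<theta>)"] by (simp add: boundary_B1 boundary_inner)
  show "lam (mob_T, \<theta>) > 0" using boundary_sign[of \<theta>] by (simp add: lam_def)
qed

lemma boundary_Q: "Q i (mob_T, \<theta>) = of_real (fh (mob_T, \<theta>) $ i) + \<i> * of_real (lam (mob_T, \<theta>) * f (mob_T, \<theta>) $ i)"
  unfolding Q_def boundary_B1 by simp

lemma quartic_boundary:
  assumes p: "p \<in> mob_strip"
  shows "(\<Sum>i\<in>UNIV. pd (0, 1) (Q i) p * pd (0, 1) (Q i) p) = m p ^ 4 * q p"
proof -
  define a where "a = pd (0, 1) m p + m p * pd (1, 0) m p"
  have Qth: "pd (0, 1) (Q i) p = a * P i p + (m p)\<^sup>2 * pd (1, 0) (P i) p" for i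
  proof -
    have "pd (0, 1) (Q i) p = pd (0, 1) (\<lambda>p. m p * P i p) p" by (rule pd_cong[OF _ p]) (rule Q_eq)
    also have "\<dots> = m p * pd (0, 1) (P i) p + pd (0, 1) m p * P i p" by (simp add: pd_mult[OF p] smooth_intros)
    also have "pd (0, 1) (P i) p = pd (1, 0) (\<lambda>p. m p * P i p) p"
      unfolding closed_PQ[OF p] by (rule pd_cong[OF _ p]) (rule Q_eq)
    also have "\<dots> = m p * pd (1, 0) (P i) p + pd (1, 0) m p * P i p" by (simp add: pd_mult[OF p] smooth_intros)
    finally show ?thesis by (simp add: a_def algebra_simps power2_eq_square)
  qed
  have "(\<Sum>i\<in>UNIV. pd (0, 1) (Q i) p * pd (0, 1) (Q i) p) =
     (\<Sum>i\<in>UNIV. a * a * (P i p * P i p) + 2 * a * (m p)\<^sup>2 * (P i p * pd (1, 0) (P i) p) + m p ^ 4 * (pd (1, 0) (P i) p * pd (1, 0) (P i) p))"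
    unfolding Qth by (intro sum.cong) (auto simp: algebra_simps power2_eq_square power4_eq_xxxx)
  also have "\<dots> = m p ^ 4 * q p"
    unfolding sum.distrib sum_distrib_left[symmetric] P_null[OF p] P_null_derivative[OF p] q_def by simp
  finally show ?thesis .
qed

text \<open>
  Along the boundary the quartic differential is real on the tangent: its value there is \<open>\<Sum> (\<partial>\<^sub>\<theta>
  Q\<^sub>i)\<^sup>2\<close> with \<open>Q = f\<^sub>\<theta> + i lam f\<close>, whose imaginary part is the inner product of the
  derivatives of \<open>f\<^sub>\<theta>\<close> and of \<open>lam f\<close>. It vanishes by \<open>\<bar>f\<bar> = 1\<close> and
  \<open>\<bar>f\<^sub>\<theta>\<bar> = lam\<close>. A complex number with real fourth power that is nearer to the imaginary than
  to the real axis is imaginary.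
\<close>

lemma boundary_imaginary: "Re (m (mob_T, \<theta>) * \<kappa> (mob_T, \<theta>)) = 0"
proof -
  let ?p = "(mob_T, \<theta>)"
  have p: "?p \<in> mob_strip" by simp
  have T: "\<bar>mob_T\<bar> \<le> mob_T" using mob_T_pos by simp
  have sfh: "smooth (pd (0, 1) fh)" by (rule smooth_pd_th) (rule smooth_geo)
  note cong = pd_th_boundary_cong[OF _ _ _ T]
  have f_fh: "f (mob_T, s) \<bullet> fh (mob_T, s) = 0" for s
  proof -
    have "pd (0, 1) (\<lambda>p. f p \<bullet> f p) (mob_T, s) = pd (0, 1) (\<lambda>p. 1) (mob_T, s)"
      by (rule cong) (intro smooth_intros smooth_f boundary_inner)+
    then show ?thesis by (simp add: pd_inner smooth_f fh_def inner_commute)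
  qed
  have a: "f ?p \<bullet> pd (0, 1) fh ?p = - G ?p"
  proof -
    have "pd (0, 1) (\<lambda>p. f p \<bullet> fh p) ?p = pd (0, 1) (\<lambda>p. 0) ?p"
      by (rule cong) (intro smooth_intros smooth_f f_fh)+
    then show ?thesis by (simp add: pd_inner smooth_f smooth_geo fh_def[symmetric] G_def)
  qed
  have b: "lam ?p * pd (0, 1) lam ?p = fh ?p \<bullet> pd (0, 1) fh ?p"
  proof -
    have "pd (0, 1) (\<lambda>p. lam p * lam p) ?p = pd (0, 1) G ?p"
      by (rule cong) (intro smooth_intros boundary_lam)+
    then show ?thesis unfolding G_def[abs_def] by (simp add: pd_inner pd_mult smooth_intros inner_commute)
  qed
  have c: "pd (0, 1) B1 ?p = lam ?p *\<^sub>R fh ?p + pd (0, 1) lam ?p *\<^sub>R f ?p"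
  proof -
    have "pd (0, 1) B1 ?p = pd (0, 1) (\<lambda>p. lam p *\<^sub>R f p) ?p"
      by (rule cong) (intro smooth_intros smooth_f boundary_B1)+
    then show ?thesis by (simp add: pd_scaleR smooth_intros smooth_f fh_def)
  qed
  have orth: "pd (0, 1) fh ?p \<bullet> pd (0, 1) B1 ?p = 0"
  proof -
    have "pd (0, 1) fh ?p \<bullet> pd (0, 1) B1 ?p = lam ?p * (fh ?p \<bullet> pd (0, 1) fh ?p) + pd (0, 1) lam ?p * (f ?p \<bullet> pd (0, 1) fh ?p)"
      unfolding c by (simp add: inner_add_right inner_commute)
    also have "\<dots> = 0" unfolding a b[symmetric] boundary_lam(1)[symmetric] by simp
    finally show ?thesis .
  qed
  have Qth: "pd (0, 1) (Q i) ?p = of_real (pd (0, 1) fh ?p $ i) + \<i> * of_real (pd (0, 1) B1 ?p $ i)" for i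
    unfolding Q_def[abs_def] by (simp add: pd_add[OF p] pd_mult[OF p] pd_of_real[OF p] pd_vec_nth[OF p] pd_const[OF p] smooth_intros)
  have "Im (m ?p ^ 4 * q ?p) = (\<Sum>i\<in>UNIV. Im (pd (0, 1) (Q i) ?p * pd (0, 1) (Q i) ?p))"
    unfolding quartic_boundary[OF p, symmetric] by simp
  also have "\<dots> = 2 * (pd (0, 1) fh ?p \<bullet> pd (0, 1) B1 ?p)"
    unfolding Qth by (simp add: inner_vec_def sum_distrib_left mult_ac)
  finally have "Im ((m ?p * \<kappa> ?p) ^ 4) = 0" unfolding orth by (simp add: power_mult_distrib \<kappa>_power)
  moreover define x y where "x = Re (m ?p * \<kappa> ?p)" and "y = Im (m ?p * \<kappa> ?p)"
  moreover have "Im ((m ?p * \<kappa> ?p) ^ 4) = 4 * x * y * ((x - y) * (x + y))"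
  proof -
    have "m ?p * \<kappa> ?p = Complex x y" by (simp only: x_def y_def complex.collapse)
    then show ?thesis by (simp add: power4_eq_xxxx algebra_simps)
  qed
  moreover have "\<bar>x\<bar> < \<bar>y\<bar>" using boundary_argument[of \<theta>] by (simp add: x_def y_def \<kappa>_def[symmetric] mult.commute)
  ultimately have "x = 0" by auto
  then show ?thesis by (simp add: x_def)
qed

end

section \<open>The conformal coordinate and the Steklov relation\<close>

lemma mob_T_le_1: "mob_T \<le> 1"
proof (rule ccontr)
  assume "\<not> mob_T \<le> 1"
  then have T: "1 < mob_T" by simp
  have e: "exp (1::real) \<ge> 2" using exp_ge_add_one_self[of 1] by simp
  then have "exp mob_T \<ge> 2" using T by (meson exp_le_cancel_iff less_imp_le order_trans)
  then have "exp (- mob_T) \<le> 1/2" by (simp add: exp_minus field_simps)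
  with \<open>exp mob_T \<ge> 2\<close> have "sinh mob_T \<ge> 3/4" by (simp add: sinh_field_def)
  moreover have "sinh mob_T = sqrt (1/2)" by (simp add: mob_T_eq)
  moreover have "sqrt (1/2) < (3/4::real)" by (rule real_less_lsqrt) (simp_all add: power2_eq_square)
  ultimately show False by linarith
qed

locale close_strip = free_boundary_strip f for f :: "real \<times> real \<Rightarrow> real ^ 'n::finite" +
  fixes e r :: real
  assumes r: "r > 0" and e: "0 \<le> e" "e \<le> 1/100"
    and \<kappa>_near: "\<And>p. p \<in> mob_strip \<Longrightarrow> cmod (\<kappa> p - of_real r) \<le> e * r"
    and m\<kappa>_near: "\<And>p. p \<in> mob_strip \<Longrightarrow> cmod (m p * \<kappa> p - \<i> * of_real r) \<le> e * r"
begin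

text \<open>
  The primitive \<open>w\<close> of \<open>\<kappa> (dt + m d\<theta>)\<close> satisfies \<open>w (flip p) = - cnj (w p) +
  c\<^sub>0\<close> because the form changes into minus its conjugate under the flip. Dividing by the real number \<open>Im
  c\<^sub>0 / \<pi>\<close> and translating by half of the real part of \<open>c\<^sub>0\<close> normalizes the constant to
  \<open>i \<pi>\<close>. Along the top boundary the form is imaginary, so the real part of the coordinate is constant there. The
  multiples of \<open>e\<close> in the estimates come from comparing \<open>Im c\<^sub>0\<close> with its value \<open>r
  \<pi>\<close> for the linear coordinate \<open>r (t + i \<theta>)\<close>.
\<close>

lemma conformal_coordinate:
  obtains \<omega> A where "smooth \<omega>" "smooth A"
    "\<And>p. p \<in> mob_strip \<Longrightarrow> pd (1, 0) \<omega> p = A p" "\<And>p. p \<in> mob_strip \<Longrightarrow> pd (0, 1) \<omega> p = m p * A p"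
    "\<And>p. p \<in> mob_strip \<Longrightarrow> \<omega> (mob_flip p) = - cnj (\<omega> p) + \<i> * pi"
    "\<And>p. p \<in> mob_strip \<Longrightarrow> cmod (A p - 1) \<le> 6 * e" "\<And>p. p \<in> mob_strip \<Longrightarrow> cmod (m p * A p - \<i>) \<le> 6 * e"
    "Im (\<omega> (mob_T, 0)) = 0" "\<And>\<theta>. Re (\<omega> (mob_T, \<theta>)) = Re (\<omega> (mob_T, 0))" "\<bar>Re (\<omega> (mob_T, 0)) - mob_T\<bar> \<le> 10 * e"
proof -
  obtain w where w: "smooth w" "\<And>p. p \<in> mob_strip \<Longrightarrow> pd (1, 0) w p = \<kappa> p"
    "\<And>p. p \<in> mob_strip \<Longrightarrow> pd (0, 1) w p = m p * \<kappa> p" "w (mob_T, 0) = 0"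
    using primitive_on_strip[OF smooth_\<kappa> \<kappa>_closed] by blast
  have dw: "(w has_derivative (\<lambda>h. fst h *\<^sub>R \<kappa> p + snd h *\<^sub>R (m p * \<kappa> p))) (at p within mob_strip)" if "p \<in> mob_strip" for p
    using smooth_has_derivative[OF w(1) that] by (simp add: w(2,3) that)
  define c0 where "c0 = w (mob_flip (mob_T, 0))"
  have w_flip: "w (mob_flip p) + cnj (w p) = c0" if p: "p \<in> mob_strip" for p
  proof -
    have D0: "((\<lambda>q. w (mob_flip q) + cnj (w q)) has_derivative (\<lambda>h. 0)) (at q within mob_strip)" if q: "q \<in> mob_strip" for q
    proof -
      have "((\<lambda>q. w (mob_flip q)) has_derivative (\<lambda>h. fst (- fst h, snd h) *\<^sub>R \<kappa> (mob_flip q) +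
        snd (- fst h, snd h) *\<^sub>R (m (mob_flip q) * \<kappa> (mob_flip q)))) (at q within mob_strip)"
        by (rule has_derivative_in_compose2[OF dw, where f = mob_flip])
           (use q in \<open>auto simp: mob_flip_def[abs_def] intro!: derivative_eq_intros\<close>)
      from has_derivative_add[OF this bounded_linear.has_derivative[OF bounded_linear_cnj dw[OF q]]]
      show ?thesis by (rule has_derivative_eq_rhs) (simp add: fun_eq_iff flip_\<kappa>[OF q] flip_PQm[OF q])
    qed
    have "\<exists>c. \<forall>q\<in>mob_strip. w (mob_flip q) + cnj (w q) = c"
      by (rule has_derivative_zero_constant[OF convex_mob_strip]) (rule D0)
    then obtain c where c: "\<forall>q\<in>mob_strip. w (mob_flip q) + cnj (w q) = c" by (elim exE)
    from bspec[OF c p] bspec[OF c, of "(mob_T, 0)"] show ?thesis by (simp add: c0_def w(4))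
  qed
  have w_diff: "cmod ((w p - of_real r * (of_real (fst p) + \<i> * of_real (snd p))) - (w p' - of_real r * (of_real (fst p') + \<i> * of_real (snd p'))))
      \<le> 2 * e * r * norm (p - p')" if "p \<in> mob_strip" "p' \<in> mob_strip" for p p'
  proof (rule differentiable_bound[OF convex_mob_strip _ _ that])
    fix q assume q: "q \<in> mob_strip"
    show "((\<lambda>p. w p - of_real r * (of_real (fst p) + \<i> * of_real (snd p))) has_derivative
      (\<lambda>h. (fst h *\<^sub>R \<kappa> q + snd h *\<^sub>R (m q * \<kappa> q)) - of_real r * (of_real (fst h) + \<i> * of_real (snd h)))) (at q within mob_strip)"
      by (intro derivative_intros dw q)
    show "onorm (\<lambda>h. (fst h *\<^sub>R \<kappa> q + snd h *\<^sub>R (m q * \<kappa> q)) - of_real r * (of_real (fst h) + \<i> * of_real (snd h))) \<le> 2 * e * r"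
    proof (rule onorm_le)
      fix h :: "real \<times> real"
      have "fst h *\<^sub>R \<kappa> q + snd h *\<^sub>R (m q * \<kappa> q) - of_real r * (of_real (fst h) + \<i> * of_real (snd h)) =
        of_real (fst h) * (\<kappa> q - of_real r) + of_real (snd h) * (m q * \<kappa> q - \<i> * of_real r)"
        by (simp add: scaleR_conv_of_real algebra_simps)
      also have "cmod \<dots> \<le> \<bar>fst h\<bar> * (e * r) + \<bar>snd h\<bar> * (e * r)"
        by (rule order_trans[OF norm_triangle_ineq add_mono]) (auto simp: norm_mult intro!: mult_left_mono \<kappa>_near m\<kappa>_near q)
      also have "\<dots> \<le> norm h * (e * r) + norm h * (e * r)"
        using norm_fst_le[of "fst h" "snd h"] norm_snd_le[of "snd h" "fst h"] e r by (intro add_mono mult_right_mono) auto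
      finally show "cmod (fst h *\<^sub>R \<kappa> q + snd h *\<^sub>R (m q * \<kappa> q) - of_real r * (of_real (fst h) + \<i> * of_real (snd h))) \<le> 2 * e * r * norm h"
        by (simp add: algebra_simps)
    qed
  qed
  have er: "0 \<le> e * r" using e r by simp
  have c0_near: "cmod (c0 - of_real r * Complex (- 2 * mob_T) pi) \<le> 11 * (e * r)"
  proof -
    have "norm (mob_flip (mob_T, 0) - (mob_T, 0)) \<le> \<bar>- mob_T - mob_T\<bar> + \<bar>pi\<bar>"
      using norm_Pair_le[of "- mob_T - mob_T" pi] by (simp add: mob_flip_def)
    also have "\<dots> \<le> 11/2" using mob_T_le_1 pi_approx by simp
    finally have "2 * e * r * norm (mob_flip (mob_T, 0) - (mob_T, 0)) \<le> 2 * e * r * (11/2)"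
      using e r by (intro mult_left_mono) auto
    moreover have "(w (mob_flip (mob_T, 0)) - of_real r * (of_real (fst (mob_flip (mob_T, 0))) + \<i> * of_real (snd (mob_flip (mob_T, 0))))) - (w (mob_T, 0) - of_real r * (of_real (fst (mob_T, 0::real)) + \<i> * of_real (snd (mob_T, 0::real))))
       = c0 - of_real r * Complex (- 2 * mob_T) pi"
      by (simp add: c0_def w(4) mob_flip_def complex_eq_iff algebra_simps)
    ultimately show ?thesis using w_diff[of "mob_flip (mob_T, 0)" "(mob_T, 0)"] by simp
  qed
  define cc where "cc = Im c0 / pi"
  define R where "R = Re c0"
  have R: "\<bar>R + 2 * mob_T * r\<bar> \<le> 11 * (e * r)"
    using order_trans[OF abs_Re_le_cmod c0_near] by (simp add: R_def algebra_simps)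
  have cc: "\<bar>cc - r\<bar> \<le> 4 * (e * r)"
  proof -
    have "\<bar>Im c0 - r * pi\<bar> \<le> 11 * (e * r)" using order_trans[OF abs_Im_le_cmod c0_near] by simp
    moreover have "Im c0 - r * pi = pi * (cc - r)" by (simp add: cc_def algebra_simps)
    ultimately have "pi * \<bar>cc - r\<bar> \<le> 11 * (e * r)" by (simp add: abs_mult)
    moreover have "3 * \<bar>cc - r\<bar> \<le> pi * \<bar>cc - r\<bar>" using pi_gt3 by (intro mult_right_mono) auto
    ultimately have "3 * \<bar>cc - r\<bar> \<le> 11 * (e * r)" by (rule order_trans[rotated])
    then show ?thesis using er by simp
  qed
  have er2: "e * r \<le> 1/100 * r" using e r by (intro mult_right_mono) auto
  have ccr: "cc \<ge> 96/100 * r" using cc er2 by (simp add: abs_le_iff)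
  then have cc0: "cc > 0" using r by simp
  have ratio: "a / cc \<le> k * e" if "a \<le> k * (96/100) * (e * r)" "k \<ge> 0" for a k
  proof -
    have "k * (96/100) * (e * r) \<le> k * e * cc" using mult_left_mono[OF ccr, of "k * e"] that(2) e by simp
    with that(1) have "a \<le> k * e * cc" by linarith
    then show ?thesis using cc0 by (simp add: divide_le_eq)
  qed
  define \<omega> where "\<omega> p = (w p - of_real (R / 2)) * of_real (inverse cc)" for p
  define A where "A p = \<kappa> p * of_real (inverse cc)" for p
  have "\<omega> (mob_T, 0) = complex_of_real (- R / 2 * inverse cc)" by (simp add: \<omega>_def w(4))
  then have X: "Re (\<omega> (mob_T, 0)) = - R / 2 * inverse cc" and X0: "Im (\<omega> (mob_T, 0)) = 0"
    by (simp_all only: Re_complex_of_real Im_complex_of_real)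
  show ?thesis
  proof (rule that[of \<omega> A])
    show sA: "smooth A" unfolding A_def[abs_def] by (intro smooth_intros)
    have sm: "smooth (\<lambda>p. w p - of_real (R / 2))" by (intro smooth_intros w(1))
    show "smooth \<omega>" unfolding \<omega>_def[abs_def] by (intro smooth_intros w(1))
    have d: "pd b \<omega> p = pd b w p * of_real (inverse cc)" if p: "p \<in> mob_strip" for b p
      unfolding \<omega>_def[abs_def] pd_mult[OF p sm smooth_const] pd_diff[OF p w(1) smooth_const] by (simp add: pd_const[OF p])
    show "pd (1, 0) \<omega> p = A p" "pd (0, 1) \<omega> p = m p * A p" if "p \<in> mob_strip" for p
      by (simp_all add: d that w(2,3) A_def)
    show "\<omega> (mob_flip p) = - cnj (\<omega> p) + \<i> * pi" if p: "p \<in> mob_strip" for p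
    proof -
      have wf: "w (mob_flip p) = of_real R + \<i> * of_real (pi * cc) - cnj (w p)"
        using w_flip[OF p] by (simp add: R_def cc_def complex_eq_iff algebra_simps)
      show ?thesis unfolding \<omega>_def wf using cc0 by (simp add: complex_eq_iff field_simps)
    qed
    show "cmod (A p - 1) \<le> 6 * e" if p: "p \<in> mob_strip" for p
    proof -
      have "A p - 1 = (\<kappa> p - of_real cc) / of_real cc" using cc0 by (simp add: A_def field_simps)
      then have "cmod (A p - 1) = cmod (\<kappa> p - of_real cc) / cc" using cc0 by (simp add: norm_divide)
      moreover have "cmod (\<kappa> p - of_real cc) \<le> cmod (\<kappa> p - of_real r) + cmod (of_real (r - cc))"
        using norm_triangle_ineq[of "\<kappa> p - of_real r" "of_real (r - cc)"] by simp
      then have "cmod (\<kappa> p - of_real cc) \<le> 6 * (96/100) * (e * r)"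
        using \<kappa>_near[OF p] cc er by (simp only: norm_of_real)
      ultimately show ?thesis using ratio by simp
    qed
    show "cmod (m p * A p - \<i>) \<le> 6 * e" if p: "p \<in> mob_strip" for p
    proof -
      have "m p * A p - \<i> = (m p * \<kappa> p - \<i> * of_real cc) / of_real cc" using cc0 by (simp add: A_def field_simps)
      then have "cmod (m p * A p - \<i>) = cmod (m p * \<kappa> p - \<i> * of_real cc) / cc" using cc0 by (simp add: norm_divide)
      moreover have "cmod (m p * \<kappa> p - \<i> * of_real cc) \<le> cmod (m p * \<kappa> p - \<i> * of_real r) + cmod (\<i> * of_real (r - cc))"
        using norm_triangle_ineq[of "m p * \<kappa> p - \<i> * of_real r" "\<i> * of_real (r - cc)"] by (simp add: algebra_simps)
      then have "cmod (m p * \<kappa> p - \<i> * of_real cc) \<le> 6 * (96/100) * (e * r)"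
        using m\<kappa>_near[OF p] cc er by (simp add: norm_mult del: of_real_diff)
      ultimately show ?thesis using ratio by simp
    qed
    show "Im (\<omega> (mob_T, 0)) = 0" by (rule X0)
    show "Re (\<omega> (mob_T, \<theta>)) = Re (\<omega> (mob_T, 0))" for \<theta>
    proof -
      have D0: "((\<lambda>s. Re (w (mob_T, s))) has_derivative (\<lambda>h. 0)) (at s within UNIV)" for s
      proof -
        have "((\<lambda>s. w (mob_T, s)) has_vector_derivative m (mob_T, s) * \<kappa> (mob_T, s)) (at s)"
          using smooth_vector_derivative_th[OF w(1), of mob_T s UNIV] by (simp add: w(3))
        from bounded_linear.has_vector_derivative[OF bounded_linear_Re this]
        show ?thesis using boundary_imaginary[of s] by (simp add: has_vector_derivative_def del: times_complex.sel)
      qed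
      have "\<exists>c. \<forall>s\<in>UNIV. Re (w (mob_T, s)) = c"
        by (rule has_derivative_zero_constant[OF convex_UNIV]) (rule D0)
      then obtain c where "\<forall>s\<in>UNIV. Re (w (mob_T, s)) = c" by (elim exE)
      then have "Re (w (mob_T, \<theta>)) = Re (w (mob_T, 0))" by simp
      then show ?thesis by (simp add: \<omega>_def)
    qed
    show "\<bar>Re (\<omega> (mob_T, 0)) - mob_T\<bar> \<le> 10 * e"
    proof -
      have "Re (\<omega> (mob_T, 0)) - mob_T = - ((R + 2 * mob_T * cc) / 2) / cc" unfolding X using cc0 by (simp add: field_simps)
      then have "\<bar>Re (\<omega> (mob_T, 0)) - mob_T\<bar> = \<bar>R + 2 * mob_T * cc\<bar> / 2 / cc" using cc0 by (simp add: abs_minus_commute)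
      moreover have "\<bar>R + 2 * mob_T * cc\<bar> / 2 \<le> 10 * (96/100) * (e * r)"
      proof -
        have "R + 2 * mob_T * cc = (R + 2 * mob_T * r) + 2 * mob_T * (cc - r)" by (simp add: algebra_simps)
        moreover have "\<bar>2 * mob_T * (cc - r)\<bar> \<le> 2 * 1 * (4 * (e * r))"
          unfolding abs_mult using mob_T_le_1 cc by (intro mult_mono) auto
        ultimately have "\<bar>R + 2 * mob_T * cc\<bar> \<le> 19 * (e * r)" using R by linarith
        then show ?thesis using er by simp
      qed
      then have "\<bar>R + 2 * mob_T * cc\<bar> / 2 / cc \<le> 10 * e" by (rule ratio) simp
      ultimately show ?thesis by simp
    qed
  qed
qed

end

locale conformal_chart = free_boundary_strip f for f :: "real \<times> real \<Rightarrow> real ^ 'n::finite" +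
  fixes \<omega> A :: "real \<times> real \<Rightarrow> complex" and X e :: real
  assumes smooth_\<omega> [smooth_intros]: "smooth \<omega>" "smooth A"
    and \<omega>_t: "\<And>p. p \<in> mob_strip \<Longrightarrow> pd (1, 0) \<omega> p = A p"
    and \<omega>_th: "\<And>p. p \<in> mob_strip \<Longrightarrow> pd (0, 1) \<omega> p = m p * A p"
    and \<omega>_flip: "\<And>p. p \<in> mob_strip \<Longrightarrow> \<omega> (mob_flip p) = - cnj (\<omega> p) + \<i> * pi"
    and A_near: "\<And>p. p \<in> mob_strip \<Longrightarrow> cmod (A p - 1) \<le> e" "\<And>p. p \<in> mob_strip \<Longrightarrow> cmod (m p * A p - \<i>) \<le> e"
    and \<omega>_0: "Im (\<omega> (mob_T, 0)) = 0" and \<omega>_X: "\<And>\<theta>. Re (\<omega> (mob_T, \<theta>)) = X"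
    and X_pos: "X > 0" and e_small: "0 \<le> e" "e \<le> 1/10"
begin

lemma flip_flip: "mob_flip (mob_flip (t, \<theta>)) = (t, \<theta> + 2 * pi)"
  by (simp add: mob_flip_def)

lemma periodic: assumes "\<bar>t\<bar> \<le> mob_T"
  shows "f (t, \<theta> + 2 * pi) = f (t, \<theta>)" "P i (t, \<theta> + 2 * pi) = P i (t, \<theta>)" "Q i (t, \<theta> + 2 * pi) = Q i (t, \<theta>)"
    "\<omega> (t, \<theta> + 2 * pi) = \<omega> (t, \<theta>) + \<i> * (2 * pi)" "fh (t, \<theta> + 2 * pi) = fh (t, \<theta>)" "lam (t, \<theta> + 2 * pi) = lam (t, \<theta>)"
proof -
  have p: "(t, \<theta>) \<in> mob_strip" using assms by simp
  then have p': "mob_flip (t, \<theta>) \<in> mob_strip" by simp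
  show "f (t, \<theta> + 2 * pi) = f (t, \<theta>)" "P i (t, \<theta> + 2 * pi) = P i (t, \<theta>)" "Q i (t, \<theta> + 2 * pi) = Q i (t, \<theta>)"
    "\<omega> (t, \<theta> + 2 * pi) = \<omega> (t, \<theta>) + \<i> * (2 * pi)" "fh (t, \<theta> + 2 * pi) = fh (t, \<theta>)" "lam (t, \<theta> + 2 * pi) = lam (t, \<theta>)"
    unfolding flip_flip[symmetric] lam_def flip[OF p'] flip_PQm[OF p'] \<omega>_flip[OF p'] flip_fh[OF p'] flip_B[OF p']
      flip[OF p] flip_PQm[OF p] \<omega>_flip[OF p] flip_fh[OF p] flip_B[OF p]
    by (simp_all add: complex_eq_iff)
qed

text \<open>
  The boundary parameter \<open>yy\<close> of the conformal coordinate; \<open>\<Theta>\<close> below is its inverse.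
\<close>

definition yy where "yy \<theta> = Im (\<omega> (mob_T, \<theta>))"
definition yy' where "yy' \<theta> = Im (m (mob_T, \<theta>) * A (mob_T, \<theta>))"

lemma \<omega>_boundary: "\<omega> (mob_T, \<theta>) = Complex X (yy \<theta>)"
  using \<omega>_X[of \<theta>] by (simp add: complex_eq_iff yy_def)

lemma yy: "(yy has_real_derivative yy' \<theta>) (at \<theta>)" "yy 0 = 0" "yy (\<theta> + 2 * pi) = yy \<theta> + 2 * pi"
  "\<bar>yy' \<theta> - 1\<bar> \<le> e" "continuous_on UNIV yy'"
proof -
  have "((\<lambda>s. \<omega> (mob_T, s)) has_vector_derivative m (mob_T, \<theta>) * A (mob_T, \<theta>)) (at \<theta>)"
    using smooth_vector_derivative_th[OF smooth_\<omega>(1), of mob_T \<theta> UNIV] by (simp add: \<omega>_th)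
  from bounded_linear.has_vector_derivative[OF bounded_linear_Im this]
  show "(yy has_real_derivative yy' \<theta>) (at \<theta>)"
    unfolding yy_def[abs_def] yy'_def by (simp add: has_real_derivative_iff_has_vector_derivative)
  show "yy 0 = 0" by (simp add: yy_def \<omega>_0)
  show "yy (\<theta> + 2 * pi) = yy \<theta> + 2 * pi" using periodic(4)[of mob_T \<theta>] by (simp add: yy_def)
  have "\<bar>Im (m (mob_T, \<theta>) * A (mob_T, \<theta>) - \<i>)\<bar> \<le> e"
    by (rule order_trans[OF abs_Im_le_cmod A_near(2)]) simp
  then show "\<bar>yy' \<theta> - 1\<bar> \<le> e" by (simp add: yy'_def)
  have "smooth (\<lambda>p. Im (m p * A p))" by (intro smooth_intros)
  from continuous_on_strip_line[OF smooth_continuous[OF this], of mob_T UNIV] show "continuous_on UNIV yy'"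
    by (simp add: yy'_def[abs_def])
qed

definition \<Theta> where "\<Theta> = (SOME \<Theta>. (\<forall>x. yy (\<Theta> x) = x) \<and> (\<forall>x. \<Theta> (yy x) = x) \<and> \<Theta> 0 = 0 \<and> (\<forall>x. \<Theta> (x + 2 * pi) = \<Theta> x + 2 * pi) \<and>
  (\<forall>x. (\<Theta> has_real_derivative inverse (yy' (\<Theta> x))) (at x)))"

lemma \<Theta>: "yy (\<Theta> x) = x" "\<Theta> (yy x) = x" "\<Theta> 0 = 0" "\<Theta> (x + 2 * pi) = \<Theta> x + 2 * pi"
  "(\<Theta> has_real_derivative inverse (yy' (\<Theta> x))) (at x)"
proof -
  have pos: "1/2 \<le> yy' x" for x using yy(4)[of x] e_small by (simp add: abs_le_iff)
  have "\<exists>\<Theta>. (\<forall>x. yy (\<Theta> x) = x) \<and> (\<forall>x. \<Theta> (yy x) = x) \<and> \<Theta> 0 = 0 \<and> (\<forall>x. \<Theta> (x + 2 * pi) = \<Theta> x + 2 * pi) \<and>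
    (\<forall>x. (\<Theta> has_real_derivative inverse (yy' (\<Theta> x))) (at x))"
    by (rule circle_diffeomorphism_inverse[OF yy(1) pos yy(3,2)]) blast
  from someI_ex[OF this, folded \<Theta>_def]
  show "yy (\<Theta> x) = x" "\<Theta> (yy x) = x" "\<Theta> 0 = 0" "\<Theta> (x + 2 * pi) = \<Theta> x + 2 * pi"
    "(\<Theta> has_real_derivative inverse (yy' (\<Theta> x))) (at x)" by blast+
qed

text \<open>
  The boundary curve \<open>U\<close> in the conformal parameter; \<open>l\<close> is both its speed and the size of the outward
  normal derivative.
\<close>

definition \<Theta>' where "\<Theta>' x = inverse (yy' (\<Theta> x))"
definition U where "U x = f (mob_T, \<Theta> x)"
definition U' where "U' x = \<Theta>' x *\<^sub>R fh (mob_T, \<Theta> x)"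
definition l where "l x = \<Theta>' x * lam (mob_T, \<Theta> x)"

lemma continuous_\<Theta>: "continuous_on UNIV \<Theta>" "continuous_on UNIV \<Theta>'"
proof -
  show 1: "continuous_on UNIV \<Theta>" by (rule continuous_on_of_DERIV[OF \<Theta>(5)])
  have nz: "yy' x \<noteq> 0" for x using yy(4)[of x] e_small by (auto simp: abs_le_iff)
  show "continuous_on UNIV \<Theta>'" unfolding \<Theta>'_def[abs_def]
    by (intro continuous_on_inverse continuous_on_compose2[OF yy(5) 1]) (auto simp: nz)
qed

lemma yy'_periodic: "yy' (\<theta> + 2 * pi) = yy' \<theta>"
proof -
  have "((\<lambda>s. yy (s + 2 * pi)) has_real_derivative yy' (\<theta> + 2 * pi)) (at \<theta>)"
    using yy(1)[of "\<theta> + 2 * pi"] by (simp add: DERIV_shift)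
  moreover have "((\<lambda>s. yy (s + 2 * pi)) has_real_derivative yy' \<theta>) (at \<theta>)"
    unfolding yy(3) by (auto intro!: derivative_eq_intros yy(1))
  ultimately show ?thesis by (rule DERIV_unique)
qed

lemma continuous_boundary: "continuous_on mob_strip g \<Longrightarrow> continuous_on UNIV (\<lambda>x. g (mob_T, \<Theta> x))"
  by (rule continuous_on_compose2[of mob_strip]) (auto intro!: continuous_intros continuous_\<Theta>)

lemma U_facts:
  "(U has_vector_derivative U' x) (at x)" "continuous_on UNIV U'" "U (x + 2 * pi) = U x" "continuous_on UNIV l" "l (x + 2 * pi) = l x"
  "norm (U x) = 1" "l x = norm (U' x)" "continuous_on UNIV U"
proof -
  have "((\<lambda>s. f (mob_T, s)) \<circ> \<Theta> has_vector_derivative \<Theta>' x *\<^sub>R fh (mob_T, \<Theta> x)) (at x)"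
  proof (rule vector_diff_chain_at)
    show "(\<Theta> has_vector_derivative \<Theta>' x) (at x)" using \<Theta>(5) by (simp add: \<Theta>'_def has_real_derivative_iff_has_vector_derivative)
    show "((\<lambda>s. f (mob_T, s)) has_vector_derivative fh (mob_T, \<Theta> x)) (at (\<Theta> x))"
      unfolding fh_def by (rule smooth_vector_derivative_th[OF smooth_f]) simp
  qed
  then show "(U has_vector_derivative U' x) (at x)" by (simp add: U_def[abs_def] U'_def o_def)
  show "continuous_on UNIV U'" "continuous_on UNIV l" "continuous_on UNIV U" unfolding U'_def[abs_def] l_def[abs_def] U_def[abs_def]
    by (intro continuous_intros continuous_\<Theta> continuous_boundary smooth_continuous smooth_intros smooth_f)+
  have \<Theta>'p: "\<Theta>' (x + 2 * pi) = \<Theta>' x" by (simp add: \<Theta>'_def \<Theta>(4) yy'_periodic)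
  show "U (x + 2 * pi) = U x" "l (x + 2 * pi) = l x" by (simp_all add: U_def l_def \<Theta>'p \<Theta>(4) periodic)
  show "norm (U x) = 1" by (simp add: U_def boundary_norm)
  have "0 < \<Theta>' x" using yy(4)[of "\<Theta> x"] e_small by (auto simp: \<Theta>'_def abs_le_iff)
  moreover have "norm (fh (mob_T, \<Theta> x)) = lam (mob_T, \<Theta> x)"
    unfolding norm_eq_sqrt_inner G_def[symmetric] boundary_lam(1)[symmetric] using boundary_lam(2) by (simp add: less_imp_le)
  ultimately show "l x = norm (U' x)" by (simp add: l_def U'_def)
qed

text \<open>
  Apply Green's formula to the closed form \<open>exp (- k \<omega>) (P dt + Q d\<theta>)\<close>. The integral over the top
  boundary becomes a Fourier coefficient after substitution of the conformal parameter; the flip turns the integral over the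
  bottom boundary into the conjugate of the top integral for \<open>- k\<close>, with a sign depending on the parity of
  \<open>k\<close>.
\<close>

theorem steklov:
  "fourier (\<lambda>x. complex_of_real (l x * U x $ i)) k = of_real (dtn X k) * fourier (\<lambda>x. complex_of_real (U x $ i)) k"
proof (rule dtn_relation[OF X_pos])
  define Z where "Z k p = Q i p * exp (- of_int k * \<omega> p)" for k p
  define Y where "Y k p = P i p * exp (- of_int k * \<omega> p)" for k p
  have smZ: "smooth (Z k)" "smooth (Y k)" for k unfolding Z_def[abs_def] Y_def[abs_def] by (intro smooth_intros)+
  have sE: "smooth (\<lambda>p. - of_int k * \<omega> p)" "smooth (\<lambda>p. exp (- of_int k * \<omega> p))" for k by (intro smooth_intros)+
  have ek: "exp (complex_of_int k * (z + \<i> * (2 * pi))) = exp (complex_of_int k * z)" for k z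
    unfolding distrib_left exp_add using cis_int_2pi[of k] by (simp add: cis_conv_exp mult_ac)
  have per: "Z k (t, \<theta> + 2 * pi) = Z k (t, \<theta>)" "Y k (t, \<theta> + 2 * pi) = Y k (t, \<theta>)" if "\<bar>t\<bar> \<le> mob_T" for k t \<theta>
    unfolding Z_def Y_def periodic[OF that] using ek[of "-k"] by simp_all
  have closed: "pd (1, 0) (Z k) p = pd (0, 1) (Y k) p" if p: "p \<in> mob_strip" for k p
  proof -
    have dE: "pd b (\<lambda>p. exp (- of_int k * \<omega> p)) p = exp (- of_int k * \<omega> p) * (- of_int k * pd b \<omega> p)" for b
      unfolding pd_exp[OF p sE(1)] pd_mult[OF p smooth_const smooth_\<omega>(1)] pd_const[OF p] by simp
    show ?thesis
      unfolding Z_def[abs_def] Y_def[abs_def] pd_mult[OF p smooth_complex(3) sE(2)] pd_mult[OF p smooth_complex(2) sE(2)] dE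
        \<omega>_t[OF p] \<omega>_th[OF p] closed_PQ[OF p] Q_eq[OF p] by simp
  qed
  have green: "integral {0..2*pi} (\<lambda>\<theta>. Z k (mob_T, \<theta>)) = integral {0..2*pi} (\<lambda>\<theta>. Z k (- mob_T, \<theta>))" for k
  proof -
    have g1: "((\<lambda>t. integral {0..2*pi} (\<lambda>\<theta>. pd (1, 0) (Z k) (t, \<theta>) - pd (0, 1) (Y k) (t, \<theta>))) has_integral
      (integral {0..2*pi} (\<lambda>\<theta>. Z k (mob_T, \<theta>)) - integral {0..2*pi} (\<lambda>\<theta>. Z k (-mob_T, \<theta>)))) {-mob_T..mob_T}"
      by (rule green_strip[OF smZ]) (use per(2)[of _ k 0] in simp)
    have g0: "((\<lambda>t. integral {0..2*pi} (\<lambda>\<theta>. pd (1, 0) (Z k) (t, \<theta>) - pd (0, 1) (Y k) (t, \<theta>))) has_integral 0) {-mob_T..mob_T}"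
    proof (rule has_integral_is_0)
      fix t assume t: "t \<in> {-mob_T..mob_T}"
      have "pd (1, 0) (Z k) (t, \<theta>) - pd (0, 1) (Y k) (t, \<theta>) = 0" for \<theta> using closed[of "(t, \<theta>)" k] t by auto
      then show "integral {0..2*pi} (\<lambda>\<theta>. pd (1, 0) (Z k) (t, \<theta>) - pd (0, 1) (Y k) (t, \<theta>)) = 0" by simp
    qed
    show ?thesis using has_integral_unique[OF g1 g0] by simp
  qed
  have cZ: "continuous_on X (\<lambda>\<theta>. Z k (t, \<theta>))" if "\<bar>t\<bar> \<le> mob_T" for k X t
    by (rule continuous_on_strip_line[OF smooth_continuous[OF smZ(1)] that])
  have top: "integral {0..2*pi} (\<lambda>\<theta>. Z k (mob_T, \<theta>)) =
      of_real (exp (- of_int k * X)) * (\<i> * of_int k * fourier (\<lambda>x. complex_of_real (U x $ i)) k + \<i> * fourier (\<lambda>x. complex_of_real (l x * U x $ i)) k)" for k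
  proof -
    have "((\<lambda>x. \<Theta>' x *\<^sub>R Z k (mob_T, \<Theta> x)) has_integral (integral {\<Theta> 0..\<Theta> (2*pi)} (\<lambda>\<theta>. Z k (mob_T, \<theta>)))) {0..2*pi}"
    proof (rule has_integral_substitution[where c = 0 and d = "2 * pi"])
      have end2: "\<Theta> (2 * pi) = 2 * pi" using \<Theta>(4)[of 0] \<Theta>(3) by simp
      then show "\<Theta> 0 \<le> \<Theta> (2 * pi)" using \<Theta>(3) by simp
      show "continuous_on {0..2*pi} (\<lambda>\<theta>. Z k (mob_T, \<theta>))"
        by (rule cZ) simp
      show "(\<Theta> has_real_derivative \<Theta>' x) (at x within {0..2*pi})" for x
        unfolding \<Theta>'_def by (rule has_field_derivative_at_within[OF \<Theta>(5)])
      have mono: "\<Theta> a \<le> \<Theta> b" if "a \<le> b" for a b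
      proof (rule DERIV_nonneg_imp_nondecreasing[OF that])
        fix x
        have "0 \<le> inverse (yy' (\<Theta> x))" using yy(4)[of "\<Theta> x"] e_small by (simp add: abs_le_iff)
        then show "\<exists>y. (\<Theta> has_real_derivative y) (at x) \<and> 0 \<le> y" using \<Theta>(5) by blast
      qed
      show "\<Theta> ` {0..2*pi} \<subseteq> {0..2*pi}" using mono[of 0] mono[of _ "2*pi"] end2 \<Theta>(3) by auto
    qed simp
    moreover have "\<Theta> 0 = 0" "\<Theta> (2 * pi) = 2 * pi" using \<Theta>(4)[of 0] \<Theta>(3) by simp_all
    ultimately have "integral {0..2*pi} (\<lambda>\<theta>. Z k (mob_T, \<theta>)) = integral {0..2*pi} (\<lambda>x. \<Theta>' x *\<^sub>R Z k (mob_T, \<Theta> x))"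
      by (simp add: integral_unique)
    also have "(\<lambda>x. \<Theta>' x *\<^sub>R Z k (mob_T, \<Theta> x)) =
       (\<lambda>x. of_real (exp (- of_int k * X)) * ((complex_of_real (U' x $ i) + \<i> * complex_of_real (l x * U x $ i)) * cis (- of_int k * x)))"
    proof
      fix x
      have "exp (- of_int k * \<omega> (mob_T, \<Theta> x)) = of_real (exp (- of_int k * X)) * cis (- of_int k * x)"
        unfolding \<omega>_boundary \<Theta>(1) by (simp add: exp_eq_polar)
      moreover have "\<Theta>' x *\<^sub>R ((complex_of_real (fh (mob_T, \<Theta> x) $ i) + \<i> * complex_of_real (lam (mob_T, \<Theta> x) * f (mob_T, \<Theta> x) $ i)) * (R * E)) =
         R * ((complex_of_real (U' x $ i) + \<i> * complex_of_real (l x * U x $ i)) * E)" for R E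
        unfolding U'_def l_def U_def vector_scaleR_component by (simp add: scaleR_conv_of_real algebra_simps)
      ultimately show "\<Theta>' x *\<^sub>R Z k (mob_T, \<Theta> x) = of_real (exp (- of_int k * X)) * ((complex_of_real (U' x $ i) + \<i> * complex_of_real (l x * U x $ i)) * cis (- of_int k * x))"
        unfolding Z_def boundary_Q by (simp only:)
    qed
    also have "integral {0..2*pi} \<dots> = of_real (exp (- of_int k * X)) * fourier (\<lambda>x. complex_of_real (U' x $ i) + \<i> * complex_of_real (l x * U x $ i)) k"
      unfolding fourier_def by (rule Henstock_Kurzweil_Integration.integral_mult_right)
    also have "fourier (\<lambda>x. complex_of_real (U' x $ i) + \<i> * complex_of_real (l x * U x $ i)) k =
      fourier (\<lambda>x. complex_of_real (U' x $ i)) k + \<i> * fourier (\<lambda>x. complex_of_real (l x * U x $ i)) k"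
      unfolding fourier_cmult[symmetric] by (rule fourier_add) (intro continuous_intros U_facts)+
    also have "fourier (\<lambda>x. complex_of_real (U' x $ i)) k = \<i> * of_int k * fourier (\<lambda>x. complex_of_real (U x $ i)) k"
    proof (rule fourier_derivative)
      show "((\<lambda>x. U x $ i) has_real_derivative U' x $ i) (at x)" for x
        using bounded_linear.has_vector_derivative[OF bounded_linear_vec_nth U_facts(1)] by (simp add: has_real_derivative_iff_has_vector_derivative)
    qed (intro continuous_intros U_facts, simp add: U_facts)
    finally show ?thesis .
  qed
  have bottom: "integral {0..2*pi} (\<lambda>\<theta>. Z k (- mob_T, \<theta>)) = (if even k then 1 else -1) * cnj (integral {0..2*pi} (\<lambda>\<theta>. Z (-k) (mob_T, \<theta>)))"
  proof -
    have "integral {0..2*pi} (\<lambda>\<theta>. Z k (- mob_T, \<theta>)) = integral {0..2*pi} (\<lambda>\<theta>. Z k (- mob_T, \<theta> + pi))"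
      by (rule integral_periodic_shift[symmetric]) (use cZ[of "- mob_T"] per(1)[of "- mob_T"] in auto)
    also have "(\<lambda>\<theta>. Z k (- mob_T, \<theta> + pi)) = (\<lambda>\<theta>. (if even k then 1 else -1) * cnj (Z (-k) (mob_T, \<theta>)))"
    proof
      fix \<theta>
      have fl: "(- mob_T, \<theta> + pi) = mob_flip (mob_T, \<theta>)" by (simp add: mob_flip_def)
      have "exp (- of_int k * (\<i> * pi)) = (if even k then 1 else (-1::complex))"
      proof -
        have "exp (- of_int k * (\<i> * pi)) = cis (- of_int k * pi)" by (simp add: cis_conv_exp mult_ac)
        also have "\<dots> = (if even k then 1 else -1)" by (simp add: complex_eq_iff cos_npi_int sin_npi_int mult.commute)
        finally show ?thesis .
      qed
      then have "exp (- of_int k * (- cnj z + \<i> * pi)) = (if even k then 1 else -1) * cnj (exp (of_int k * z))" for z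
        unfolding distrib_left exp_add exp_cnj by simp
      then show "Z k (- mob_T, \<theta> + pi) = (if even k then 1 else -1) * cnj (Z (-k) (mob_T, \<theta>))"
        unfolding fl Z_def flip_PQm[OF T_strip(1)] \<omega>_flip[OF T_strip(1)] by simp
    qed
    also have "integral {0..2*pi} \<dots> = (if even k then 1 else -1) * cnj (integral {0..2*pi} (\<lambda>\<theta>. Z (-k) (mob_T, \<theta>)))"
      unfolding Henstock_Kurzweil_Integration.integral_cnj by (rule Henstock_Kurzweil_Integration.integral_mult_right)
    finally show ?thesis .
  qed
  have l: "fourier (\<lambda>x. complex_of_real (l x * U x $ i)) (- k) = cnj (fourier (\<lambda>x. complex_of_real (l x * U x $ i)) k)"
    by (rule fourier_uminus)
  show "of_real (exp (- of_int k * X)) * (\<i> * of_int k * fourier (\<lambda>x. complex_of_real (U x $ i)) k + \<i> * fourier (\<lambda>x. complex_of_real (l x * U x $ i)) k) =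
    (if even k then 1 else -1) * of_real (exp (of_int k * X)) * (\<i> * of_int k * fourier (\<lambda>x. complex_of_real (U x $ i)) k - \<i> * fourier (\<lambda>x. complex_of_real (l x * U x $ i)) k)"
    using green[of k] unfolding bottom top l fourier_uminus[of "\<lambda>x. U x $ i" k] by (simp add: exp_cnj[symmetric])
qed

end

section \<open>Uniqueness for the Dirichlet problem and surjectivity of the coordinate\<close>

text \<open>
  Induction: after matching the first \<open>n\<close> vectors, compose with the reflection that exchanges the image of the next
  vector with its target. It fixes the vectors already matched.
\<close>

lemma orthonormal_families_orthogonal_transformation:
  fixes x y :: "nat \<Rightarrow> 'a::euclidean_space"
  assumes "\<And>i j. i < n \<Longrightarrow> j < n \<Longrightarrow> x i \<bullet> x j = (if i = j then 1 else 0)"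
    and "\<And>i j. i < n \<Longrightarrow> j < n \<Longrightarrow> y i \<bullet> y j = (if i = j then 1 else 0)"
  shows "\<exists>A. orthogonal_transformation A \<and> (\<forall>i<n. A (x i) = y i)"
  using assms
proof (induction n)
  case 0
  show ?case by (intro exI[of _ "\<lambda>x. x"]) (simp add: orthogonal_transformation_id)
next
  case (Suc n)
  have "\<exists>A. orthogonal_transformation A \<and> (\<forall>i<n. A (x i) = y i)"
    by (rule Suc.IH) (use Suc.prems in auto)
  then obtain A where A: "orthogonal_transformation A" "\<And>i. i < n \<Longrightarrow> A (x i) = y i" by blast
  define z where "z = A (x n)"
  define w where "w = z - y n"
  have zz: "z \<bullet> z = 1" using A(1) Suc.prems(1)[of n n] by (simp add: z_def orthogonal_transformation_def)
  have yy: "y n \<bullet> y n = 1" using Suc.prems(2)[of n n] by simp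
  have zy: "w \<bullet> y i = 0" if "i < n" for i
  proof -
    have "z \<bullet> y i = x n \<bullet> x i" using A(1) unfolding A(2)[OF that, symmetric] z_def orthogonal_transformation_def by blast
    then show ?thesis using Suc.prems(1)[of n i] Suc.prems(2)[of n i] that by (simp add: w_def inner_diff_left)
  qed
  show ?case
  proof (cases "w = 0")
    case True
    then have "A (x n) = y n" by (simp add: w_def z_def)
    then show ?thesis using A by (auto simp: less_Suc_eq)
  next
    case False
    then have ww: "w \<bullet> w \<noteq> 0" by simp
    define R where "R v = v - (2 * (v \<bullet> w) / (w \<bullet> w)) *\<^sub>R w" for v
    have lin: "linear R" unfolding R_def[abs_def]
      by (rule linearI) (simp_all add: inner_add_left algebra_simps add_divide_distrib scaleR_add_left)
    have "R v \<bullet> R u = v \<bullet> u" for v u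
    proof -
      define a where "a = 2 * (v \<bullet> w) / (w \<bullet> w)"
      define b where "b = 2 * (u \<bullet> w) / (w \<bullet> w)"
      have "a * (w \<bullet> w) = 2 * (v \<bullet> w)" "b * (w \<bullet> w) = 2 * (u \<bullet> w)" using ww by (simp_all add: a_def b_def)
      moreover have "R v \<bullet> R u = v \<bullet> u - b * (v \<bullet> w) - a * (u \<bullet> w) + b * (a * (w \<bullet> w))"
        unfolding R_def a_def[symmetric] b_def[symmetric] by (simp add: inner_diff_left inner_diff_right inner_commute[of w u] algebra_simps)
      moreover have "a * (u \<bullet> w) = b * (v \<bullet> w)" by (simp add: a_def b_def)
      ultimately show ?thesis by (simp only:)
    qed
    then have R: "orthogonal_transformation R" using lin by (simp add: orthogonal_transformation_def)
    have "w \<bullet> w = 2 * (z \<bullet> w)" by (simp add: w_def inner_diff_left inner_diff_right zz yy inner_commute)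
    then have "R z = y n" using ww by (simp add: R_def) (simp add: w_def)
    moreover have "R (y i) = y i" if "i < n" for i using zy[OF that] by (simp add: R_def inner_commute)
    ultimately have "\<forall>i<Suc n. (R \<circ> A) (x i) = y i" using A(2) by (auto simp: less_Suc_eq z_def)
    then show ?thesis using orthogonal_transformation_compose[OF R A(1)] by blast
  qed
qed

lemma sinh_mob_T: "sinh mob_T = sqrt (1/2)" by (simp add: mob_T_eq)

lemma cosh_2_mob_T: "cosh (2 * mob_T) = 2"
  using cosh_double[of mob_T] cosh_square_eq[of mob_T] by (simp add: sinh_mob_T)

lemma crit_scale: "4 * (sinh mob_T)\<^sup>2 + (cosh (2 * mob_T))\<^sup>2 = 6"
  by (simp add: sinh_mob_T cosh_2_mob_T)

lemma cosh_div_sinh_mob_T: "cosh mob_T / sinh mob_T = sqrt 3"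
proof -
  have "cosh mob_T = sqrt (3/2)"
    using cosh_square_eq[of mob_T] by (intro real_sqrt_unique[symmetric]) (simp_all add: sinh_mob_T)
  then show ?thesis by (simp add: sinh_mob_T real_sqrt_divide[symmetric] del: real_sqrt_divide)
qed

lemma crit_map_boundary: "crit_map \<sigma> (mob_T, \<theta>) = crit_curve \<sigma> \<theta>"
proof -
  have a: "1 / sqrt 6 * 2 * sqrt (1/2) = sqrt (1/3)"
    by (rule real_sqrt_unique[symmetric]) (simp_all add: power_mult_distrib power_divide)
  have b: "1 / sqrt 6 * 2 = sqrt (2/3)"
    by (rule real_sqrt_unique[symmetric]) (simp_all add: power_mult_distrib power_divide)
  have ax: "c *\<^sub>R axis i x = axis i (c * x)" for c x and i :: 'a by (simp add: vec_eq_iff axis_def)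
  show ?thesis
    unfolding crit_map_def crit_curve_def prod.case crit_scale
    unfolding sinh_mob_T cosh_2_mob_T scaleR_add_right ax mult.assoc[symmetric] a
    unfolding b ..
qed

text \<open>
  The condition of unit length at nine angles gives linear equations for the ten inner products, with all but the ratio of the two
  lengths determined; the speed at 0 fixes this ratio.
\<close>

lemma trig_sphere_curve_orthogonal:
  fixes a b c d :: "'a::euclidean_space"
  assumes U: "\<And>x. norm (cos x *\<^sub>R a + sin x *\<^sub>R b + cos (2 * x) *\<^sub>R c + sin (2 * x) *\<^sub>R d) = 1"
    and U': "norm (b + 2 *\<^sub>R d) = sqrt 3"
  shows "a \<bullet> a = 1/3" "b \<bullet> b = 1/3" "c \<bullet> c = 2/3" "d \<bullet> d = 2/3"
    "a \<bullet> b = 0" "a \<bullet> c = 0" "a \<bullet> d = 0" "b \<bullet> c = 0" "b \<bullet> d = 0" "c \<bullet> d = 0"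
proof -
  define Q where "Q p q r s = (p *\<^sub>R a + q *\<^sub>R b + r *\<^sub>R c + s *\<^sub>R d) \<bullet> (p *\<^sub>R a + q *\<^sub>R b + r *\<^sub>R c + s *\<^sub>R d)" for p q r s
  have Q: "Q p q r s = p * p * (a \<bullet> a) + q * q * (b \<bullet> b) + r * r * (c \<bullet> c) + s * s * (d \<bullet> d) +
     2 * (p * q * (a \<bullet> b) + p * r * (a \<bullet> c) + p * s * (a \<bullet> d) + q * r * (b \<bullet> c) + q * s * (b \<bullet> d) + r * s * (c \<bullet> d))" for p q r s
    unfolding Q_def by (simp add: inner_simps inner_commute[of b a] inner_commute[of c a] inner_commute[of d a] inner_commute[of c b] inner_commute[of d b] inner_commute[of d c] algebra_simps)
  have U1: "Q (cos x) (sin x) (cos (2 * x)) (sin (2 * x)) = 1" for x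
    using U[of x] by (simp add: Q_def norm_eq_1)
  define h where "h = sqrt 2 / 2"
  have hh: "h * h = 1/2" by (simp add: h_def)
  have e0: "Q 1 0 1 0 = 1" using U1[of 0] by simp
  have e1: "Q (-1) 0 1 0 = 1" using U1[of pi] by simp
  have e2: "Q 0 1 (-1) 0 = 1" using U1[of "pi/2"] by simp
  have e3: "Q 0 (-1) (-1) 0 = 1" using U1[of "- (pi/2)"] by simp
  have e4: "Q h h 0 1 = 1" using U1[of "pi/4"] by (simp add: h_def cos_45 sin_45)
  have two: "2 * (pi/4 + pi) = pi/2 + 2 * pi" "2 * (- (pi/4) + pi) = - (pi/2) + 2 * pi" by simp_all
  have e5: "Q (-h) (-h) 0 1 = 1" using U1[of "pi/4 + pi"]
    unfolding two cos_periodic_pi sin_periodic_pi cos_periodic sin_periodic by (simp add: h_def cos_45 sin_45)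
  have e6: "Q h (-h) 0 (-1) = 1" using U1[of "- (pi/4)"] by (simp add: h_def cos_45 sin_45)
  have e7: "Q (-h) h 0 (-1) = 1" using U1[of "- (pi/4) + pi"]
    unfolding two cos_periodic_pi sin_periodic_pi cos_periodic sin_periodic by (simp add: h_def cos_45 sin_45)
  have e8: "Q (1/2) (sqrt 3/2) (-1/2) (sqrt 3/2) = 1" using U1[of "pi/3"] by (simp add: cos_60 sin_60 cos_120 sin_120)
  (* the speed at 0 is the only equation that separates the lengths of the two frequencies *)
  have e9: "b \<bullet> b + 4 * (b \<bullet> d) + 4 * (d \<bullet> d) = 3"
  proof -
    have "(norm (b + 2 *\<^sub>R d))\<^sup>2 = 3" unfolding U' by simp
    then show ?thesis unfolding power2_norm_eq_inner by (simp add: inner_simps inner_commute[of d b])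
  qed
  note E = e0 e1 e2 e3 e4 e5 e6 e7 e8
  have ac: "a \<bullet> c = 0" and bc: "b \<bullet> c = 0" and abc: "a \<bullet> a + c \<bullet> c = 1" "b \<bullet> b + c \<bullet> c = 1"
    using e0 e1 e2 e3 unfolding Q by simp_all
  have h0: "h \<noteq> 0" by (simp add: h_def)
  have f4: "1/2 * (a \<bullet> a) + 1/2 * (b \<bullet> b) + d \<bullet> d + (a \<bullet> b) + 2 * (h * (a \<bullet> d + b \<bullet> d)) = 1"
    using e4 unfolding Q by (simp add: hh algebra_simps)
  have f5: "1/2 * (a \<bullet> a) + 1/2 * (b \<bullet> b) + d \<bullet> d + (a \<bullet> b) - 2 * (h * (a \<bullet> d + b \<bullet> d)) = 1"
    using e5 unfolding Q by (simp add: hh algebra_simps)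
  have f6: "1/2 * (a \<bullet> a) + 1/2 * (b \<bullet> b) + d \<bullet> d - (a \<bullet> b) + 2 * (h * (b \<bullet> d - a \<bullet> d)) = 1"
    using e6 unfolding Q by (simp add: hh algebra_simps)
  have f7: "1/2 * (a \<bullet> a) + 1/2 * (b \<bullet> b) + d \<bullet> d - (a \<bullet> b) - 2 * (h * (b \<bullet> d - a \<bullet> d)) = 1"
    using e7 unfolding Q by (simp add: hh algebra_simps)
  have "h * (a \<bullet> d + b \<bullet> d) = 0" "h * (b \<bullet> d - a \<bullet> d) = 0" using f4 f5 f6 f7 by linarith+
  then have "a \<bullet> d + b \<bullet> d = 0" "b \<bullet> d - a \<bullet> d = 0" using h0 by simp_all
  then show ad: "a \<bullet> d = 0" and bd: "b \<bullet> d = 0" by linarith+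
  show ab: "a \<bullet> b = 0" using f4 f6 by (simp add: ad bd)
  have dd: "d \<bullet> d = c \<bullet> c" using f4 abc by (simp add: ad bd ab)
  show b: "b \<bullet> b = 1/3" using e9 abc dd bd by simp
  then show aa: "a \<bullet> a = 1/3" and cc: "c \<bullet> c = 2/3" and "d \<bullet> d = 2/3" using abc dd by simp_all
  show "a \<bullet> c = 0" "b \<bullet> c = 0" by (rule ac bc)+
  have "sqrt 3 * (c \<bullet> d) = 0" using e8 unfolding Q ac bc ad bd ab dd aa b cc by simp
  then show "c \<bullet> d = 0" by simp
qed

context conformal_chart
begin

text \<open>
  The function \<open>V\<close> is holomorphic for the conformal structure of \<open>f\<close>, so \<open>w = f\<^sub>i - Re
  V\<close> is harmonic with zero boundary values, and its Dirichlet integral vanishes. In terms of \<open>D = P\<^sub>i -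
  V\<^sub>t\<close>, the form \<open>D dt + m D d\<theta>\<close> is closed with real part \<open>dw\<close>, and the density of
  the Dirichlet integral is \<open>\<bar>D\<bar>\<^sup>2 Im m\<close>.
\<close>

lemma real_part_uniqueness:
  assumes V: "smooth V" and CR: "\<And>p. p \<in> mob_strip \<Longrightarrow> pd (0, 1) V p = m p * pd (1, 0) V p"
    and V_flip: "\<And>p. p \<in> mob_strip \<Longrightarrow> V (mob_flip p) = cnj (V p)"
    and bd: "\<And>\<theta>. f (mob_T, \<theta>) $ i = Re (V (mob_T, \<theta>))"
    and p: "p \<in> mob_strip"
  shows "f p $ i = Re (V p)"
proof -
  define w where "w p = f p $ i - Re (V p)" for p
  define D where "D p = P i p - pd (1, 0) V p" for p
  have sVt: "smooth (pd (1, 0) V)" by (rule smooth_pd_t[OF V])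
  have sw: "smooth w" unfolding w_def[abs_def] by (intro smooth_intros smooth_f V)
  have sD: "smooth D" unfolding D_def[abs_def] by (intro smooth_intros sVt)
  have smD: "smooth (\<lambda>p. m p * D p)" by (intro smooth_intros sD)
  have w_t: "pd (1, 0) w p = Re (D p)" and w_th: "pd (0, 1) w p = Re (m p * D p)" if p: "p \<in> mob_strip" for p
  proof -
    have d: "pd b w p = pd b f p $ i - Re (pd b V p)" for b
      unfolding w_def[abs_def] by (simp add: pd_diff[OF p] pd_vec_nth[OF p] pd_Re[OF p] smooth_intros smooth_f V)
    show "pd (1, 0) w p = Re (D p)" unfolding d D_def P_def ft_def by simp
    have "Re (Q i p) = pd (0, 1) f p $ i" by (simp add: Q_def fh_def)
    then show "pd (0, 1) w p = Re (m p * D p)" unfolding d D_def CR[OF p] right_diff_distrib Q_eq[OF p, symmetric] by simp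
  qed
  have D_closed: "pd (0, 1) D p = pd (1, 0) (\<lambda>p. m p * D p) p" if p: "p \<in> mob_strip" for p
  proof -
    have "pd (0, 1) D p = pd (1, 0) (Q i) p - pd (0, 1) (pd (1, 0) V) p"
      unfolding D_def[abs_def] pd_diff[OF p smooth_complex(2) sVt] closed_PQ[OF p] ..
    also have "pd (0, 1) (pd (1, 0) V) p = pd (1, 0) (pd (0, 1) V) p" by (rule pd_commute[OF V p])
    also have "pd (1, 0) (Q i) p - pd (1, 0) (pd (0, 1) V) p = pd (1, 0) (\<lambda>p. Q i p - pd (0, 1) V p) p"
      by (rule pd_diff[OF p smooth_complex(3) smooth_pd_th[OF V], symmetric])
    also have "\<dots> = pd (1, 0) (\<lambda>p. m p * D p) p"
      by (rule pd_cong[OF _ p]) (simp add: D_def Q_eq CR right_diff_distrib)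
    finally show ?thesis .
  qed
  have D_flip: "D (mob_flip p) = - cnj (D p)" and w_flip: "w (mob_flip p) = w p" if p: "p \<in> mob_strip" for p
    using pd_flip(1)[OF V bounded_linear_cnj V_flip p] by (simp_all add: D_def w_def flip_PQm[OF p] flip[OF p] V_flip[OF p])
  have per: "D (t, \<theta> + 2 * pi) = D (t, \<theta>)" "w (t, \<theta> + 2 * pi) = w (t, \<theta>)" if "\<bar>t\<bar> \<le> mob_T" for t \<theta>
  proof -
    have q: "(t, \<theta>) \<in> mob_strip" "mob_flip (t, \<theta>) \<in> mob_strip" using that by simp_all
    show "D (t, \<theta> + 2 * pi) = D (t, \<theta>)" "w (t, \<theta> + 2 * pi) = w (t, \<theta>)"
      unfolding flip_flip[symmetric] D_flip[OF q(2)] D_flip[OF q(1)] w_flip[OF q(2)] w_flip[OF q(1)] by simp_all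
  qed
  have w_top: "w (mob_T, \<theta>) = 0" for \<theta> by (simp add: w_def bd)
  have w_bot: "w (- mob_T, \<theta>) = 0" for \<theta>
    using w_flip[of "(mob_T, \<theta> - pi)"] w_top[of "\<theta> - pi"] by (simp add: mob_flip_def)
  define Z where "Z p = w p * Im (m p * D p)" for p
  define Y where "Y p = w p * Im (D p)" for p
  have sZ: "smooth Z" and sY: "smooth Y" unfolding Z_def[abs_def] Y_def[abs_def] by (intro smooth_intros sw sD)+
  define R where "R p = (cmod (D p))\<^sup>2 * Im (m p)" for p
  have ZY: "pd (1, 0) Z p - pd (0, 1) Y p = R p" if p: "p \<in> mob_strip" for p
  proof -
    have "pd (1, 0) Z p = w p * Im (pd (1, 0) (\<lambda>p. m p * D p) p) + Re (D p) * Im (m p * D p)"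
      unfolding Z_def[abs_def] pd_mult[OF p sw smooth_linears(3)[OF smD]] pd_Im[OF p smD] w_t[OF p] ..
    moreover have "pd (0, 1) Y p = w p * Im (pd (0, 1) D p) + Re (m p * D p) * Im (D p)"
      unfolding Y_def[abs_def] pd_mult[OF p sw smooth_linears(3)[OF sD]] pd_Im[OF p sD] w_th[OF p] ..
    ultimately show ?thesis unfolding D_closed[OF p] R_def cmod_power2 by (simp add: algebra_simps power2_eq_square)
  qed
  have Im_m: "Im (m p) > 0" if "p \<in> mob_strip" for p
    using W_pos[OF that] E_pos[OF that] unfolding m_def by (simp flip: of_real_divide add: add_divide_distrib)
  have R0: "R p \<ge> 0" if "p \<in> mob_strip" for p using Im_m[OF that] by (simp add: R_def)
  have cR: "continuous_on mob_strip R" unfolding R_def[abs_def]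
    by (intro continuous_intros smooth_continuous sD smooth_complex)
  have int0: "((\<lambda>t. integral {0..2*pi} (\<lambda>\<theta>. R (t, \<theta>))) has_integral 0) {-mob_T..mob_T}"
  proof -
    have "((\<lambda>t. integral {0..2*pi} (\<lambda>\<theta>. pd (1, 0) Z (t, \<theta>) - pd (0, 1) Y (t, \<theta>))) has_integral
       (integral {0..2*pi} (\<lambda>\<theta>. Z (mob_T, \<theta>)) - integral {0..2*pi} (\<lambda>\<theta>. Z (-mob_T, \<theta>)))) {-mob_T..mob_T}"
      by (rule green_strip[OF sZ sY]) (use per(1)[of _ 0] per(2)[of _ 0] in \<open>simp add: Y_def\<close>)
    moreover have "Z (mob_T, \<theta>) = 0" "Z (- mob_T, \<theta>) = 0" for \<theta> by (simp_all add: Z_def w_top w_bot)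
    ultimately have "((\<lambda>t. integral {0..2*pi} (\<lambda>\<theta>. pd (1, 0) Z (t, \<theta>) - pd (0, 1) Y (t, \<theta>))) has_integral 0) {-mob_T..mob_T}" by simp
    then show ?thesis
      by (rule has_integral_eq[rotated]) (use ZY in auto)
  qed
  have cI: "continuous_on {-mob_T..mob_T} (\<lambda>t. integral {0..2*pi} (\<lambda>\<theta>. R (t, \<theta>)))"
  proof -
    have "continuous_on ({-mob_T..mob_T} \<times> cbox 0 (2*pi)) (\<lambda>(t, \<theta>). R (t, \<theta>))"
      unfolding split_beta prod.collapse by (rule continuous_on_subset[OF cR]) auto
    from integral_continuous_on_param[OF this] show ?thesis by simp
  qed
  have I0: "0 \<le> integral {0..2*pi} (\<lambda>\<theta>. R (t, \<theta>))" if "\<bar>t\<bar> \<le> mob_T" for t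
    by (rule integral_nonneg) (use that R0 in \<open>auto intro!: integrable_continuous_real continuous_on_strip_line[OF cR]\<close>)
  have int_zero: "integral {0..2*pi} (\<lambda>\<theta>. R (t, \<theta>)) = 0" if t: "t \<in> {-mob_T..mob_T}" for t
  proof -
    have "integral {-mob_T..mob_T} (\<lambda>t. integral {0..2*pi} (\<lambda>\<theta>. R (t, \<theta>))) = 0" using int0 by (rule integral_unique)
    then have "\<forall>t\<in>{-mob_T..mob_T}. integral {0..2*pi} (\<lambda>\<theta>. R (t, \<theta>)) = 0"
      by (subst (asm) integral_eq_0_iff[OF cI]) (use I0 in auto)
    with t show ?thesis by blast
  qed
  have R_zero: "R (t, \<theta>) = 0" if t: "\<bar>t\<bar> \<le> mob_T" and th: "\<theta> \<in> {0..2*pi}" for t \<theta>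
  proof -
    have "integral {0..2*pi} (\<lambda>\<theta>. R (t, \<theta>)) = 0" using int_zero[of t] t by (simp add: abs_le_iff)
    then have "\<forall>\<theta>\<in>{0..2*pi}. R (t, \<theta>) = 0"
      by (subst (asm) integral_eq_0_iff[OF continuous_on_strip_line[OF cR t]]) (use R0 t in auto)
    with th show ?thesis by blast
  qed
  have w_zero: "w (t, \<theta>) = 0" if t: "\<bar>t\<bar> \<le> mob_T" and th: "\<theta> \<in> {0..2*pi}" for t \<theta>
  proof -
    have "((\<lambda>s. pd (1, 0) w (s, \<theta>)) has_integral w (mob_T, \<theta>) - w (t, \<theta>)) {t..mob_T}"
    proof (rule fundamental_theorem_of_calculus)
      show "((\<lambda>s. w (s, \<theta>)) has_vector_derivative pd (1, 0) w (s, \<theta>)) (at s within {t..mob_T})" if "s \<in> {t..mob_T}" for s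
        by (rule has_vector_derivative_within_subset[OF smooth_vector_derivative_t[OF sw]]) (use that t in auto)
    qed (use t in auto)
    moreover have "((\<lambda>s. pd (1, 0) w (s, \<theta>)) has_integral 0) {t..mob_T}"
    proof (rule has_integral_is_0)
      fix s assume s: "s \<in> {t..mob_T}"
      then have s': "\<bar>s\<bar> \<le> mob_T" using t by auto
      then have "D (s, \<theta>) = 0" using R_zero[OF s' th] Im_m[of "(s, \<theta>)"] by (simp add: R_def)
      then show "pd (1, 0) w (s, \<theta>) = 0" using w_t[of "(s, \<theta>)"] s' by simp
    qed
    ultimately have "w (mob_T, \<theta>) - w (t, \<theta>) = 0" by (rule has_integral_unique)
    then show ?thesis by (simp add: w_top)
  qed
  obtain t \<theta> where pt: "p = (t, \<theta>)" by fastforce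
  have t: "\<bar>t\<bar> \<le> mob_T" using p pt by simp
  define k where "k = \<lfloor>\<theta> / (2 * pi)\<rfloor>"
  have "of_int k \<le> \<theta> / (2 * pi)" "\<theta> / (2 * pi) \<le> of_int k + 1" unfolding k_def by linarith+
  then have "\<theta> + of_int (- k) * (2 * pi) \<in> {0..2*pi}" by (auto simp: field_simps)
  from w_zero[OF t this] periodic_int_shift[of "\<lambda>\<theta>. w (t, \<theta>)" \<theta> "- k", OF per(2)[OF t]]
  have "w p = 0" by (simp add: pt)
  then show ?thesis by (simp add: w_def)
qed

lemma Re_\<omega>_bounds: assumes "(t, \<theta>) \<in> mob_strip" shows "\<bar>Re (\<omega> (t, \<theta>))\<bar> \<le> X"
proof -
  have t: "\<bar>t\<bar> \<le> mob_T" using assms by simp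
  have mono: "Re (\<omega> (a, \<theta>)) \<le> Re (\<omega> (b, \<theta>))" if "- mob_T \<le> a" "a \<le> b" "b \<le> mob_T" for a b
  proof -
    have "((\<lambda>s. Re (A (s, \<theta>))) has_integral Re (\<omega> (b, \<theta>)) - Re (\<omega> (a, \<theta>))) {a..b}"
    proof (rule fundamental_theorem_of_calculus)
      fix s assume s: "s \<in> {a..b}"
      then have s': "\<bar>s\<bar> \<le> mob_T" using that by auto
      have "((\<lambda>s. \<omega> (s, \<theta>)) has_vector_derivative A (s, \<theta>)) (at s within {a..b})"
        using has_vector_derivative_within_subset[OF smooth_vector_derivative_t[OF smooth_\<omega>(1) s'], of "{a..b}"] that s' by (auto simp: \<omega>_t)
      from bounded_linear.has_vector_derivative[OF bounded_linear_Re this]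
      show "((\<lambda>s. Re (\<omega> (s, \<theta>))) has_vector_derivative Re (A (s, \<theta>))) (at s within {a..b})" .
    qed (rule that(2))
    moreover have "0 \<le> Re (A (s, \<theta>))" if "s \<in> {a..b}" for s
    proof -
      have "(s, \<theta>) \<in> mob_strip" using that \<open>- mob_T \<le> a\<close> \<open>b \<le> mob_T\<close> by auto
      from order_trans[OF abs_Re_le_cmod A_near(1)[OF this]] show ?thesis using e_small by (simp add: abs_le_iff)
    qed
    ultimately have "0 \<le> Re (\<omega> (b, \<theta>)) - Re (\<omega> (a, \<theta>))" by (rule has_integral_nonneg)
    then show ?thesis by simp
  qed
  have "Re (\<omega> (- mob_T, \<theta>)) = - X"
    using \<omega>_flip[of "(mob_T, \<theta> - pi)"] \<omega>_X[of "\<theta> - pi"] by (simp add: mob_flip_def)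
  moreover have "- mob_T \<le> t" "t \<le> mob_T" using t by auto
  ultimately show ?thesis using mono[of "- mob_T" t] mono[of t mob_T] \<omega>_X[of \<theta>] by (simp add: abs_le_iff)
qed

text \<open>
  A point with \<open>\<omega> p = z\<close> is a fixed point of \<open>p - (\<omega> p - z)\<close>, a contraction as
  \<open>\<omega>\<close> is \<open>C\<^sup>1\<close>-close to the identity. Truncating the first coordinate keeps the iteration
  in the strip; at a fixed point the truncation is not active, since \<open>\<omega>\<close> maps boundary to boundary.
\<close>

lemma \<omega>_surj:
  assumes XT: "X = mob_T" and x: "\<bar>x\<bar> \<le> mob_T"
  obtains p where "p \<in> mob_strip" "\<omega> p = Complex x y"
proof -
  (* the nearest point of the interval; a map that does not increase distances *)
  define cl where "cl s = max (- mob_T) (min mob_T s)" for s :: real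
  define \<Phi> where "\<Phi> p = (cl (fst p - (Re (\<omega> p) - x)), snd p - (Im (\<omega> p) - y))" for p
  have lip: "norm ((p - (Re (\<omega> p), Im (\<omega> p))) - (p' - (Re (\<omega> p'), Im (\<omega> p')))) \<le> 1/2 * norm (p - p')"
    if "p \<in> mob_strip" "p' \<in> mob_strip" for p p'
  proof (rule differentiable_bound[OF convex_mob_strip _ _ that])
    fix q assume q: "q \<in> mob_strip"
    define B where "B h = of_real (fst h) * A q + of_real (snd h) * (m q * A q)" for h :: "real \<times> real"
    have dw: "(\<omega> has_derivative B) (at q within mob_strip)"
      by (rule has_derivative_eq_rhs[OF smooth_has_derivative[OF smooth_\<omega>(1) q]])
         (auto simp: B_def \<omega>_t[OF q] \<omega>_th[OF q] scaleR_conv_of_real)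
    show "((\<lambda>p. p - (Re (\<omega> p), Im (\<omega> p))) has_derivative (\<lambda>h. h - (Re (B h), Im (B h)))) (at q within mob_strip)"
      by (intro derivative_intros bounded_linear.has_derivative[OF bounded_linear_Re dw] bounded_linear.has_derivative[OF bounded_linear_Im dw])
    show "onorm (\<lambda>h. h - (Re (B h), Im (B h))) \<le> 1/2"
    proof (rule onorm_le)
      fix h :: "real \<times> real"
      define z where "z = of_real (fst h) * (A q - 1) + of_real (snd h) * (m q * A q - \<i>)"
      have "norm (h - (Re (B h), Im (B h))) = norm (- Re z, - Im z)"
        by (cases h) (simp add: B_def z_def algebra_simps)
      also have "\<dots> = cmod z" by (simp add: norm_Pair cmod_def)
      also have "\<dots> \<le> \<bar>fst h\<bar> * (1/10) + \<bar>snd h\<bar> * (1/10)"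
        unfolding z_def
      proof (rule order_trans[OF norm_triangle_ineq add_mono])
        show "cmod (of_real (fst h) * (A q - 1)) \<le> \<bar>fst h\<bar> * (1/10)"
          unfolding norm_mult norm_of_real by (rule mult_left_mono[OF order_trans[OF A_near(1)[OF q] e_small(2)]]) simp
        show "cmod (of_real (snd h) * (m q * A q - \<i>)) \<le> \<bar>snd h\<bar> * (1/10)"
          unfolding norm_mult[of "of_real _"] norm_of_real by (rule mult_left_mono[OF order_trans[OF A_near(2)[OF q] e_small(2)]]) simp
      qed
      also have "\<dots> \<le> norm h * (1/10) + norm h * (1/10)"
        using norm_fst_le[of "fst h" "snd h"] norm_snd_le[of "snd h" "fst h"] by (intro add_mono mult_right_mono) auto
      also have "\<dots> \<le> 1/2 * norm h" by simp
      finally show "norm (h - (Re (B h), Im (B h))) \<le> 1/2 * norm h" .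
    qed
  qed
  have "\<exists>!p. p \<in> mob_strip \<and> \<Phi> p = p"
  proof (rule Banach_fix[where c = "1/2"])
    have "closed mob_strip" unfolding mob_strip_def by (intro closed_Times) auto
    then show "complete mob_strip" by (simp add: complete_eq_closed)
    show "mob_strip \<noteq> {}" using T_strip by blast
    show "\<Phi> ` mob_strip \<subseteq> mob_strip" by (auto simp: \<Phi>_def cl_def)
    show "dist (\<Phi> p) (\<Phi> p') \<le> 1/2 * dist p p'" if "p \<in> mob_strip" "p' \<in> mob_strip" for p p'
    proof -
      define a where "a = fst p - (Re (\<omega> p) - x)" define a' where "a' = fst p' - (Re (\<omega> p') - x)"
      define b where "b = snd p - (Im (\<omega> p) - y)" define b' where "b' = snd p' - (Im (\<omega> p') - y)"
      have "\<bar>cl a - cl a'\<bar> \<le> \<bar>a - a'\<bar>" by (auto simp: cl_def max_def min_def abs_if)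
      then have "sqrt ((cl a - cl a')\<^sup>2 + (b - b')\<^sup>2) \<le> sqrt ((a - a')\<^sup>2 + (b - b')\<^sup>2)"
        by (simp add: abs_le_square_iff)
      moreover have "dist (\<Phi> p) (\<Phi> p') = sqrt ((cl a - cl a')\<^sup>2 + (b - b')\<^sup>2)"
        by (simp add: \<Phi>_def dist_norm norm_Pair a_def a'_def b_def b'_def)
      moreover have "sqrt ((a - a')\<^sup>2 + (b - b')\<^sup>2) = norm ((p - (Re (\<omega> p), Im (\<omega> p))) - (p' - (Re (\<omega> p'), Im (\<omega> p'))))"
        by (cases p, cases p') (simp add: norm_Pair a_def a'_def b_def b'_def algebra_simps)
      ultimately show ?thesis using lip[OF that] by (simp add: dist_norm)
    qed
  qed auto
  then obtain p where p: "p \<in> mob_strip" "\<Phi> p = p" by blast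
  obtain t \<theta> where pt: "p = (t, \<theta>)" by fastforce
  have t: "\<bar>t\<bar> \<le> mob_T" using p pt by simp
  have im: "Im (\<omega> p) = y" using p(2) by (simp add: \<Phi>_def pt)
  have cl: "cl (t - (Re (\<omega> p) - x)) = t" using p(2) by (simp add: \<Phi>_def pt)
  have "Re (\<omega> p) = x"
  proof (cases "t = mob_T")
    case True
    then have "Re (\<omega> p) = mob_T" using \<omega>_X[of \<theta>] XT by (simp add: pt)
    then show ?thesis using cl True x mob_T_pos by (auto simp: cl_def max_def min_def split: if_splits)
  next
    case False
    show ?thesis
    proof (cases "t = - mob_T")
      case True
      then have "Re (\<omega> p) = - mob_T"
        using \<omega>_flip[of "(mob_T, \<theta> - pi)"] \<omega>_X[of "\<theta> - pi"] XT by (simp add: mob_flip_def pt)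
      then show ?thesis using cl True x mob_T_pos by (auto simp: cl_def max_def min_def split: if_splits)
    next
      case F2: False
      then show ?thesis using cl False t by (auto simp: cl_def max_def min_def split: if_splits)
    qed
  qed
  with im have "\<omega> p = Complex x y" by (simp add: complex_eq_iff)
  with p(1) show ?thesis by (rule that)
qed

end

section \<open>From the boundary curve to the surface\<close>

lemma dtn_minus: "dtn X (- k) = dtn X k"
  by (simp add: dtn_def)

text \<open>
  The eigenvalues away from \<open>\<plusminus>1\<close>, \<open>\<plusminus>2\<close> keep a distance from the square root of 3.
  For even \<open>k \<ge> 4\<close> one needs a little more than \<open>tanh X \<ge> 1/2\<close>, which the doubling formula
  provides.
\<close>

lemma dtn_bounds:
  assumes X: "X > 0" "tanh X \<ge> 1/2" and k: "\<bar>k\<bar> \<ge> 3"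
  shows "5/2 \<le> dtn X k" "dtn X k \<le> 3 * \<bar>of_int k\<bar>"
proof -
  have main: "5/2 \<le> dtn X j \<and> dtn X j \<le> 3 * of_int j" if j: "j \<ge> 3" for j
  proof -
    have mono: "tanh (of_int i * X) \<le> tanh (of_int j * X)" if "i \<le> j" for i
      using that X(1) by simp
    have t1: "tanh (of_int j * X) < 1" by (rule tanh_real_lt_1)
    have "tanh (of_int 1 * X) \<le> tanh (of_int j * X)" by (rule mono) (use j in simp)
    then have th: "1/2 \<le> tanh (of_int j * X)" using X(2) unfolding of_int_1 mult_1_left by (rule order_trans[rotated])
    show ?thesis
    proof (cases "even j")
      case True
      then have j4: "j \<ge> 4" using j by presburger
      have t: "tanh X < 1" by (rule tanh_real_lt_1)
      have "tanh (2 * X) = 2 * tanh X / (1 + (tanh X)\<^sup>2)"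
        using tanh_add[of X X] by (simp add: power2_eq_square)
      moreover have "5/8 \<le> 2 * tanh X / (1 + (tanh X)\<^sup>2)"
      proof -
        have "(tanh X)\<^sup>2 \<le> tanh X" using mult_right_mono[of "tanh X" 1 "tanh X"] t X by (simp add: power2_eq_square)
        then show ?thesis using X(2) by (simp add: field_simps add_pos_nonneg)
      qed
      ultimately have "5/8 \<le> tanh (2 * X)" by simp
      moreover have "tanh (of_int 2 * X) \<le> tanh (of_int j * X)" by (rule mono) (use j in simp)
      ultimately have "5/8 \<le> tanh (of_int j * X)" unfolding of_int_numeral by (rule order_trans)
      then have "4 * (5/8) \<le> of_int j * tanh (of_int j * X)" using j4 by (intro mult_mono) auto
      moreover have "of_int j * tanh (of_int j * X) \<le> of_int j * 1" using t1 j by (intro mult_left_mono) auto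
      ultimately show ?thesis using True j by (simp add: dtn_def)
    next
      case False
      have s: "sinh (of_int j * X) > 0" using X(1) j by simp
      have r: "cosh (of_int j * X) / sinh (of_int j * X) = 1 / tanh (of_int j * X)" by (simp add: tanh_def)
      have "1 \<le> 1 / z" "1 / z \<le> 3" if "1/2 \<le> z" "z < 1" for z :: real
        using that by (simp_all add: field_simps)
      from this[OF th t1] have "1 \<le> 1 / tanh (of_int j * X)" "1 / tanh (of_int j * X) \<le> 3" .
      then have "of_int j * 1 \<le> of_int j * (1 / tanh (of_int j * X))" "of_int j * (1 / tanh (of_int j * X)) \<le> of_int j * 3"
        using j by (intro mult_left_mono; simp)+
      moreover have "dtn X j = of_int j * (1 / tanh (of_int j * X))" unfolding dtn_def r using False by simp
      moreover have "3 \<le> (of_int j :: real)" using j by simp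
      ultimately show ?thesis using j by (simp only: abs_of_nonneg) linarith
    qed
  qed
  show "5/2 \<le> dtn X k" "dtn X k \<le> 3 * \<bar>of_int k\<bar>"
    using main[of k] main[of "-k"] k dtn_minus[of X k] by (cases "k \<ge> 0"; auto)+
qed

lemma abs_cos_diff_le: "\<bar>cos a - cos b\<bar> \<le> \<bar>a - b :: real\<bar>" and abs_sin_diff_le: "\<bar>sin a - sin b\<bar> \<le> \<bar>a - b\<bar>"
proof -
  have "norm (cos a - cos b) \<le> 1 * norm (a - b)"
    by (rule field_differentiable_bound[of UNIV cos "\<lambda>x. - sin x"]) (auto intro!: derivative_eq_intros)
  then show "\<bar>cos a - cos b\<bar> \<le> \<bar>a - b\<bar>" by simp
  have "norm (sin a - sin b) \<le> 1 * norm (a - b)"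
    by (rule field_differentiable_bound[of UNIV sin cos]) (auto intro!: derivative_eq_intros)
  then show "\<bar>sin a - sin b\<bar> \<le> \<bar>a - b\<bar>" by simp
qed

lemma trig_combination_diff_le:
  fixes a b p q r s :: real
  assumes "\<bar>p\<bar> \<le> 2" "\<bar>q\<bar> \<le> 2" "\<bar>r\<bar> \<le> 2" "\<bar>s\<bar> \<le> 2"
  shows "\<bar>(p * cos a + q * sin a + r * cos (2 * a) + s * sin (2 * a)) - (p * cos b + q * sin b + r * cos (2 * b) + s * sin (2 * b))\<bar> \<le> 12 * \<bar>a - b\<bar>"
proof -
  have "\<bar>p * (cos a - cos b)\<bar> \<le> 2 * \<bar>a - b\<bar>" "\<bar>q * (sin a - sin b)\<bar> \<le> 2 * \<bar>a - b\<bar>"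
    "\<bar>r * (cos (2 * a) - cos (2 * b))\<bar> \<le> 2 * \<bar>2 * a - 2 * b\<bar>" "\<bar>s * (sin (2 * a) - sin (2 * b))\<bar> \<le> 2 * \<bar>2 * a - 2 * b\<bar>"
    unfolding abs_mult using assms by (intro mult_mono abs_cos_diff_le abs_sin_diff_le; simp)+
  moreover have "\<bar>2 * a - 2 * b\<bar> = 2 * \<bar>a - b\<bar>" by (simp add: abs_if)
  moreover have "\<bar>w + x + y + z\<bar> \<le> \<bar>w\<bar> + \<bar>x\<bar> + \<bar>y\<bar> + \<bar>z\<bar>" for w x y z :: real by linarith
  from this[of "p * (cos a - cos b)" "q * (sin a - sin b)" "r * (cos (2 * a) - cos (2 * b))" "s * (sin (2 * a) - sin (2 * b))"]
  have "\<bar>(p * cos a + q * sin a + r * cos (2 * a) + s * sin (2 * a)) - (p * cos b + q * sin b + r * cos (2 * b) + s * sin (2 * b))\<bar>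
    \<le> \<bar>p * (cos a - cos b)\<bar> + \<bar>q * (sin a - sin b)\<bar> + \<bar>r * (cos (2 * a) - cos (2 * b))\<bar> + \<bar>s * (sin (2 * a) - sin (2 * b))\<bar>"
    by (simp add: algebra_simps)
  ultimately show ?thesis by linarith
qed

lemma crit_curve_lipschitz: "\<bar>crit_curve \<sigma> a $ i - crit_curve \<sigma> b $ i\<bar> \<le> 12 * \<bar>a - b\<bar>"
  and crit_curve'_lipschitz: "\<bar>crit_curve' \<sigma> a $ i - crit_curve' \<sigma> b $ i\<bar> \<le> 12 * \<bar>a - b\<bar>"
  and crit_curve'_bound: "\<bar>crit_curve' \<sigma> a $ i\<bar> \<le> 8"
proof -
  have C: "crit_curve \<sigma> x $ i = (if i = \<sigma> 1 then sqrt (1/3) else 0) * cos x + (if i = \<sigma> 2 then sqrt (1/3) else 0) * sin x +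
    (if i = \<sigma> 3 then sqrt (2/3) else 0) * cos (2 * x) + (if i = \<sigma> 4 then sqrt (2/3) else 0) * sin (2 * x)" for x
    by (auto simp: crit_curve_def axis_def)
  have C': "crit_curve' \<sigma> x $ i = (if i = \<sigma> 2 then sqrt (1/3) else 0) * cos x + (if i = \<sigma> 1 then - sqrt (1/3) else 0) * sin x +
    (if i = \<sigma> 4 then 2 * sqrt (2/3) else 0) * cos (2 * x) + (if i = \<sigma> 3 then - 2 * sqrt (2/3) else 0) * sin (2 * x)" for x
    by (auto simp: crit_curve'_def axis_def)
  note b = sqrt_third_bounds
  have c: "\<bar>if i = \<sigma> j then sqrt (1/3) else 0\<bar> \<le> 2" "\<bar>if i = \<sigma> j then sqrt (2/3) else 0\<bar> \<le> 2"
    "\<bar>if i = \<sigma> j then - sqrt (1/3) else 0\<bar> \<le> 2" "\<bar>if i = \<sigma> j then 2 * sqrt (2/3) else 0\<bar> \<le> 2" "\<bar>if i = \<sigma> j then - 2 * sqrt (2/3) else 0\<bar> \<le> 2" for j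
    using b by auto
  show "\<bar>crit_curve \<sigma> a $ i - crit_curve \<sigma> b $ i\<bar> \<le> 12 * \<bar>a - b\<bar>"
    unfolding C by (rule trig_combination_diff_le; rule c)
  show "\<bar>crit_curve' \<sigma> a $ i - crit_curve' \<sigma> b $ i\<bar> \<le> 12 * \<bar>a - b\<bar>"
    unfolding C' by (rule trig_combination_diff_le; rule c)
  have m: "\<bar>p * y\<bar> \<le> 2" if "\<bar>p\<bar> \<le> 2" "\<bar>y\<bar> \<le> 1" for p y :: real
    using mult_mono[OF that] by (simp add: abs_mult)
  show "\<bar>crit_curve' \<sigma> a $ i\<bar> \<le> 8"
    unfolding C' using m[OF c(1)[of 2] abs_cos_le_one[of a]] m[OF c(3)[of 1] abs_sin_le_one[of a]]
      m[OF c(4)[of 4] abs_cos_le_one[of "2*a"]] m[OF c(5)[of 3] abs_sin_le_one[of "2*a"]] by linarith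
qed

lemma norm_crit_curve':
  assumes "distinct [\<sigma> 1, \<sigma> 2, \<sigma> 3, \<sigma> 4]"
  shows "norm (crit_curve' \<sigma> x) = sqrt 3"
proof -
  have n: "\<sigma> 1 \<noteq> \<sigma> 2" "\<sigma> 1 \<noteq> \<sigma> 3" "\<sigma> 1 \<noteq> \<sigma> 4" "\<sigma> 2 \<noteq> \<sigma> 1" "\<sigma> 2 \<noteq> \<sigma> 3" "\<sigma> 2 \<noteq> \<sigma> 4"
    "\<sigma> 3 \<noteq> \<sigma> 1" "\<sigma> 3 \<noteq> \<sigma> 2" "\<sigma> 3 \<noteq> \<sigma> 4" "\<sigma> 4 \<noteq> \<sigma> 1" "\<sigma> 4 \<noteq> \<sigma> 2" "\<sigma> 4 \<noteq> \<sigma> 3"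
    using assms by auto
  have gen: "(axis (\<sigma> 1) (- r * S) + axis (\<sigma> 2) (r * C) + axis (\<sigma> 3) (- 2 * q * S') + axis (\<sigma> 4) (2 * q * C')) \<bullet>
     (axis (\<sigma> 1) (- r * S) + axis (\<sigma> 2) (r * C) + axis (\<sigma> 3) (- 2 * q * S') + axis (\<sigma> 4) (2 * q * C')) =
     r * r * (S * S + C * C) + 4 * (q * q) * (S' * S' + C' * C')" for r q S C S' C' :: real
    by (simp add: inner_add_left inner_add_right inner_axis_axis n del: One_nat_def) (simp add: algebra_simps)
  have tr: "sin y * sin y + cos y * cos y = 1" for y :: real
    using sin_cos_squared_add[of y] by (simp add: power2_eq_square)
  have "crit_curve' \<sigma> x \<bullet> crit_curve' \<sigma> x = 3"
    unfolding crit_curve'_def gen tr by simp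
  then show ?thesis by (simp add: norm_eq_sqrt_inner)
qed

context conformal_chart
begin

lemma \<Theta>_near: "\<bar>\<Theta> x - x\<bar> \<le> 7 * e" "\<bar>\<Theta>' x - 1\<bar> \<le> 2 * e" "\<bar>\<Theta>' x\<bar> \<le> 2"
proof -
  define g where "g z = yy z - z" for z
  have gp: "g (z + 2 * pi) = g z" for z by (simp add: g_def yy(3))
  have g1: "\<bar>g z\<bar> \<le> 7 * e" if z: "z \<in> {0..2*pi}" for z
  proof -
    have "norm (g z - g 0) \<le> e * norm (z - 0)"
    proof (rule field_differentiable_bound[of UNIV g "\<lambda>z. yy' z - 1"])
      show "(g has_field_derivative yy' z - 1) (at z within UNIV)" for z
        unfolding g_def[abs_def] by (auto intro!: derivative_eq_intros yy(1))
      show "norm (yy' z - 1) \<le> e" for z using yy(4)[of z] by simp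
    qed auto
    also have "\<dots> \<le> e * 7" using z pi_approx e_small by (intro mult_left_mono) auto
    finally show ?thesis by (simp add: g_def yy(2))
  qed
  have "\<bar>g z\<bar> \<le> 7 * e" for z
  proof -
    define k where "k = \<lfloor>z / (2 * pi)\<rfloor>"
    have "of_int k \<le> z / (2 * pi)" "z / (2 * pi) \<le> of_int k + 1" unfolding k_def by linarith+
    then have "z + of_int (- k) * (2 * pi) \<in> {0..2*pi}" by (auto simp: field_simps)
    from g1[OF this] periodic_int_shift[of g z "- k", OF gp] show ?thesis by simp
  qed
  from this[of "\<Theta> x"] show "\<bar>\<Theta> x - x\<bar> \<le> 7 * e" by (simp add: g_def \<Theta>(1) abs_minus_commute)
  have y: "\<bar>yy' (\<Theta> x) - 1\<bar> \<le> e" by (rule yy(4))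
  then have y9: "yy' (\<Theta> x) \<ge> 9/10" using e_small by (simp add: abs_le_iff)
  have "\<bar>\<Theta>' x - 1\<bar> = \<bar>yy' (\<Theta> x) - 1\<bar> / yy' (\<Theta> x)"
    using y9 by (simp add: \<Theta>'_def field_simps abs_div_pos[symmetric] abs_minus_commute)
  also have "\<dots> \<le> e / (9/10)" using y y9 e_small by (intro frac_le) auto
  also have "\<dots> \<le> 2 * e" using e_small by simp
  finally show "\<bar>\<Theta>' x - 1\<bar> \<le> 2 * e" .
  then show "\<bar>\<Theta>' x\<bar> \<le> 2" using e_small by (simp add: abs_le_iff)
qed

text \<open>
  The rigidity of the boundary curve gives \<open>d\<^sub>1 = d\<^sub>2\<close>, which is the equation of \<open>T\<close>, and
  makes \<open>U\<close> a trigonometric curve with orthogonal coefficient vectors. The orthogonal map \<open>M\<close> sends the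
  critical frame to these. Then \<open>f\<close> and \<open>M\<close> composed with the critical map at \<open>\<omega>\<close>
  are real parts of holomorphic functions with the same boundary values.
\<close>

theorem image_of_nearly_critical:
  fixes \<sigma> :: "nat \<Rightarrow> 'n" and e' :: real
  assumes distinct: "distinct [\<sigma> 1, \<sigma> 2, \<sigma> 3, \<sigma> 4]"
    and f_near: "\<And>\<theta> i. \<bar>f (mob_T, \<theta>) $ i - crit_curve \<sigma> \<theta> $ i\<bar> \<le> e'"
    and fh_near: "\<And>\<theta> i. \<bar>fh (mob_T, \<theta>) $ i - crit_curve' \<sigma> \<theta> $ i\<bar> \<le> e'"
    and e': "e \<le> e'" "120 * real CARD('n) * e' \<le> 1 / (10000000 * (real CARD('n))\<^sup>2)"
    and X1: "\<bar>cosh X / sinh X - sqrt 3\<bar> \<le> 1 / (10000000 * (real CARD('n))\<^sup>2)" and X2: "1/2 \<le> tanh X"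
  shows "\<exists>A. orthogonal_transformation A \<and> f ` mob_strip = A ` crit_map \<sigma> ` mob_strip"
proof -
  define N where "N = real CARD('n)"
  define \<epsilon> where "\<epsilon> = 1 / (10000000 * N\<^sup>2)"
  have N1: "1 \<le> N" by (simp add: N_def Suc_le_eq)
  have e'0: "0 \<le> e'" using e'(1) e_small by simp
  have Ne: "120 * N * e' \<le> \<epsilon>" using e'(2) by (simp add: N_def \<epsilon>_def)
  have "1 * e' \<le> N * e'" using N1 e'0 by (intro mult_right_mono)
  then have e1: "120 * e' \<le> \<epsilon>" using Ne by simp
  have U_near: "\<bar>U x $ i - crit_curve \<sigma> x $ i\<bar> \<le> 85 * e'" for x i
  proof -
    have "\<bar>U x $ i - crit_curve \<sigma> (\<Theta> x) $ i\<bar> \<le> e'" unfolding U_def by (rule f_near)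
    moreover have "\<bar>crit_curve \<sigma> (\<Theta> x) $ i - crit_curve \<sigma> x $ i\<bar> \<le> 12 * (7 * e)"
      by (rule order_trans[OF crit_curve_lipschitz mult_left_mono[OF \<Theta>_near(1)]]) simp
    ultimately show ?thesis using e'(1) by linarith
  qed
  have U'_near: "\<bar>U' x $ i - crit_curve' \<sigma> x $ i\<bar> \<le> 102 * e'" for x i
  proof -
    have 1: "\<bar>\<Theta>' x * (fh (mob_T, \<Theta> x) $ i - crit_curve' \<sigma> (\<Theta> x) $ i)\<bar> \<le> 2 * e'"
      unfolding abs_mult by (intro mult_mono \<Theta>_near fh_near) auto
    have 2: "\<bar>(\<Theta>' x - 1) * crit_curve' \<sigma> (\<Theta> x) $ i\<bar> \<le> (2 * e) * 8"
      unfolding abs_mult using e_small by (intro mult_mono \<Theta>_near crit_curve'_bound) auto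
    have 3: "\<bar>crit_curve' \<sigma> (\<Theta> x) $ i - crit_curve' \<sigma> x $ i\<bar> \<le> 12 * (7 * e)"
      by (rule order_trans[OF crit_curve'_lipschitz mult_left_mono[OF \<Theta>_near(1)]]) simp
    have "U' x $ i - crit_curve' \<sigma> x $ i = \<Theta>' x * (fh (mob_T, \<Theta> x) $ i - crit_curve' \<sigma> (\<Theta> x) $ i) +
      (\<Theta>' x - 1) * crit_curve' \<sigma> (\<Theta> x) $ i + (crit_curve' \<sigma> (\<Theta> x) $ i - crit_curve' \<sigma> x $ i)"
      by (simp add: U'_def algebra_simps)
    with 1 2 3 e'(1) show ?thesis by linarith
  qed
  have l_near: "\<bar>l x - sqrt 3\<bar> \<le> \<epsilon>" for x
  proof -
    have "\<bar>norm (U' x) - norm (crit_curve' \<sigma> x)\<bar> \<le> norm (U' x - crit_curve' \<sigma> x)" by (rule norm_triangle_ineq3)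
    also have "\<dots> \<le> (\<Sum>i\<in>UNIV. \<bar>(U' x - crit_curve' \<sigma> x) $ i\<bar>)" by (rule norm_le_l1_cart)
    also have "\<dots> \<le> (\<Sum>i\<in>(UNIV::'n set). 102 * e')" using U'_near by (intro sum_mono) simp
    also have "\<dots> = 102 * N * e'" by (simp add: N_def)
    also have "\<dots> \<le> 120 * N * e'" using N1 e'0 by (intro mult_right_mono) auto
    finally show ?thesis using Ne by (simp add: U_facts(7) norm_crit_curve'[OF distinct])
  qed
  interpret nc: near_critical U U' l "dtn X" \<sigma> \<epsilon> N
  proof
    show "\<bar>dtn X 1 - sqrt 3\<bar> \<le> \<epsilon>" using X1 by (simp add: dtn_def \<epsilon>_def N_def)
    show "\<bar>U x $ i - crit_curve \<sigma> x $ i\<bar> \<le> \<epsilon>" for x i using U_near[of x i] e1 e'0 by linarith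
    show "\<bar>U' x $ i - crit_curve' \<sigma> x $ i\<bar> \<le> \<epsilon>" for x i using U'_near[of x i] e1 e'0 by linarith
    show "0 < \<epsilon>" using N1 by (simp add: \<epsilon>_def)
    show "\<epsilon> \<le> 1 / (10000000 * N\<^sup>2)" by (simp add: \<epsilon>_def)
    show "dtn X 0 = 0" by (simp add: dtn_def)
    show "dtn X (- 1) = dtn X 1" "dtn X (- 2) = dtn X 2" by (rule dtn_minus)+
    show "5/2 \<le> dtn X k" "dtn X k \<le> 3 * \<bar>of_int k\<bar>" if "\<bar>k\<bar> \<ge> 3" for k
      using dtn_bounds[OF X_pos X2 that] by simp_all
  qed (fact distinct U_facts l_near steklov N_def)+
  (* d 2 = d 1 reads 2 tanh (2 X) = coth X *)
  have XT: "X = mob_T"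
  proof -
    have "2 * tanh (2 * X) = cosh X / sinh X" using nc.rigidity(1) by (simp add: dtn_def)
    then show ?thesis using mob_T_equation_iff[OF X_pos] mob_T_eq by simp
  qed
  have l3: "l x = sqrt 3" for x
    using nc.rigidity(2)[of x] cosh_div_sinh_mob_T by (simp add: dtn_def XT)
  define a b c d where "a = (\<chi> i. Re (fourier (nc.u i) 1) / pi)" and "b = (\<chi> i. - Im (fourier (nc.u i) 1) / pi)"
    and "c = (\<chi> i. Re (fourier (nc.u i) 2) / pi)" and "d = (\<chi> i. - Im (fourier (nc.u i) 2) / pi)"
  have U_eq: "U x = cos x *\<^sub>R a + sin x *\<^sub>R b + cos (2 * x) *\<^sub>R c + sin (2 * x) *\<^sub>R d" for x
    by (simp add: vec_eq_iff nc.rigidity(3) nc.L_def a_def b_def c_def d_def mult.commute)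
  have U'_0: "U' 0 = b + 2 *\<^sub>R d"
  proof -
    have "(U has_vector_derivative (- sin 0) *\<^sub>R a + cos 0 *\<^sub>R b + (- sin (2 * 0) * 2) *\<^sub>R c + (cos (2 * 0) * 2) *\<^sub>R d) (at 0)"
      unfolding U_eq[abs_def]
      by (intro has_vector_derivative_add has_vector_derivative_scaleR[where g = "\<lambda>x. v" and g' = 0 for v, simplified])
         (auto intro!: derivative_eq_intros)
    from vector_derivative_unique_at[OF U_facts(1) this] show ?thesis by simp
  qed
  have orth: "a \<bullet> a = 1/3" "b \<bullet> b = 1/3" "c \<bullet> c = 2/3" "d \<bullet> d = 2/3"
    "a \<bullet> b = 0" "a \<bullet> c = 0" "a \<bullet> d = 0" "b \<bullet> c = 0" "b \<bullet> d = 0" "c \<bullet> d = 0"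
    using trig_sphere_curve_orthogonal[of a b c d] U_facts(6) U_facts(7)[of 0] l3[of 0] unfolding U_eq U'_0 by auto
  define x where "x k = axis (\<sigma> (Suc k)) (1::real)" for k
  define y where "y k = (if k = 0 then sqrt 3 *\<^sub>R a else if k = 1 then sqrt 3 *\<^sub>R b else if k = 2 then sqrt (3/2) *\<^sub>R c else sqrt (3/2) *\<^sub>R d)" for k :: nat
  have "\<exists>A. orthogonal_transformation A \<and> (\<forall>i<4. A (x i) = y i)"
  proof (rule orthonormal_families_orthogonal_transformation)
    fix i j :: nat assume ij: "i < 4" "j < 4"
    have ic: "i = 0 \<or> i = 1 \<or> i = 2 \<or> i = 3" "j = 0 \<or> j = 1 \<or> j = 2 \<or> j = 3" using ij by linarith+
    have n: "\<sigma> 1 \<noteq> \<sigma> 2" "\<sigma> 1 \<noteq> \<sigma> 3" "\<sigma> 1 \<noteq> \<sigma> 4" "\<sigma> 2 \<noteq> \<sigma> 3" "\<sigma> 2 \<noteq> \<sigma> 4" "\<sigma> 3 \<noteq> \<sigma> 4"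
      using distinct by auto
    have suc: "Suc (Suc 0) = 2" "Suc 2 = 3" "Suc 3 = 4" by simp_all
    show "x i \<bullet> x j = (if i = j then 1 else 0)"
      using ic n by (elim disjE) (simp_all add: x_def inner_axis_axis suc n[symmetric])
    have s: "sqrt 3 * sqrt 3 = (3::real)" "sqrt (3/2) * sqrt (3/2) = (3/2::real)" by simp_all
    show "y i \<bullet> y j = (if i = j then 1 else 0)"
      using ic by (elim disjE) (simp_all add: y_def orth inner_commute[of b a] inner_commute[of c a] inner_commute[of d a]
        inner_commute[of c b] inner_commute[of d b] inner_commute[of d c] s mult.assoc[symmetric] del: real_sqrt_divide)
  qed
  then obtain M where M: "orthogonal_transformation M" and Mx: "\<And>i. i < 4 \<Longrightarrow> M (x i) = y i" by blast
  have lin: "linear M" using M by (simp add: orthogonal_transformation_def)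
  have Max: "M (axis (\<sigma> 1) t) = (t * sqrt 3) *\<^sub>R a" "M (axis (\<sigma> 2) t) = (t * sqrt 3) *\<^sub>R b"
    "M (axis (\<sigma> 3) t) = (t * sqrt (3/2)) *\<^sub>R c" "M (axis (\<sigma> 4) t) = (t * sqrt (3/2)) *\<^sub>R d" for t
  proof -
    have ax: "axis i t = t *\<^sub>R axis i 1" for i :: 'n by (simp add: vec_eq_iff axis_def)
    have *: "M (axis (\<sigma> (Suc k)) t) = t *\<^sub>R y k" if "k < 4" for k
      using Mx[OF that] linear_scale[OF lin, of t "x k"] by (subst ax) (simp add: x_def)
    show "M (axis (\<sigma> 1) t) = (t * sqrt 3) *\<^sub>R a" "M (axis (\<sigma> 2) t) = (t * sqrt 3) *\<^sub>R b"
      "M (axis (\<sigma> 3) t) = (t * sqrt (3/2)) *\<^sub>R c" "M (axis (\<sigma> 4) t) = (t * sqrt (3/2)) *\<^sub>R d"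
      using *[of 0] *[of 1] *[of 2] *[of 3] by (simp_all add: y_def numeral_eq_Suc)
  qed
  define s where "s = 1 / sqrt 6"
  have M_crit: "M (crit_map \<sigma> (t, \<theta>)) = s *\<^sub>R ((2 * sinh t * cos \<theta> * sqrt 3) *\<^sub>R a + (2 * sinh t * sin \<theta> * sqrt 3) *\<^sub>R b +
      (cosh (2 * t) * cos (2 * \<theta>) * sqrt (3/2)) *\<^sub>R c + (cosh (2 * t) * sin (2 * \<theta>) * sqrt (3/2)) *\<^sub>R d)" for t \<theta>
    unfolding crit_map_def prod.case crit_scale linear_scale[OF lin] linear_add[OF lin] Max s_def ..
  have M_bd: "M (crit_map \<sigma> (mob_T, \<theta>)) = U \<theta>" for \<theta>
  proof -
    have k: "sqrt (1/3) * sqrt 3 = 1" "sqrt (2/3) * sqrt (3/2) = 1" by (simp_all add: real_sqrt_mult[symmetric])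
    have k': "sqrt (1/3) * z * sqrt 3 = z" "sqrt (2/3) * z * sqrt (3/2) = z" for z
      using k by (metis mult.commute mult.left_commute mult_1_right)+
    show ?thesis unfolding crit_map_boundary crit_curve_def linear_add[OF lin] Max U_eq k' ..
  qed
  have f_eq: "f p = M (crit_map \<sigma> (Re (\<omega> p), Im (\<omega> p)))" if p: "p \<in> mob_strip" for p
  proof -
    have "f p $ i = M (crit_map \<sigma> (Re (\<omega> p), Im (\<omega> p))) $ i" for i
    proof -
      define E where "E k p = exp (of_int k * \<omega> p)" for k p
      (* V is the holomorphic function with real part the i-th coordinate of the rotated critical map at the conformal coordinate *)
      define c1 where "c1 = of_real s * (of_real (sqrt 3 * a $ i) - \<i> * of_real (sqrt 3 * b $ i))"
      define c3 where "c3 = of_real s * (of_real (sqrt (3/2) * c $ i) - \<i> * of_real (sqrt (3/2) * d $ i)) / 2"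
      define V where "V p = c1 * E 1 p + (- cnj c1) * E (-1) p + c3 * E 2 p + cnj c3 * E (-2) p" for p
      have sE0: "smooth (\<lambda>p. of_int k * \<omega> p)" for k by (intro smooth_intros)
      have sE: "smooth (E k)" for k unfolding E_def[abs_def] by (intro smooth_intros)
      have sV: "smooth V" unfolding V_def[abs_def] by (intro smooth_intros sE)
      have dE: "pd bb (E k) p = of_int k * pd bb \<omega> p * E k p" if p: "p \<in> mob_strip" for bb k p
        unfolding E_def[abs_def] pd_exp[OF p sE0] pd_mult[OF p smooth_const smooth_\<omega>(1)] pd_const[OF p] by simp
      have dV: "pd bb V p = pd bb \<omega> p * (c1 * E 1 p + cnj c1 * E (-1) p + 2 * c3 * E 2 p - 2 * cnj c3 * E (-2) p)" if p: "p \<in> mob_strip" for bb p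
        unfolding V_def[abs_def]
        by (simp only: pd_add[OF p] pd_mult[OF p] pd_const[OF p] dE[OF p] smooth_const sE smooth_add smooth_bilinears)
           (simp add: algebra_simps)
      have Efl: "E k (mob_flip p) = (if even k then 1 else -1) * cnj (E (-k) p)" if p: "p \<in> mob_strip" for k p
      proof -
        have "exp (of_int k * (\<i> * pi)) = (if even k then 1 else (-1::complex))"
        proof -
          have "exp (of_int k * (\<i> * pi)) = cis (of_int k * pi)" by (simp add: cis_conv_exp mult_ac)
          also have "\<dots> = (if even k then 1 else -1)" by (simp add: complex_eq_iff cos_npi_int sin_npi_int mult.commute)
          finally show ?thesis .
        qed
        then show ?thesis unfolding E_def \<omega>_flip[OF p] distrib_left exp_add exp_cnj by simp
      qed
      have re: "Re (V p) = M (crit_map \<sigma> (Re (\<omega> p), Im (\<omega> p))) $ i" for p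
      proof -
        have E_re: "E k p = of_real (exp (of_int k * Re (\<omega> p))) * cis (of_int k * Im (\<omega> p))" for k
          unfolding E_def by (simp add: exp_eq_polar)
        show ?thesis
          unfolding M_crit V_def E_re c1_def c3_def
          by (simp add: sinh_def cosh_def exp_minus algebra_simps) (simp add: field_simps power2_eq_square)
      qed
      have "f p $ i = Re (V p)"
      proof (rule real_part_uniqueness[OF sV _ _ _ p])
        show "pd (0, 1) V p = m p * pd (1, 0) V p" if "p \<in> mob_strip" for p
          unfolding dV[OF that] \<omega>_t[OF that] \<omega>_th[OF that] by simp
        show "V (mob_flip p) = cnj (V p)" if "p \<in> mob_strip" for p
          unfolding V_def Efl[OF that] by simp
        show "f (mob_T, \<theta>) $ i = Re (V (mob_T, \<theta>))" for \<theta>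
        proof -
          have "f (mob_T, \<theta>) = U (yy \<theta>)" by (simp add: U_def \<Theta>(2))
          then show ?thesis unfolding re \<omega>_boundary using M_bd[of "yy \<theta>"] XT by simp
        qed
      qed
      then show ?thesis by (simp add: re)
    qed
    then show ?thesis by (simp add: vec_eq_iff)
  qed
  have "f ` mob_strip = M ` crit_map \<sigma> ` mob_strip"
  proof (intro equalityI subsetI)
    fix z assume "z \<in> f ` mob_strip"
    then obtain p where p: "p \<in> mob_strip" "z = f p" by blast
    have "(Re (\<omega> p), Im (\<omega> p)) \<in> mob_strip" using Re_\<omega>_bounds[of "fst p" "snd p"] p(1) XT by simp
    then show "z \<in> M ` crit_map \<sigma> ` mob_strip" using f_eq[OF p(1)] p(2) by blast
  next
    fix z assume "z \<in> M ` crit_map \<sigma> ` mob_strip"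
    then obtain t \<theta> where t: "(t, \<theta>) \<in> mob_strip" "z = M (crit_map \<sigma> (t, \<theta>))" by auto
    obtain p where p: "p \<in> mob_strip" "\<omega> p = Complex t \<theta>" using \<omega>_surj[OF XT, of t \<theta>] t(1) by auto
    then have "z = f p" using f_eq[OF p(1)] t(2) by simp
    then show "z \<in> f ` mob_strip" using p(1) by blast
  qed
  with M show ?thesis by blast
qed

end

section \<open>Dependence of the conformal data on the 2-jet\<close>

lemma compact_image_periodic:
  fixes g :: "real \<times> real \<Rightarrow> 'b::real_normed_vector"
  assumes g: "continuous_on mob_strip g" and per: "\<And>t \<theta>. \<bar>t\<bar> \<le> mob_T \<Longrightarrow> g (t, \<theta> + 2 * pi) = g (t, \<theta>)"
  shows "compact (g ` mob_strip)"
proof -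
  have "g ` mob_strip = g ` ({- mob_T..mob_T} \<times> {0..2 * pi})"
  proof (intro equalityI subsetI)
    fix y assume "y \<in> g ` mob_strip"
    then obtain t \<theta> where t: "\<bar>t\<bar> \<le> mob_T" and y: "y = g (t, \<theta>)" by auto
    define k where "k = \<lfloor>\<theta> / (2 * pi)\<rfloor>"
    have "of_int k \<le> \<theta> / (2 * pi)" "\<theta> / (2 * pi) < of_int k + 1" unfolding k_def by linarith+
    then have b: "of_int k * (2 * pi) \<le> \<theta>" "\<theta> < (of_int k + 1) * (2 * pi)" by (simp_all add: field_simps)
    have "g (t, \<theta> + of_int (- k) * (2 * pi)) = g (t, \<theta>)"
      using periodic_int_shift[of "\<lambda>x. g (t, x)" \<theta> "- k"] per[OF t] by (simp add: mult.commute)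
    moreover have "\<theta> + of_int (- k) * (2 * pi) \<in> {0..2 * pi}" using b by (simp add: algebra_simps)
    ultimately show "y \<in> g ` ({- mob_T..mob_T} \<times> {0..2 * pi})"
      using t unfolding y by (intro image_eqI[of _ _ "(t, \<theta> + of_int (- k) * (2 * pi))"]) (auto simp: abs_le_iff)
  next
    fix y assume "y \<in> g ` ({- mob_T..mob_T} \<times> {0..2 * pi})"
    then show "y \<in> g ` mob_strip" by (auto simp: abs_le_iff)
  qed
  moreover have "continuous_on ({- mob_T..mob_T} \<times> {0..2 * pi}) g"
    by (rule continuous_on_subset[OF g]) (auto simp: abs_le_iff)
  then have "compact (g ` ({- mob_T..mob_T} \<times> {0..2 * pi}))"
    by (rule compact_continuous_image) (intro compact_Times compact_Icc)
  ultimately show ?thesis by simp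
qed

text \<open>
  Uniform continuity at the points of a compact set, the second point being arbitrary; a Lebesgue number of a cover by balls does
  it.
\<close>

lemma compact_uniform_continuity_nearby:
  fixes \<Phi> :: "'a::metric_space \<Rightarrow> 'b::metric_space"
  assumes K: "compact K" and cont: "\<And>x. x \<in> K \<Longrightarrow> isCont \<Phi> x" and e: "e > 0"
  obtains d where "d > 0" "\<And>x y. x \<in> K \<Longrightarrow> dist x y < d \<Longrightarrow> dist (\<Phi> y) (\<Phi> x) < e"
proof -
  define C where "C = {ball x d |x d. x \<in> K \<and> (\<forall>y\<in>ball x d. dist (\<Phi> y) (\<Phi> x) < e / 2)}"
  have "K \<subseteq> \<Union>C"
  proof
    fix x assume x: "x \<in> K"
    obtain d where d: "d > 0" "\<And>y. dist y x < d \<Longrightarrow> dist (\<Phi> y) (\<Phi> x) < e / 2"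
      using cont[OF x] half_gt_zero[OF e] unfolding continuous_at_eps_delta by blast
    have "\<forall>y\<in>ball x d. dist (\<Phi> y) (\<Phi> x) < e / 2" using d(2) by (metis mem_ball dist_commute)
    with x have "ball x d \<in> C" unfolding C_def by blast
    then show "x \<in> \<Union>C" using d(1) by (intro UnionI[of "ball x d"]) simp_all
  qed
  moreover have "open B" if "B \<in> C" for B using that by (auto simp: C_def)
  ultimately obtain d where d: "0 < d" "\<And>x. x \<in> K \<Longrightarrow> \<exists>B\<in>C. ball x d \<subseteq> B"
    using Heine_Borel_lemma[OF K] by metis
  show ?thesis
  proof
    fix x y assume x: "x \<in> K" and xy: "dist x y < d"
    obtain B where B: "B \<in> C" "ball x d \<subseteq> B" using d(2)[OF x] by blast
    then obtain z where z: "\<And>y. y \<in> B \<Longrightarrow> dist (\<Phi> y) (\<Phi> z) < e / 2" unfolding C_def by blast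
    have "dist (\<Phi> y) (\<Phi> z) < e / 2" "dist (\<Phi> x) (\<Phi> z) < e / 2"
      using B(2) xy d(1) by (intro z; force)+
    then show "dist (\<Phi> y) (\<Phi> x) < e" by (rule dist_triangle_half_l)
  qed (rule d(1))
qed

text \<open>
  The values of \<open>f\<close>, \<open>f\<^sub>t\<close>, \<open>f\<^sub>\<theta>\<close>, \<open>f\<^sub>t\<^sub>t\<close>,
  \<open>f\<^sub>t\<^sub>\<theta>\<close>. They determine the quartic differential, which is defined by
  \<open>t\<close>-derivatives of first order quantities.
\<close>

type_synonym 'n jet = "(real ^ 'n) \<times> (real ^ 'n) \<times> (real ^ 'n) \<times> (real ^ 'n) \<times> (real ^ 'n)"

definition jet :: "(real \<times> real \<Rightarrow> real ^ 'n::finite) \<Rightarrow> real \<times> real \<Rightarrow> 'n jet" where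
  "jet f p = (f p, pd (1, 0) f p, pd (0, 1) f p, pd (1, 0) (pd (1, 0) f) p, pd (1, 0) (pd (0, 1) f) p)"

abbreviation "jx \<equiv> fst"
abbreviation "jt J \<equiv> fst (snd J)"
abbreviation "jh J \<equiv> fst (snd (snd J))"
abbreviation "jtt J \<equiv> fst (snd (snd (snd J)))"
abbreviation "jht J \<equiv> snd (snd (snd (snd J)))"

text \<open>
  The functions below express \<open>Wsq\<close>, the inverse of \<open>W\<close>, \<open>B1\<close>, \<open>B2\<close>, the
  \<open>t\<close>-derivative of \<open>B2\<close>, and \<open>q\<close>, \<open>m\<close>, \<open>\<kappa>\<close> of a minimal
  strip by its jet, so that they can be compared with those of the critical map, pointwise and by continuity alone.
\<close>

definition jet_Wsq :: "'n::finite jet \<Rightarrow> real" where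
  "jet_Wsq J = (jt J \<bullet> jt J) * (jh J \<bullet> jh J) - (jt J \<bullet> jh J) * (jt J \<bullet> jh J)"
definition jet_iW :: "'n::finite jet \<Rightarrow> real" where "jet_iW J = inverse (sqrt (jet_Wsq J))"
definition jet_B1 :: "'n::finite jet \<Rightarrow> real ^ 'n" where
  "jet_B1 J = jet_iW J *\<^sub>R ((jh J \<bullet> jh J) *\<^sub>R jt J - (jt J \<bullet> jh J) *\<^sub>R jh J)"
definition jet_B2 :: "'n::finite jet \<Rightarrow> real ^ 'n" where
  "jet_B2 J = jet_iW J *\<^sub>R ((jt J \<bullet> jt J) *\<^sub>R jh J - (jt J \<bullet> jh J) *\<^sub>R jt J)"
definition jet_B2t :: "'n::finite jet \<Rightarrow> real ^ 'n" where
  "jet_B2t J = jet_iW J *\<^sub>R ((jt J \<bullet> jt J) *\<^sub>R jht J + (2 * (jt J \<bullet> jtt J)) *\<^sub>R jh J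
     - ((jt J \<bullet> jh J) *\<^sub>R jtt J + (jt J \<bullet> jht J + jh J \<bullet> jtt J) *\<^sub>R jt J))
     - (jet_iW J * (jet_B1 J \<bullet> jtt J + jet_B2 J \<bullet> jht J)) *\<^sub>R jet_B2 J"
definition jet_q :: "'n::finite jet \<Rightarrow> complex" where
  "jet_q J = of_real (jtt J \<bullet> jtt J - jet_B2t J \<bullet> jet_B2t J) - \<i> * of_real (2 * (jtt J \<bullet> jet_B2t J))"
definition jet_m :: "'n::finite jet \<Rightarrow> complex" where
  "jet_m J = (of_real (jt J \<bullet> jh J) + \<i> * of_real (sqrt (jet_Wsq J))) / of_real (jt J \<bullet> jt J)"
definition jet_kappa :: "'n::finite jet \<Rightarrow> complex" where "jet_kappa J = csqrt (csqrt (jet_q J))"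

context minimal_strip
begin

lemma jet_eqs:
  assumes p: "p \<in> mob_strip"
  shows "jet_Wsq (jet f p) = Wsq p" "jet_B1 (jet f p) = B1 p" "jet_m (jet f p) = m p" "jet_q (jet f p) = q p"
proof -
  let ?J = "jet f p"
  have nz: "W p \<noteq> 0" using W_pos[OF p] by simp
  have J: "jx ?J = f p" "jt ?J = ft p" "jh ?J = fh p" "jtt ?J = pd (1, 0) ft p" "jht ?J = pd (1, 0) fh p"
    by (simp_all add: jet_def ft_def fh_def)
  note EFG = E_def[symmetric] F_def[symmetric] G_def[symmetric]
  show 1: "jet_Wsq ?J = Wsq p" unfolding jet_Wsq_def J EFG Wsq_def ..
  have iW: "jet_iW ?J = inverse (W p)" unfolding jet_iW_def 1 W_def ..
  show 2: "jet_B1 ?J = B1 p" unfolding jet_B1_def J EFG iW B1_def ..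
  have 3: "jet_B2 ?J = B2 p" unfolding jet_B2_def J EFG iW B2_def ..
  show "jet_m ?J = m p" unfolding jet_m_def J EFG 1 m_def W_def ..
  have nz': "W r \<noteq> 0" if "r \<in> mob_strip" for r using W_pos[OF that] by simp
  have siW: "smooth (\<lambda>p. inverse (W p))" by (rule smooth_inverse[OF smooth_geo(7) nz'])
  note sm = smooth_geo siW
  have dE: "pd (1, 0) E p = 2 * (ft p \<bullet> pd (1, 0) ft p)" and dF: "pd (1, 0) F p = ft p \<bullet> pd (1, 0) fh p + fh p \<bullet> pd (1, 0) ft p"
    unfolding E_def[abs_def] F_def[abs_def] by (simp_all add: pd_inner[OF p] smooth_geo inner_commute)
  have diW: "pd (1, 0) (\<lambda>p. inverse (W p)) p = - pd (1, 0) W p / (W p)\<^sup>2" by (rule pd_inverse[OF p smooth_geo(7) nz])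
  have quot: "A + (- s / (W p)\<^sup>2) *\<^sub>R V = A - (inverse (W p) * s) *\<^sub>R (inverse (W p) *\<^sub>R V)" for A V :: "real ^ 'n" and s
    by (simp add: divide_inverse power2_eq_square)
  have "pd (1, 0) B2 p = inverse (W p) *\<^sub>R (E p *\<^sub>R pd (1, 0) fh p + pd (1, 0) E p *\<^sub>R fh p - (F p *\<^sub>R pd (1, 0) ft p + pd (1, 0) F p *\<^sub>R ft p)) +
     pd (1, 0) (\<lambda>p. inverse (W p)) p *\<^sub>R (E p *\<^sub>R fh p - F p *\<^sub>R ft p)"
    unfolding B2_def[abs_def] by (simp add: pd_scaleR[OF p] pd_diff[OF p] smooth_intros sm)
  also have "\<dots> = jet_B2t ?J"
    unfolding jet_B2t_def J EFG iW 2 3 dE dF diW W_derivative[OF p] quot B2_def[of p, symmetric] ..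
  finally have 4: "pd (1, 0) B2 p = jet_B2t ?J" .
  have Pt: "pd (1, 0) (P i) p = of_real (pd (1, 0) ft p $ i) - \<i> * of_real (jet_B2t ?J $ i)" for i
    unfolding P_def[abs_def] 4[symmetric]
    by (simp add: pd_diff[OF p] pd_mult[OF p] pd_of_real[OF p] pd_vec_nth[OF p] pd_const[OF p] smooth_intros sm)
  show "jet_q ?J = q p"
    unfolding q_def jet_q_def Pt J inner_vec_def
    by (simp add: complex_eq_iff sum_subtractf[symmetric] sum_distrib_left sum.distrib algebra_simps)
qed

end

lemma isCont_jet:
  assumes W: "jet_Wsq J > 0" and E: "jt J \<bullet> jt J \<noteq> 0" and q: "jet_q J \<notin> \<real>\<^sub>\<le>\<^sub>0"
  shows "isCont jet_Wsq J" "isCont jet_q J" "isCont jet_kappa J" "isCont (\<lambda>J. jet_m J * jet_kappa J) J"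
    "isCont (\<lambda>J. jet_B1 J \<bullet> jx J) J"
proof -
  show 1: "isCont jet_Wsq J" unfolding jet_Wsq_def[abs_def] by (intro continuous_intros)
  have 2: "isCont jet_iW J" unfolding jet_iW_def[abs_def] using W by (intro continuous_intros 1) simp
  have 3: "isCont jet_B1 J" "isCont jet_B2 J" unfolding jet_B1_def[abs_def] jet_B2_def[abs_def]
    by (intro continuous_intros 2)+
  have 4: "isCont jet_B2t J" unfolding jet_B2t_def[abs_def] by (intro continuous_intros 2 3)
  show 5: "isCont jet_q J" unfolding jet_q_def[abs_def] by (intro continuous_intros 4)
  have "csqrt (jet_q J) \<notin> \<real>\<^sub>\<le>\<^sub>0"
    using q by auto
  then show 6: "isCont jet_kappa J" unfolding jet_kappa_def[abs_def] by (intro isCont_csqrt' 5 q)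
  have 7: "isCont jet_m J" unfolding jet_m_def[abs_def] using E by (intro continuous_intros 1) simp
  show "isCont (\<lambda>J. jet_m J * jet_kappa J) J" "isCont (\<lambda>J. jet_B1 J \<bullet> jx J) J"
    by (intro continuous_intros 6 7 3)+
qed

section \<open>The 2-jet of the critical map\<close>

text \<open>
  Vectors in the four-dimensional subspace that contains the critical band.
\<close>

definition frame :: "(nat \<Rightarrow> 'n::finite) \<Rightarrow> real \<Rightarrow> real \<Rightarrow> real \<Rightarrow> real \<Rightarrow> real ^ 'n" where
  "frame \<sigma> a b c d = a *\<^sub>R axis (\<sigma> 1) 1 + b *\<^sub>R axis (\<sigma> 2) 1 + c *\<^sub>R axis (\<sigma> 3) 1 + d *\<^sub>R axis (\<sigma> 4) 1"

lemma axis_scale: "axis i (t::real) = t *\<^sub>R axis i 1"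
  by (simp add: vec_eq_iff axis_def)

lemma inner_frame:
  assumes "distinct [\<sigma> 1, \<sigma> 2, \<sigma> 3, \<sigma> 4]"
  shows "frame \<sigma> a b c d \<bullet> frame \<sigma> a' b' c' d' = a * a' + b * b' + c * c' + d * d'"
proof -
  have n: "\<sigma> 1 \<noteq> \<sigma> 2" "\<sigma> 1 \<noteq> \<sigma> 3" "\<sigma> 1 \<noteq> \<sigma> 4" "\<sigma> 2 \<noteq> \<sigma> 3" "\<sigma> 2 \<noteq> \<sigma> 4" "\<sigma> 3 \<noteq> \<sigma> 4"
    using assms by auto
  show ?thesis
    unfolding frame_def inner_add_left inner_add_right inner_scaleR_left inner_scaleR_right inner_axis_axis
    using n n[symmetric] by simp
qed

lemma frame_ops: "frame \<sigma> a b c d + frame \<sigma> a' b' c' d' = frame \<sigma> (a + a') (b + b') (c + c') (d + d')"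
  "r *\<^sub>R frame \<sigma> a b c d = frame \<sigma> (r * a) (r * b) (r * c) (r * d)"
  by (simp_all add: frame_def algebra_simps)

lemma smooth_frame:
  "smooth a \<Longrightarrow> smooth b \<Longrightarrow> smooth c \<Longrightarrow> smooth d \<Longrightarrow> smooth (\<lambda>p. frame \<sigma> (a p) (b p) (c p) (d p))"
  unfolding frame_def by (intro smooth_intros)

lemma has_derivative_frame:
  assumes "(a has_derivative a') (at p within S)" "(b has_derivative b') (at p within S)"
    "(c has_derivative c') (at p within S)" "(d has_derivative d') (at p within S)"
  shows "((\<lambda>p. frame \<sigma> (a p) (b p) (c p) (d p)) has_derivative (\<lambda>h. frame \<sigma> (a' h) (b' h) (c' h) (d' h))) (at p within S)"
  unfolding frame_def by (intro has_derivative_add has_derivative_scaleR_left assms)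

lemma elementary_derivatives:
  fixes p :: "real \<times> real"
  shows "((\<lambda>p. sinh (c * fst p)) has_derivative (\<lambda>h. fst h * (c * cosh (c * fst p)))) (at p within S)"
    "((\<lambda>p. cosh (c * fst p)) has_derivative (\<lambda>h. fst h * (c * sinh (c * fst p)))) (at p within S)"
    "((\<lambda>p. sin (c * snd p)) has_derivative (\<lambda>h. snd h * (c * cos (c * snd p)))) (at p within S)"
    "((\<lambda>p. cos (c * snd p)) has_derivative (\<lambda>h. snd h * ((- c) * sin (c * snd p)))) (at p within S)"
proof -
  have D: "((\<lambda>p. g (L p)) has_derivative (\<lambda>h. L' h * g' (L p))) (at p within S)"
    if "(L has_derivative L') (at p within S)" "\<And>x. (g has_field_derivative g' x) (at x)" for g g' :: "real \<Rightarrow> real" and L L'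
    using has_derivative_compose[OF that(1) that(2)[unfolded has_field_derivative_def]] by (simp add: mult.commute)
  have L: "((\<lambda>p. c * fst p) has_derivative (\<lambda>h. c * fst h)) (at p within S)" "((\<lambda>p. c * snd p) has_derivative (\<lambda>h. c * snd h)) (at p within S)"
    by (intro derivative_intros)+
  have g: "(sinh has_field_derivative cosh x) (at x)" "(cosh has_field_derivative sinh x) (at x)"
    "(sin has_field_derivative cos x) (at x)" "(cos has_field_derivative - sin x) (at x)" for x :: real
    by (auto intro!: derivative_eq_intros)
  show "((\<lambda>p. sinh (c * fst p)) has_derivative (\<lambda>h. fst h * (c * cosh (c * fst p)))) (at p within S)"
    "((\<lambda>p. cosh (c * fst p)) has_derivative (\<lambda>h. fst h * (c * sinh (c * fst p)))) (at p within S)"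
    "((\<lambda>p. sin (c * snd p)) has_derivative (\<lambda>h. snd h * (c * cos (c * snd p)))) (at p within S)"
    "((\<lambda>p. cos (c * snd p)) has_derivative (\<lambda>h. snd h * ((- c) * sin (c * snd p)))) (at p within S)"
    using D[where g = sinh and g' = cosh, OF L(1) g(1)] D[where g = cosh and g' = sinh, OF L(1) g(2)] D[where g = sin and g' = cos, OF L(2) g(3)]
      D[where g = cos and g' = "\<lambda>x. - sin x", OF L(2) g(4)] by (simp_all add: ac_simps)
qed

lemma Ck_on_hyperbolic:
  "Ck_on mob_strip k (\<lambda>p. sinh (c * fst p :: real)) \<and> Ck_on mob_strip k (\<lambda>p. cosh (c * fst p :: real))"
proof (induction k)
  case 0
  show ?case by (auto intro!: continuous_intros)
next
  case (Suc k)
  have z: "Ck_on mob_strip k (\<lambda>p. 0 :: real)" by (rule Ck_on_const)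
  have "Ck_on mob_strip (Suc k) (\<lambda>p. sinh (c * fst p :: real))"
  proof (rule Ck_on_SucI[OF _ _ z])
    show "((\<lambda>p. sinh (c * fst p)) has_derivative (\<lambda>h. fst h *\<^sub>R (c * cosh (c * fst p)) + snd h *\<^sub>R 0)) (at p within mob_strip)" for p
      unfolding real_scaleR_def mult_zero_right add_0_left add_0_right by (rule elementary_derivatives)
  qed (intro Ck_on_mult Ck_on_const conjunct2[OF Suc])
  moreover have "Ck_on mob_strip (Suc k) (\<lambda>p. cosh (c * fst p :: real))"
  proof (rule Ck_on_SucI[OF _ _ z])
    show "((\<lambda>p. cosh (c * fst p)) has_derivative (\<lambda>h. fst h *\<^sub>R (c * sinh (c * fst p)) + snd h *\<^sub>R 0)) (at p within mob_strip)" for p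
      unfolding real_scaleR_def mult_zero_right add_0_left add_0_right by (rule elementary_derivatives)
  qed (intro Ck_on_mult Ck_on_const conjunct1[OF Suc])
  ultimately show ?case ..
qed

lemma Ck_on_trigonometric:
  "Ck_on mob_strip k (\<lambda>p. sin (c * snd p :: real)) \<and> Ck_on mob_strip k (\<lambda>p. cos (c * snd p :: real))"
proof (induction k)
  case 0
  show ?case by (auto intro!: continuous_intros)
next
  case (Suc k)
  have z: "Ck_on mob_strip k (\<lambda>p. 0 :: real)" by (rule Ck_on_const)
  have "Ck_on mob_strip (Suc k) (\<lambda>p. sin (c * snd p :: real))"
  proof (rule Ck_on_SucI[OF _ z])
    show "((\<lambda>p. sin (c * snd p)) has_derivative (\<lambda>h. fst h *\<^sub>R 0 + snd h *\<^sub>R (c * cos (c * snd p)))) (at p within mob_strip)" for p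
      unfolding real_scaleR_def mult_zero_right add_0_left add_0_right by (rule elementary_derivatives)
  qed (intro Ck_on_mult Ck_on_const conjunct2[OF Suc])
  moreover have "Ck_on mob_strip (Suc k) (\<lambda>p. cos (c * snd p :: real))"
  proof (rule Ck_on_SucI[OF _ z])
    show "((\<lambda>p. cos (c * snd p)) has_derivative (\<lambda>h. fst h *\<^sub>R 0 + snd h *\<^sub>R ((- c) * sin (c * snd p)))) (at p within mob_strip)" for p
      unfolding real_scaleR_def mult_zero_right add_0_left add_0_right by (rule elementary_derivatives)
  qed (intro Ck_on_mult Ck_on_const conjunct1[OF Suc])
  ultimately show ?case ..
qed

lemma smooth_elementary:
  "smooth (\<lambda>p. sinh (fst p :: real))" "smooth (\<lambda>p. sinh (2 * fst p :: real))"
  "smooth (\<lambda>p. cosh (fst p :: real))" "smooth (\<lambda>p. cosh (2 * fst p :: real))"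
  "smooth (\<lambda>p. sin (snd p :: real))" "smooth (\<lambda>p. sin (2 * snd p :: real))"
  "smooth (\<lambda>p. cos (snd p :: real))" "smooth (\<lambda>p. cos (2 * snd p :: real))"
  using Ck_on_hyperbolic[where c = 1] Ck_on_hyperbolic[where c = 2] Ck_on_trigonometric[where c = 1] Ck_on_trigonometric[where c = 2]
  by (simp_all add: smooth_on_set_def)

lemma crit_map_frame:
  "crit_map \<sigma> = (\<lambda>p. (1 / sqrt 6) *\<^sub>R frame \<sigma> (2 * (sinh (fst p) * cos (snd p))) (2 * (sinh (fst p) * sin (snd p)))
     (cosh (2 * fst p) * cos (2 * snd p)) (cosh (2 * fst p) * sin (2 * snd p)))"
  unfolding crit_map_def crit_scale frame_def axis_scale[of _ "_ * _"] by (simp add: fun_eq_iff split_beta mult.assoc)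

lemma smooth_crit_map: "smooth (crit_map \<sigma>)"
  unfolding crit_map_frame by (intro smooth_intros smooth_frame smooth_elementary)

lemma pd_crit_map:
  assumes p: "p \<in> mob_strip"
  defines "s \<equiv> 1 / sqrt 6"
  shows "pd (1, 0) (crit_map \<sigma>) p = s *\<^sub>R frame \<sigma> (2 * (cosh (fst p) * cos (snd p))) (2 * (cosh (fst p) * sin (snd p)))
       (2 * (sinh (2 * fst p) * cos (2 * snd p))) (2 * (sinh (2 * fst p) * sin (2 * snd p)))" (is "_ = ?t p")
    and "pd (0, 1) (crit_map \<sigma>) p = s *\<^sub>R frame \<sigma> (- 2 * (sinh (fst p) * sin (snd p))) (2 * (sinh (fst p) * cos (snd p)))
       (- 2 * (cosh (2 * fst p) * sin (2 * snd p))) (2 * (cosh (2 * fst p) * cos (2 * snd p)))" (is "_ = ?h p")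
    and "pd (1, 0) (pd (1, 0) (crit_map \<sigma>)) p = s *\<^sub>R frame \<sigma> (2 * (sinh (fst p) * cos (snd p))) (2 * (sinh (fst p) * sin (snd p)))
       (4 * (cosh (2 * fst p) * cos (2 * snd p))) (4 * (cosh (2 * fst p) * sin (2 * snd p)))"
    and "pd (1, 0) (pd (0, 1) (crit_map \<sigma>)) p = s *\<^sub>R frame \<sigma> (- 2 * (cosh (fst p) * sin (snd p))) (2 * (cosh (fst p) * cos (snd p)))
       (- 4 * (sinh (2 * fst p) * sin (2 * snd p))) (4 * (sinh (2 * fst p) * cos (2 * snd p)))"
proof -
  have D: "pd b (\<lambda>p. s *\<^sub>R frame \<sigma> (A p) (B p) (C p) (D p)) p = s *\<^sub>R frame \<sigma> (A' b) (B' b) (C' b) (D' b)"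
    if "p \<in> mob_strip" "(A has_derivative A') (at p within mob_strip)" "(B has_derivative B') (at p within mob_strip)"
    "(C has_derivative C') (at p within mob_strip)" "(D has_derivative D') (at p within mob_strip)" for A A' B B' C C' D D' p b
    by (rule pd_eq[OF has_derivative_scaleR_right[OF has_derivative_frame[OF that(2-)]] that(1)])
  note derivs = has_derivative_mult_right elementary_derivatives elementary_derivatives[where c = 1, simplified] has_derivative_mult
  have 1: "pd (1, 0) (crit_map \<sigma>) p = ?t p" if "p \<in> mob_strip" for p
    unfolding crit_map_frame s_def[symmetric]
    by (rule trans, rule D[OF that], (rule derivs)+, simp add: ac_simps)
  have 2: "pd (0, 1) (crit_map \<sigma>) p = ?h p" if "p \<in> mob_strip" for p
    unfolding crit_map_frame s_def[symmetric]
    by (rule trans, rule D[OF that], (rule derivs)+, simp add: ac_simps)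
  show "pd (1, 0) (crit_map \<sigma>) p = ?t p" "pd (0, 1) (crit_map \<sigma>) p = ?h p" by (rule 1[OF p] 2[OF p])+
  have c1: "pd (1, 0) (pd (1, 0) (crit_map \<sigma>)) p = pd (1, 0) ?t p" by (rule pd_cong[OF _ p]) (rule 1)
  have c2: "pd (1, 0) (pd (0, 1) (crit_map \<sigma>)) p = pd (1, 0) ?h p" by (rule pd_cong[OF _ p]) (rule 2)
  show "pd (1, 0) (pd (1, 0) (crit_map \<sigma>)) p = s *\<^sub>R frame \<sigma> (2 * (sinh (fst p) * cos (snd p))) (2 * (sinh (fst p) * sin (snd p)))
       (4 * (cosh (2 * fst p) * cos (2 * snd p))) (4 * (cosh (2 * fst p) * sin (2 * snd p)))"
    unfolding c1
    by (rule trans, rule D[OF p], (rule derivs)+, simp add: ac_simps)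
  show "pd (1, 0) (pd (0, 1) (crit_map \<sigma>)) p = s *\<^sub>R frame \<sigma> (- 2 * (cosh (fst p) * sin (snd p))) (2 * (cosh (fst p) * cos (snd p)))
       (- 4 * (sinh (2 * fst p) * sin (2 * snd p))) (4 * (sinh (2 * fst p) * cos (2 * snd p)))"
    unfolding c2
    by (rule trans, rule D[OF p], (rule derivs)+, simp add: ac_simps)
qed

lemma crit_map_flip: "p \<in> mob_strip \<Longrightarrow> crit_map \<sigma> (mob_flip p) = crit_map \<sigma> p"
  by (cases p) (simp add: mob_flip_def crit_map_frame distrib_left)

text \<open>
  The value of \<open>\<kappa>\<close> for the critical map, whose \<open>q\<close> is 2.
\<close>

definition crit_radius :: real where "crit_radius = Re (csqrt (csqrt 2))"

lemma crit_radius: "crit_radius > 0" "csqrt (csqrt 2) = of_real crit_radius"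
proof -
  have "csqrt 2 = of_real (sqrt 2)" using of_real_sqrt[of 2] by simp
  then have "csqrt (csqrt 2) = of_real (sqrt (sqrt 2))" using of_real_sqrt[of "sqrt 2"] by simp
  then show "crit_radius > 0" "csqrt (csqrt 2) = of_real crit_radius" by (simp_all add: crit_radius_def)
qed

text \<open>
  The strip coordinates are isothermal for the critical map: \<open>E = G\<close> and \<open>F = 0\<close>, hence \<open>m =
  i\<close>. The remaining terms of \<open>q\<close> are hyperbolic and trigonometric squares that add up to a constant, as they
  must for a holomorphic function invariant under rotation.
\<close>

lemma jet_crit_map:
  assumes dist: "distinct [\<sigma> 1, \<sigma> 2, \<sigma> 3, \<sigma> 4]" and p: "p \<in> mob_strip"
  defines "J \<equiv> jet (crit_map \<sigma>) p"
  shows "jet_Wsq J \<ge> 4/9" "jt J \<bullet> jt J > 0" "jet_q J = 2" "jet_m J = \<i>" "fst p = mob_T \<Longrightarrow> jet_B1 J \<bullet> jx J \<ge> 1"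
proof -
  define x where "x = fst p"
  define y where "y = snd p"
  define s where "s = 1 / sqrt (6::real)"
  define E where "E = (4 * (cosh x)\<^sup>2 + 4 * (sinh (2 * x))\<^sup>2) / 6"
  have s: "s * s = 1/6" by (simp add: s_def)
  note h = cosh_square_eq[of x] cosh_square_eq[of "2 * x"]
  have t: "(sin y)\<^sup>2 = 1 - (cos y)\<^sup>2" "(sin (2 * y))\<^sup>2 = 1 - (cos (2 * y))\<^sup>2"
    by (simp_all add: sin_squared_eq)
  define a b c d where "a = jt J" and "b = jh J" and "c = jtt J" and "d = jht J"
  have jx: "crit_map \<sigma> p = s *\<^sub>R frame \<sigma> (2 * (sinh x * cos y)) (2 * (sinh x * sin y)) (cosh (2 * x) * cos (2 * y)) (cosh (2 * x) * sin (2 * y))"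
    by (simp add: crit_map_frame s_def x_def y_def)
  have J: "a = s *\<^sub>R frame \<sigma> (2 * (cosh x * cos y)) (2 * (cosh x * sin y)) (2 * (sinh (2 * x) * cos (2 * y))) (2 * (sinh (2 * x) * sin (2 * y)))"
    "b = s *\<^sub>R frame \<sigma> (- 2 * (sinh x * sin y)) (2 * (sinh x * cos y)) (- 2 * (cosh (2 * x) * sin (2 * y))) (2 * (cosh (2 * x) * cos (2 * y)))"
    "c = s *\<^sub>R frame \<sigma> (2 * (sinh x * cos y)) (2 * (sinh x * sin y)) (4 * (cosh (2 * x) * cos (2 * y))) (4 * (cosh (2 * x) * sin (2 * y)))"
    "d = s *\<^sub>R frame \<sigma> (- 2 * (cosh x * sin y)) (2 * (cosh x * cos y)) (- 4 * (sinh (2 * x) * sin (2 * y))) (4 * (sinh (2 * x) * cos (2 * y)))"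
    "jx J = s *\<^sub>R frame \<sigma> (2 * (sinh x * cos y)) (2 * (sinh x * sin y)) (cosh (2 * x) * cos (2 * y)) (cosh (2 * x) * sin (2 * y))"
    unfolding a_def b_def c_def d_def J_def jet_def fst_conv snd_conv pd_crit_map[OF p] jx s_def x_def y_def by (rule refl)+
  have sq: "(s *\<^sub>R u) \<bullet> (s *\<^sub>R v) = (u \<bullet> v) / 6" for u v :: "real ^ 'n"
    using s by (simp add: mult.assoc[symmetric])
  note i = sq inner_frame[OF dist]
  have sc: "sin z * sin z = 1 - cos z * cos z" for z :: real using sin_squared_eq[of z] by (simp add: power2_eq_square)
  have hc: "cosh z * cosh z = sinh z * sinh z + 1" for z :: real using cosh_square_eq[of z] by (simp add: power2_eq_square)
  note alg = mult.assoc mult.left_commute mult.commute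
  have aa: "a \<bullet> a = E" unfolding J i E_def power2_eq_square using sc[of y] sc[of "2 * y"] by (simp; algebra)
  have bb: "b \<bullet> b = E" unfolding J i E_def power2_eq_square using sc[of y] sc[of "2 * y"] hc[of x] hc[of "2 * x"] by (simp; algebra)
  have ab: "a \<bullet> b = 0" unfolding J i by (simp add: algebra_simps)
  have ac: "a \<bullet> c = b \<bullet> d" unfolding J i using sc[of y] sc[of "2 * y"] by (simp; algebra)
  have ad: "a \<bullet> d + b \<bullet> c = 0" unfolding J i by (simp add: algebra_simps)
  have cd: "c \<bullet> d = 0" unfolding J i by (simp add: algebra_simps)
  have ccdd: "c \<bullet> c - d \<bullet> d = 2" unfolding J i using sc[of y] sc[of "2 * y"] hc[of x] hc[of "2 * x"] by (simp; algebra)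
  have E: "E \<ge> 2/3" unfolding E_def using h by simp
  have Wsq: "jet_Wsq J = E * E" unfolding jet_Wsq_def a_def[symmetric] b_def[symmetric] aa bb ab by simp
  have "(2/3) * (2/3) \<le> E * E" using E by (intro mult_mono) auto
  then show "jet_Wsq J \<ge> 4/9" unfolding Wsq by simp
  show "jt J \<bullet> jt J > 0" using aa E unfolding a_def by simp
  have W: "sqrt (jet_Wsq J) = E" using E unfolding Wsq by simp
  have nz: "E \<noteq> 0" using E by simp
  have iW: "jet_iW J = inverse E" by (simp add: jet_iW_def W)
  have B1: "jet_B1 J = a" unfolding jet_B1_def a_def[symmetric] b_def[symmetric] bb ab iW using nz by simp
  have B2: "jet_B2 J = b" unfolding jet_B2_def a_def[symmetric] b_def[symmetric] aa ab iW using nz by simp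
  have B2t: "jet_B2t J = d"
    unfolding jet_B2t_def B1 B2 a_def[symmetric] b_def[symmetric] c_def[symmetric] d_def[symmetric] aa ab iW ac ad
    using nz by (simp add: scaleR_add_right mult.commute)
  show "jet_q J = 2" unfolding jet_q_def B2t c_def[symmetric] cd ccdd by simp
  show "jet_m J = \<i>" unfolding jet_m_def a_def[symmetric] b_def[symmetric] ab aa W using nz by simp
  show "jet_B1 J \<bullet> jx J \<ge> 1" if T: "fst p = mob_T"
  proof -
    have xT: "x = mob_T" using T by (simp add: x_def)
    have "a \<bullet> jx J = (4 * (cosh x * sinh x) + 2 * (sinh (2 * x) * cosh (2 * x))) / 6"
      unfolding J i using sc[of y] sc[of "2 * y"] by (simp; algebra)
    also have "\<dots> = sinh (2 * mob_T)" unfolding xT cosh_2_mob_T sinh_double by simp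
    also have "\<dots> \<ge> 1"
    proof -
      have "(sinh (2 * mob_T))\<^sup>2 = 3" using cosh_square_eq[of "2 * mob_T"] cosh_2_mob_T by simp
      then have "1\<^sup>2 \<le> (sinh (2 * mob_T))\<^sup>2" by simp
      moreover have "0 \<le> sinh (2 * mob_T)" using mob_T_pos by simp
      ultimately show ?thesis by (rule power2_le_imp_le)
    qed
    finally show ?thesis unfolding B1 .
  qed
qed

section \<open>Closeness in the second order norm\<close>

lemma flip_derivatives:
  fixes f :: "real \<times> real \<Rightarrow> real ^ 'n::finite"
  assumes f: "smooth f" and flip: "\<And>q. q \<in> mob_strip \<Longrightarrow> f (mob_flip q) = f q" and p: "p \<in> mob_strip"
  shows "pd (1, 0) f (mob_flip p) = - pd (1, 0) f p" "pd (0, 1) f (mob_flip p) = pd (0, 1) f p"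
    "pd (1, 0) (pd (1, 0) f) (mob_flip p) = pd (1, 0) (pd (1, 0) f) p"
    "pd (1, 0) (pd (0, 1) f) (mob_flip p) = - pd (1, 0) (pd (0, 1) f) p"
    "pd (0, 1) (pd (0, 1) f) (mob_flip p) = pd (0, 1) (pd (0, 1) f) p"
proof -
  have t: "pd (1, 0) f (mob_flip q) = - pd (1, 0) f q" and h: "pd (0, 1) f (mob_flip q) = pd (0, 1) f q" if "q \<in> mob_strip" for q
    using pd_flip[OF f bounded_linear_ident flip that] by simp_all
  show "pd (1, 0) f (mob_flip p) = - pd (1, 0) f p" "pd (0, 1) f (mob_flip p) = pd (0, 1) f p" by (rule t[OF p] h[OF p])+
  show "pd (1, 0) (pd (1, 0) f) (mob_flip p) = pd (1, 0) (pd (1, 0) f) p"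
    using pd_flip(1)[OF smooth_pd_t[OF f] bounded_linear_minus[OF bounded_linear_ident] t p] by simp
  show "pd (1, 0) (pd (0, 1) f) (mob_flip p) = - pd (1, 0) (pd (0, 1) f) p"
    "pd (0, 1) (pd (0, 1) f) (mob_flip p) = pd (0, 1) (pd (0, 1) f) p"
    using pd_flip[OF smooth_pd_th[OF f] bounded_linear_ident h p] by simp_all
qed

text \<open>
  Two flips make a translation by \<open>2 \<pi>\<close>, so the derivatives are periodic and take their values on a compact part
  of the strip.
\<close>

lemma compact_image_derivatives:
  fixes f :: "real \<times> real \<Rightarrow> real ^ 'n::finite"
  assumes f: "smooth f" and flip: "\<And>q. q \<in> mob_strip \<Longrightarrow> f (mob_flip q) = f q"
  shows "compact (jet f ` mob_strip)" "compact (pd (0, 1) (pd (0, 1) f) ` mob_strip)"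
proof -
  have ff: "mob_flip (mob_flip (t, \<theta>)) = (t, \<theta> + 2 * pi)" for t \<theta> by (simp add: mob_flip_def)
  have "continuous_on mob_strip (jet f)"
    unfolding jet_def[abs_def] by (intro continuous_on_Pair smooth_continuous smooth_pd_t smooth_pd_th f)
  moreover have "jet f (t, \<theta> + 2 * pi) = jet f (t, \<theta>)" if "\<bar>t\<bar> \<le> mob_T" for t \<theta>
    using that unfolding ff[symmetric] jet_def by (simp add: flip_derivatives[OF f flip] flip)
  ultimately show "compact (jet f ` mob_strip)" by (rule compact_image_periodic)
  have "pd (0, 1) (pd (0, 1) f) (t, \<theta> + 2 * pi) = pd (0, 1) (pd (0, 1) f) (t, \<theta>)" if "\<bar>t\<bar> \<le> mob_T" for t \<theta>
    using that unfolding ff[symmetric] by (simp add: flip_derivatives[OF f flip])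
  then show "compact (pd (0, 1) (pd (0, 1) f) ` mob_strip)"
    by (intro compact_image_periodic smooth_continuous smooth_pd_th f)
qed

lemma mob_proj_flip:
  assumes "p \<in> mob_strip" shows "mob_proj (mob_flip p) = mob_proj p"
proof -
  obtain t \<theta> where p: "p = (t, \<theta>)" by fastforce
  have "(p, mob_flip p) \<in> mob_rel"
    using assms unfolding p mob_flip_def fst_conv snd_conv by (intro mob_relI_flip[where k = 0]) auto
  then show ?thesis unfolding mob_proj_def by (rule equiv_class_eq[OF equiv_mob_rel, symmetric])
qed

lemma pullback_flip: "p \<in> mob_strip \<Longrightarrow> pullback u (mob_flip p) = pullback u p"
  by (simp add: pullback_def mob_proj_flip)

text \<open>
  Each supremum bounds the function below it because the range is bounded, and none of them is negative.
\<close>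

lemma C2_norm_bounds_jet:
  fixes w :: "(real \<times> real) set \<Rightarrow> real ^ 'n::finite"
  assumes w: "smooth (pullback w)" and d: "mob_C2_norm w < d" and p: "p \<in> mob_strip"
  shows "norm (jet (pullback w) p) < d"
proof -
  define g where "g = pullback w"
  define M where "M h = (SUP p\<in>mob_strip. norm (h p))" for h :: "real \<times> real \<Rightarrow> real ^ 'n"
  note comp = compact_image_derivatives[OF w pullback_flip, folded g_def]
  have b: "norm (h q) \<le> M h" if "bounded (h ` mob_strip)" "q \<in> mob_strip" for h q
    unfolding M_def using that by (intro cSUP_upper) (auto simp: bounded_iff bdd_above_def)
  have bj: "bounded ((\<lambda>p. L (jet g p)) ` mob_strip)" if "bounded_linear L" for L :: "'n jet \<Rightarrow> real ^ 'n"
    using bounded_linear_image[OF compact_imp_bounded[OF comp(1)] that] by (simp add: image_image)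
  have lin: "bounded_linear (\<lambda>J::'n jet. jx J)" "bounded_linear (\<lambda>J::'n jet. jt J)" "bounded_linear (\<lambda>J::'n jet. jh J)"
    "bounded_linear (\<lambda>J::'n jet. jtt J)" "bounded_linear (\<lambda>J::'n jet. jht J)"
    by (intro bounded_linear_intros)+
  have "bounded (g ` mob_strip)" "bounded (pd (1, 0) g ` mob_strip)" "bounded (pd (0, 1) g ` mob_strip)"
    "bounded (pd (1, 0) (pd (1, 0) g) ` mob_strip)" "bounded (pd (1, 0) (pd (0, 1) g) ` mob_strip)"
    using lin[THEN bj] by (simp_all add: jet_def)
  note bb = this[THEN b, OF p]
  have "0 \<le> norm (pd (0, 1) (pd (0, 1) g) p)" by simp
  also have "\<dots> \<le> M (pd (0, 1) (pd (0, 1) g))" by (rule b[OF compact_imp_bounded[OF comp(2)] p])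
  finally have b6: "0 \<le> M (pd (0, 1) (pd (0, 1) g))" .
  have "mob_C2_norm w = M g + M (pd (1, 0) g) + M (pd (0, 1) g) + M (pd (1, 0) (pd (1, 0) g)) + M (pd (1, 0) (pd (0, 1) g)) + M (pd (0, 1) (pd (0, 1) g))"
    unfolding mob_C2_norm_def Let_def g_def M_def mob_dt_def mob_d\<theta>_def ..
  then have "norm (g p) + norm (pd (1, 0) g p) + norm (pd (0, 1) g p) + norm (pd (1, 0) (pd (1, 0) g) p) + norm (pd (1, 0) (pd (0, 1) g) p) < d"
    using bb b6 d by linarith
  moreover have "norm (jet g p) \<le> norm (g p) + (norm (pd (1, 0) g p) + (norm (pd (0, 1) g p) + (norm (pd (1, 0) (pd (1, 0) g) p) + norm (pd (1, 0) (pd (0, 1) g) p))))"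
    unfolding jet_def by (intro order_trans[OF norm_Pair_le] add_left_mono order_refl)
  ultimately show ?thesis unfolding g_def by linarith
qed

lemma jet_diff:
  fixes f g :: "real \<times> real \<Rightarrow> real ^ 'n::finite"
  assumes f: "smooth f" and g: "smooth g" and h: "\<And>q. q \<in> mob_strip \<Longrightarrow> h q = f q - g q" and p: "p \<in> mob_strip"
  shows "jet h p = jet f p - jet g p"
proof -
  have 1: "pd b h q = pd b f q - pd b g q" if "q \<in> mob_strip" for b q
    using pd_cong[OF h that] pd_diff[OF that f g] by simp
  have 2: "pd (1, 0) (pd b h) p = pd (1, 0) (pd b f) p - pd (1, 0) (pd b g) p" if "smooth (pd b f)" "smooth (pd b g)" for b
    using pd_cong[OF 1 p] pd_diff[OF p that] by simp
  show ?thesis unfolding jet_def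
    by (simp add: h[OF p] 1[OF p] 2 smooth_pd_t smooth_pd_th f g)
qed

text \<open>
  The compact set of jets of the critical map consists of points at which the conformal data are continuous functions of the jet.
\<close>

lemma nearby_jets:
  fixes \<sigma> :: "nat \<Rightarrow> 'n::finite"
  assumes dist: "distinct [\<sigma> 1, \<sigma> 2, \<sigma> 3, \<sigma> 4]" and e: "e > 0"
  obtains d where "d > 0" "\<And>p J. p \<in> mob_strip \<Longrightarrow> dist (jet (crit_map \<sigma>) p) J < d \<Longrightarrow>
    jet_Wsq J > 0 \<and> jet_q J \<notin> \<real>\<^sub>\<le>\<^sub>0 \<and> cmod (jet_kappa J - of_real crit_radius) \<le> e * crit_radius \<and>
    cmod (jet_m J * jet_kappa J - \<i> * of_real crit_radius) \<le> e * crit_radius \<and> (fst p = mob_T \<longrightarrow> jet_B1 J \<bullet> jx J > 0)"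
proof -
  define K where "K = jet (crit_map \<sigma>) ` mob_strip"
  have K: "compact K" unfolding K_def by (rule compact_image_derivatives[OF smooth_crit_map crit_map_flip])
  note jc = jet_crit_map[OF dist]
  have J: "jet_Wsq J \<ge> 4/9" "jt J \<bullet> jt J \<noteq> 0" "jet_q J = 2" "jet_m J = \<i>" if "J \<in> K" for J
    using that jc(1-4) unfolding K_def by force+
  have c: "isCont jet_Wsq J" "isCont jet_q J" "isCont jet_kappa J" "isCont (\<lambda>J. jet_m J * jet_kappa J) J"
    "isCont (\<lambda>J. jet_B1 J \<bullet> jx J) J" if JK: "J \<in> K" for J
  proof -
    have "jet_Wsq J > 0" using J(1)[OF JK] by linarith
    moreover have "jet_q J \<notin> \<real>\<^sub>\<le>\<^sub>0" unfolding J(3)[OF JK] by (simp add: complex_nonpos_Reals_iff)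
    ultimately show "isCont jet_Wsq J" "isCont jet_q J" "isCont jet_kappa J" "isCont (\<lambda>J. jet_m J * jet_kappa J) J"
      "isCont (\<lambda>J. jet_B1 J \<bullet> jx J) J" using isCont_jet[OF _ J(2)[OF JK]] by simp_all
  qed
  have er: "e * crit_radius > 0" using e crit_radius(1) by simp
  obtain d1 where d1: "d1 > 0" "\<And>x y. x \<in> K \<Longrightarrow> dist x y < d1 \<Longrightarrow> dist (jet_Wsq y) (jet_Wsq x) < 1/9"
    by (rule compact_uniform_continuity_nearby[OF K c(1), of "1/9"]) auto
  obtain d2 where d2: "d2 > 0" "\<And>x y. x \<in> K \<Longrightarrow> dist x y < d2 \<Longrightarrow> dist (jet_q y) (jet_q x) < 1"
    by (rule compact_uniform_continuity_nearby[OF K c(2), of 1]) auto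
  obtain d3 where d3: "d3 > 0" "\<And>x y. x \<in> K \<Longrightarrow> dist x y < d3 \<Longrightarrow> dist (jet_kappa y) (jet_kappa x) < e * crit_radius"
    by (rule compact_uniform_continuity_nearby[OF K c(3) er]) auto
  obtain d4 where d4: "d4 > 0" "\<And>x y. x \<in> K \<Longrightarrow> dist x y < d4 \<Longrightarrow> dist (jet_m y * jet_kappa y) (jet_m x * jet_kappa x) < e * crit_radius"
    by (rule compact_uniform_continuity_nearby[OF K c(4) er]) auto
  obtain d5 where d5: "d5 > 0" "\<And>x y. x \<in> K \<Longrightarrow> dist x y < d5 \<Longrightarrow> dist (jet_B1 y \<bullet> jx y) (jet_B1 x \<bullet> jx x) < 1"
    by (rule compact_uniform_continuity_nearby[OF K c(5), of 1]) auto
  define d where "d = min d1 (min d2 (min d3 (min d4 d5)))"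
  show ?thesis
  proof (rule that[of d])
    show "d > 0" using d1(1) d2(1) d3(1) d4(1) d5(1) by (simp add: d_def)
    fix p and J :: "'n jet"
    assume p: "p \<in> mob_strip" and D: "dist (jet (crit_map \<sigma>) p) J < d"
    define I where "I = jet (crit_map \<sigma>) p"
    have I: "I \<in> K" unfolding I_def K_def using p by (rule imageI)
    have D': "dist I J < d1" "dist I J < d2" "dist I J < d3" "dist I J < d4" "dist I J < d5"
      using D unfolding I_def d_def by simp_all
    note JI = J[OF I]
    have kI: "jet_kappa I = of_real crit_radius" unfolding jet_kappa_def JI(3) by (rule crit_radius(2))
    have 1: "jet_Wsq J > 0" using d1(2)[OF I D'(1)] JI(1) unfolding dist_real_def by linarith
    have "\<bar>Re (jet_q J - 2)\<bar> < 1" using d2(2)[OF I D'(2)] abs_Re_le_cmod[of "jet_q J - 2"] unfolding JI(3) dist_norm by linarith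
    then have "Re (jet_q J) > 0" by (simp add: abs_less_iff)
    then have 2: "jet_q J \<notin> \<real>\<^sub>\<le>\<^sub>0" by (simp add: complex_nonpos_Reals_iff)
    have 3: "cmod (jet_kappa J - of_real crit_radius) \<le> e * crit_radius"
      using d3(2)[OF I D'(3)] unfolding kI dist_norm by linarith
    have 4: "cmod (jet_m J * jet_kappa J - \<i> * of_real crit_radius) \<le> e * crit_radius"
      using d4(2)[OF I D'(4)] unfolding kI JI(4) dist_norm by linarith
    have 5: "jet_B1 J \<bullet> jx J > 0" if "fst p = mob_T"
      using d5(2)[OF I D'(5)] jc(5)[OF p that] unfolding I_def[symmetric] dist_real_def by linarith
    show "jet_Wsq J > 0 \<and> jet_q J \<notin> \<real>\<^sub>\<le>\<^sub>0 \<and> cmod (jet_kappa J - of_real crit_radius) \<le> e * crit_radius \<and>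
      cmod (jet_m J * jet_kappa J - \<i> * of_real crit_radius) \<le> e * crit_radius \<and> (fst p = mob_T \<longrightarrow> jet_B1 J \<bullet> jx J > 0)"
      using 1 2 3 4 5 by blast
  qed
qed

section \<open>Rigidity of the critical Moebius band\<close>

lemma pd_crit_map_boundary: "pd (0, 1) (crit_map \<sigma>) (mob_T, \<theta>) = crit_curve' \<sigma> \<theta>"
proof -
  have k1: "(1 / sqrt 6) * (2 * sqrt (1/2)) = sqrt (1/3)"
    by (rule real_sqrt_unique[symmetric]) (simp_all add: power_mult_distrib power_divide)
  have k2: "(1 / sqrt 6) * 2 = sqrt (2/3)"
    by (rule real_sqrt_unique[symmetric]) (simp_all add: power_mult_distrib power_divide)
  have k: "(1 / sqrt 6) * (2 * (sqrt (1/2) * x)) = sqrt (1/3) * x" "(1 / sqrt 6) * (2 * (2 * x)) = 2 * sqrt (2/3) * x" for x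
    unfolding k1[symmetric] k2[symmetric] by simp_all
  have T: "(mob_T, \<theta>) \<in> mob_strip" by simp
  show ?thesis
    unfolding pd_crit_map(2)[OF T] fst_conv snd_conv sinh_mob_T cosh_2_mob_T frame_ops mult_minus_left mult_minus_right k
    by (simp add: crit_curve'_def frame_def axis_scale[of _ "- _"] axis_scale[of _ "_ * _"])
qed

text \<open>
  By continuity at \<open>T\<close>, where \<open>coth\<close> is the square root of 3 and \<open>tanh\<close> exceeds
  \<open>1/2\<close>.
\<close>

lemma steklov_data_near_mob_T:
  fixes \<epsilon> :: real
  assumes "\<epsilon> > 0"
  obtains \<eta> where "\<eta> > 0" "\<And>X. \<bar>X - mob_T\<bar> < \<eta> \<Longrightarrow> X > 0 \<and> \<bar>cosh X / sinh X - sqrt 3\<bar> \<le> \<epsilon> \<and> 1/2 \<le> tanh X"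
proof -
  have "mob_T \<noteq> 0" using mob_T_pos by linarith
  then have s: "sinh mob_T \<noteq> 0" by simp
  have t: "1/2 < tanh mob_T"
  proof -
    have "tanh mob_T = 1 / (cosh mob_T / sinh mob_T)" by (simp add: tanh_def)
    moreover have "sqrt 3 < 2" by (rule real_less_lsqrt) simp_all
    then have "1/2 < 1 / sqrt 3" by (simp add: field_simps)
    ultimately show ?thesis unfolding cosh_div_sinh_mob_T by simp
  qed
  have "isCont (\<lambda>X. cosh X / sinh X) mob_T" using s by (intro continuous_intros)
  then obtain a where a: "a > 0" "\<And>X. dist X mob_T < a \<Longrightarrow> dist (cosh X / sinh X) (sqrt 3) < \<epsilon>"
    unfolding continuous_at_eps_delta cosh_div_sinh_mob_T using assms by blast
  have "isCont tanh mob_T" by (intro continuous_intros) (simp add: less_imp_neq[symmetric])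
  then obtain b where b: "b > 0" "\<And>X. dist X mob_T < b \<Longrightarrow> dist (tanh X) (tanh mob_T) < tanh mob_T - 1/2"
    using t unfolding continuous_at_eps_delta by (meson diff_gt_0_iff_gt)
  show ?thesis
  proof (rule that[of "min mob_T (min a b)"])
    show "min mob_T (min a b) > 0" using a(1) b(1) mob_T_pos by simp
    fix X assume X: "\<bar>X - mob_T\<bar> < min mob_T (min a b)"
    then have "X > 0" by (auto simp: abs_less_iff)
    moreover have "\<bar>cosh X / sinh X - sqrt 3\<bar> \<le> \<epsilon>" using a(2)[of X] X by (simp add: dist_real_def)
    moreover have "1/2 \<le> tanh X" using b(2)[of X] X by (simp add: dist_real_def abs_less_iff)
    ultimately show "X > 0 \<and> \<bar>cosh X / sinh X - sqrt 3\<bar> \<le> \<epsilon> \<and> 1/2 \<le> tanh X" by blast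
  qed
qed

text \<open>
  The constants are chosen from the end: \<open>\<epsilon>\<close> for the rigidity of the boundary curve, \<open>e'\<close> for
  the distance of the boundary data, then the accuracy \<open>e\<close> of the conformal coordinate, which also has to keep
  \<open>X\<close> close to \<open>T\<close>, and last the distance of the jets.
\<close>

proposition rigidity_near_crit_map:
  fixes \<sigma> :: "nat \<Rightarrow> 'n::finite"
  assumes dist: "distinct [\<sigma> 1, \<sigma> 2, \<sigma> 3, \<sigma> 4]"
  obtains d where "d > 0" "\<And>f. smooth f \<Longrightarrow> (\<And>p. p \<in> mob_strip \<Longrightarrow> f (mob_flip p) = f p) \<Longrightarrow> (\<And>\<theta>. norm (f (mob_T, \<theta>)) = 1) \<Longrightarrow>
    (\<And>\<theta> v. v \<bullet> f (mob_T, \<theta>) = 0 \<Longrightarrow> conormal f (mob_T, \<theta>) \<bullet> v = 0) \<Longrightarrow> (\<And>p. p \<in> mob_strip \<Longrightarrow> mean_curvature f p = 0) \<Longrightarrow>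
    (\<And>p. p \<in> mob_strip \<Longrightarrow> norm (jet f p - jet (crit_map \<sigma>) p) < d) \<Longrightarrow>
    \<exists>A. orthogonal_transformation A \<and> f ` mob_strip = A ` crit_map \<sigma> ` mob_strip"
proof -
  define N where "N = real CARD('n)"
  define \<epsilon> where "\<epsilon> = 1 / (10000000 * N\<^sup>2)"
  define e' where "e' = \<epsilon> / (120 * N)"
  have N: "N > 0" by (simp add: N_def)
  have \<epsilon>: "\<epsilon> > 0" using N by (simp add: \<epsilon>_def)
  have e': "e' > 0" "120 * N * e' \<le> \<epsilon>" using N \<epsilon> by (simp_all add: e'_def)
  obtain \<eta> where \<eta>: "\<eta> > 0" "\<And>X. \<bar>X - mob_T\<bar> < \<eta> \<Longrightarrow> X > 0 \<and> \<bar>cosh X / sinh X - sqrt 3\<bar> \<le> \<epsilon> \<and> 1/2 \<le> tanh X"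
    using steklov_data_near_mob_T[OF \<epsilon>] by blast
  (* the coordinate is accurate up to 6 e, and X differs from T by at most 10 e *)
  define e where "e = min (min (e' / 6) (1 / 100)) (\<eta> / 20)"
  have e_bounds: "e > 0" "6 * e \<le> e'" "e \<le> 1/100" "10 * e < \<eta>"
    using e'(1) \<eta>(1) by (auto simp: e_def min_def)
  define r where "r = crit_radius"
  have r: "r > 0" unfolding r_def by (rule crit_radius(1))
  obtain d where d: "d > 0" "\<And>p J. p \<in> mob_strip \<Longrightarrow> dist (jet (crit_map \<sigma>) p) J < d \<Longrightarrow>
    jet_Wsq J > 0 \<and> jet_q J \<notin> \<real>\<^sub>\<le>\<^sub>0 \<and> cmod (jet_kappa J - of_real r) \<le> e * r \<and>
    cmod (jet_m J * jet_kappa J - \<i> * of_real r) \<le> e * r \<and> (fst p = mob_T \<longrightarrow> jet_B1 J \<bullet> jx J > 0)"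
    unfolding r_def by (rule nearby_jets[OF dist e_bounds(1)]) blast
  show ?thesis
  proof (rule that[of "min d e'"])
    show "min d e' > 0" using d(1) e'(1) by simp
    fix f :: "real \<times> real \<Rightarrow> real ^ 'n"
    assume f: "smooth f" "\<And>p. p \<in> mob_strip \<Longrightarrow> f (mob_flip p) = f p" "\<And>\<theta>. norm (f (mob_T, \<theta>)) = 1"
      "\<And>\<theta> v. v \<bullet> f (mob_T, \<theta>) = 0 \<Longrightarrow> conormal f (mob_T, \<theta>) \<bullet> v = 0" "\<And>p. p \<in> mob_strip \<Longrightarrow> mean_curvature f p = 0"
      and near: "\<And>p. p \<in> mob_strip \<Longrightarrow> norm (jet f p - jet (crit_map \<sigma>) p) < min d e'"
    have "dist (jet (crit_map \<sigma>) p) (jet f p) < d" if "p \<in> mob_strip" for p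
      using near[OF that] by (simp add: dist_norm norm_minus_commute)
    note J = d(2)[OF _ this]
    interpret minimal_strip f
    proof
      show "smooth f" by (rule f(1))
      show "(pd (1, 0) f p \<bullet> pd (1, 0) f p) * (pd (0, 1) f p \<bullet> pd (0, 1) f p) - (pd (1, 0) f p \<bullet> pd (0, 1) f p)\<^sup>2 > 0" if "p \<in> mob_strip" for p
        using J[OF that that] by (simp add: jet_Wsq_def jet_def power2_eq_square)
      show "mean_curvature f p = 0" if "p \<in> mob_strip" for p by (rule f(5)[OF that])
    qed
    have kap: "jet_kappa (jet f p) = csqrt (csqrt (q p))" if "p \<in> mob_strip" for p
      unfolding jet_kappa_def jet_eqs[OF that] ..
    have T: "(mob_T, \<theta>) \<in> mob_strip" for \<theta> by simp
    interpret free_boundary_strip f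
    proof
      show "f (mob_flip p) = f p" if "p \<in> mob_strip" for p by (rule f(2)[OF that])
      show "norm (f (mob_T, \<theta>)) = 1" for \<theta> by (rule f(3))
      show "conormal f (mob_T, \<theta>) \<bullet> v = 0" if "v \<bullet> f (mob_T, \<theta>) = 0" for \<theta> v by (rule f(4)[OF that])
      show "B1 (mob_T, \<theta>) \<bullet> f (mob_T, \<theta>) > 0" for \<theta>
        using J[OF T T, of \<theta>] unfolding jet_eqs[OF T] by (simp add: jet_def)
      show "q p \<notin> \<real>\<^sub>\<le>\<^sub>0" if "p \<in> mob_strip" for p using J[OF that that] unfolding jet_eqs[OF that] by blast
      show "\<bar>Re (csqrt (csqrt (q (mob_T, \<theta>))) * m (mob_T, \<theta>))\<bar> < \<bar>Im (csqrt (csqrt (q (mob_T, \<theta>))) * m (mob_T, \<theta>))\<bar>" for \<theta>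
      proof -
        define z where "z = csqrt (csqrt (q (mob_T, \<theta>))) * m (mob_T, \<theta>)"
        have "cmod (z - \<i> * of_real r) \<le> e * r"
          using J[OF T T, of \<theta>] unfolding z_def kap[OF T] jet_eqs[OF T] by (simp add: mult.commute)
        also have "e * r \<le> (1/100) * r" using e_bounds(3) r by (intro mult_right_mono) auto
        finally have "cmod (z - \<i> * of_real r) \<le> (1/100) * r" .
        then have "\<bar>Re z\<bar> \<le> (1/100) * r" "\<bar>Im z - r\<bar> \<le> (1/100) * r"
          using abs_Re_le_cmod[of "z - \<i> * of_real r"] abs_Im_le_cmod[of "z - \<i> * of_real r"] by simp_all
        then have "\<bar>Re z\<bar> < \<bar>Im z\<bar>" using r by linarith
        then show ?thesis unfolding z_def .
      qed
    qed
    interpret close_strip f e r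
    proof
      show "r > 0" "0 \<le> e" "e \<le> 1/100" using r e_bounds by simp_all
      show "cmod (\<kappa> p - of_real r) \<le> e * r" "cmod (m p * \<kappa> p - \<i> * of_real r) \<le> e * r" if "p \<in> mob_strip" for p
        using J[OF that that] unfolding kap[OF that] jet_eqs[OF that] \<kappa>_def by blast+
    qed
    obtain \<omega> A where \<omega>: "smooth \<omega>" "smooth A"
      "\<And>p. p \<in> mob_strip \<Longrightarrow> pd (1, 0) \<omega> p = A p" "\<And>p. p \<in> mob_strip \<Longrightarrow> pd (0, 1) \<omega> p = m p * A p"
      "\<And>p. p \<in> mob_strip \<Longrightarrow> \<omega> (mob_flip p) = - cnj (\<omega> p) + \<i> * pi"
      "\<And>p. p \<in> mob_strip \<Longrightarrow> cmod (A p - 1) \<le> 6 * e" "\<And>p. p \<in> mob_strip \<Longrightarrow> cmod (m p * A p - \<i>) \<le> 6 * e"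
      "Im (\<omega> (mob_T, 0)) = 0" "\<And>\<theta>. Re (\<omega> (mob_T, \<theta>)) = Re (\<omega> (mob_T, 0))" "\<bar>Re (\<omega> (mob_T, 0)) - mob_T\<bar> \<le> 10 * e"
      using conformal_coordinate by metis
    define X where "X = Re (\<omega> (mob_T, 0))"
    have "\<bar>X - mob_T\<bar> < \<eta>" using \<omega>(10) e_bounds(4) unfolding X_def by linarith
    then have X: "X > 0" "\<bar>cosh X / sinh X - sqrt 3\<bar> \<le> \<epsilon>" "1/2 \<le> tanh X" using \<eta>(2)[of X] by blast+
    interpret conformal_chart f \<omega> A X "6 * e"
    proof
      show "smooth \<omega>" "smooth A" by (rule \<omega>)+
      show "Re (\<omega> (mob_T, \<theta>)) = X" for \<theta> unfolding X_def by (rule \<omega>(9))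
      show "Im (\<omega> (mob_T, 0)) = 0" "X > 0" by (rule \<omega>(8) X(1))+
      show "0 \<le> 6 * e" "6 * e \<le> 1/10" using e_bounds by simp_all
    qed (simp_all add: \<omega>)
    have jn: "norm (f p - crit_map \<sigma> p) \<le> e'" "norm (pd (0, 1) f p - pd (0, 1) (crit_map \<sigma>) p) \<le> e'" if "p \<in> mob_strip" for p
    proof -
      let ?D = "jet f p - jet (crit_map \<sigma>) p"
      have D: "norm ?D \<le> e'" using near[OF that] by simp
      have "norm (jx ?D) \<le> norm ?D" by (rule norm_fst_le[of "jx ?D" "snd ?D", unfolded prod.collapse])
      moreover have "norm (jh ?D) \<le> norm (snd (snd ?D))" by (rule norm_fst_le[of "jh ?D" "snd (snd (snd ?D))", unfolded prod.collapse])
      moreover have "norm (snd (snd ?D)) \<le> norm (snd ?D)" by (rule norm_snd_le[of "snd (snd ?D)" "fst (snd ?D)", unfolded prod.collapse])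
      moreover have "norm (snd ?D) \<le> norm ?D" by (rule norm_snd_le[of "snd ?D" "fst ?D", unfolded prod.collapse])
      ultimately have "norm (jx ?D) \<le> e'" "norm (jh ?D) \<le> e'" using D by linarith+
      then show "norm (f p - crit_map \<sigma> p) \<le> e'" "norm (pd (0, 1) f p - pd (0, 1) (crit_map \<sigma>) p) \<le> e'"
        by (simp_all add: jet_def)
    qed
    show "\<exists>A. orthogonal_transformation A \<and> f ` mob_strip = A ` crit_map \<sigma> ` mob_strip"
    proof (rule image_of_nearly_critical[OF dist])
      show "\<bar>f (mob_T, \<theta>) $ i - crit_curve \<sigma> \<theta> $ i\<bar> \<le> e'" for \<theta> i
        using jn(1)[OF T] component_le_norm_cart[of "f (mob_T, \<theta>) - crit_map \<sigma> (mob_T, \<theta>)" i]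
        unfolding crit_map_boundary vector_minus_component by (meson order_trans)
      show "\<bar>fh (mob_T, \<theta>) $ i - crit_curve' \<sigma> \<theta> $ i\<bar> \<le> e'" for \<theta> i
        using jn(2)[OF T] component_le_norm_cart[of "fh (mob_T, \<theta>) - crit_curve' \<sigma> \<theta>" i]
        unfolding fh_def pd_crit_map_boundary vector_minus_component by (meson order_trans)
    qed (use e_bounds(2) e'(2) X in \<open>simp_all add: \<epsilon>_def N_def\<close>)
  qed
qed

lemma image_mobius_band: "u ` mobius_band = pullback u ` mob_strip"
proof -
  have band: "mobius_band = mob_proj ` mob_strip" by (auto simp: mobius_band_def quotient_def mob_proj_def)
  show ?thesis unfolding band image_image pullback_def[abs_def] ..
qed

theorem theorem3p4:
  fixes \<sigma> :: "nat \<Rightarrow> 'n::finite"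
  assumes "CARD('n) \<ge> 4"
    and "bij_betw \<sigma> {1..CARD('n)} (UNIV :: 'n set)"
  shows "\<exists>\<delta>>0. \<forall>u :: (real \<times> real) set \<Rightarrow> real ^ 'n.
           free_boundary_minimal_immersion u \<and>
           mob_C2_norm (\<lambda>x. u x - critical_mobius \<sigma> x) < \<delta> \<longrightarrow>
           (\<exists>A. orthogonal_transformation A \<and>
                u ` mobius_band = A ` (critical_mobius \<sigma> ` mobius_band))"
proof -
  have "distinct [\<sigma> 1, \<sigma> 2, \<sigma> 3, \<sigma> 4]"
  proof -
    have inj: "inj_on \<sigma> {1..CARD('n)}" using assms(2) by (rule bij_betw_imp_inj_on)
    have "\<sigma> i \<noteq> \<sigma> j" if "1 \<le> i" "i < j" "j \<le> 4" for i j
      using inj_onD[OF inj, of i j] that assms(1) by auto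
    then show ?thesis by simp
  qed
  then obtain d where d: "d > 0" "\<And>f. smooth f \<Longrightarrow> (\<And>p. p \<in> mob_strip \<Longrightarrow> f (mob_flip p) = f p) \<Longrightarrow> (\<And>\<theta>. norm (f (mob_T, \<theta>)) = 1) \<Longrightarrow>
    (\<And>\<theta> v. v \<bullet> f (mob_T, \<theta>) = 0 \<Longrightarrow> conormal f (mob_T, \<theta>) \<bullet> v = 0) \<Longrightarrow> (\<And>p. p \<in> mob_strip \<Longrightarrow> mean_curvature f p = 0) \<Longrightarrow>
    (\<And>p. p \<in> mob_strip \<Longrightarrow> norm (jet f p - jet (crit_map \<sigma>) p) < d) \<Longrightarrow>
    \<exists>A. orthogonal_transformation A \<and> f ` mob_strip = A ` crit_map \<sigma> ` mob_strip"
    by (rule rigidity_near_crit_map) blast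
  have "\<exists>A. orthogonal_transformation A \<and> u ` mobius_band = A ` (critical_mobius \<sigma> ` mobius_band)"
    if u: "free_boundary_minimal_immersion u" and near: "mob_C2_norm (\<lambda>x. u x - critical_mobius \<sigma> x) < d"
    for u :: "(real \<times> real) set \<Rightarrow> real ^ 'n"
  proof -
    define f where "f = pullback u"
    have smf: "smooth f" using u by (simp add: free_boundary_minimal_immersion_def mob_immersion_def f_def)
    have bd: "mob_proj (mob_T, \<theta>) \<in> mobius_boundary" for \<theta> by (auto simp: mobius_boundary_def)
    have T: "(mob_T, \<theta>) \<in> mob_strip" for \<theta> using mob_T_pos by simp
    have band: "mob_proj p \<in> mobius_band" if "p \<in> mob_strip" for p
      using that by (auto simp: mobius_band_def mob_proj_def intro: quotientI)
    have w: "pullback (\<lambda>x. u x - critical_mobius \<sigma> x) q = f q - crit_map \<sigma> q" if "q \<in> mob_strip" for q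
      using pullback_critical_mobius[OF that, of \<sigma>] by (simp add: pullback_def f_def)
    have smw: "smooth (pullback (\<lambda>x. u x - critical_mobius \<sigma> x))"
      using smooth_diff[OF smf smooth_crit_map] by (subst smooth_cong) (rule w)
    have "\<exists>A. orthogonal_transformation A \<and> f ` mob_strip = A ` crit_map \<sigma> ` mob_strip"
    proof (rule d(2)[OF smf])
      show "f (mob_flip p) = f p" if "p \<in> mob_strip" for p unfolding f_def by (rule pullback_flip[OF that])
      have "u (mob_proj (mob_T, \<theta>)) \<in> sphere 0 1" for \<theta>
        using u band[OF T] bd by (simp add: free_boundary_minimal_immersion_def)
      then show "norm (f (mob_T, \<theta>)) = 1" for \<theta> by (simp add: f_def pullback_def)
      show "conormal f (mob_T, \<theta>) \<bullet> v = 0" if "v \<bullet> f (mob_T, \<theta>) = 0" for \<theta> v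
        using u bd T that unfolding free_boundary_minimal_immersion_def f_def by blast
      show "mean_curvature f p = 0" if "p \<in> mob_strip" for p
        using u that unfolding free_boundary_minimal_immersion_def f_def by blast
      show "norm (jet f p - jet (crit_map \<sigma>) p) < d" if "p \<in> mob_strip" for p
      proof -
        have "jet (pullback (\<lambda>x. u x - critical_mobius \<sigma> x)) p = jet f p - jet (crit_map \<sigma>) p"
          by (rule jet_diff[OF smf smooth_crit_map _ that]) (rule w)
        then show ?thesis using C2_norm_bounds_jet[OF smw near that] by simp
      qed
    qed
    moreover have "critical_mobius \<sigma> ` mobius_band = crit_map \<sigma> ` mob_strip"
      unfolding image_mobius_band by (rule image_cong[OF refl]) (rule pullback_critical_mobius)
    ultimately show ?thesis unfolding image_mobius_band f_def by simp
  qed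
  with d(1) show ?thesis by blast
qed

end
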